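(* Let $\alpha,\beta\ge -1/2$, let $[a,b]\subset[-1,1]$, let $1\le p<\infty$, and let $w\in A_p(\mathbb{N})$. For $m,n\in\mathbb{N}$ put \[ K_{[a,b]}(m,n)=\int_a^b p_m^{(\alpha,\beta)}(x)\,p_n^{(\alpha,\beta)}(x)\,d\mu_{\alpha,\beta}(x). \] Then for every $f\in\ell^p(\mathbb{N},w)$ and every $n\in\mathbb{N}$, \[ T_{[a,b]}f(n)=\sum_{m=0}^{\infty} f(m)\,K_{[a,b]}(m,n). \] Moreover, if $1<p<\infty$, \[ \|T_{[a,b]}f\|_{\ell^p(\mathbb{N},w)}\le C\|f\|_{\ell^p(\mathbb{N},w)}, \] and if $p=1$, \[ \|T_{[a,b]}f\|_{\ell^{1,\infty}(\mathbb{N},w)}\le C\|f\|_{\ell^1(\mathbb{N},w)}, \] where in both inequalities $C$ is a constant independent of $f$ and of the interval $[a,b]$.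
   Context: For $\alpha,\beta>-1$, $d\mu_{\alpha,\beta}(x)=(1-x)^\alpha(1+x)^\beta\,dx$ on $[-1,1]$. $P_n^{(\alpha,\beta)}$ denotes the classical Jacobi polynomial of degree $n$ (given by Rodrigues' formula $(1-x)^{\alpha}(1+x)^{\beta}P_n^{(\alpha,\beta)}(x)=\frac{(-1)^n}{2^n n!}\frac{d^n}{dx^n}\big((1-x)^{\alpha+n}(1+x)^{\beta+n}\big)$), and $p_n^{(\alpha,\beta)}=P_n^{(\alpha,\beta)}/\|P_n^{(\alpha,\beta)}\|_{L^2([-1,1],d\mu_{\alpha,\beta})}$ are the orthonormal Jacobi polynomials, a complete orthonormal system of $L^2([-1,1],d\mu_{\alpha,\beta})$. For a sequence $f=\{f(n)\}_{n\ge0}$ (e.g. $f\in\ell^2(\mathbb{N})$), $\mathcal{F}_{\alpha,\beta}f(x)=\sum_{k\ge0}f(k)p_k^{(\alpha,\beta)}(x)$, and for $F\in L^2([-1,1],d\mu_{\alpha,\beta})$, $\mathcal{F}^{-1}_{\alpha,\beta}F(n)=\int_{-1}^1F(x)p_n^{(\alpha,\beta)}(x)\,d\mu_{\alpha,\beta}(x)$. The multiplier of the interval $[a,b]$ is $T_{[a,b]}f=\mathcal{F}^{-1}_{\alpha,\beta}(\chi_{[a,b]}\mathcal{F}_{\alpha,\beta}f)$ (initially for $f\in\ell^2(\mathbb{N})$; on $\ell^p(\mathbb{N},w)$ it denotes the operator given by the displayed series, which agrees with this definition on $\ell^2(\mathbb{N})\cap\ell^p(\mathbb{N},w)$). Here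 $\mathbb{N}=\{0,1,2,\dots\}$. A weight is a strictly positive sequence $w$ on $\mathbb{N}$; $\ell^p(\mathbb{N},w)$ has norm $(\sum_m|f(m)|^pw(m))^{1/p}$ and $\ell^{1,\infty}(\mathbb{N},w)$ has quasi-norm $\sup_{t>0}t\sum_{\{m:|f(m)|>t\}}w(m)$. For $1<p<\infty$, $w\in A_p(\mathbb{N})$ means $\sup_{0\le n\le m}\frac{1}{(m-n+1)^p}\big(\sum_{k=n}^m w(k)\big)\big(\sum_{k=n}^m w(k)^{-1/(p-1)}\big)^{p-1}<\infty$; $w\in A_1(\mathbb{N})$ means $\sup_{0\le n\le m}\frac{1}{m-n+1}\big(\sum_{k=n}^m w(k)\big)\max_{n\le k\le m}w(k)^{-1}<\infty$. *)

theory Defs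
  imports "HOL-Analysis.Analysis"
begin

definition jacobi_weight :: "real \<Rightarrow> real \<Rightarrow> real \<Rightarrow> real" where
  "jacobi_weight \<alpha> \<beta> x = (1 - x) powr \<alpha> * (1 + x) powr \<beta>"

definition jacobi_measure :: "real \<Rightarrow> real \<Rightarrow> real measure" where
  "jacobi_measure \<alpha> \<beta> =
     density lborel (\<lambda>x. ennreal (indicator {-1..1} x * jacobi_weight \<alpha> \<beta> x))"

text \<open>Classical Jacobi polynomial, given by Rodrigues' formula on the open
  interval (-1,1). Values at the endpoints (a null set) are irrelevant for
  everything below, which only involves integrals against the Jacobi measure;
  we set them to 0 outside (-1,1).\<close>
definition jacobiP :: "real \<Rightarrow> real \<Rightarrow> nat \<Rightarrow> real \<Rightarrow> real" where
  "jacobiP \<alpha> \<beta> n x =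
     (if -1 < x \<and> x < 1 then
        ((-1) ^ n / (2 ^ n * fact n)) *
        (deriv ^^ n) (\<lambda>y. (1 - y) powr (\<alpha> + real n) * (1 + y) powr (\<beta> + real n)) x
        / jacobi_weight \<alpha> \<beta> x
      else 0)"

definition jacobi_norm :: "real \<Rightarrow> real \<Rightarrow> nat \<Rightarrow> real" where
  "jacobi_norm \<alpha> \<beta> n = sqrt (integral\<^sup>L (jacobi_measure \<alpha> \<beta>) (\<lambda>x. (jacobiP \<alpha> \<beta> n x)\<^sup>2))"

definition jacobi_on :: "real \<Rightarrow> real \<Rightarrow> nat \<Rightarrow> real \<Rightarrow> real" where
  "jacobi_on \<alpha> \<beta> n x = jacobiP \<alpha> \<beta> n x / jacobi_norm \<alpha> \<beta> n"

definition jacobi_kernel :: "real \<Rightarrow> real \<Rightarrow> real \<Rightarrow> real \<Rightarrow> nat \<Rightarrow> nat \<Rightarrow> real" where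
  "jacobi_kernel \<alpha> \<beta> a b m n =
     set_lebesgue_integral (jacobi_measure \<alpha> \<beta>) {a..b}
       (\<lambda>x. jacobi_on \<alpha> \<beta> m x * jacobi_on \<alpha> \<beta> n x)"

definition is_jacobi_transform :: "real \<Rightarrow> real \<Rightarrow> (nat \<Rightarrow> real) \<Rightarrow> (real \<Rightarrow> real) \<Rightarrow> bool" where
  "is_jacobi_transform \<alpha> \<beta> f G \<longleftrightarrow>
     G \<in> borel_measurable borel \<and>
     integrable (jacobi_measure \<alpha> \<beta>) (\<lambda>x. (G x)\<^sup>2) \<and>
     (\<lambda>N. integral\<^sup>L (jacobi_measure \<alpha> \<beta>)
             (\<lambda>x. (G x - (\<Sum>k<N. f k * jacobi_on \<alpha> \<beta> k x))\<^sup>2)) \<longlonglongrightarrow> 0"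

definition jacobi_transform :: "real \<Rightarrow> real \<Rightarrow> (nat \<Rightarrow> real) \<Rightarrow> real \<Rightarrow> real" where
  "jacobi_transform \<alpha> \<beta> f = (SOME G. is_jacobi_transform \<alpha> \<beta> f G)"

text \<open>Multiplier of the interval [a,b], for f in l^2:
  T f (n) = int chi_[a,b] (F f) p_n d mu.\<close>
definition interval_multiplier :: "real \<Rightarrow> real \<Rightarrow> real \<Rightarrow> real \<Rightarrow> (nat \<Rightarrow> real) \<Rightarrow> nat \<Rightarrow> real" where
  "interval_multiplier \<alpha> \<beta> a b f n =
     set_lebesgue_integral (jacobi_measure \<alpha> \<beta>) {a..b}
       (\<lambda>x. jacobi_transform \<alpha> \<beta> f x * jacobi_on \<alpha> \<beta> n x)"

text \<open>The operator given by the series (used on l^p(w)).\<close>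
definition interval_multiplier_series :: "real \<Rightarrow> real \<Rightarrow> real \<Rightarrow> real \<Rightarrow> (nat \<Rightarrow> real) \<Rightarrow> nat \<Rightarrow> real" where
  "interval_multiplier_series \<alpha> \<beta> a b f n = (\<Sum>m. f m * jacobi_kernel \<alpha> \<beta> a b m n)"

definition in_l2 :: "(nat \<Rightarrow> real) \<Rightarrow> bool" where
  "in_l2 f \<longleftrightarrow> summable (\<lambda>m. (f m)\<^sup>2)"

definition in_lpw :: "real \<Rightarrow> (nat \<Rightarrow> real) \<Rightarrow> (nat \<Rightarrow> real) \<Rightarrow> bool" where
  "in_lpw p w f \<longleftrightarrow> summable (\<lambda>m. \<bar>f m\<bar> powr p * w m)"

definition lpw_norm :: "real \<Rightarrow> (nat \<Rightarrow> real) \<Rightarrow> (nat \<Rightarrow> real) \<Rightarrow> real" where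
  "lpw_norm p w f = (\<Sum>m. \<bar>f m\<bar> powr p * w m) powr (1 / p)"

definition weak_l1w_bounded :: "(nat \<Rightarrow> real) \<Rightarrow> (nat \<Rightarrow> real) \<Rightarrow> real \<Rightarrow> bool" where
  "weak_l1w_bounded w g B \<longleftrightarrow>
     (\<forall>t>0. summable (\<lambda>m. if \<bar>g m\<bar> > t then w m else 0) \<and>
            t * (\<Sum>m. if \<bar>g m\<bar> > t then w m else 0) \<le> B)"

definition weight :: "(nat \<Rightarrow> real) \<Rightarrow> bool" where
  "weight w \<longleftrightarrow> (\<forall>k. w k > 0)"

definition Ap_weight :: "real \<Rightarrow> (nat \<Rightarrow> real) \<Rightarrow> bool" where
  "Ap_weight p w \<longleftrightarrow> weight w \<and>
     (if p = 1 then
        (\<exists>K. \<forall>n m. n \<le> m \<longrightarrow>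
           (1 / real (m - n + 1)) * (\<Sum>k=n..m. w k) * (MAX k\<in>{n..m}. inverse (w k)) \<le> K)
      else
        (\<exists>K. \<forall>n m. n \<le> m \<longrightarrow>
           (1 / real (m - n + 1) powr p) * (\<Sum>k=n..m. w k)
             * (\<Sum>k=n..m. w k powr (-1 / (p - 1))) powr (p - 1) \<le> K))"

end

theory Submission
  imports Defs
begin

text \<open>By the Wronskian identity for the Jacobi differential equation, the kernel \<open>K(m,n)\<close> is, up to the
  factor \<open>1 / ((m - n) (m + n + \<alpha> + \<beta> + 1))\<close>, a difference of boundary terms in \<open>p\<^sub>m p\<^sub>n' - p\<^sub>m' p\<^sub>n\<close>. For
  \<open>\<alpha>, \<beta> \<ge> -1/2\<close> the suitably weighted \<open>p\<^sub>n\<close> and \<open>p\<^sub>n' / n\<close> are bounded uniformly in \<open>n\<close> and \<open>x\<close>, so the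
  multiplier is a combination of discrete Hilbert transforms, composed with multiplications by sequences
  bounded independently of the interval, and an operator dominated by the Stieltjes matrix
  \<open>1 / (m + n + 1)\<close>. The Hilbert transform has weak type (1,1) by Boole's identity, and a good-lambda
  inequality compares a kernel of this type with the maximal function in any \<open>A\<^sub>p\<close> weight.

  The uniform bounds come from the oscillator equation satisfied by the weighted polynomials in the
  variable \<open>\<phi>\<close> with \<open>x = cos (2 * \<phi>)\<close>: the \<open>L\<^sup>2\<close> normalisation bounds the energy away from the
  endpoints, and monotone energy functionals carry the bound to the endpoints.\<close>

section \<open>Boole's identity and the discrete Hilbert transform\<close>

text \<open>The obstacle is that \<open>jacobi_kernel\<close> is not a Calderon-Zygmund kernel: the
  boundary values of \<open>p\<^sub>n\<close> oscillate in \<open>n\<close>, so a difference in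
  \<open>n\<close> need not be smaller than the size \<open>1 / \<bar>m - n\<bar>\<close> of the
  kernel itself. Each boundary term is, however, a product of a sequence in \<open>m\<close> and a
  sequence in \<open>n\<close>. The first is absorbed into the input, where it costs a factor in
  \<open>\<bar>f\<bar>\<close>, the second multiplies the output, and regularity is asked only of
  the fixed matrices in between. This is why the weighted theory is applied to two explicit kernels
  and why the interval drops out of the constants. All operator inequalities are proved for finite
  sections (input below \<open>N\<close>, output below \<open>L\<close>) with constants free of
  \<open>N\<close> and \<open>L\<close>. Convergence of the series for general \<open>f\<close>
  comes afterwards: the Stieltjes inequality read at the output index 0 makes
  \<open>\<bar>f m\<bar> / (m + 1)\<close> summable, and for fixed \<open>n\<close> the kernel is
  \<open>O(1 / (m + 1))\<close>.\<close>

lemma coeff_prod_linear: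
  fixes a :: "'i \<Rightarrow> real"
  assumes "finite I"
  shows "degree (\<Prod>i\<in>I. [:- a i, 1:]) = card I"
    and "coeff (\<Prod>i\<in>I. [:- a i, 1:]) (card I) = 1"
    and "card I \<ge> 1 \<Longrightarrow> coeff (\<Prod>i\<in>I. [:- a i, 1:]) (card I - 1) = - (\<Sum>i\<in>I. a i)"
proof -
  have *: "degree (\<Prod>i\<in>I. [:- a i, 1:]) = card I \<and> coeff (\<Prod>i\<in>I. [:- a i, 1:]) (card I) = 1 \<and>
     (card I \<ge> 1 \<longrightarrow> coeff (\<Prod>i\<in>I. [:- a i, 1:]) (card I - 1) = - (\<Sum>i\<in>I. a i))"
    using assms
  proof (induction I rule: finite_induct)
    case empty
    then show ?case by simp
  next
    case (insert x I)
    let ?p = "\<Prod>i\<in>I. [:- a i, 1:]"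
    have nz: "?p \<noteq> 0" using insert.IH by (auto)
    have e: "(\<Prod>i\<in>insert x I. [:- a i, 1:]) = [:- a x, 1:] * ?p" using insert by simp
    have d: "degree ([:- a x, 1:] * ?p) = card (insert x I)"
      using nz insert by (subst degree_mult_eq) auto
    have c: "coeff ([:- a x, 1:] * ?p) (card (insert x I)) = 1"
      using insert by (simp add: coeff_eq_0)
    have c1: "coeff ([:- a x, 1:] * ?p) (card (insert x I) - 1) = - (\<Sum>i\<in>insert x I. a i)"
      using insert by (cases "card I") (auto simp: coeff_pCons card_eq_0_iff split: nat.splits)
    show ?case unfolding e using d c c1 by simp
  qed
  then show "degree (\<Prod>i\<in>I. [:- a i, 1:]) = card I"
    and "coeff (\<Prod>i\<in>I. [:- a i, 1:]) (card I) = 1"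
    and "card I \<ge> 1 \<Longrightarrow> coeff (\<Prod>i\<in>I. [:- a i, 1:]) (card I - 1) = - (\<Sum>i\<in>I. a i)"
    by auto
qed

text \<open>Boole's identity. Multiplying \<open>l - (\<Sum>m. f m / (x - m))\<close> by \<open>\<Prod>m. x - m\<close> gives a polynomial of
  degree \<open>N\<close> that changes sign between consecutive integers; the sum of its roots is read off from
  its second coefficient.\<close>

lemma boole_roots:
  fixes f :: "nat \<Rightarrow> real"
  assumes N: "N \<ge> 1" and f: "\<And>m. m < N \<Longrightarrow> f m > 0" and l: "l > 0"
  obtains \<xi> where "\<And>j. j < N \<Longrightarrow> \<xi> j > real j" "\<And>j. Suc j < N \<Longrightarrow> \<xi> j < real j + 1"
    "(\<Sum>j<N. \<xi> j - real j) = (\<Sum>j<N. f j) / l"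
    "\<And>x. (\<And>m. m < N \<Longrightarrow> x \<noteq> real m) \<Longrightarrow>
       l - (\<Sum>m<N. f m / (x - real m)) = l * (\<Prod>j<N. (x - \<xi> j) / (x - real j))"
proof -
  define P where "P = (\<Prod>m<N. [:- real m, 1:])"
  define q where "q m = (\<Prod>i\<in>{..<N} - {m}. [:- real i, 1:])" for m
  define R where "R = smult l P - (\<Sum>m<N. smult (f m) (q m))"
  have q0: "poly (q m) (real j) = 0" if "j \<noteq> m" "j < N" for m j
    using that by (auto simp: q_def poly_prod)
  have P0: "poly P (real j) = 0" if "j < N" for j using that by (auto simp: P_def poly_prod)
  \<comment> \<open>At the node \<open>j\<close> exactly the \<open>N - 1 - j\<close> factors with
    \<open>i > j\<close> are negative.\<close>
  have qs: "(-1) ^ (N - 1 - j) * poly (q j) (real j) > 0" if "j < N" for j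
  proof -
    have sp: "{..<N} - {j} = {..<j} \<union> {j<..<N}" using that by auto
    have "poly (q j) (real j) = (\<Prod>i<j. real j - real i) * (\<Prod>i\<in>{j<..<N}. real j - real i)"
      unfolding q_def sp poly_prod by (subst prod.union_disjoint) auto
    also have "(\<Prod>i\<in>{j<..<N}. real j - real i) = (\<Prod>i\<in>{j<..<N}. (-1) * (real i - real j))"
      by simp
    also have "\<dots> = (-1) ^ (N - 1 - j) * (\<Prod>i\<in>{j<..<N}. real i - real j)"
      using that by (simp only: prod.distrib prod_constant card_greaterThanLessThan) simp
    finally have "(-1) ^ (N - 1 - j) * poly (q j) (real j)
       = (\<Prod>i<j. real j - real i) * (\<Prod>i\<in>{j<..<N}. real i - real j) * ((-1) ^ (N - 1 - j))\<^sup>2"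
      by (simp add: power2_eq_square)
    moreover have "\<dots> > 0"
      by (intro mult_pos_pos prod_pos) (auto simp flip: power_mult)
    ultimately show ?thesis by simp
  qed
  have Rj: "poly R (real j) = - f j * poly (q j) (real j)" if "j < N" for j
  proof -
    have "(\<Sum>m<N. f m * poly (q m) (real j)) = (\<Sum>m\<in>{j}. f m * poly (q m) (real j))"
      using that q0 by (intro sum.mono_neutral_right) auto
    then show ?thesis by (simp add: R_def poly_sum P0[OF that])
  qed
  \<comment> \<open>At a node \<open>P\<close> vanishes and one term of the sum survives, so
    \<open>R\<close> alternates in sign along the nodes.\<close>
  have Rs: "(-1) ^ (N - 1 - j) * poly R (real j) < 0" if "j < N" for j
    using mult_pos_pos[OF f[OF that] qs[OF that]] by (simp add: Rj[OF that] algebra_simps)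
  have degP: "degree P = N" "coeff P N = 1" "coeff P (N - 1) = - (\<Sum>m<N. real m)"
    using coeff_prod_linear[of "{..<N}" real] N by (auto simp: P_def)
  have degq: "degree (q m) = N - 1" "coeff (q m) (N - 1) = 1" if "m < N" for m
    using coeff_prod_linear[of "{..<N} - {m}" real] that by (auto simp: q_def)
  have degS: "degree (\<Sum>m<N. smult (f m) (q m)) \<le> N - 1"
    using degq by (intro degree_sum_le) (auto intro: order.trans[OF degree_smult_le])
  have cS: "coeff (\<Sum>m<N. smult (f m) (q m)) (N - 1) = (\<Sum>m<N. f m)"
    using degq by (simp add: coeff_sum)
  have cSN: "coeff (\<Sum>m<N. smult (f m) (q m)) N = 0"
    using degS N by (intro coeff_eq_0) linarith
  have cR: "coeff R N = l" "coeff R (N - 1) = - l * (\<Sum>m<N. real m) - (\<Sum>m<N. f m)"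
    using degP cS cSN by (auto simp: R_def)
  have degR: "degree R = N"
  proof (rule antisym)
    show "degree R \<le> N" unfolding R_def using degS degP
      by (intro degree_diff_le) (auto intro: order.trans[OF degree_smult_le])
    show "N \<le> degree R" using cR l by (intro le_degree) auto
  qed
  have ex1: "\<exists>x. real j < x \<and> (Suc j < N \<longrightarrow> x < real j + 1) \<and> poly R x = 0" if j: "j < N" for j
  proof (cases "Suc j < N")
    case True
    have e: "N - 1 - j = Suc (N - 1 - Suc j)" using True by simp
    have "poly R (real j) * poly R (real (Suc j)) < 0"
    proof -
      let ?s = "(-1::real) ^ (N - 1 - Suc j)"
      have a: "- (?s * poly R (real j)) < 0" using Rs[OF j] unfolding e by simp
      have b: "?s * poly R (real (Suc j)) < 0" using Rs[OF True] .
      have "0 < (- (?s * poly R (real j))) * (?s * poly R (real (Suc j)))"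
        using a b by (rule mult_neg_neg)
      also have "\<dots> = - (poly R (real j) * poly R (real (Suc j))) * ?s\<^sup>2"
        by (simp add: power2_eq_square algebra_simps)
      also have "?s\<^sup>2 = 1" by (simp flip: power_mult)
      finally show ?thesis by simp
    qed
    then show ?thesis using poly_IVT[of "real j" "real (Suc j)" R] by auto
  next
    case False
    \<comment> \<open>The last root has no node to its right; it exists because \<open>R\<close> is
      negative at \<open>N - 1\<close> while its leading coefficient \<open>l\<close> is positive.
      This is why no upper bound is claimed for it.\<close>
    then have jj: "j = N - 1" using j by simp
    have neg: "poly R (real j) < 0" using Rs[OF j] jj by simp
    obtain x where "\<forall>y\<ge>x. poly R y \<ge> lead_coeff R"
      using poly_pinfty_gt_lc[of R] cR degR l by auto
    then have "poly R (max x (real j + 1)) > 0" using cR degR l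
      by (smt (verit) max.cobounded1)
    moreover have "real j < max x (real j + 1)" by simp
    ultimately obtain z where "real j < z" "poly R z = 0"
      using poly_IVT_pos[of "real j" "max x (real j + 1)" R] neg by blast
    then show ?thesis using False by blast
  qed
  then obtain \<xi> where \<xi>: "\<And>j. j < N \<Longrightarrow> real j < \<xi> j \<and> (Suc j < N \<longrightarrow> \<xi> j < real j + 1) \<and> poly R (\<xi> j) = 0"
    by metis
  have inc: "\<xi> i < \<xi> j" if "i < j" "j < N" for i j
  proof -
    have "\<xi> i < real i + 1" using \<xi>[of i] that by auto
    also have "\<dots> \<le> real j" using that by simp
    also have "\<dots> < \<xi> j" using \<xi>[of j] that by auto
    finally show ?thesis .
  qed
  have inj: "inj_on \<xi> {..<N}"
    by (rule linorder_inj_onI') (use inc in force)+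
  define T where "T = smult l (\<Prod>j<N. [:- \<xi> j, 1:])"
  have degT: "degree (\<Prod>j<N. [:- \<xi> j, 1:]) = N" "coeff T N = l" "coeff T (N - 1) = - l * (\<Sum>m<N. \<xi> m)"
    using coeff_prod_linear[of "{..<N}" \<xi>] N by (auto simp: T_def)
  \<comment> \<open>The leading coefficients agree, so the difference has degree below
    \<open>N\<close>, yet it vanishes at \<open>N\<close> distinct points.\<close>
  have RT: "R = T"
  proof (rule ccontr)
    assume "R \<noteq> T"
    then have nz: "R - T \<noteq> 0" by simp
    have "degree (R - T) \<le> N" using degR degT
      by (intro degree_diff_le) (auto simp: T_def intro: order.trans[OF degree_smult_le])
    moreover have "coeff (R - T) N = 0" using cR degT by simp
    ultimately have d: "degree (R - T) < N" using N nz
      by (metis eq_zero_or_degree_less)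
    have "\<xi> ` {..<N} \<subseteq> {x. poly (R - T) x = 0}"
      using \<xi> by (auto simp: T_def poly_prod)
    then have "card (\<xi> ` {..<N}) \<le> card {x. poly (R - T) x = 0}"
      using poly_roots_finite[OF nz] by (intro card_mono) auto
    also have "\<dots> \<le> degree (R - T)" using card_poly_roots_bound[OF nz] .
    finally show False using d by (simp add: card_image[OF inj])
  qed
  have "- l * (\<Sum>m<N. real m) - (\<Sum>m<N. f m) = - l * (\<Sum>m<N. \<xi> m)"
    using cR degT RT by simp
  then have sm: "(\<Sum>j<N. \<xi> j - real j) = (\<Sum>j<N. f j) / l"
    using l by (simp add: sum_subtractf field_simps)
  have id: "l - (\<Sum>m<N. f m / (x - real m)) = l * (\<Prod>j<N. (x - \<xi> j) / (x - real j))"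
    if x: "\<And>m. m < N \<Longrightarrow> x \<noteq> real m" for x
  proof -
    have Pp: "poly P x = (\<Prod>m<N. x - real m)" by (simp add: P_def poly_prod)
    have Pn: "poly P x \<noteq> 0" unfolding Pp using x by auto
    have qq: "poly (q m) x = poly P x / (x - real m)" if "m < N" for m
      unfolding q_def poly_prod Pp using that x by (simp add: prod_diff1)
    have "poly R x = l * poly P x - (\<Sum>m<N. f m * (poly P x / (x - real m)))"
      by (simp add: R_def poly_sum qq)
    also have "\<dots> = poly P x * (l - (\<Sum>m<N. f m / (x - real m)))"
      by (simp add: algebra_simps sum_distrib_left)
    finally have "poly P x * (l - (\<Sum>m<N. f m / (x - real m))) = l * (\<Prod>j<N. x - \<xi> j)"
      unfolding RT by (simp add: T_def poly_prod)
    then have "(l - (\<Sum>m<N. f m / (x - real m))) = l * (\<Prod>j<N. x - \<xi> j) / poly P x"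
      using Pn by (simp add: field_simps)
    then show ?thesis by (simp add: Pp prod_dividef)
  qed
  show ?thesis by (rule that[of \<xi>]) (use \<xi> sm id in auto)
qed

text \<open>The function \<open>l - (\<Sum>m. f m / (x - m))\<close> can only be negative at \<open>n + 1/2\<close> when the root attached to
  \<open>min n (N - 1)\<close> lies to the right of \<open>n + 1/2\<close>, so each such \<open>n\<close> uses up a piece of length at
  least \<open>1/2\<close> of the total root displacement.\<close>

lemma boole_count_pos:
  fixes f :: "nat \<Rightarrow> real"
  assumes N: "N \<ge> 1" and f: "\<And>m. m < N \<Longrightarrow> f m > 0" and l: "l > 0"
    and A: "finite A" "\<And>n. n \<in> A \<Longrightarrow> (\<Sum>m<N. f m / (real n - real m + 1/2)) > l"
  shows "real (card A) \<le> 2 / l * (\<Sum>m<N. f m)"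
proof -
  obtain \<xi> where \<xi>: "\<And>j. j < N \<Longrightarrow> \<xi> j > real j" "\<And>j. Suc j < N \<Longrightarrow> \<xi> j < real j + 1"
    and sm: "(\<Sum>j<N. \<xi> j - real j) = (\<Sum>j<N. f j) / l"
    and id: "\<And>x. (\<And>m. m < N \<Longrightarrow> x \<noteq> real m) \<Longrightarrow>
       l - (\<Sum>m<N. f m / (x - real m)) = l * (\<Prod>j<N. (x - \<xi> j) / (x - real j))"
    using boole_roots[of N f l, OF N f l] by blast
  have key: "\<xi> (min n (N - 1)) > real n + 1/2" if n: "n \<in> A" for n
  proof (rule ccontr)
    assume neg: "\<not> ?thesis"
    let ?x = "real n + 1/2"
    have xm: "?x \<noteq> real m" for m
    proof
      assume "?x = real m"
      then have "2 * real m = 2 * real n + 1" by simp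
      then have "real (2 * m) = real (2 * n + 1)" by simp
      then have "2 * m = 2 * n + 1" by (simp only: of_nat_eq_iff)
      then show False by presburger
    qed
    have "(\<Prod>j<N. (?x - \<xi> j) / (?x - real j)) \<ge> 0"
    proof (rule prod_nonneg)
      fix j assume "j \<in> {..<N}"
      then have j: "j < N" by simp
      consider "j = min n (N - 1)" | "j < min n (N - 1)" | "j > min n (N - 1)" by linarith
      then show "0 \<le> (?x - \<xi> j) / (?x - real j)"
      proof cases
        case 1
        then have "real j \<le> real n" by simp
        then show ?thesis using neg 1 by (intro divide_nonneg_nonneg) auto
      next
        case 2
        then have "\<xi> j < real j + 1" "real j + 1 \<le> real n" using \<xi>(2)[of j] by auto
        then show ?thesis by (intro divide_nonneg_nonneg) auto
      next
        case 3
        then have "n < j" using j by linarith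
        then have "real n + 1 \<le> real j" by simp
        then show ?thesis using \<xi>(1)[OF j] by (intro divide_nonpos_nonpos) auto
      qed
    qed
    then have "l - (\<Sum>m<N. f m / (?x - real m)) \<ge> 0"
      using id[OF xm] l by simp
    moreover have "(\<Sum>m<N. f m / (?x - real m)) = (\<Sum>m<N. f m / (real n - real m + 1/2))"
      by (simp add: algebra_simps)
    ultimately show False using A(2)[OF n] by simp
  qed
  define B where "B = A \<inter> {..<N - 1}"
  define E where "E = A - {..<N - 1}"
  have cardA: "card A = card B + card E" unfolding B_def E_def
    using A(1) by (subst card_Un_disjoint[symmetric]) (auto intro!: arg_cong[where f = card])
  have "real (card B) = (\<Sum>j\<in>B. 1)" by simp
  also have "\<dots> \<le> (\<Sum>j\<in>B. 2 * (\<xi> j - real j))"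
  proof (rule sum_mono)
    fix j assume j: "j \<in> B"
    then have "min j (N - 1) = j" "j \<in> A" by (auto simp: B_def)
    then show "1 \<le> 2 * (\<xi> j - real j)" using key[of j] by simp
  qed
  also have "\<dots> \<le> (\<Sum>j<N - 1. 2 * (\<xi> j - real j))"
  proof (rule sum_mono2)
    show "0 \<le> 2 * (\<xi> j - real j)" if "j \<in> {..<N - 1} - B" for j
    proof -
      have "j < N" using that by auto
      from \<xi>(1)[OF this] show ?thesis by simp
    qed
  qed (auto simp: B_def)
  finally have cB: "real (card B) \<le> (\<Sum>j<N - 1. 2 * (\<xi> j - real j))" .
  \<comment> \<open>All outputs \<open>n \<ge> N - 1\<close> compete for the last root. They lie
    between \<open>N - 1\<close> and \<open>Max E\<close>, and the root lies beyond
    \<open>Max E + 1/2\<close>, so twice its displacement pays for all of them.\<close>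
  have cE: "real (card E) \<le> 2 * (\<xi> (N - 1) - real (N - 1))"
  proof (cases "E = {}")
    case True then show ?thesis using \<xi>(1)[of "N - 1"] N by simp
  next
    case False
    have fE: "finite E" using A by (simp add: E_def)
    let ?M = "Max E"
    have "?M \<in> E" using fE False by simp
    then have "?M \<in> A" "\<not> ?M < N - 1" by (auto simp: E_def)
    then have M: "\<xi> (N - 1) > real ?M + 1/2" using key[of ?M] by (simp add: min_def split: if_splits)
    have "E \<subseteq> {N - 1..?M}" using fE by (auto simp: E_def)
    then have "card E \<le> card {N - 1..?M}" by (intro card_mono) auto
    then have "card E \<le> Suc ?M - (N - 1)" by simp
    moreover have "N - 1 \<le> ?M" using \<open>\<not> ?M < N - 1\<close> by simp
    ultimately have c: "real (card E) \<le> real ?M + 1 - real (N - 1)"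
      by linarith
    have "real (N - 1) \<le> real ?M" using \<open>N - 1 \<le> ?M\<close> by linarith
    then show ?thesis using c M by (simp)
  qed
  have "(\<Sum>j<N. \<xi> j - real j) = (\<Sum>j<N - 1. \<xi> j - real j) + (\<xi> (N - 1) - real (N - 1))"
    using N by (metis Suc_diff_1 less_eq_Suc_le One_nat_def sum.lessThan_Suc)
  then have "real (card A) \<le> 2 * (\<Sum>j<N. \<xi> j - real j)"
    using cB cE cardA by (simp add: sum_distrib_left)
  then show ?thesis using sm by simp
qed

text \<open>The interlacing of the roots requires a positive mass at every node, so each mass is
  raised by \<open>e > 0\<close>. The strict inequalities on the finite set \<open>A\<close> survive
  for small \<open>e\<close>, and \<open>e\<close> tends to 0 in the conclusion.\<close>

lemma boole_count_nonneg:
  fixes f :: "nat \<Rightarrow> real"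
  assumes f: "\<And>m. m < N \<Longrightarrow> f m \<ge> 0" and l: "l > 0"
    and A: "finite A" "\<And>n. n \<in> A \<Longrightarrow> (\<Sum>m<N. f m / (real n - real m + 1/2)) > l"
  shows "real (card A) \<le> 2 / l * (\<Sum>m<N. f m)"
proof (cases "N = 0")
  case True
  then have "A = {}" using A(2) l by force
  then show ?thesis using True by simp
next
  case False
  have ev: "\<forall>\<^sub>F e in at_right 0. \<forall>n\<in>A. (\<Sum>m<N. (f m + e) / (real n - real m + 1/2)) > l"
  proof (rule eventually_ball_finite[OF A(1)], rule ballI)
    fix n assume "n \<in> A"
    have "((\<lambda>e. \<Sum>m<N. (f m + e) / (real n - real m + 1/2)) \<longlongrightarrow> (\<Sum>m<N. (f m + 0) / (real n - real m + 1/2))) (at_right 0)"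
      unfolding divide_inverse by (intro tendsto_intros)
    then show "\<forall>\<^sub>F e in at_right 0. (\<Sum>m<N. (f m + e) / (real n - real m + 1/2)) > l"
      by (rule order_tendstoD) (use A(2)[OF \<open>n \<in> A\<close>] in simp)
  qed
  have "\<forall>\<^sub>F e::real in at_right 0. e > 0" by (simp add: eventually_at_right_less)
  with ev have bd: "\<forall>\<^sub>F e in at_right 0. real (card A) \<le> 2 / l * (\<Sum>m<N. (f m + e))"
  proof eventually_elim
    case (elim e)
    show ?case by (rule boole_count_pos) (use elim False f l A in \<open>auto intro: add_nonneg_pos\<close>)
  qed
  have "((\<lambda>e. 2 / l * (\<Sum>m<N. (f m + e))) \<longlongrightarrow> 2 / l * (\<Sum>m<N. (f m + 0))) (at_right 0)"
    by (intro tendsto_intros)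
  from tendsto_lowerbound[OF this bd] show ?thesis by simp
qed

text \<open>The reflection \<open>m \<mapsto> N - 1 - m\<close>,
  \<open>n \<mapsto> N - 2 - n\<close> changes the sign of \<open>n - m + 1/2\<close> and reduces
  lower level sets to upper ones. It stays within the naturals because for
  \<open>n \<ge> N - 1\<close> all denominators are positive and the sum cannot be negative.\<close>

lemma boole_count_nonneg_neg:
  fixes f :: "nat \<Rightarrow> real"
  assumes f: "\<And>m. m < N \<Longrightarrow> f m \<ge> 0" and l: "l > 0"
    and A: "finite A" "\<And>n. n \<in> A \<Longrightarrow> (\<Sum>m<N. f m / (real n - real m + 1/2)) < - l"
  shows "real (card A) \<le> 2 / l * (\<Sum>m<N. f m)"
proof -
  have lt: "Suc n < N" if "n \<in> A" for n
  proof (rule ccontr)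
    assume "\<not> ?thesis"
    then have "(\<Sum>m<N. f m / (real n - real m + 1/2)) \<ge> 0"
      by (intro sum_nonneg divide_nonneg_nonneg) (auto simp: f)
    then show False using A(2)[OF that] l by simp
  qed
  define h where "h n = N - 2 - n" for n
  have inj: "inj_on h A"
  proof (rule inj_onI)
    fix x y assume "x \<in> A" "y \<in> A" "h x = h y"
    with lt[of x] lt[of y] show "x = y" unfolding h_def by linarith
  qed
  have "real (card (h ` A)) \<le> 2 / l * (\<Sum>m<N. f (N - Suc m))"
  proof (rule boole_count_nonneg)
    fix k assume "k \<in> h ` A"
    then obtain n where n: "n \<in> A" "k = h n" by auto
    have kn: "real k = real N - 2 - real n" using lt[OF n(1)] n(2) by (simp add: h_def of_nat_diff)
    have "(\<Sum>m<N. f (N - Suc m) / (real k - real m + 1/2)) = (\<Sum>m<N. f m / (real k - real (N - Suc m) + 1/2))"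
      by (subst sum.nat_diff_reindex[symmetric]) (intro sum.cong, auto)
    also have "\<dots> = (\<Sum>m<N. - (f m / (real n - real m + 1/2)))"
    proof (rule sum.cong)
      fix m assume "m \<in> {..<N}"
      then have "real (N - Suc m) = real N - 1 - real m" by auto
      then have "real k - real (N - Suc m) + 1/2 = - (real n - real m + 1/2)" using kn by simp
      then show "f m / (real k - real (N - Suc m) + 1/2) = - (f m / (real n - real m + 1/2))"
        by (metis minus_divide_right)
    qed simp
    also have "\<dots> > l" using A(2)[OF n(1)] by (simp add: sum_negf)
    finally show "l < (\<Sum>m<N. f (N - Suc m) / (real k - real m + 1/2))" .
  qed (use f l A in auto)
  moreover have "(\<Sum>m<N. f (N - Suc m)) = (\<Sum>m<N. f m)"
    by (rule sum.nat_diff_reindex)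
  ultimately show ?thesis by (simp add: card_image[OF inj])
qed

text \<open>Boole's identity concerns nonnegative masses, so the positive and negative parts of
  \<open>f\<close> are treated separately at level \<open>l / 2\<close>. Each part has an upper and
  a lower level set, each costing \<open>4 / l\<close> times its mass; together this is the
  8.\<close>

lemma half_hilbert_weak_type:
  fixes f :: "nat \<Rightarrow> real"
  assumes l: "l > 0"
  shows "l * real (card {n. n < L \<and> \<bar>\<Sum>m<N. f m / (real n - real m + 1/2)\<bar> > l}) \<le> 8 * (\<Sum>m<N. \<bar>f m\<bar>)"
proof -
  define H where "H g n = (\<Sum>m<N. g m / (real n - real m + 1/2))" for g :: "nat \<Rightarrow> real" and n :: nat
  define fp where "fp m = max (f m) 0" for m
  define fm where "fm m = max (- f m) 0" for m
  define A1 where "A1 = {n. n < L \<and> H fp n > l / 2}"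
  define A2 where "A2 = {n. n < L \<and> H fp n < - (l / 2)}"
  define A3 where "A3 = {n. n < L \<and> H fm n > l / 2}"
  define A4 where "A4 = {n. n < L \<and> H fm n < - (l / 2)}"
  have fin: "finite A1" "finite A2" "finite A3" "finite A4" by (auto simp: A1_def A2_def A3_def A4_def)
  have Hf: "H f n = H fp n - H fm n" for n
    unfolding H_def sum_subtractf[symmetric]
    by (intro sum.cong) (auto simp: fp_def fm_def max_def diff_divide_distrib[symmetric])
  have "{n. n < L \<and> \<bar>H f n\<bar> > l} \<subseteq> A1 \<union> A2 \<union> A3 \<union> A4"
    by (auto simp: Hf A1_def A2_def A3_def A4_def)
  then have "card {n. n < L \<and> \<bar>H f n\<bar> > l} \<le> card (A1 \<union> A2 \<union> A3 \<union> A4)"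
    using fin by (intro card_mono) auto
  also have "\<dots> \<le> card A1 + card A2 + card A3 + card A4"
    using card_Un_le[of "A1 \<union> A2 \<union> A3" A4] card_Un_le[of "A1 \<union> A2" A3] card_Un_le[of A1 A2] by linarith
  finally have c: "real (card {n. n < L \<and> \<bar>H f n\<bar> > l}) \<le> real (card A1) + real (card A2) + real (card A3) + real (card A4)"
    by linarith
  have "real (card A1) \<le> 2 / (l/2) * (\<Sum>m<N. fp m)"
    by (rule boole_count_nonneg) (use l fin in \<open>auto simp: fp_def A1_def H_def\<close>)
  moreover have "real (card A2) \<le> 2 / (l/2) * (\<Sum>m<N. fp m)"
    by (rule boole_count_nonneg_neg) (use l fin in \<open>auto simp: fp_def A2_def H_def\<close>)
  moreover have "real (card A3) \<le> 2 / (l/2) * (\<Sum>m<N. fm m)"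
    by (rule boole_count_nonneg) (use l fin in \<open>auto simp: fm_def A3_def H_def\<close>)
  moreover have "real (card A4) \<le> 2 / (l/2) * (\<Sum>m<N. fm m)"
    by (rule boole_count_nonneg_neg) (use l fin in \<open>auto simp: fm_def A4_def H_def\<close>)
  moreover have "(\<Sum>m<N. \<bar>f m\<bar>) = (\<Sum>m<N. fp m) + (\<Sum>m<N. fm m)"
    unfolding sum.distrib[symmetric] by (intro sum.cong) (auto simp: fp_def fm_def)
  ultimately have "real (card {n. n < L \<and> \<bar>H f n\<bar> > l}) \<le> 8 / l * (\<Sum>m<N. \<bar>f m\<bar>)"
    using c by (simp add: algebra_simps)
  then show ?thesis using l by (simp add: H_def field_simps)
qed

section \<open>Kernels of Calderon-Zygmund type: the Hilbert and Stieltjes matrices\<close>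

text \<open>Unweighted weak type (1,1) together with regularity in the output variable, with one
  constant for both. Both indices are truncated in the weak type inequality so that convergence is
  never at issue. The denominator uses the distance to \<open>n'\<close>, which later is the point
  where the maximal function is known to be small.\<close>

definition cz_kernel :: "real \<Rightarrow> (nat \<Rightarrow> nat \<Rightarrow> real) \<Rightarrow> bool" where
  "cz_kernel A k \<longleftrightarrow> A > 0 \<and>
     (\<forall>f N L l. l > 0 \<longrightarrow>
        l * real (card {n. n < L \<and> \<bar>\<Sum>m<N. f m * k m n\<bar> > l}) \<le> A * (\<Sum>m<N. \<bar>f m\<bar>)) \<and>
     (\<forall>m n n'. m \<noteq> n \<longrightarrow> m \<noteq> n' \<longrightarrow> \<bar>real m - real n'\<bar> \<le> 2 * \<bar>real m - real n\<bar> \<longrightarrow>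
        \<bar>k m n - k m n'\<bar> \<le> A * \<bar>real n - real n'\<bar> / (real m - real n')\<^sup>2)"

definition hilbert_kernel :: "nat \<Rightarrow> nat \<Rightarrow> real" where
  "hilbert_kernel m n = (if m = n then 0 else 1 / (real n - real m))"

definition stieltjes_kernel :: "nat \<Rightarrow> nat \<Rightarrow> real" where
  "stieltjes_kernel m n = 1 / (real m + real n + 1)"

lemma card_chebyshev:
  fixes F :: "nat \<Rightarrow> real"
  assumes "l > 0" "\<And>n. n < L \<Longrightarrow> F n \<ge> 0"
  shows "l * real (card {n. n < L \<and> F n > l}) \<le> (\<Sum>n<L. F n)"
proof -
  have "l * real (card {n. n < L \<and> F n > l}) = (\<Sum>n\<in>{n. n < L \<and> F n > l}. l)" by simp
  also have "\<dots> \<le> (\<Sum>n\<in>{n. n < L \<and> F n > l}. F n)" by (intro sum_mono) auto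
  also have "\<dots> \<le> (\<Sum>n<L. F n)" by (intro sum_mono2) (auto simp: assms)
  finally show ?thesis .
qed

text \<open>Comparison with the telescoping terms \<open>1 / n - 1 / (n + 1)\<close>. At
  \<open>n = 0\<close> the right-hand side is 2, because \<open>1 / 0 = 0\<close>.\<close>

lemma sum_inverse_square_le: "(\<Sum>i=1..n. 1 / (real i)\<^sup>2) \<le> 2 - 1 / real n"
proof (induction n)
  case (Suc n)
  show ?case
  proof (cases "n = 0")
    case False
    have "1 / (real (Suc n))\<^sup>2 \<le> 1 / real n - 1 / real (Suc n)"
      using False by (simp add: divide_simps power2_eq_square)
    then show ?thesis using Suc by simp
  qed simp
qed simp

lemma sum_inverse_square_dist_le:
  "(\<Sum>n<L. if n = m then 0 else 1 / (real n - real m)\<^sup>2) \<le> 4"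
proof -
  have b: "(\<Sum>i=1..n. 1 / (real i)\<^sup>2) \<le> 2" for n
    using sum_inverse_square_le[of n] by (smt (verit) divide_nonneg_nonneg of_nat_0_le_iff)
  have "(\<Sum>n<L. if n = m then 0 else 1 / (real n - real m)\<^sup>2)
      \<le> (\<Sum>n\<in>{..<m} \<union> {m<..<L + m + 1}. 1 / (real n - real m)\<^sup>2)"
  proof -
    have "(\<Sum>n<L. if n = m then 0 else 1 / (real n - real m)\<^sup>2) = (\<Sum>n\<in>{..<L} - {m}. 1 / (real n - real m)\<^sup>2)"
      by (simp add: sum.If_cases Diff_eq)
    also have "\<dots> \<le> (\<Sum>n\<in>{..<m} \<union> {m<..<L + m + 1}. 1 / (real n - real m)\<^sup>2)"
      by (intro sum_mono2) auto
    finally show ?thesis .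
  qed
  also have "\<dots> = (\<Sum>n<m. 1 / (real n - real m)\<^sup>2) + (\<Sum>n\<in>{m<..<L + m + 1}. 1 / (real n - real m)\<^sup>2)"
    by (subst sum.union_disjoint) auto
  also have "(\<Sum>n<m. 1 / (real n - real m)\<^sup>2) = (\<Sum>i=1..m. 1 / (real i)\<^sup>2)"
    by (rule sum.reindex_bij_witness[of _ "\<lambda>i. m - i" "\<lambda>n. m - n"]) (auto simp: of_nat_diff power2_commute)
  also have "(\<Sum>n\<in>{m<..<L + m + 1}. 1 / (real n - real m)\<^sup>2) = (\<Sum>i=1..L. 1 / (real i)\<^sup>2)"
    by (rule sum.reindex_bij_witness[of _ "\<lambda>i. m + i" "\<lambda>n. n - m"]) (auto simp: of_nat_diff)
  finally show ?thesis using b[of m] b[of L] by linarith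
qed

text \<open>The half-shifted kernel controlled by Boole's identity differs from the Hilbert kernel
  by at most \<open>1 / (n - m)^2\<close> off the diagonal and by 2 on it. This error maps l^1 to
  l^1 with norm at most \<open>2 + 4\<close>, so Chebyshev's inequality gives its weak type. Halving
  the level yields \<open>2 * 8 + 2 * 6\<close>, which is below 40.\<close>

lemma cz_hilbert: "cz_kernel 40 hilbert_kernel"
proof -
  have wk: "l * real (card {n. n < L \<and> \<bar>\<Sum>m<N. f m * hilbert_kernel m n\<bar> > l}) \<le> 40 * (\<Sum>m<N. \<bar>f m\<bar>)"
    if l: "l > 0" for l :: real and f N L
  proof -
    define H where "H n = (\<Sum>m<N. f m / (real n - real m + 1/2))" for n
    define e where "e m n = (if n = m then 2 else 1 / (real n - real m)\<^sup>2)" for m n :: nat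
    define E where "E n = (\<Sum>m<N. \<bar>f m\<bar> * e m n)" for n
    have ke: "\<bar>hilbert_kernel m n - 1 / (real n - real m + 1/2)\<bar> \<le> e m n" for m n
    proof (cases "n = m")
      case False
      define d where "d = real n - real m"
      have d: "d \<ge> 1 \<or> d \<le> -1" using False unfolding d_def by linarith
      then have "d \<noteq> 0" "2 * d + 1 \<noteq> 0" by auto
      then have "1 / d - 1 / (d + 1/2) = 1 / (d * (2 * d + 1))"
        by (simp add: divide_simps)
      moreover have "\<bar>1 / (d * (2 * d + 1))\<bar> \<le> 1 / d\<^sup>2"
      proof -
        have "\<bar>d\<bar> \<le> \<bar>2 * d + 1\<bar>" using d by linarith
        then have "\<bar>d\<bar> * \<bar>d\<bar> \<le> \<bar>d\<bar> * \<bar>2 * d + 1\<bar>" by (intro mult_left_mono) auto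
        moreover have "\<bar>d\<bar> * \<bar>d\<bar> > 0" using \<open>d \<noteq> 0\<close> by (intro mult_pos_pos) auto
        ultimately show ?thesis
          by (simp add: abs_mult power2_eq_square frac_le)
      qed
      ultimately show ?thesis using False by (simp add: hilbert_kernel_def e_def d_def)
    qed (simp add: hilbert_kernel_def e_def)
    have dec: "\<bar>\<Sum>m<N. f m * hilbert_kernel m n\<bar> \<le> \<bar>H n\<bar> + E n" for n
    proof -
      have "(\<Sum>m<N. f m * hilbert_kernel m n) = H n + (\<Sum>m<N. f m * (hilbert_kernel m n - 1 / (real n - real m + 1/2)))"
        unfolding H_def sum.distrib[symmetric] by (intro sum.cong) (auto simp: algebra_simps)
      moreover have "\<bar>\<Sum>m<N. f m * (hilbert_kernel m n - 1 / (real n - real m + 1/2))\<bar> \<le> E n"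
        unfolding E_def by (rule order.trans[OF sum_abs]) (auto intro!: sum_mono mult_left_mono ke simp: abs_mult)
      ultimately show ?thesis by linarith
    qed
    have "{n. n < L \<and> \<bar>\<Sum>m<N. f m * hilbert_kernel m n\<bar> > l} \<subseteq> {n. n < L \<and> \<bar>H n\<bar> > l/2} \<union> {n. n < L \<and> E n > l/2}"
    proof
      fix n assume "n \<in> {n. n < L \<and> \<bar>\<Sum>m<N. f m * hilbert_kernel m n\<bar> > l}"
      with dec[of n] have "n < L" "\<bar>H n\<bar> > l/2 \<or> E n > l/2" by auto
      then show "n \<in> {n. n < L \<and> \<bar>H n\<bar> > l/2} \<union> {n. n < L \<and> E n > l/2}" by auto
    qed
    then have "card {n. n < L \<and> \<bar>\<Sum>m<N. f m * hilbert_kernel m n\<bar> > l} \<le> card ({n. n < L \<and> \<bar>H n\<bar> > l/2} \<union> {n. n < L \<and> E n > l/2})"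
      by (intro card_mono) auto
    also have "\<dots> \<le> card {n. n < L \<and> \<bar>H n\<bar> > l/2} + card {n. n < L \<and> E n > l/2}"
      by (rule card_Un_le)
    finally have c: "real (card {n. n < L \<and> \<bar>\<Sum>m<N. f m * hilbert_kernel m n\<bar> > l}) \<le>
      real (card {n. n < L \<and> \<bar>H n\<bar> > l/2}) + real (card {n. n < L \<and> E n > l/2})" by linarith
    have c1: "(l/2) * real (card {n. n < L \<and> \<bar>H n\<bar> > l/2}) \<le> 8 * (\<Sum>m<N. \<bar>f m\<bar>)"
      unfolding H_def using half_hilbert_weak_type[of "l/2"] l by simp
    have "(l/2) * real (card {n. n < L \<and> E n > l/2}) \<le> (\<Sum>n<L. E n)"
      by (rule card_chebyshev) (use l in \<open>auto simp: E_def e_def intro!: sum_nonneg\<close>)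
    also have "\<dots> = (\<Sum>m<N. \<bar>f m\<bar> * (\<Sum>n<L. e m n))"
      unfolding E_def by (subst sum.swap) (simp add: sum_distrib_left)
    also have "\<dots> \<le> (\<Sum>m<N. \<bar>f m\<bar> * 6)"
    proof (intro sum_mono mult_left_mono)
      fix m
      have "(\<Sum>n<L. e m n) = (\<Sum>n<L. (if n = m then 2 else 0) + (if n = m then 0 else 1 / (real n - real m)\<^sup>2))"
        by (intro sum.cong) (auto simp: e_def)
      also have "\<dots> \<le> 2 + 4" unfolding sum.distrib
        by (intro add_mono sum_inverse_square_dist_le) simp
      finally show "(\<Sum>n<L. e m n) \<le> 6" by simp
    qed auto
    finally have c2: "(l/2) * real (card {n. n < L \<and> E n > l/2}) \<le> 6 * (\<Sum>m<N. \<bar>f m\<bar>)"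
      by (simp add: sum_distrib_left mult.commute)
    have s0: "(\<Sum>m<N. \<bar>f m\<bar>) \<ge> 0" by (simp add: sum_nonneg)
    have "l * real (card {n. n < L \<and> \<bar>\<Sum>m<N. f m * hilbert_kernel m n\<bar> > l}) \<le>
      l * (real (card {n. n < L \<and> \<bar>H n\<bar> > l/2}) + real (card {n. n < L \<and> E n > l/2}))"
      using c l by (intro mult_left_mono) auto
    also have "\<dots> = 2 * ((l/2) * real (card {n. n < L \<and> \<bar>H n\<bar> > l/2})) + 2 * ((l/2) * real (card {n. n < L \<and> E n > l/2}))"
      by (simp add: algebra_simps)
    also have "\<dots> \<le> 40 * (\<Sum>m<N. \<bar>f m\<bar>)" using c1 c2 s0 by linarith
    finally show ?thesis .
  qed
  have sm: "\<bar>hilbert_kernel m n - hilbert_kernel m n'\<bar> \<le> 40 * \<bar>real n - real n'\<bar> / (real m - real n')\<^sup>2"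
    if "m \<noteq> n" "m \<noteq> n'" "\<bar>real m - real n'\<bar> \<le> 2 * \<bar>real m - real n\<bar>" for m n n'
  proof -
    have nz: "real n - real m \<noteq> 0" "real n' - real m \<noteq> 0" using that by auto
    have e: "hilbert_kernel m n - hilbert_kernel m n' = (real n' - real n) / ((real n - real m) * (real n' - real m))"
      using that nz by (simp add: hilbert_kernel_def divide_simps) 
    have "\<bar>real n' - real n\<bar> / \<bar>(real n - real m) * (real n' - real m)\<bar> \<le> \<bar>real n' - real n\<bar> / ((real m - real n')\<^sup>2 / 2)"
    proof (rule divide_left_mono)
      have "(real m - real n')\<^sup>2 = \<bar>real m - real n'\<bar> * \<bar>real m - real n'\<bar>"
        by (simp add: power2_eq_square)
      also have "\<dots> \<le> (2 * \<bar>real m - real n\<bar>) * \<bar>real m - real n'\<bar>"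
        using that by (intro mult_right_mono) auto
      finally show "(real m - real n')\<^sup>2 / 2 \<le> \<bar>(real n - real m) * (real n' - real m)\<bar>"
        by (simp add: abs_mult abs_minus_commute)
    qed (use nz in auto)
    also have "\<dots> = 2 * \<bar>real n - real n'\<bar> / (real m - real n')\<^sup>2" by (simp add: abs_minus_commute)
    also have "\<dots> \<le> 40 * \<bar>real n - real n'\<bar> / (real m - real n')\<^sup>2" by (intro divide_right_mono) auto
    finally show ?thesis unfolding e by (simp add: abs_divide)
  qed
  show ?thesis unfolding cz_kernel_def using wk sm by auto
qed

text \<open>The kernel is at most \<open>1 / (n + 1)\<close> uniformly in \<open>m\<close>, so every
  \<open>n\<close> in the level set satisfies
  \<open>l * (n + 1) < (\<Sum>m<N. \<bar>f m\<bar>)\<close>. Applied to the largest such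
  \<open>n\<close> this bounds the cardinality. Regularity follows from
  \<open>\<bar>m - n\<bar> \<le> m + n + 1\<close>.\<close>

lemma cz_stieltjes: "cz_kernel 2 stieltjes_kernel"
proof -
  have wk: "l * real (card {n. n < L \<and> \<bar>\<Sum>m<N. f m * stieltjes_kernel m n\<bar> > l}) \<le> 2 * (\<Sum>m<N. \<bar>f m\<bar>)"
    if l: "l > 0" for l :: real and f N L
  proof (cases "{n. n < L \<and> \<bar>\<Sum>m<N. f m * stieltjes_kernel m n\<bar> > l} = {}")
    case True show ?thesis unfolding True by (simp add: sum_nonneg)
  next
    case False
    define B where "B = {n. n < L \<and> \<bar>\<Sum>m<N. f m * stieltjes_kernel m n\<bar> > l}"
    have fB: "finite B" "B \<noteq> {}" using False by (auto simp: B_def)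
    let ?M = "Max B"
    have "?M \<in> B" using fB by simp
    then have "l < \<bar>\<Sum>m<N. f m * stieltjes_kernel m ?M\<bar>" by (auto simp: B_def)
    also have "\<dots> \<le> (\<Sum>m<N. \<bar>f m\<bar> * (1 / (real ?M + 1)))"
      by (rule order.trans[OF sum_abs])
         (auto intro!: sum_mono mult_left_mono simp: abs_mult stieltjes_kernel_def frac_le)
    also have "\<dots> = (\<Sum>m<N. \<bar>f m\<bar>) / (real ?M + 1)" by (simp add: sum_divide_distrib)
    finally have "l * (real ?M + 1) < (\<Sum>m<N. \<bar>f m\<bar>)" by (simp add: pos_less_divide_eq)
    moreover have "card B \<le> card {..?M}" using fB by (intro card_mono) auto
    then have "l * real (card B) \<le> l * (real ?M + 1)" using l by (intro mult_left_mono) auto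
    moreover have "(\<Sum>m<N. \<bar>f m\<bar>) \<ge> 0" by (simp add: sum_nonneg)
    ultimately show ?thesis unfolding B_def[symmetric] by linarith
  qed
  have sm: "\<bar>stieltjes_kernel m n - stieltjes_kernel m n'\<bar> \<le> 2 * \<bar>real n - real n'\<bar> / (real m - real n')\<^sup>2"
    if "m \<noteq> n" "m \<noteq> n'" "\<bar>real m - real n'\<bar> \<le> 2 * \<bar>real m - real n\<bar>" for m n n'
  proof -
    have e: "stieltjes_kernel m n - stieltjes_kernel m n' = (real n' - real n) / ((real m + real n + 1) * (real m + real n' + 1))"
      by (simp add: stieltjes_kernel_def divide_simps)
    have "\<bar>real n' - real n\<bar> / \<bar>(real m + real n + 1) * (real m + real n' + 1)\<bar> \<le> \<bar>real n' - real n\<bar> / ((real m - real n')\<^sup>2 / 2)"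
    proof (rule divide_left_mono)
      have "(real m - real n')\<^sup>2 = \<bar>real m - real n'\<bar> * \<bar>real m - real n'\<bar>"
        by (simp add: power2_eq_square)
      also have "\<dots> \<le> (2 * (real m + real n + 1)) * (real m + real n' + 1)"
      proof (intro mult_mono)
        have "\<bar>real m - real n\<bar> \<le> real m + real n + 1" by linarith
        then show "\<bar>real m - real n'\<bar> \<le> 2 * (real m + real n + 1)" by (intro order.trans[OF that(3)]) simp
      qed auto
      also have "\<dots> = 2 * \<bar>(real m + real n + 1) * (real m + real n' + 1)\<bar>" by (simp add: abs_mult)
      finally show "(real m - real n')\<^sup>2 / 2 \<le> \<bar>(real m + real n + 1) * (real m + real n' + 1)\<bar>"
        by linarith
      have "(real m - real n')\<^sup>2 > 0" using that by simp
      then show "0 < \<bar>(real m + real n + 1) * (real m + real n' + 1)\<bar> * ((real m - real n')\<^sup>2 / 2)"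
        by (intro mult_pos_pos) (auto simp: add_pos_nonneg)
    qed auto
    then show ?thesis unfolding e by (simp add: abs_divide abs_minus_commute mult.commute)
  qed
  show ?thesis unfolding cz_kernel_def using wk sm by auto
qed

section \<open>Weighted maximal functions\<close>

text \<open>If three intervals share a point, then the one that neither reaches furthest left nor furthest
  right is covered by the other two and can be dropped.\<close>

lemma interval_subcover:
  fixes F :: "(nat \<times> nat) set"
  assumes "finite F"
  shows "\<exists>G\<subseteq>F. (\<Union>I\<in>G. {fst I..snd I}) = (\<Union>I\<in>F. {fst I..snd I}) \<and>
           (\<forall>x. card {I\<in>G. x \<in> {fst I..snd I}} \<le> 2)"
  using assms
proof (induction "card F" arbitrary: F rule: less_induct)
  case less
  show ?case
  proof (cases "\<forall>x. card {I\<in>F. x \<in> {fst I..snd I}} \<le> 2")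
    case True
    then show ?thesis by (intro exI[of _ F]) auto
  next
    case False
    then obtain x where x: "card {I\<in>F. x \<in> {fst I..snd I}} > 2" by (auto simp: not_le)
    define B where "B = {I\<in>F. x \<in> {fst I..snd I}}"
    have cB: "card B > 2" using x by (simp only: B_def)
    have fB: "finite B" using less.prems by (simp add: B_def)
    have "B \<noteq> {}" using cB by auto
    note fB = fB this
    have "Min (fst ` B) \<in> fst ` B" using fB by (intro Min_in) auto
    then obtain l where l: "l \<in> B" "fst l = Min (fst ` B)" by force
    have "Max (snd ` B) \<in> snd ` B" using fB by (intro Max_in) auto
    then obtain r where r: "r \<in> B" "snd r = Max (snd ` B)" by force
    have "\<not> B \<subseteq> {l, r}"
    proof
      assume "B \<subseteq> {l, r}"
      then have "card B \<le> card {l, r}" by (intro card_mono) auto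
      also have "\<dots> \<le> 2" by (simp add: card_insert_if)
      finally show False using x by (simp add: B_def)
    qed
    then obtain I where I: "I \<in> B" "I \<noteq> l" "I \<noteq> r" by auto
    have li: "fst l \<le> fst I" using l fB I by simp
    have ri: "snd I \<le> snd r" using r fB I by simp
    have xl: "x \<in> {fst l..snd l}" "x \<in> {fst r..snd r}" using l r by (auto simp: B_def)
    have sub: "{fst I..snd I} \<subseteq> {fst l..snd l} \<union> {fst r..snd r}"
      using li ri xl by auto
    have IF: "I \<in> F" "l \<in> F" "r \<in> F" using I l r by (auto simp: B_def)
    have un: "(\<Union>I\<in>F - {I}. {fst I..snd I}) = (\<Union>I\<in>F. {fst I..snd I})"
    proof
      show "(\<Union>I\<in>F. {fst I..snd I}) \<subseteq> (\<Union>I\<in>F - {I}. {fst I..snd I})"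
      proof
        fix y assume "y \<in> (\<Union>I\<in>F. {fst I..snd I})"
        then obtain J where J: "J \<in> F" "y \<in> {fst J..snd J}" by auto
        show "y \<in> (\<Union>I\<in>F - {I}. {fst I..snd I})"
        proof (cases "J = I")
          case True
          then have "y \<in> {fst l..snd l} \<or> y \<in> {fst r..snd r}" using J sub by auto
          moreover have "l \<in> F - {I}" "r \<in> F - {I}" using IF I by auto
          ultimately show ?thesis by blast
        next
          case False
          then show ?thesis using J by blast
        qed
      qed
    qed auto
    have "card (F - {I}) < card F" using less.prems IF by (intro psubset_card_mono) auto
    from less.hyps[OF this finite_Diff[OF less.prems]] obtain G where "G \<subseteq> F - {I}"
      "(\<Union>I\<in>G. {fst I..snd I}) = (\<Union>I\<in>F. {fst I..snd I})"
      "\<forall>x. card {I\<in>G. x \<in> {fst I..snd I}} \<le> 2"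
      unfolding un by blast
    then show ?thesis by blast
  qed
qed

text \<open>After thinning the cover, every point of \<open>E\<close> lies in one or two intervals.
  Adding the inequality over the thinned family therefore loses only a factor 2, whatever the weight
  \<open>v\<close> is.\<close>

lemma interval_cover_sum:
  fixes v h :: "nat \<Rightarrow> real"
  assumes F: "finite F" and E: "E = (\<Union>I\<in>F. {fst I..snd I})" and \<mu>: "\<mu> \<ge> 0"
    and v: "\<And>k. k \<in> E \<Longrightarrow> v k \<ge> 0" and h: "\<And>k. k \<in> E \<Longrightarrow> h k \<ge> 0"
    and le: "\<And>I. I \<in> F \<Longrightarrow> \<mu> * (\<Sum>k\<in>{fst I..snd I}. v k) \<le> (\<Sum>k\<in>{fst I..snd I}. h k)"
  shows "\<mu> * (\<Sum>k\<in>E. v k) \<le> 2 * (\<Sum>k\<in>E. h k)"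
proof -
  obtain G where G: "G \<subseteq> F" "(\<Union>I\<in>G. {fst I..snd I}) = E"
    "\<And>x. card {I\<in>G. x \<in> {fst I..snd I}} \<le> 2"
    using interval_subcover[OF F] unfolding E[symmetric] by blast
  have fG: "finite G" using G(1) F finite_subset by blast
  have fE: "finite E" unfolding E using F by auto
  define c where "c x = card {I\<in>G. x \<in> {fst I..snd I}}" for x
  have c: "1 \<le> c x" if "x \<in> E" for x
  proof -
    have "x \<in> (\<Union>I\<in>G. {fst I..snd I})" using that G(2) by simp
    then have "{I\<in>G. x \<in> {fst I..snd I}} \<noteq> {}" by blast
    then show ?thesis unfolding c_def using fG by (simp add: Suc_le_eq card_gt_0_iff)
  qed
  have sw: "(\<Sum>I\<in>G. \<Sum>k\<in>{fst I..snd I}. u k) = (\<Sum>k\<in>E. real (c k) * u k)" for u :: "nat \<Rightarrow> real"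
  proof -
    have "(\<Sum>I\<in>G. \<Sum>k\<in>{fst I..snd I}. u k) = (\<Sum>I\<in>G. \<Sum>k\<in>E. if k \<in> {fst I..snd I} then u k else 0)"
    proof (rule sum.cong[OF refl])
      fix I assume "I \<in> G"
      then have "{fst I..snd I} \<subseteq> E" using G by blast
      then show "(\<Sum>k\<in>{fst I..snd I}. u k) = (\<Sum>k\<in>E. if k \<in> {fst I..snd I} then u k else 0)"
        using fE by (subst sum.inter_restrict[symmetric]) (auto simp only: Int_absorb1)
    qed
    also have "\<dots> = (\<Sum>k\<in>E. \<Sum>I\<in>G. if k \<in> {fst I..snd I} then u k else 0)" by (rule sum.swap)
    also have "\<dots> = (\<Sum>k\<in>E. real (c k) * u k)"
      using fG by (intro sum.cong) (auto simp: c_def sum.inter_filter[symmetric])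
    finally show ?thesis .
  qed
  have "\<mu> * (\<Sum>k\<in>E. v k) \<le> \<mu> * (\<Sum>k\<in>E. real (c k) * v k)"
  proof (intro mult_left_mono sum_mono)
    fix k assume "k \<in> E"
    then show "v k \<le> real (c k) * v k"
      using mult_right_mono[of 1 "real (c k)" "v k"] c[of k] v[of k] by simp
  qed (rule \<mu>)
  also have "\<dots> = (\<Sum>I\<in>G. \<mu> * (\<Sum>k\<in>{fst I..snd I}. v k))"
    by (simp add: sw[symmetric] sum_distrib_left)
  also have "\<dots> \<le> (\<Sum>I\<in>G. \<Sum>k\<in>{fst I..snd I}. h k)"
    using le G(1) by (intro sum_mono) auto
  also have "\<dots> = (\<Sum>k\<in>E. real (c k) * h k)" by (rule sw)
  also have "\<dots> \<le> (\<Sum>k\<in>E. 2 * h k)"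
  proof (intro sum_mono mult_right_mono)
    fix k show "real (c k) \<le> 2" using G(3)[of k] by (simp add: c_def)
  qed (use h in auto)
  finally show ?thesis by (simp add: sum_distrib_left)
qed

section \<open>Maximal operators with respect to a weight\<close>

text \<open>The uncentred Hardy-Littlewood maximal function for the measure \<open>v\<close>, over
  intervals inside \<open>{0..<N}\<close>, so that the supremum is a maximum over a finite set. For
  \<open>n \<ge> N\<close> this set is empty and the value carries no information. Absolute values
  are left to the caller.\<close>

definition wmax :: "nat \<Rightarrow> (nat \<Rightarrow> real) \<Rightarrow> (nat \<Rightarrow> real) \<Rightarrow> nat \<Rightarrow> real" where
  "wmax N v f n = Max ((\<lambda>(i,j). (\<Sum>k=i..j. f k * v k) / (\<Sum>k=i..j. v k)) ` {(i,j). i \<le> n \<and> n \<le> j \<and> j < N})"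

lemma wmax_set:
  assumes "n < N"
  shows "finite {(i,j). i \<le> n \<and> n \<le> j \<and> j < (N::nat)}" "{(i,j). i \<le> n \<and> n \<le> j \<and> j < N} \<noteq> {}"
proof -
  have "{(i,j). i \<le> n \<and> n \<le> j \<and> j < N} \<subseteq> {..n} \<times> {..<N}" by auto
  then show "finite {(i,j). i \<le> n \<and> n \<le> j \<and> j < N}" by (rule finite_subset) auto
  show "{(i,j). i \<le> n \<and> n \<le> j \<and> j < N} \<noteq> {}" using assms by auto
qed

lemma wmax_ge:
  assumes "i \<le> n" "n \<le> j" "j < N"
  shows "(\<Sum>k=i..j. f k * v k) / (\<Sum>k=i..j. v k) \<le> wmax N v f n"
proof -
  have "(\<Sum>k=i..j. f k * v k) / (\<Sum>k=i..j. v k) \<in> (\<lambda>(i,j). (\<Sum>k=i..j. f k * v k) / (\<Sum>k=i..j. v k)) ` {(i,j). i \<le> n \<and> n \<le> j \<and> j < N}"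
    by (rule image_eqI[where x = "(i,j)"]) (use assms in auto)
  then show ?thesis unfolding wmax_def using wmax_set[of n N] assms by (intro Max_ge) auto
qed

lemma wmax_attained:
  assumes "n < N"
  obtains i j where "i \<le> n" "n \<le> j" "j < N" "wmax N v f n = (\<Sum>k=i..j. f k * v k) / (\<Sum>k=i..j. v k)"
proof -
  have "wmax N v f n \<in> (\<lambda>(i,j). (\<Sum>k=i..j. f k * v k) / (\<Sum>k=i..j. v k)) ` {(i,j). i \<le> n \<and> n \<le> j \<and> j < N}"
    unfolding wmax_def using wmax_set[OF assms] by (intro Max_in) auto
  then show ?thesis using that by auto
qed

lemma wmax_nonneg:
  assumes "n < N" "\<And>k. v k > 0" "\<And>k. f k \<ge> 0"
  shows "wmax N v f n \<ge> 0"
proof -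
  have "f n \<le> wmax N v f n" using wmax_ge[of n n n N f v] assms by (simp add: less_imp_neq[THEN not_sym])
  then show ?thesis using assms(3)[of n] by linarith
qed

text \<open>Here the uncentred definition pays off: an interval whose average exceeds
  \<open>l\<close> is entirely contained in the level set.\<close>

lemma wmax_superlevel_Union:
  obtains F where "finite F" "{n. n < N \<and> wmax N v f n > l} = (\<Union>I\<in>F. {fst I..snd I})"
    "\<forall>I\<in>F. fst I \<le> snd I \<and> (\<Sum>k=fst I..snd I. f k * v k) / (\<Sum>k=fst I..snd I. v k) > l"
proof -
  define F where "F = {(i,j). i \<le> j \<and> j < N \<and> (\<Sum>k=i..j. f k * v k) / (\<Sum>k=i..j. v k) > l}"
  have "F \<subseteq> {..<N} \<times> {..<N}" by (auto simp: F_def)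
  then have fF: "finite F" by (rule finite_subset) auto
  have un: "{n. n < N \<and> wmax N v f n > l} = (\<Union>I\<in>F. {fst I..snd I})"
  proof (intro set_eqI iffI)
    fix n assume "n \<in> {n. n < N \<and> wmax N v f n > l}"
    then have n: "n < N" "wmax N v f n > l" by auto
    obtain i j where ij: "i \<le> n" "n \<le> j" "j < N" "wmax N v f n = (\<Sum>k=i..j. f k * v k) / (\<Sum>k=i..j. v k)"
      using wmax_attained[OF n(1)] .
    then have "(i,j) \<in> F" using n by (auto simp: F_def)
    moreover have "n \<in> {fst (i,j)..snd (i,j)}" using ij by simp
    ultimately show "n \<in> (\<Union>I\<in>F. {fst I..snd I})" by blast
  next
    fix n assume "n \<in> (\<Union>I\<in>F. {fst I..snd I})"
    then obtain i j where "(i,j) \<in> F" "i \<le> n" "n \<le> j" by auto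
    then show "n \<in> {n. n < N \<and> wmax N v f n > l}"
      using wmax_ge[of i n j N f v] by (auto simp: F_def)
  qed
  show ?thesis by (rule that[OF fF un]) (auto simp: F_def)
qed

text \<open>The right-hand sum extends over the level set only. This sharper form of weak type is
  what can be integrated in \<open>l\<close> to give strong type.\<close>

lemma wmax_superlevel:
  assumes v: "\<And>k. v k > (0::real)" and f: "\<And>k. f k \<ge> 0" and l: "l > 0"
  shows "l * (\<Sum>n | n < N \<and> wmax N v f n > l. v n) \<le> 2 * (\<Sum>n | n < N \<and> wmax N v f n > l. f n * v n)"
proof -
  obtain F where fF: "finite F" and un: "{n. n < N \<and> wmax N v f n > l} = (\<Union>I\<in>F. {fst I..snd I})"
    and "\<forall>I\<in>F. fst I \<le> snd I \<and> (\<Sum>k=fst I..snd I. f k * v k) / (\<Sum>k=fst I..snd I. v k) > l"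
    by (rule wmax_superlevel_Union[where N = N and v = v and f = f and l = l])
  note F = bspec[OF this(3)]
  show ?thesis
  proof (rule interval_cover_sum[OF fF un])
    fix I assume I: "I \<in> F"
    have "(\<Sum>k=fst I..snd I. v k) > 0" using F[OF I] v by (intro sum_pos) auto
    then show "l * (\<Sum>k\<in>{fst I..snd I}. v k) \<le> (\<Sum>k\<in>{fst I..snd I}. f k * v k)"
      using F[OF I] by (simp add: pos_less_divide_eq)
  qed (use v f l in \<open>auto simp: less_imp_le\<close>)
qed

section \<open>The layer cake formula and strong type from level sets\<close>

lemma layer_cake_point:
  assumes "s > 0" "F \<ge> (0::real)"
  shows "(\<integral>\<^sup>+ l. ennreal (l powr (s - 1)) * indicator {0<..<F} l \<partial>lborel) = ennreal (F powr s / s)"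
proof -
  have "((\<lambda>x. x powr (s - 1)) has_integral (F powr (s - 1 + 1) / (s - 1 + 1))) {0..F}"
    using assms by (intro has_integral_powr_from_0) auto
  then have "((\<lambda>x. x powr (s - 1)) has_integral (F powr s / s)) {0<..<F}"
    by (subst has_integral_Icc_iff_Ioo[symmetric]) simp
  then have "((\<lambda>x. if x \<in> {0<..<F} then x powr (s - 1) else 0) has_integral (F powr s / s)) UNIV"
    by (subst has_integral_restrict_UNIV)
  then have "(\<integral>\<^sup>+ l. ennreal (if l \<in> {0<..<F} then l powr (s - 1) else 0) \<partial>lborel) = ennreal (F powr s / s)"
    by (intro nn_integral_has_integral_lborel) auto
  moreover have "(\<integral>\<^sup>+ l. ennreal (l powr (s - 1)) * indicator {0<..<F} l \<partial>lborel) = (\<integral>\<^sup>+ l. ennreal (if l \<in> {0<..<F} then l powr (s - 1) else 0) \<partial>lborel)"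
    by (intro nn_integral_cong) (auto simp: indicator_def)
  ultimately show ?thesis by simp
qed

lemma layer_cake:
  assumes s: "s > 0" and X: "finite X" and v: "\<And>n. n \<in> X \<Longrightarrow> v n \<ge> 0" and F: "\<And>n. n \<in> X \<Longrightarrow> F n \<ge> (0::real)"
  shows "(\<integral>\<^sup>+ l. ennreal (l powr (s - 1) * (\<Sum>n | n \<in> X \<and> F n > l. v n)) * indicator {0<..} l \<partial>lborel)
     = ennreal ((\<Sum>n\<in>X. v n * F n powr s) / s)"
proof -
  have "(\<integral>\<^sup>+ l. ennreal (l powr (s - 1) * (\<Sum>n | n \<in> X \<and> F n > l. v n)) * indicator {0<..} l \<partial>lborel)
     = (\<integral>\<^sup>+ l. (\<Sum>n\<in>X. ennreal (v n) * (ennreal (l powr (s - 1)) * indicator {0<..<F n} l)) \<partial>lborel)"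
  proof (rule nn_integral_cong)
    fix l :: real
    have "l powr (s - 1) * (\<Sum>n | n \<in> X \<and> F n > l. v n) = (\<Sum>n\<in>X. v n * (l powr (s - 1) * (if l < F n then 1 else 0)))"
      using X by (simp add: sum.inter_filter[symmetric] sum_distrib_left mult_ac if_distrib cong: if_cong)
    then have "ennreal (l powr (s - 1) * (\<Sum>n | n \<in> X \<and> F n > l. v n)) = (\<Sum>n\<in>X. ennreal (v n * (l powr (s - 1) * (if l < F n then 1 else 0))))"
      using v by (simp only:) (subst sum_ennreal, auto)
    also have "\<dots> * indicator {0<..} l = (\<Sum>n\<in>X. ennreal (v n) * (ennreal (l powr (s - 1)) * indicator {0<..<F n} l))"
      unfolding sum_distrib_right using v by (intro sum.cong) (auto simp: indicator_def ennreal_mult)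
    finally show "ennreal (l powr (s - 1) * (\<Sum>n | n \<in> X \<and> F n > l. v n)) * indicator {0<..} l = (\<Sum>n\<in>X. ennreal (v n) * (ennreal (l powr (s - 1)) * indicator {0<..<F n} l))" .
  qed
  also have "\<dots> = (\<Sum>n\<in>X. ennreal (v n) * ennreal (F n powr s / s))"
    using s F by (simp add: nn_integral_sum nn_integral_cmult layer_cake_point)
  also have "\<dots> = (\<Sum>n\<in>X. ennreal (v n * (F n powr s / s)))"
    using v s by (intro sum.cong) (auto simp: ennreal_mult[symmetric])
  also have "\<dots> = ennreal ((\<Sum>n\<in>X. v n * F n powr s) / s)"
    using v s by (subst sum_ennreal) (auto simp: sum_divide_distrib)
  finally show ?thesis .
qed

text \<open>Integrating the hypothesis against \<open>l powr (r - 2)\<close> gives a bound of the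
  sum of \<open>v F^r\<close> by \<open>c\<close> times the sum of \<open>v f F^(r-1)\<close>, with
  \<open>c = 2 * r / (r - 1)\<close>. Pointwise, if \<open>F > 2 * c * f\<close> then the right side
  is at most half of \<open>F^r\<close>, and otherwise \<open>F\<close> is dominated by
  \<open>f\<close>. The half is absorbed on the left, which is legitimate since all sums are
  finite.\<close>

lemma superlevel_strong_type:
  fixes v f F :: "'a \<Rightarrow> real"
  assumes r: "r > 1" and X: "finite X" and v: "\<And>n. n \<in> X \<Longrightarrow> v n \<ge> 0"
    and F: "\<And>n. n \<in> X \<Longrightarrow> F n \<ge> 0" and f: "\<And>n. n \<in> X \<Longrightarrow> f n \<ge> 0"
    and le: "\<And>l. l > 0 \<Longrightarrow> l * (\<Sum>n | n \<in> X \<and> F n > l. v n) \<le> 2 * (\<Sum>n | n \<in> X \<and> F n > l. f n * v n)"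
  shows "(\<Sum>n\<in>X. v n * F n powr r) \<le> (4 * r / (r - 1)) powr r * (\<Sum>n\<in>X. v n * f n powr r)"
proof -
  define c where "c = 2 * r / (r - 1)"
  have c0: "c > 0" using r by (simp add: c_def)
  have "ennreal ((\<Sum>n\<in>X. v n * F n powr r) / r) =
     (\<integral>\<^sup>+ l. ennreal (l powr (r - 1) * (\<Sum>n | n \<in> X \<and> F n > l. v n)) * indicator {0<..} l \<partial>lborel)"
    using r X v F by (subst layer_cake) auto
  also have "\<dots> \<le> (\<integral>\<^sup>+ l. ennreal (l powr (r - 1 - 1) * (\<Sum>n | n \<in> X \<and> F n > l. 2 * (f n * v n))) * indicator {0<..} l \<partial>lborel)"
  proof (intro nn_integral_mono)
    fix l :: real
    show "ennreal (l powr (r - 1) * (\<Sum>n | n \<in> X \<and> F n > l. v n)) * indicator {0<..} l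
      \<le> ennreal (l powr (r - 1 - 1) * (\<Sum>n | n \<in> X \<and> F n > l. 2 * (f n * v n))) * indicator {0<..} l"
    proof (cases "l > 0")
      case True
      have "l powr (r - 1) = l powr (r - 1 - 1) * l" using True powr_add[of l "r - 1 - 1" 1] by simp
      then have "l powr (r - 1) * (\<Sum>n | n \<in> X \<and> F n > l. v n) = l powr (r - 1 - 1) * (l * (\<Sum>n | n \<in> X \<and> F n > l. v n))"
        by simp
      also have "\<dots> \<le> l powr (r - 1 - 1) * (\<Sum>n | n \<in> X \<and> F n > l. 2 * (f n * v n))"
        using le[OF True] by (intro mult_left_mono) (auto simp: sum_distrib_left)
      finally show ?thesis using True by (auto intro: ennreal_leI)
    qed auto
  qed
  also have "\<dots> = ennreal ((\<Sum>n\<in>X. 2 * (f n * v n) * F n powr (r - 1)) / (r - 1))"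
    using r X v F f by (subst layer_cake) auto
  finally have "(\<Sum>n\<in>X. v n * F n powr r) / r \<le> (\<Sum>n\<in>X. 2 * (f n * v n) * F n powr (r - 1)) / (r - 1)"
    using r v f F by (subst (asm) ennreal_le_iff) (auto intro!: divide_nonneg_pos sum_nonneg mult_nonneg_nonneg)
  then have "(\<Sum>n\<in>X. v n * F n powr r) \<le> r * ((\<Sum>n\<in>X. 2 * (f n * v n) * F n powr (r - 1)) / (r - 1))"
    using r by (simp add: field_simps)
  also have "\<dots> = (\<Sum>n\<in>X. v n * (c * f n * F n powr (r - 1)))"
    unfolding c_def sum_distrib_left sum_divide_distrib by (intro sum.cong) (auto simp: field_simps)
  also have "\<dots> \<le> (\<Sum>n\<in>X. v n * (1/2 * F n powr r + 1/2 * (2 * c) powr r * f n powr r))"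
  proof (intro sum_mono mult_left_mono)
    fix n assume n: "n \<in> X"
    have e: "F n powr r = F n powr (r - 1) * F n" using F[OF n] r
      by (cases "F n = 0") (auto simp: powr_diff)
    show "c * f n * F n powr (r - 1) \<le> 1/2 * F n powr r + 1/2 * (2 * c) powr r * f n powr r"
    proof (cases "F n \<le> 2 * c * f n")
      case True
      have "c * f n * F n powr (r - 1) \<le> c * f n * (2 * c * f n) powr (r - 1)"
        using True c0 f[OF n] F[OF n] r by (intro mult_left_mono powr_mono2) auto
      also have "\<dots> = 1/2 * (2 * c * f n) powr r"
        using c0 f[OF n] r by (cases "f n = 0") (auto simp: powr_diff)
      also have "\<dots> = 1/2 * (2 * c) powr r * f n powr r" using c0 f[OF n] by (simp add: powr_mult)
      finally show ?thesis using powr_ge_zero[of "F n" r] by linarith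
    next
      case False
      then have "c * f n * F n powr (r - 1) \<le> (1/2 * F n) * F n powr (r - 1)"
        by (intro mult_right_mono) auto
      moreover have "0 \<le> 1/2 * (2 * c) powr r * f n powr r" by simp
      moreover have "(1/2 * F n) * F n powr (r - 1) = 1/2 * F n powr r" unfolding e by simp
      ultimately show ?thesis by linarith
    qed
  qed (use v in auto)
  also have "\<dots> = 1/2 * (\<Sum>n\<in>X. v n * F n powr r) + 1/2 * ((2 * c) powr r * (\<Sum>n\<in>X. v n * f n powr r))"
    by (simp add: sum.distrib sum_distrib_left algebra_simps)
  finally have "(\<Sum>n\<in>X. v n * F n powr r) \<le> (2 * c) powr r * (\<Sum>n\<in>X. v n * f n powr r)" by simp
  moreover have "2 * c = 4 * r / (r - 1)" by (simp add: c_def)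
  ultimately show ?thesis by simp
qed

lemma wmax_strong_type:
  assumes r: "r > 1" and v: "\<And>k. v k > (0::real)" and f: "\<And>k. f k \<ge> 0"
  shows "(\<Sum>n<N. v n * wmax N v f n powr r) \<le> (4 * r / (r - 1)) powr r * (\<Sum>n<N. v n * f n powr r)"
proof (rule superlevel_strong_type[OF r])
  fix l :: real assume "l > 0"
  from wmax_superlevel[OF v f this, where N = N]
  show "l * (\<Sum>n | n \<in> {..<N} \<and> wmax N v f n > l. v n) \<le> 2 * (\<Sum>n | n \<in> {..<N} \<and> wmax N v f n > l. f n * v n)"
    by simp
qed (use wmax_nonneg[where N = N and v = v and f = f] v f in \<open>auto simp: less_imp_le\<close>)

text \<open>Lerner's proof: the \<open>A\<^sub>p\<close> condition bounds \<open>(M f) powr (p - 1)\<close> pointwise by \<open>M\<^sub>w h\<close> with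
  \<open>h = (M\<^sub>\<sigma> (f / \<sigma>)) powr (p - 1) / w\<close>, and the weighted maximal operators \<open>M\<^sub>w\<close>, \<open>M\<^sub>\<sigma>\<close> are bounded
  on their own \<open>L\<^sup>p\<close> spaces for arbitrary weights.\<close>

lemma muckenhoupt_maximal:
  fixes w :: "nat \<Rightarrow> real"
  assumes p: "p > 1" and w: "\<And>k. w k > 0" and s: "\<And>k. \<sigma> k = w k powr (-1 / (p - 1))" and K: "K \<ge> 0"
    and Ap: "\<And>i j. i \<le> j \<Longrightarrow> (\<Sum>k=i..j. w k) * (\<Sum>k=i..j. \<sigma> k) powr (p - 1) \<le> K * real (j - i + 1) powr p"
  shows "\<exists>C\<ge>0. \<forall>N f. (\<forall>n. f n \<ge> 0) \<longrightarrow>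
    (\<Sum>n<N. w n * wmax N (\<lambda>_. 1) f n powr p) \<le> C * (\<Sum>n<N. w n * f n powr p)"
proof -
  \<comment> \<open>The conjugate exponent: \<open>(p - 1) * q = p\<close> and
    \<open>1 - q = -1 / (p - 1)\<close>. The first restores the power \<open>p\<close> of the
    maximal function, the second turns \<open>w * h powr q\<close> into
    \<open>\<sigma> * g powr p\<close>.\<close>
  define q where "q = p / (p - 1)"
  have q: "q > 1" using p by (simp add: q_def)
  define C where "C = K powr q * ((4 * q / (q - 1)) powr q * (4 * p / (p - 1)) powr p)"
  have s0: "\<sigma> k > 0" for k using w by (simp add: s less_imp_neq[THEN not_sym])
  have "(\<Sum>n<N. w n * wmax N (\<lambda>_. 1) f n powr p) \<le> C * (\<Sum>n<N. w n * f n powr p)"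
    if f: "\<And>n. f n \<ge> 0" for N f
  proof -
    define g where "g = wmax N \<sigma> (\<lambda>n. f n / \<sigma> n)"
    \<comment> \<open>\<open>g\<close> is meaningful only below \<open>N\<close>; setting it to 0
      beyond makes \<open>h\<close> a function on all of the naturals to which the maximal operator
      applies.\<close>
    define g' where "g' n = (if n < N then g n else 0)" for n
    define h where "h n = g' n powr (p - 1) / w n" for n
    have h0: "h n \<ge> 0" for n using w by (simp add: h_def less_imp_le)
    have g0: "g n \<ge> 0" if "n < N" for n unfolding g_def using that s0 f
      by (intro wmax_nonneg) (auto simp: less_imp_le)
    have pt: "wmax N (\<lambda>_. 1) f n powr p \<le> K powr q * wmax N w h n powr q" if n: "n < N" for n
    proof -
      obtain i j where ij: "i \<le> n" "n \<le> j" "j < N"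
        and e: "wmax N (\<lambda>_. 1) f n = (\<Sum>k=i..j. f k * 1) / (\<Sum>k=i..j. 1)"
        using wmax_attained[OF n] .
      define W where "W = (\<Sum>k=i..j. w k)"
      define S where "S = (\<Sum>k=i..j. \<sigma> k)"
      define L where "L = real (j - i + 1)"
      define t where "t = (\<Sum>k=i..j. f k) / S"
      have pos: "W > 0" "S > 0" "L > 0" unfolding W_def S_def L_def using w s0 ij by (auto intro!: sum_pos)
      have t0: "t \<ge> 0" unfolding t_def using pos f by (intro divide_nonneg_pos sum_nonneg) auto
      have e': "wmax N (\<lambda>_. 1) f n = t * S / L" using e pos ij
        by (simp add: t_def L_def of_nat_diff Suc_diff_le)
      have tg: "t \<le> g k" if "k \<in> {i..j}" for k
      proof -
        have "(\<Sum>m=i..j. f m / \<sigma> m * \<sigma> m) / (\<Sum>m=i..j. \<sigma> m) \<le> g k"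
          unfolding g_def using that ij by (intro wmax_ge) auto
        moreover have "(\<Sum>m=i..j. f m / \<sigma> m * \<sigma> m) = (\<Sum>m=i..j. f m)"
          using s0 by (intro sum.cong) (auto simp: less_imp_neq[THEN not_sym])
        ultimately show ?thesis by (simp add: t_def S_def)
      qed
      have "L * t powr (p - 1) = (\<Sum>k=i..j. t powr (p - 1))"
        using ij by (simp add: L_def of_nat_diff Suc_diff_le)
      also have "\<dots> \<le> (\<Sum>k=i..j. h k * w k)"
      proof (rule sum_mono)
        fix k assume k: "k \<in> {i..j}"
        have "t powr (p - 1) \<le> g k powr (p - 1)" using tg[OF k] t0 p by (intro powr_mono2) auto
        also have "\<dots> = h k * w k" using k ij w[of k] by (simp add: h_def g'_def)
        finally show "t powr (p - 1) \<le> h k * w k" .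
      qed
      finally have "L * t powr (p - 1) / W \<le> (\<Sum>k=i..j. h k * w k) / W"
        using pos by (intro divide_right_mono) auto
      also have "\<dots> \<le> wmax N w h n" unfolding W_def using ij by (intro wmax_ge) auto
      finally have a: "L * t powr (p - 1) / W \<le> wmax N w h n" .
      \<comment> \<open>The factor \<open>W / W\<close> is inserted so that the product
        \<open>W * S powr (p - 1)\<close> of the \<open>A\<^sub>p\<close> condition appears.\<close>
      have "(t * S / L) powr (p - 1) = t powr (p - 1) * (W * S powr (p - 1)) / (W * L powr (p - 1))"
        using t0 pos by (simp add: powr_mult powr_divide)
      also have "\<dots> \<le> t powr (p - 1) * (K * L powr p) / (W * L powr (p - 1))"
        using Ap[of i j] ij pos unfolding W_def[symmetric] S_def[symmetric] L_def[symmetric]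
        by (intro divide_right_mono mult_left_mono) auto
      also have "\<dots> = K * (L * t powr (p - 1) / W)"
        using pos by (simp add: powr_diff)
      also have "\<dots> \<le> K * wmax N w h n" using a K by (rule mult_left_mono)
      finally have b: "(t * S / L) powr (p - 1) \<le> K * wmax N w h n" .
      have "wmax N (\<lambda>_. 1) f n powr p = ((t * S / L) powr (p - 1)) powr q"
        unfolding e' powr_powr using p by (simp add: q_def)
      also have "\<dots> \<le> (K * wmax N w h n) powr q" using b q by (intro powr_mono2) auto
      also have "\<dots> = K powr q * wmax N w h n powr q"
        using K wmax_nonneg[of n N w h] n w h0 by (simp add: powr_mult)
      finally show ?thesis .
    qed
    have "(\<Sum>n<N. w n * wmax N (\<lambda>_. 1) f n powr p) \<le> (\<Sum>n<N. w n * (K powr q * wmax N w h n powr q))"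
      using pt w by (intro sum_mono mult_left_mono) (auto simp: less_imp_le)
    also have "\<dots> = K powr q * (\<Sum>n<N. w n * wmax N w h n powr q)"
      by (simp add: sum_distrib_left mult_ac)
    also have "\<dots> \<le> K powr q * ((4 * q / (q - 1)) powr q * (\<Sum>n<N. w n * h n powr q))"
      using q w h0 by (intro mult_left_mono wmax_strong_type) auto
    also have "(\<Sum>n<N. w n * h n powr q) = (\<Sum>n<N. \<sigma> n * g n powr p)"
    proof (rule sum.cong[OF refl])
      fix n assume "n \<in> {..<N}"
      then have n: "n < N" by simp
      have "h n powr q = g n powr p / w n powr q"
        using n w[of n] g0[OF n] p by (simp add: h_def g'_def powr_divide powr_powr q_def)
      moreover have "w n / w n powr q = \<sigma> n"
      proof -
        have "1 - q = -1 / (p - 1)" using p by (simp add: q_def field_simps)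
        then have "\<sigma> n = w n powr (1 - q)" by (simp add: s)
        also have "\<dots> = w n / w n powr q" using w[of n] by (simp add: powr_diff)
        finally show ?thesis by simp
      qed
      ultimately show "w n * h n powr q = \<sigma> n * g n powr p" by (metis times_divide_eq_left times_divide_eq_right mult.commute)
    qed
    also have "\<dots> \<le> (4 * p / (p - 1)) powr p * (\<Sum>n<N. \<sigma> n * (f n / \<sigma> n) powr p)"
      unfolding g_def using p s0 f by (intro wmax_strong_type) (auto simp: less_imp_le)
    also have "(\<Sum>n<N. \<sigma> n * (f n / \<sigma> n) powr p) = (\<Sum>n<N. w n * f n powr p)"
    proof (rule sum.cong[OF refl])
      fix n
      have "\<sigma> n / \<sigma> n powr p = \<sigma> n powr (1 - p)" using s0[of n] by (simp add: powr_diff)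
      also have "\<dots> = w n powr ((-1 / (p - 1)) * (1 - p))" by (simp add: s powr_powr)
      also have "(-1 / (p - 1)) * (1 - p) = 1" using p by (simp add: field_simps)
      also have "w n powr 1 = w n" using w[of n] by simp
      finally have "\<sigma> n / \<sigma> n powr p = w n" .
      moreover have "(f n / \<sigma> n) powr p = f n powr p / \<sigma> n powr p"
        using f[of n] s0[of n] by (simp add: powr_divide)
      ultimately show "\<sigma> n * (f n / \<sigma> n) powr p = w n * f n powr p"
        by (metis times_divide_eq_left times_divide_eq_right mult.commute)
    qed
    finally show ?thesis by (simp add: C_def mult_left_mono mult.assoc)
  qed
  moreover have "C \<ge> 0" by (simp add: C_def)
  ultimately show ?thesis by blast
qed

section \<open>A good-lambda inequality\<close>

definition dyadic :: "nat \<Rightarrow> nat \<Rightarrow> nat set" where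
  "dyadic j k = {k * 2 ^ j..<(k + 1) * 2 ^ j}"

text \<open>The union of the dyadic intervals on more than half of which \<open>\<bar>g\<bar> > l\<close> plays the role of the level
  set of a dyadic maximal function. Counting instead of averaging means that only weak type
  information about \<open>g\<close> is needed.\<close>

definition majority :: "(nat \<Rightarrow> real) \<Rightarrow> real \<Rightarrow> nat \<Rightarrow> nat \<Rightarrow> bool" where
  "majority g l j k \<longleftrightarrow> 2 ^ j < 2 * card {n \<in> dyadic j k. \<bar>g n\<bar> > l}"

text \<open>The recursion descends from the given interval and stops at the first majority interval
  it meets, so the result is the disjoint union of the maximal majority intervals inside it. At
  scale 0 majority just means \<open>\<bar>g n\<bar> > l\<close>. The stopping time thus becomes an
  induction on the scale.\<close>

fun majority_set :: "(nat \<Rightarrow> real) \<Rightarrow> real \<Rightarrow> nat \<Rightarrow> nat \<Rightarrow> nat set" where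
  "majority_set g l 0 k = {n \<in> dyadic 0 k. \<bar>g n\<bar> > l}"
| "majority_set g l (Suc j) k =
     (if majority g l (Suc j) k then dyadic (Suc j) k
      else majority_set g l j (2 * k) \<union> majority_set g l j (2 * k + 1))"

lemma dyadic_finite [simp]: "finite (dyadic j k)"
  and dyadic_card [simp]: "card (dyadic j k) = 2 ^ j"
  and dyadic_0 [simp]: "dyadic 0 k = {k}"
proof -
  show "finite (dyadic j k)" by (simp add: dyadic_def)
  show "card (dyadic j k) = 2 ^ j" by (simp add: dyadic_def)
  show "dyadic 0 k = {k}" unfolding dyadic_def by auto
qed

lemma dyadic_Suc: "dyadic (Suc j) k = dyadic j (2 * k) \<union> dyadic j (2 * k + 1)"
  "dyadic j (2 * k) \<inter> dyadic j (2 * k + 1) = {}"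
proof -
  define K x where "K = k * 2 ^ j" and "x = (2::nat) ^ j"
  have e: "dyadic (Suc j) k = {2 * K..<2 * K + 2 * x}" "dyadic j (2 * k) = {2 * K..<2 * K + x}"
    "dyadic j (2 * k + 1) = {2 * K + x..<2 * K + 2 * x}"
    by (simp_all add: dyadic_def K_def x_def algebra_simps)
  show "dyadic (Suc j) k = dyadic j (2 * k) \<union> dyadic j (2 * k + 1)"
    "dyadic j (2 * k) \<inter> dyadic j (2 * k + 1) = {}"
    unfolding e by auto
qed

lemma dyadic_parent: "dyadic j k \<subseteq> dyadic (Suc j) (k div 2)"
proof -
  have "k = 2 * (k div 2) \<or> k = 2 * (k div 2) + 1" by presburger
  then show ?thesis using dyadic_Suc(1)[of j "k div 2"] by (metis Un_upper1 Un_upper2)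
qed

lemma majority_set_subset: "majority_set g l j k \<subseteq> dyadic j k"
proof (induction j arbitrary: k)
  case (Suc j)
  show ?case using Suc[of "2 * k"] Suc[of "2 * k + 1"] dyadic_Suc(1)[of j k] by auto
qed auto

lemma majority_set_finite [simp]: "finite (majority_set g l j k)"
  by (rule finite_subset[OF majority_set_subset dyadic_finite])

lemma majority_mono:
  assumes "l \<le> l'" "majority g l' j k"
  shows "majority g l j k"
proof -
  have "card {n \<in> dyadic j k. \<bar>g n\<bar> > l'} \<le> card {n \<in> dyadic j k. \<bar>g n\<bar> > l}"
    using assms by (intro card_mono) auto
  then show ?thesis using assms unfolding majority_def by linarith
qed

lemma majority_set_majority:
  assumes "majority g l j k"
  shows "majority_set g l j k = dyadic j k"
proof (cases j)
  case 0
  have "{n \<in> dyadic 0 k. \<bar>g n\<bar> > l} \<noteq> {}" using assms 0 unfolding majority_def by (metis card.empty mult_0_right not_less_zero)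
  then show ?thesis using 0 by auto
next
  case (Suc i) then show ?thesis using assms by simp
qed

lemma majority_set_antimono:
  assumes "l \<le> l'"
  shows "majority_set g l' j k \<subseteq> majority_set g l j k"
proof (induction j arbitrary: k)
  case 0
  then show ?case using assms by auto
next
  case (Suc j)
  show ?case
  proof (cases "majority g l (Suc j) k")
    case True
    then show ?thesis using majority_set_subset[of g l' "Suc j" k] majority_set_majority by metis
  next
    case False
    then have "\<not> majority g l' (Suc j) k" using majority_mono assms by blast
    then show ?thesis using False Suc[of "2 * k"] Suc[of "2 * k + 1"] by auto
  qed
qed

lemma superlevel_subset_majority_set: "{n \<in> dyadic j k. \<bar>g n\<bar> > l} \<subseteq> majority_set g l j k"
proof (induction j arbitrary: k)
  case (Suc j)
  show ?case using Suc[of "2 * k"] Suc[of "2 * k + 1"] dyadic_Suc(1)[of j k] by auto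
qed auto

text \<open>The maximal majority intervals are disjoint and each is filled to more than one half by
  points with \<open>\<bar>g n\<bar> > l\<close>.\<close>

lemma card_majority_set_le: "card (majority_set g l j k) \<le> 2 * card {n \<in> dyadic j k. \<bar>g n\<bar> > l}"
proof (induction j arbitrary: k)
  case (Suc j)
  show ?case
  proof (cases "majority g l (Suc j) k")
    case True
    then show ?thesis by (simp add: majority_def)
  next
    case False
    have "{n \<in> dyadic (Suc j) k. \<bar>g n\<bar> > l} = {n \<in> dyadic j (2 * k). \<bar>g n\<bar> > l} \<union> {n \<in> dyadic j (2 * k + 1). \<bar>g n\<bar> > l}"
      using dyadic_Suc(1)[of j k] by auto
    then have "card {n \<in> dyadic (Suc j) k. \<bar>g n\<bar> > l} = card {n \<in> dyadic j (2 * k). \<bar>g n\<bar> > l} + card {n \<in> dyadic j (2 * k + 1). \<bar>g n\<bar> > l}"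
      using dyadic_Suc(2)[of j k] by (simp only:) (subst card_Un_disjoint, auto)
    moreover have "card (majority_set g l (Suc j) k) \<le> card (majority_set g l j (2 * k)) + card (majority_set g l j (2 * k + 1))"
      using False by (simp add: card_Un_le)
    ultimately show ?thesis using Suc[of "2 * k"] Suc[of "2 * k + 1"] by linarith
  qed
qed auto

text \<open>The maximal majority intervals at level \<open>l\<close> contribute independently, and
  those that miss \<open>G\<close> contribute nothing. Maximality is encoded by the alternative in
  \<open>loc\<close>: the interval is the top one, or its parent lies in the top one and is not a
  majority interval. The induction on the scale carries this alternative downwards.\<close>

lemma majority_set_good_lambda:
  fixes w :: "nat \<Rightarrow> real"
  assumes w: "\<And>n. w n \<ge> 0" and e: "e \<ge> 0" and ll: "l \<le> l'"
    and loc: "\<And>j k. dyadic j k \<subseteq> dyadic J 0 \<Longrightarrow>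
        (j = J \<and> k = 0) \<or> (dyadic (Suc j) (k div 2) \<subseteq> dyadic J 0 \<and> \<not> majority g l (Suc j) (k div 2)) \<Longrightarrow>
        majority g l j k \<Longrightarrow> dyadic j k \<inter> G \<noteq> {} \<Longrightarrow>
        sum w (majority_set g l' j k) \<le> e * sum w (dyadic j k)"
  shows "sum w (majority_set g l' J 0 \<inter> G) \<le> e * sum w (majority_set g l J 0)"
proof -
  have "sum w (majority_set g l' j k \<inter> G) \<le> e * sum w (majority_set g l j k)"
    if "dyadic j k \<subseteq> dyadic J 0"
       "(j = J \<and> k = 0) \<or> (dyadic (Suc j) (k div 2) \<subseteq> dyadic J 0 \<and> \<not> majority g l (Suc j) (k div 2))" for j k
    using that
  proof (induction j arbitrary: k)
    case 0
    show ?case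
    proof (cases "majority g l 0 k")
      case True
      show ?thesis
      proof (cases "dyadic 0 k \<inter> G = {}")
        case True
        then have "majority_set g l' 0 k \<inter> G = {}" by auto
        then show ?thesis using e w by (simp only: sum.empty) (simp add: sum_nonneg)
      next
        case False
        have "sum w (majority_set g l' 0 k \<inter> G) \<le> sum w (majority_set g l' 0 k)"
          using w by (intro sum_mono2) auto
        also have "\<dots> \<le> e * sum w (dyadic 0 k)" using loc[OF 0 True False] .
        finally show ?thesis using majority_set_majority[OF True] by metis
      qed
    next
      case False
      have "{n \<in> dyadic 0 k. \<bar>g n\<bar> > l} = {}"
      proof (rule ccontr)
        assume "{n \<in> dyadic 0 k. \<bar>g n\<bar> > l} \<noteq> {}"
        then have "{n \<in> dyadic 0 k. \<bar>g n\<bar> > l} = {k}" by auto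
        then have "majority g l 0 k" unfolding majority_def by simp
        then show False using False by simp
      qed
      then have "majority_set g l 0 k = {}" by simp
      moreover have "majority_set g l' 0 k = {}" using majority_set_antimono[OF ll, of g 0 k] calculation by auto
      ultimately show ?thesis by (simp only: Int_empty_left sum.empty)
    qed
  next
    case (Suc j)
    show ?case
    proof (cases "majority g l (Suc j) k")
      case True
      show ?thesis
      proof (cases "dyadic (Suc j) k \<inter> G = {}")
        case T: True
        then have "majority_set g l' (Suc j) k \<inter> G = {}" using majority_set_subset[of g l' "Suc j" k] by blast
        then show ?thesis using e w by (simp only: sum.empty) (simp add: sum_nonneg)
      next
        case False
        have "sum w (majority_set g l' (Suc j) k \<inter> G) \<le> sum w (majority_set g l' (Suc j) k)"
          using w by (intro sum_mono2) auto
        also have "\<dots> \<le> e * sum w (dyadic (Suc j) k)" using loc[OF Suc.prems True False] .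
        finally show ?thesis using majority_set_majority[OF True] by metis
      qed
    next
      case False
      then have F': "\<not> majority g l' (Suc j) k" using majority_mono ll by blast
      have sub: "dyadic j (2 * k) \<subseteq> dyadic J 0" "dyadic j (2 * k + 1) \<subseteq> dyadic J 0"
        using Suc.prems(1) dyadic_Suc(1)[of j k] by auto
      have ih: "sum w (majority_set g l' j (2 * k) \<inter> G) \<le> e * sum w (majority_set g l j (2 * k))"
        "sum w (majority_set g l' j (2 * k + 1) \<inter> G) \<le> e * sum w (majority_set g l j (2 * k + 1))"
        using sub False Suc.prems(1) by (auto intro!: Suc.IH)
      have dj: "majority_set g x j (2 * k) \<inter> majority_set g x j (2 * k + 1) = {}" for x
        using majority_set_subset[of g x j "2 * k"] majority_set_subset[of g x j "2 * k + 1"] dyadic_Suc(2)[of j k] by blast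
      have "sum w (majority_set g l' (Suc j) k \<inter> G) = sum w ((majority_set g l' j (2 * k) \<inter> G) \<union> (majority_set g l' j (2 * k + 1) \<inter> G))"
        using F' by (simp add: Int_Un_distrib2)
      also have "\<dots> = sum w (majority_set g l' j (2 * k) \<inter> G) + sum w (majority_set g l' j (2 * k + 1) \<inter> G)"
        using dj[of l'] by (intro sum.union_disjoint) auto
      also have "\<dots> \<le> e * (sum w (majority_set g l j (2 * k)) + sum w (majority_set g l j (2 * k + 1)))"
        using ih by (simp add: distrib_left)
      also have "sum w (majority_set g l j (2 * k)) + sum w (majority_set g l j (2 * k + 1)) = sum w (majority_set g l (Suc j) k)"
        using dj[of l] False by (simp add: sum.union_disjoint)
      finally show ?thesis .
    qed
  qed
  then show ?thesis by simp
qed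

section \<open>Tail sums and the oscillation of a singular integral\<close>

text \<open>Summation by parts: partial sums growing at most linearly, weighted with
  \<open>1 / d^2\<close>, have a tail of size \<open>O(1 / L)\<close>.\<close>

lemma tail_sum_bound:
  fixes a :: "nat \<Rightarrow> real"
  assumes a: "\<And>d. a d \<ge> 0" and L: "L \<ge> 1" and \<mu>: "\<mu> \<ge> 0"
    and F: "\<And>r. (\<Sum>d\<le>r. a d) \<le> \<mu> * (real r + 1)" and R: "R \<ge> L"
  shows "(\<Sum>d=L..R. a d / (real d)\<^sup>2) \<le> 6 * \<mu> / real L"
proof -
  have F2: "(\<Sum>d\<le>r. a d) \<le> 2 * \<mu> * real r" if "r \<ge> 1" for r
  proof -
    have "(\<Sum>d\<le>r. a d) \<le> \<mu> * (real r + 1)" by (rule F)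
    also have "\<dots> \<le> \<mu> * (2 * real r)" using that \<mu> by (intro mult_left_mono) auto
    finally show ?thesis by simp
  qed
  \<comment> \<open>The induction keeps the boundary term of the summation by parts explicitly; the
    remaining terms telescope.\<close>
  have "(\<Sum>d=L..R. a d / (real d)\<^sup>2) \<le> (\<Sum>d\<le>R. a d) / (real R)\<^sup>2 + 4 * \<mu> * (1 / real L - 1 / real R)"
    using R
  proof (induction R rule: dec_induct)
    case base
    have "a L \<le> (\<Sum>d\<le>L. a d)" by (intro member_le_sum) (auto simp: a)
    then show ?case by (simp add: divide_right_mono)
  next
    case (step r)
    have r: "real r \<ge> 1" using step L by linarith
    define x where "x = real r"
    have x: "x \<ge> 1" using r by (simp add: x_def)
    let ?F = "\<Sum>d\<le>r. a d"
    have "?F * (1 / x\<^sup>2 - 1 / (x + 1)\<^sup>2) \<le> (2 * \<mu> * x) * (1 / x\<^sup>2 - 1 / (x + 1)\<^sup>2)"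
      using F2[of r] r x by (intro mult_right_mono) (auto simp: x_def frac_le power_mono)
    also have "\<dots> = \<mu> * (2 * x * (1 / x\<^sup>2 - 1 / (x + 1)\<^sup>2))" by simp
    also have "\<dots> \<le> \<mu> * (4 * (1 / x - 1 / (x + 1)))"
    proof (rule mult_left_mono[OF _ \<mu>])
      have "2 * x * (1 / x\<^sup>2 - 1 / (x + 1)\<^sup>2) = 2 * (2 * x + 1) / (x * (x + 1)\<^sup>2)"
        using x by (simp add: divide_simps power2_eq_square) (simp add: algebra_simps)
      also have "\<dots> \<le> 4 * (x + 1) / (x * (x + 1)\<^sup>2)"
        using x by (intro divide_right_mono) auto
      also have "\<dots> = 4 * (1 / x - 1 / (x + 1))"
        using x by (simp add: divide_simps power2_eq_square)
      finally show "2 * x * (1 / x\<^sup>2 - 1 / (x + 1)\<^sup>2) \<le> 4 * (1 / x - 1 / (x + 1))" .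
    qed
    finally have key: "?F / x\<^sup>2 - ?F / (x + 1)\<^sup>2 \<le> 4 * \<mu> * (1 / x - 1 / (x + 1))"
      by (simp add: algebra_simps)
    have "(\<Sum>d=L..Suc r. a d / (real d)\<^sup>2) = (\<Sum>d=L..r. a d / (real d)\<^sup>2) + a (Suc r) / (x + 1)\<^sup>2"
      using step by (simp add: x_def add.commute)
    also have "\<dots> \<le> ?F / x\<^sup>2 + 4 * \<mu> * (1 / real L - 1 / x) + a (Suc r) / (x + 1)\<^sup>2"
      using step.IH by (simp add: x_def)
    also have "\<dots> \<le> ?F / (x + 1)\<^sup>2 + a (Suc r) / (x + 1)\<^sup>2 + 4 * \<mu> * (1 / real L - 1 / (x + 1))"
      using key by (simp add: right_diff_distrib)
    also have "?F / (x + 1)\<^sup>2 + a (Suc r) / (x + 1)\<^sup>2 = (\<Sum>d\<le>Suc r. a d) / (real (Suc r))\<^sup>2"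
      by (simp add: x_def add_divide_distrib add.commute)
    finally show ?case by (simp add: x_def add.commute)
  qed
  also have "(\<Sum>d\<le>R. a d) / (real R)\<^sup>2 \<le> (2 * \<mu> * real R) / (real R)\<^sup>2"
    using F2[of R] R L by (intro divide_right_mono) auto
  also have "\<dots> = 2 * \<mu> / real R" by (simp add: power2_eq_square)
  also have "2 * \<mu> / real R + 4 * \<mu> * (1 / real L - 1 / real R) = 4 * \<mu> / real L - 2 * \<mu> / real R"
    by (simp add: right_diff_distrib)
  also have "\<dots> \<le> 6 * \<mu> / real L"
  proof -
    have "0 \<le> 2 * \<mu> / real R" "4 * \<mu> / real L \<le> 6 * \<mu> / real L" using \<mu> L by (auto intro!: divide_right_mono)
    then show ?thesis by linarith
  qed
  finally show ?thesis by simp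
qed

text \<open>The two sides of \<open>n0\<close> are treated as tail sums in the distance
  \<open>d\<close>, each costing \<open>6 * \<mu> / L\<close>. On the left \<open>b\<close>
  continues the sequence by 0 beyond the origin.\<close>

lemma far_sum_bound:
  fixes f :: "nat \<Rightarrow> real"
  assumes L: "L \<ge> 1" and \<mu>: "\<mu> \<ge> 0"
    and M: "\<And>i j. i \<le> n0 \<Longrightarrow> n0 \<le> j \<Longrightarrow> (\<Sum>m=i..j. \<bar>f m\<bar>) \<le> \<mu> * real (j - i + 1)"
  shows "(\<Sum>m | m < N \<and> (n0 + L \<le> m \<or> m + L \<le> n0). \<bar>f m\<bar> / (real m - real n0)\<^sup>2) \<le> 12 * \<mu> / real L"
proof -
  define R where "R = N + n0 + L"
  define b where "b d = (if d \<le> n0 then \<bar>f (n0 - d)\<bar> else 0)" for d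
  have s1: "(\<Sum>d=L..R. \<bar>f (n0 + d)\<bar> / (real d)\<^sup>2) \<le> 6 * \<mu> / real L"
  proof (rule tail_sum_bound)
    fix r
    have "(\<Sum>d\<le>r. \<bar>f (n0 + d)\<bar>) = (\<Sum>m=n0..n0 + r. \<bar>f m\<bar>)"
      by (rule sum.reindex_bij_witness[of _ "\<lambda>m. m - n0" "\<lambda>d. n0 + d"]) auto
    also have "\<dots> \<le> \<mu> * (real r + 1)" using M[of n0 "n0 + r"] by (simp add: add.commute)
    finally show "(\<Sum>d\<le>r. \<bar>f (n0 + d)\<bar>) \<le> \<mu> * (real r + 1)" .
  qed (use L \<mu> in \<open>auto simp: R_def\<close>)
  have s2: "(\<Sum>d=L..R. b d / (real d)\<^sup>2) \<le> 6 * \<mu> / real L"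
  proof (rule tail_sum_bound)
    fix r
    have "(\<Sum>d\<le>r. b d) = (\<Sum>d\<le>min r n0. \<bar>f (n0 - d)\<bar>)"
      by (intro sum.mono_neutral_cong_right) (auto simp: b_def)
    also have "\<dots> = (\<Sum>m=n0 - r..n0. \<bar>f m\<bar>)"
      by (rule sum.reindex_bij_witness[of _ "\<lambda>m. n0 - m" "\<lambda>d. n0 - d"]) auto
    also have "\<dots> \<le> \<mu> * real (n0 - (n0 - r) + 1)" using M[of "n0 - r" n0] by simp
    also have "\<dots> \<le> \<mu> * (real r + 1)" using \<mu> by (intro mult_left_mono) auto
    finally show "(\<Sum>d\<le>r. b d) \<le> \<mu> * (real r + 1)" .
  qed (use L \<mu> in \<open>auto simp: R_def b_def\<close>)
  have "{m. m < N \<and> (n0 + L \<le> m \<or> m + L \<le> n0)} = {n0 + L..<N} \<union> {m. m < N \<and> m + L \<le> n0}" by auto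
  moreover have "{n0 + L..<N} \<inter> {m. m < N \<and> m + L \<le> n0} = {}" using L by auto
  ultimately have "(\<Sum>m | m < N \<and> (n0 + L \<le> m \<or> m + L \<le> n0). \<bar>f m\<bar> / (real m - real n0)\<^sup>2)
     = (\<Sum>m\<in>{n0 + L..<N}. \<bar>f m\<bar> / (real m - real n0)\<^sup>2) + (\<Sum>m | m < N \<and> m + L \<le> n0. \<bar>f m\<bar> / (real m - real n0)\<^sup>2)"
    by (simp add: sum.union_disjoint)
  also have "(\<Sum>m\<in>{n0 + L..<N}. \<bar>f m\<bar> / (real m - real n0)\<^sup>2) = (\<Sum>d\<in>{L..<N - n0}. \<bar>f (n0 + d)\<bar> / (real d)\<^sup>2)"
    by (rule sum.reindex_bij_witness[of _ "\<lambda>d. n0 + d" "\<lambda>m. m - n0"]) auto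
  also have "\<dots> \<le> (\<Sum>d=L..R. \<bar>f (n0 + d)\<bar> / (real d)\<^sup>2)"
    by (intro sum_mono2) (auto simp: R_def)
  also have "(\<Sum>m | m < N \<and> m + L \<le> n0. \<bar>f m\<bar> / (real m - real n0)\<^sup>2) = (\<Sum>d | d \<le> n0 \<and> L \<le> d \<and> n0 - d < N. b d / (real d)\<^sup>2)"
    by (rule sum.reindex_bij_witness[of _ "\<lambda>d. n0 - d" "\<lambda>m. n0 - m"]) (auto simp: b_def of_nat_diff power2_commute)
  also have "\<dots> \<le> (\<Sum>d=L..R. b d / (real d)\<^sup>2)"
    by (intro sum_mono2) (auto simp: R_def b_def)
  finally show ?thesis using s1 s2 by linarith
qed

text \<open>The part of \<open>f\<close> within distance \<open>L\<close> of the interval has mass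
  at most \<open>3 * \<mu> * L\<close> and is handled by weak type at level \<open>t / 2\<close>.
  The far part varies by at most \<open>12 * A * \<mu>\<close> over the interval, by regularity and
  the tail estimate at \<open>n0\<close>; its value at \<open>n0\<close> is the witness
  \<open>c\<close>. Weak type with one exceptional point in eight requires
  \<open>48 * A * \<mu> \<le> t\<close>, hence the 50.\<close>

lemma cz_oscillation:
  fixes f :: "nat \<Rightarrow> real"
  assumes cz: "cz_kernel A k" and L: "L \<ge> 1" and n0: "n0 \<in> {s..<s + L}" and \<mu>: "\<mu> \<ge> 0"
    and M: "\<And>i j. i \<le> n0 \<Longrightarrow> n0 \<le> j \<Longrightarrow> (\<Sum>m=i..j. \<bar>f m\<bar>) \<le> \<mu> * real (j - i + 1)"
    and t: "t > 0" "50 * A * \<mu> \<le> t"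
  shows "\<exists>c. 8 * card {n \<in> {s..<s + L}. \<bar>(\<Sum>m<N. f m * k m n) - c\<bar> > t} \<le> L"
proof -
  define near where "near m \<longleftrightarrow> s \<le> m + L \<and> m < s + 2 * L" for m
  define f1 where "f1 m = (if near m then f m else 0)" for m
  define f2 where "f2 m = (if near m then 0 else f m)" for m
  define T where "T g n = (\<Sum>m<N. g m * k m n)" for g n
  have A: "A > 0" using cz by (simp add: cz_kernel_def)
  have wk: "l * real (card {n. n < L \<and> \<bar>\<Sum>m<N. g m * k m n\<bar> > l}) \<le> A * (\<Sum>m<N. \<bar>g m\<bar>)" if "l > 0" for g N L l
    using cz that by (simp add: cz_kernel_def)
  have sm: "\<bar>k m n - k m n'\<bar> \<le> A * \<bar>real n - real n'\<bar> / (real m - real n')\<^sup>2"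
    if "m \<noteq> n" "m \<noteq> n'" "\<bar>real m - real n'\<bar> \<le> 2 * \<bar>real m - real n\<bar>" for m n n'
    using cz that by (simp add: cz_kernel_def)
  have dec: "T f n = T f1 n + T f2 n" for n
    unfolding T_def sum.distrib[symmetric] by (intro sum.cong) (auto simp: f1_def f2_def)
  have far: "\<bar>T f2 n - T f2 n0\<bar> \<le> t / 2" if n: "n \<in> {s..<s + L}" for n
  proof -
    have "\<bar>T f2 n - T f2 n0\<bar> = \<bar>\<Sum>m<N. f2 m * (k m n - k m n0)\<bar>"
      by (simp add: T_def sum_subtractf right_diff_distrib)
    also have "\<dots> \<le> (\<Sum>m<N. \<bar>f2 m * (k m n - k m n0)\<bar>)" by (rule sum_abs)
    also have "\<dots> = (\<Sum>m | m < N \<and> \<not> near m. \<bar>f m * (k m n - k m n0)\<bar>)"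
      by (intro sum.mono_neutral_cong_right) (auto simp: f2_def)
    also have "\<dots> \<le> (\<Sum>m | m < N \<and> \<not> near m. A * real L * (\<bar>f m\<bar> / (real m - real n0)\<^sup>2))"
    proof (rule sum_mono)
      fix m assume "m \<in> {m. m < N \<and> \<not> near m}"
      then have m: "m + L < s \<or> s + 2 * L \<le> m" by (auto simp: near_def)
      have d: "\<bar>real n - real n0\<bar> \<le> real L" using n n0 by auto
      have c: "\<bar>real m - real n0\<bar> \<le> 2 * \<bar>real m - real n\<bar>" "m \<noteq> n" "m \<noteq> n0"
        using m n n0 L by auto
      have "\<bar>k m n - k m n0\<bar> \<le> A * \<bar>real n - real n0\<bar> / (real m - real n0)\<^sup>2" by (rule sm) (use c in auto)
      also have "\<dots> \<le> A * real L / (real m - real n0)\<^sup>2"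
        using d A by (intro divide_right_mono mult_left_mono) auto
      finally have "\<bar>f m\<bar> * \<bar>k m n - k m n0\<bar> \<le> \<bar>f m\<bar> * (A * real L / (real m - real n0)\<^sup>2)"
        by (intro mult_left_mono) auto
      then show "\<bar>f m * (k m n - k m n0)\<bar> \<le> A * real L * (\<bar>f m\<bar> / (real m - real n0)\<^sup>2)"
        by (simp add: abs_mult mult_ac)
    qed
    also have "\<dots> \<le> (\<Sum>m | m < N \<and> (n0 + L \<le> m \<or> m + L \<le> n0). A * real L * (\<bar>f m\<bar> / (real m - real n0)\<^sup>2))"
      using n0 A by (intro sum_mono2) (auto simp: near_def)
    also have "\<dots> = A * real L * (\<Sum>m | m < N \<and> (n0 + L \<le> m \<or> m + L \<le> n0). \<bar>f m\<bar> / (real m - real n0)\<^sup>2)"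
      by (simp add: sum_distrib_left)
    also have "\<dots> \<le> A * real L * (12 * \<mu> / real L)"
      using A by (intro mult_left_mono far_sum_bound[OF L \<mu> M]) auto
    also have "\<dots> = 12 * A * \<mu>" using L by simp
    also have "\<dots> \<le> t / 2" using t A \<mu> mult_nonneg_nonneg[of A \<mu>] by linarith
    finally show ?thesis .
  qed
  have "{n \<in> {s..<s + L}. \<bar>T f n - T f2 n0\<bar> > t} \<subseteq> {n. n < s + L \<and> \<bar>T f1 n\<bar> > t / 2}"
  proof
    fix n assume "n \<in> {n \<in> {s..<s + L}. \<bar>T f n - T f2 n0\<bar> > t}"
    then have n: "n \<in> {s..<s + L}" "\<bar>T f n - T f2 n0\<bar> > t" by auto
    from far[OF n(1)] n(2) dec[of n] have "\<bar>T f1 n\<bar> > t / 2" by linarith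
    then show "n \<in> {n. n < s + L \<and> \<bar>T f1 n\<bar> > t / 2}" using n by auto
  qed
  then have "card {n \<in> {s..<s + L}. \<bar>T f n - T f2 n0\<bar> > t} \<le> card {n. n < s + L \<and> \<bar>T f1 n\<bar> > t / 2}"
    by (intro card_mono) auto
  then have "t / 2 * real (card {n \<in> {s..<s + L}. \<bar>T f n - T f2 n0\<bar> > t}) \<le> t / 2 * real (card {n. n < s + L \<and> \<bar>T f1 n\<bar> > t / 2})"
    using t by (intro mult_left_mono) auto
  also have "\<dots> \<le> A * (\<Sum>m<N. \<bar>f1 m\<bar>)" unfolding T_def using t by (intro wk) auto
  also have "\<dots> \<le> A * (\<mu> * (3 * real L))"
  proof (rule mult_left_mono)
    have "(\<Sum>m<N. \<bar>f1 m\<bar>) = (\<Sum>m | m < N \<and> near m. \<bar>f m\<bar>)"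
      by (intro sum.mono_neutral_cong_right) (auto simp: f1_def)
    also have "\<dots> \<le> (\<Sum>m=s - L..s + 2 * L - 1. \<bar>f m\<bar>)"
      by (intro sum_mono2) (auto simp: near_def)
    also have "\<dots> \<le> \<mu> * real (s + 2 * L - 1 - (s - L) + 1)" using n0 L by (intro M) auto
    also have "\<dots> \<le> \<mu> * (3 * real L)"
    proof (rule mult_left_mono[OF _ \<mu>])
      have "s + 2 * L - 1 - (s - L) + 1 \<le> 3 * L" using L by linarith
      then have "real (s + 2 * L - 1 - (s - L) + 1) \<le> real (3 * L)" by (rule of_nat_mono)
      then show "real (s + 2 * L - 1 - (s - L) + 1) \<le> 3 * real L" by simp
    qed
    finally show "(\<Sum>m<N. \<bar>f1 m\<bar>) \<le> \<mu> * (3 * real L)" .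
  qed (use A in auto)
  finally have "t * (8 * real (card {n \<in> {s..<s + L}. \<bar>T f n - T f2 n0\<bar> > t})) \<le> (48 * A * \<mu>) * real L"
    by (simp add: algebra_simps)
  also have "\<dots> \<le> t * real L"
    using t A \<mu> mult_nonneg_nonneg[of A \<mu>] by (intro mult_right_mono) auto
  finally have "8 * real (card {n \<in> {s..<s + L}. \<bar>T f n - T f2 n0\<bar> > t}) \<le> real L"
    using t by simp
  then have "real (8 * card {n \<in> {s..<s + L}. \<bar>T f n - T f2 n0\<bar> > t}) \<le> real L" by simp
  then have "8 * card {n \<in> {s..<s + L}. \<bar>T f n - T f2 n0\<bar> > t} \<le> L" by (simp only: of_nat_le_iff)
  then show ?thesis unfolding T_def by blast
qed

text \<open>A maximal interval of \<open>majority_set g l\<close> has a parent on which \<open>\<bar>g\<bar> \<le> l\<close> at least half of the time,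
  which pins the constant of \<open>cz_oscillation\<close> to size about \<open>l\<close>. The top interval has no parent, but
  if it is a majority interval then the weak type bound makes the maximal function large on all of it.\<close>

lemma cz_good_lambda:
  fixes f w :: "nat \<Rightarrow> real"
  assumes cz: "cz_kernel A k" and w: "\<And>n. w n \<ge> 0"
    and \<eta>: "\<eta> \<ge> 0" and Ainf: "\<And>i j E. E \<subseteq> {i..j} \<Longrightarrow> 2 * card E \<le> card {i..j} \<Longrightarrow> sum w E \<le> \<eta> * sum w {i..j}"
    and \<theta>: "1 < \<theta>" "\<theta> \<le> 2" and f: "\<And>m. m \<ge> 2 ^ J \<Longrightarrow> f m = 0" and l: "l > 0"
    and A1: "A \<ge> 1"
  defines "g \<equiv> \<lambda>n. \<Sum>m<2 ^ J. f m * k m n"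
    and "\<gamma> \<equiv> (\<theta> - 1) / (100 * A)"
  shows "sum w (majority_set g (\<theta> * l) J 0) \<le> \<eta> * sum w (majority_set g l J 0)
     + sum w {n. n < 2 ^ J \<and> wmax (2 ^ J) (\<lambda>_. 1) (\<lambda>m. \<bar>f m\<bar>) n > \<gamma> * l}"
proof -
  define N where "N = (2::nat) ^ J"
  define Mf where "Mf = wmax N (\<lambda>_. 1) (\<lambda>m. \<bar>f m\<bar>)"
  define G where "G = {n. n < N \<and> Mf n \<le> \<gamma> * l}"
  have "N \<ge> 1" by (simp add: N_def)
  have g0: "\<gamma> > 0" "\<gamma> * l > 0" using A1 \<theta> l by (auto simp: \<gamma>_def)
  have D0: "dyadic J 0 = {..<N}" by (auto simp: dyadic_def N_def)
  \<comment> \<open>Since \<open>f\<close> vanishes from \<open>2 ^ J\<close> on, an interval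
    reaching beyond \<open>N\<close> can be cut at \<open>N - 1\<close> without changing the
    sum.\<close>
  have Gav: "(\<Sum>m=i..j. \<bar>f m\<bar>) \<le> \<gamma> * l * real (j - i + 1)" if n0: "n0 \<in> G" and ij: "i \<le> n0" "n0 \<le> j" for n0 i j
  proof -
    define j' where "j' = min j (N - 1)"
    have j': "n0 \<le> j'" "j' < N" "j' \<le> j" using n0 ij by (auto simp: j'_def G_def)
    have "(\<Sum>m=i..j. \<bar>f m\<bar>) = (\<Sum>m=i..j'. \<bar>f m\<bar>)"
      using f by (intro sum.mono_neutral_right) (auto simp: j'_def N_def min_def split: if_splits)
    moreover have "(\<Sum>m=i..j'. \<bar>f m\<bar> * 1) / (\<Sum>m=i..j'. 1) \<le> Mf n0"
      unfolding Mf_def using ij j' by (intro wmax_ge) auto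
    ultimately have "(\<Sum>m=i..j. \<bar>f m\<bar>) / real (j' - i + 1) \<le> \<gamma> * l"
      using n0 ij j' by (simp add: G_def Suc_diff_le)
    then have "(\<Sum>m=i..j. \<bar>f m\<bar>) \<le> \<gamma> * l * real (j' - i + 1)" by (simp add: pos_divide_le_eq)
    also have "\<dots> \<le> \<gamma> * l * real (j - i + 1)" using g0 j' by (intro mult_left_mono) auto
    finally show ?thesis .
  qed
  have loc: "sum w (majority_set g (\<theta> * l) j i) \<le> \<eta> * sum w (dyadic j i)"
    if top: "(j = J \<and> i = 0) \<or> (dyadic (Suc j) (i div 2) \<subseteq> dyadic J 0 \<and> \<not> majority g l (Suc j) (i div 2))"
      and maj: "majority g l j i" and ne: "dyadic j i \<inter> G \<noteq> {}" for j i
  proof -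
    obtain n0 where n0: "n0 \<in> dyadic j i" "n0 \<in> G" using ne by auto
    from top have "2 * card (majority_set g (\<theta> * l) j i) \<le> 2 ^ j"
    proof
      assume "j = J \<and> i = 0"
      then have ji: "j = J" "i = 0" by auto
      have "l * real (card {n. n < N \<and> \<bar>g n\<bar> > l}) \<le> A * (\<Sum>m<N. \<bar>f m\<bar>)"
        using cz l unfolding cz_kernel_def g_def N_def by blast
      also have "\<dots> \<le> A * (\<gamma> * l * real N)"
      proof (rule mult_left_mono)
        have "{..<N} = {0..N - 1}" using \<open>N \<ge> 1\<close> by auto
        then have "(\<Sum>m<N. \<bar>f m\<bar>) = (\<Sum>m=0..N - 1. \<bar>f m\<bar>)" by simp
        also have "\<dots> \<le> \<gamma> * l * real (N - 1 - 0 + 1)"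
          using n0 by (intro Gav[OF n0(2)]) (auto simp: G_def)
        also have "N - 1 - 0 + 1 = N" using \<open>N \<ge> 1\<close> by simp
        finally show "(\<Sum>m<N. \<bar>f m\<bar>) \<le> \<gamma> * l * real N" .
      qed (use A1 in auto)
      finally have "l * real (card {n. n < N \<and> \<bar>g n\<bar> > l}) \<le> l * (A * \<gamma> * real N)"
        using A1 by (simp add: mult_ac)
      then have "real (card {n. n < N \<and> \<bar>g n\<bar> > l}) \<le> A * \<gamma> * real N" using l by simp
      also have "\<dots> \<le> 1 / 2 * real N" using A1 \<theta> by (intro mult_right_mono) (auto simp: \<gamma>_def)
      finally have "2 * real (card {n. n < N \<and> \<bar>g n\<bar> > l}) \<le> real N" by simp
      then have "2 * card {n. n < N \<and> \<bar>g n\<bar> > l} \<le> N" by linarith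
      moreover have "{n \<in> dyadic J 0. \<bar>g n\<bar> > l} = {n. n < N \<and> \<bar>g n\<bar> > l}" by (auto simp: D0)
      ultimately have False using maj ji by (simp add: majority_def N_def)
      then show ?thesis ..
    next
      assume par: "dyadic (Suc j) (i div 2) \<subseteq> dyadic J 0 \<and> \<not> majority g l (Suc j) (i div 2)"
      define L where "L = (2::nat) ^ Suc j"
      define s where "s = (i div 2) * L"
      have P: "dyadic (Suc j) (i div 2) = {s..<s + L}" by (auto simp: dyadic_def s_def L_def)
      have sub: "dyadic j i \<subseteq> {s..<s + L}" using dyadic_parent[of j i] P by simp
      \<comment> \<open>Half the gap between \<open>l\<close> and \<open>\<theta> * l\<close>. The
        100 in \<open>\<gamma>\<close> makes \<open>50 * A * (\<gamma> * l)\<close> equal to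
        \<open>t\<close>.\<close>
      define t where "t = (\<theta> - 1) * l / 2"
      have t0: "t > 0" "50 * A * (\<gamma> * l) \<le> t" using \<theta> l A1 by (auto simp: t_def \<gamma>_def)
      have "\<exists>c. 8 * card {n \<in> {s..<s + L}. \<bar>(\<Sum>m<2 ^ J. f m * k m n) - c\<bar> > t} \<le> L"
      proof (rule cz_oscillation[OF cz])
        show "n0 \<in> {s..<s + L}" using n0 sub by auto
        show "0 \<le> \<gamma> * l" using g0 by simp
      qed (use Gav[OF n0(2)] t0 in \<open>auto simp: L_def\<close>)
      then obtain c where c: "8 * card {n \<in> {s..<s + L}. \<bar>g n - c\<bar> > t} \<le> L" unfolding g_def by blast
      have nb: "2 * card {n \<in> {s..<s + L}. \<bar>g n\<bar> > l} \<le> L" using par P by (simp add: majority_def L_def)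
      \<comment> \<open>At most one half of the parent has \<open>\<bar>g\<bar> > l\<close> and at
        most one eighth deviates from \<open>c\<close> by more than \<open>t\<close>, so some point
        avoids both and forces \<open>\<bar>c\<bar> \<le> l + t\<close>.\<close>
      have "{s..<s + L} \<noteq> {n \<in> {s..<s + L}. \<bar>g n\<bar> > l} \<union> {n \<in> {s..<s + L}. \<bar>g n - c\<bar> > t}"
      proof
        assume eq: "{s..<s + L} = {n \<in> {s..<s + L}. \<bar>g n\<bar> > l} \<union> {n \<in> {s..<s + L}. \<bar>g n - c\<bar> > t}"
        have "L = card {s..<s + L}" by simp
        also have "\<dots> = card ({n \<in> {s..<s + L}. \<bar>g n\<bar> > l} \<union> {n \<in> {s..<s + L}. \<bar>g n - c\<bar> > t})"
          using eq by (rule arg_cong)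
        also have "\<dots> \<le> card {n \<in> {s..<s + L}. \<bar>g n\<bar> > l} + card {n \<in> {s..<s + L}. \<bar>g n - c\<bar> > t}"
          by (rule card_Un_le)
        finally have "8 * L \<le> 5 * L" using c nb by linarith
        then show False by (simp add: L_def)
      qed
      then obtain n1 where n1: "n1 \<in> {s..<s + L}"
        "n1 \<notin> {n \<in> {s..<s + L}. \<bar>g n\<bar> > l} \<union> {n \<in> {s..<s + L}. \<bar>g n - c\<bar> > t}" by blast
      then have "\<bar>g n1\<bar> \<le> l" "\<bar>g n1 - c\<bar> \<le> t" by (auto simp: not_less)
      then have cl: "\<bar>c\<bar> \<le> l + t" by linarith
      have th: "\<theta> * l = l + 2 * t" by (simp add: t_def field_simps)
      have "{n \<in> dyadic j i. \<bar>g n\<bar> > \<theta> * l} \<subseteq> {n \<in> {s..<s + L}. \<bar>g n - c\<bar> > t}"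
      proof
        fix n assume "n \<in> {n \<in> dyadic j i. \<bar>g n\<bar> > \<theta> * l}"
        then have "n \<in> dyadic j i" "\<bar>g n\<bar> > l + 2 * t" by (auto simp: th)
        then show "n \<in> {n \<in> {s..<s + L}. \<bar>g n - c\<bar> > t}" using sub cl by auto
      qed
      then have "card {n \<in> dyadic j i. \<bar>g n\<bar> > \<theta> * l} \<le> card {n \<in> {s..<s + L}. \<bar>g n - c\<bar> > t}"
        by (intro card_mono) auto
      \<comment> \<open>The parent has length \<open>L = 2 * 2 ^ j\<close>, so at most
        \<open>2 ^ j / 4\<close> points exceed \<open>\<theta> * l\<close>, and passing to the
        majority set doubles this to \<open>2 ^ j / 2\<close>. This is the reason for the 8 in
        \<open>cz_oscillation\<close>.\<close>
      then show ?thesis using c card_majority_set_le[of g "\<theta> * l" j i] by (simp add: L_def)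
    qed
    moreover have D: "dyadic j i = {i * 2 ^ j..(i + 1) * 2 ^ j - 1}"
    proof -
      have *: "{a..<b} = {a..b - 1}" if "b \<ge> 1" for a b :: nat using that by auto
      show ?thesis unfolding dyadic_def by (rule *) (simp add: Suc_le_eq)
    qed
    ultimately show ?thesis
      using majority_set_subset[of g "\<theta> * l" j i] dyadic_card[of j i]
      unfolding D by (intro Ainf) auto
  qed
  have "sum w (majority_set g (\<theta> * l) J 0 \<inter> G) \<le> \<eta> * sum w (majority_set g l J 0)"
    by (rule majority_set_good_lambda[OF w \<eta>]) (use loc l \<theta> in auto)
  moreover have "sum w (majority_set g (\<theta> * l) J 0) \<le> sum w (majority_set g (\<theta> * l) J 0 \<inter> G) + sum w {n. n < N \<and> Mf n > \<gamma> * l}"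
  proof -
    have "majority_set g (\<theta> * l) J 0 \<subseteq> {..<N}" using majority_set_subset D0 by metis
    then have "majority_set g (\<theta> * l) J 0 \<subseteq> (majority_set g (\<theta> * l) J 0 \<inter> G) \<union> {n. n < N \<and> Mf n > \<gamma> * l}"
      by (auto simp: G_def not_le)
    then have "sum w (majority_set g (\<theta> * l) J 0) \<le> sum w ((majority_set g (\<theta> * l) J 0 \<inter> G) \<union> {n. n < N \<and> Mf n > \<gamma> * l})"
      using w by (intro sum_mono2) auto
    also have "\<dots> \<le> sum w (majority_set g (\<theta> * l) J 0 \<inter> G) + sum w {n. n < N \<and> Mf n > \<gamma> * l}"
      using w by (subst sum_Un) (auto simp: sum_nonneg)
    finally show ?thesis .
  qed
  ultimately show ?thesis unfolding Mf_def N_def by linarith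
qed

section \<open>From good-lambda inequalities to norm inequalities\<close>

text \<open>Integrating against \<open>l powr (p - 1)\<close> and rescaling the level by
  \<open>\<theta>\<close> bounds the integral \<open>I\<close> of \<open>\<phi>\<close> by
  \<open>\<theta> powr p * \<eta> * I\<close> plus a multiple of the norm of \<open>M\<close>.
  Absorption is legitimate because \<open>I\<close> is finite: \<open>\<phi>\<close> is bounded by
  \<open>W\<close> and vanishes beyond \<open>\<Lambda>\<close>. The recursion closes for
  \<open>\<phi>\<close>, a majorant of the distribution function of \<open>F\<close>, and
  monotonicity of \<open>\<phi>\<close> provides its measurability.\<close>

lemma strong_from_good_lambda:
  fixes w F M :: "'a \<Rightarrow> real" and \<phi> :: "real \<Rightarrow> real"
  assumes p: "p > 0" and X: "finite X" and w: "\<And>n. n \<in> X \<Longrightarrow> w n \<ge> 0"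
    and F: "\<And>n. n \<in> X \<Longrightarrow> F n \<ge> 0" and M: "\<And>n. n \<in> X \<Longrightarrow> M n \<ge> 0"
    and \<theta>: "\<theta> > 1" and \<gamma>: "\<gamma> > 0" and \<eta>: "\<eta> \<ge> 0" "\<theta> powr p * \<eta> < 1"
    and anti: "\<And>l l'. l \<le> l' \<Longrightarrow> \<phi> l' \<le> \<phi> l"
    and \<phi>0: "\<And>l. \<phi> l \<ge> 0" and W: "\<And>l. \<phi> l \<le> W" and \<Lambda>: "\<Lambda> \<ge> 0" "\<And>l. l \<ge> \<Lambda> \<Longrightarrow> \<phi> l = 0"
    and FW: "\<And>l. l > 0 \<Longrightarrow> (\<Sum>n | n \<in> X \<and> F n > l. w n) \<le> \<phi> l"
    and gl: "\<And>l. l > 0 \<Longrightarrow> \<phi> (\<theta> * l) \<le> \<eta> * \<phi> l + (\<Sum>n | n \<in> X \<and> M n > \<gamma> * l. w n)"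
  shows "(\<Sum>n\<in>X. w n * F n powr p) \<le> \<theta> powr p / (\<gamma> powr p * (1 - \<theta> powr p * \<eta>)) * (\<Sum>n\<in>X. w n * M n powr p)"
proof -
  define I where "I = (\<integral>\<^sup>+ l. ennreal (l powr (p - 1) * \<phi> l) * indicator {0<..} l \<partial>lborel)"
  have "(\<lambda>l. - \<phi> l) \<in> borel_measurable borel"
    by (rule borel_measurable_mono) (auto intro!: monoI anti)
  then have "(\<lambda>l. - (- \<phi> l)) \<in> borel_measurable borel" by (rule borel_measurable_uminus)
  then have [measurable]: "\<phi> \<in> borel_measurable borel" by simp
  have W0: "W \<ge> 0" using \<phi>0[of 0] W[of 0] by simp
  have "I \<le> (\<integral>\<^sup>+ l. ennreal W * (ennreal (l powr (p - 1)) * indicator {0<..<\<Lambda>} l) \<partial>lborel)"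
    unfolding I_def
  proof (rule nn_integral_mono)
    fix l :: real
    show "ennreal (l powr (p - 1) * \<phi> l) * indicator {0<..} l \<le> ennreal W * (ennreal (l powr (p - 1)) * indicator {0<..<\<Lambda>} l)"
    proof (cases "0 < l \<and> l < \<Lambda>")
      case True
      have "l powr (p - 1) * \<phi> l \<le> W * l powr (p - 1)"
        using W[of l] by (simp add: mult.commute mult_right_mono)
      then show ?thesis using True W0 by (simp add: ennreal_mult[symmetric] ennreal_leI)
    next
      case False
      then show ?thesis using \<Lambda>(2)[of l] by (cases "l > 0") auto
    qed
  qed
  also have "\<dots> = ennreal W * ennreal (\<Lambda> powr p / p)"
    using p \<Lambda> by (simp add: nn_integral_cmult layer_cake_point)
  also have "\<dots> < \<infinity>" by (simp add: ennreal_mult_less_top)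
  finally have "I < \<infinity>" .
  then obtain i where i: "I = ennreal i" "i \<ge> 0" by (cases I) auto
  define S where "S = (\<Sum>n\<in>X. w n * M n powr p)"
  have S0: "S \<ge> 0" unfolding S_def using w by (intro sum_nonneg) auto
  have t0: "\<theta> > 0" using \<theta> by simp
  \<comment> \<open>The substitution of \<open>\<theta> * l\<close> for \<open>l\<close> produces
    the factor \<open>\<theta> powr p\<close>.\<close>
  have "I = ennreal \<bar>\<theta>\<bar> * (\<integral>\<^sup>+ l. ennreal ((0 + \<theta> * l) powr (p - 1) * \<phi> (0 + \<theta> * l)) * indicator {0<..} (0 + \<theta> * l) \<partial>lborel)"
    unfolding I_def using t0 by (intro nn_integral_real_affine) auto
  also have "\<dots> = (\<integral>\<^sup>+ l. ennreal (\<theta> powr p) * (ennreal (l powr (p - 1) * \<phi> (\<theta> * l)) * indicator {0<..} l) \<partial>lborel)"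
  proof (subst nn_integral_cmult[symmetric])
    show "(\<integral>\<^sup>+ l. ennreal \<bar>\<theta>\<bar> * (ennreal ((0 + \<theta> * l) powr (p - 1) * \<phi> (0 + \<theta> * l)) * indicator {0<..} (0 + \<theta> * l)) \<partial>lborel)
      = (\<integral>\<^sup>+ l. ennreal (\<theta> powr p) * (ennreal (l powr (p - 1) * \<phi> (\<theta> * l)) * indicator {0<..} l) \<partial>lborel)"
    proof (rule nn_integral_cong)
      fix l :: real
      show "ennreal \<bar>\<theta>\<bar> * (ennreal ((0 + \<theta> * l) powr (p - 1) * \<phi> (0 + \<theta> * l)) * indicator {0<..} (0 + \<theta> * l))
        = ennreal (\<theta> powr p) * (ennreal (l powr (p - 1) * \<phi> (\<theta> * l)) * indicator {0<..} l)"
      proof (cases "l > 0")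
        case True
        have e: "\<theta> * (\<theta> * l) powr (p - 1) = \<theta> powr p * l powr (p - 1)"
          using True t0 by (simp add: powr_mult powr_diff)
        have "\<theta> * ((\<theta> * l) powr (p - 1) * \<phi> (\<theta> * l)) = \<theta> powr p * (l powr (p - 1) * \<phi> (\<theta> * l))"
          unfolding mult.assoc[symmetric] e ..
        then show ?thesis using True t0 \<phi>0[of "\<theta> * l"] by (simp add: ennreal_mult[symmetric])
      next
        case False
        then have "\<not> 0 < \<theta> * l" using t0 by (simp add: zero_less_mult_iff)
        then show ?thesis using False by simp
      qed
    qed
  qed auto
  also have "\<dots> \<le> (\<integral>\<^sup>+ l. ennreal (\<theta> powr p * \<eta>) * (ennreal (l powr (p - 1) * \<phi> l) * indicator {0<..} l)
      + ennreal (\<theta> powr p) * (ennreal (l powr (p - 1) * (\<Sum>n | n \<in> X \<and> M n / \<gamma> > l. w n)) * indicator {0<..} l) \<partial>lborel)"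
  proof (rule nn_integral_mono)
    fix l :: real
    show "ennreal (\<theta> powr p) * (ennreal (l powr (p - 1) * \<phi> (\<theta> * l)) * indicator {0<..} l)
      \<le> ennreal (\<theta> powr p * \<eta>) * (ennreal (l powr (p - 1) * \<phi> l) * indicator {0<..} l)
      + ennreal (\<theta> powr p) * (ennreal (l powr (p - 1) * (\<Sum>n | n \<in> X \<and> M n / \<gamma> > l. w n)) * indicator {0<..} l)"
    proof (cases "l > 0")
      case True
      define Q where "Q = (\<Sum>n | n \<in> X \<and> M n / \<gamma> > l. w n)"
      have Qe: "(\<Sum>n | n \<in> X \<and> M n > \<gamma> * l. w n) = Q"
        unfolding Q_def using \<gamma> by (intro sum.cong) (auto simp: pos_less_divide_eq mult.commute)
      have Q0: "Q \<ge> 0" unfolding Q_def using w by (intro sum_nonneg) auto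
      have "\<theta> powr p * (l powr (p - 1) * \<phi> (\<theta> * l)) \<le> \<theta> powr p * (l powr (p - 1) * (\<eta> * \<phi> l + Q))"
        using gl[OF True] Qe by (intro mult_left_mono) auto
      also have "\<dots> = \<theta> powr p * \<eta> * (l powr (p - 1) * \<phi> l) + \<theta> powr p * (l powr (p - 1) * Q)"
        by (simp add: algebra_simps)
      finally have "ennreal (\<theta> powr p * (l powr (p - 1) * \<phi> (\<theta> * l))) \<le> ennreal (\<theta> powr p * \<eta> * (l powr (p - 1) * \<phi> l) + \<theta> powr p * (l powr (p - 1) * Q))"
        by (rule ennreal_leI)
      also have "\<dots> = ennreal (\<theta> powr p * \<eta> * (l powr (p - 1) * \<phi> l)) + ennreal (\<theta> powr p * (l powr (p - 1) * Q))"
        using \<eta> \<phi>0[of l] Q0 by (intro ennreal_plus) auto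
      finally have "ennreal (\<theta> powr p * (l powr (p - 1) * \<phi> (\<theta> * l))) \<le> ennreal (\<theta> powr p * \<eta> * (l powr (p - 1) * \<phi> l)) + ennreal (\<theta> powr p * (l powr (p - 1) * Q))" .
      then show ?thesis unfolding Q_def[symmetric] using True \<eta> \<phi>0[of l] \<phi>0[of "\<theta> * l"] Q0
        by (simp add: ennreal_mult[symmetric])
    qed auto
  qed
  also have "\<dots> = ennreal (\<theta> powr p * \<eta>) * I + ennreal (\<theta> powr p) * ennreal ((\<Sum>n\<in>X. w n * (M n / \<gamma>) powr p) / p)"
  proof -
    define R where "R l = (\<Sum>n | n \<in> X \<and> M n / \<gamma> > l. w n)" for l
    have "(\<lambda>l. - R l) \<in> borel_measurable borel"
    proof (rule borel_measurable_mono, rule monoI)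
      fix x y :: real assume "x \<le> y"
      then show "- R x \<le> - R y" unfolding R_def using X w
        by (simp, intro sum_mono2) auto
    qed
    then have "(\<lambda>l. - (- R l)) \<in> borel_measurable borel" by (rule borel_measurable_uminus)
    then have [measurable]: "R \<in> borel_measurable borel" by simp
    have lc: "(\<integral>\<^sup>+ l. ennreal (l powr (p - 1) * R l) * indicator {0<..} l \<partial>lborel) = ennreal ((\<Sum>n\<in>X. w n * (M n / \<gamma>) powr p) / p)"
      unfolding R_def using p X w M \<gamma> by (intro layer_cake) auto
    show ?thesis unfolding I_def R_def[symmetric] lc[symmetric]
      by (subst nn_integral_add) (auto simp: nn_integral_cmult)
  qed
  also have "(\<Sum>n\<in>X. w n * (M n / \<gamma>) powr p) = S / \<gamma> powr p"
    unfolding S_def sum_divide_distrib using M \<gamma> by (intro sum.cong) (auto simp: powr_divide)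
  also have "ennreal (\<theta> powr p * \<eta>) * I + ennreal (\<theta> powr p) * ennreal (S / \<gamma> powr p / p)
     = ennreal (\<theta> powr p * \<eta> * i + \<theta> powr p * (S / \<gamma> powr p / p))"
    using i \<eta> S0 p by (simp add: ennreal_mult[symmetric] ennreal_plus[symmetric] del: ennreal_plus)
  finally have "i \<le> \<theta> powr p * \<eta> * i + \<theta> powr p * (S / \<gamma> powr p / p)"
    using i \<eta> S0 p by (subst (asm) i(1), subst (asm) ennreal_le_iff) auto
  then have "i * (1 - \<theta> powr p * \<eta>) \<le> \<theta> powr p * (S / \<gamma> powr p / p)" by (simp add: algebra_simps)
  then have ib: "i \<le> \<theta> powr p * (S / \<gamma> powr p / p) / (1 - \<theta> powr p * \<eta>)"
  proof -
    have "1 - \<theta> powr p * \<eta> > 0" using \<eta> by simp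
    with \<open>i * (1 - \<theta> powr p * \<eta>) \<le> \<theta> powr p * (S / \<gamma> powr p / p)\<close>
    show ?thesis by (simp only: pos_le_divide_eq)
  qed
  have "ennreal ((\<Sum>n\<in>X. w n * F n powr p) / p) = (\<integral>\<^sup>+ l. ennreal (l powr (p - 1) * (\<Sum>n | n \<in> X \<and> F n > l. w n)) * indicator {0<..} l \<partial>lborel)"
    using p X w F by (subst layer_cake) auto
  also have "\<dots> \<le> I" unfolding I_def
  proof (rule nn_integral_mono)
    fix l :: real
    show "ennreal (l powr (p - 1) * (\<Sum>n | n \<in> X \<and> F n > l. w n)) * indicator {0<..} l \<le> ennreal (l powr (p - 1) * \<phi> l) * indicator {0<..} l"
      using FW[of l] by (cases "l > 0") (auto intro!: ennreal_leI mult_left_mono)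
  qed
  finally have "(\<Sum>n\<in>X. w n * F n powr p) / p \<le> i"
    using i by (simp add: ennreal_le_iff)
  then have "(\<Sum>n\<in>X. w n * F n powr p) / p \<le> \<theta> powr p * (S / \<gamma> powr p / p) / (1 - \<theta> powr p * \<eta>)"
    using ib by linarith
  then have "(\<Sum>n\<in>X. w n * F n powr p) \<le> p * (\<theta> powr p * (S / \<gamma> powr p / p) / (1 - \<theta> powr p * \<eta>))"
    using p by (simp add: pos_divide_le_eq mult.commute)
  also have "\<dots> = \<theta> powr p / (\<gamma> powr p * (1 - \<theta> powr p * \<eta>)) * S"
    using p by simp
  finally show ?thesis unfolding S_def .
qed

text \<open>The quantity \<open>l * \<phi> l\<close> at level \<open>l\<close> is at most
  \<open>q\<close> times its value at \<open>l / \<theta>\<close> plus \<open>b\<close>, with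
  \<open>q = \<theta> * \<eta> < 1\<close>. Descending through the levels sums a geometric series;
  the boundedness of \<open>\<phi>\<close> supplies the starting estimate.\<close>

lemma weak_from_good_lambda:
  fixes \<phi> \<psi> :: "real \<Rightarrow> real"
  assumes \<theta>: "\<theta> > 1" and \<gamma>: "\<gamma> > 0" and \<eta>: "\<eta> \<ge> 0" "\<theta> * \<eta> < 1"
    and \<phi>0: "\<And>l. \<phi> l \<ge> 0" and W: "\<And>l. \<phi> l \<le> W"
    and gl: "\<And>l. l > 0 \<Longrightarrow> \<phi> (\<theta> * l) \<le> \<eta> * \<phi> l + \<psi> (\<gamma> * l)"
    and B: "\<And>l. l > 0 \<Longrightarrow> l * \<psi> l \<le> B" and l: "l > 0"
  shows "l * \<phi> l \<le> \<theta> / (\<gamma> * (1 - \<theta> * \<eta>)) * B"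
proof -
  define q where "q = \<theta> * \<eta>"
  define b where "b = \<theta> * B / \<gamma>"
  have q: "0 \<le> q" "q < 1" using \<eta> \<theta> by (auto simp: q_def)
  have step: "l * \<phi> l \<le> q * (l / \<theta> * \<phi> (l / \<theta>)) + b" if l: "l > 0" for l
  proof -
    have lt: "l / \<theta> > 0" using l \<theta> by simp
    have "l * \<phi> l = l * \<phi> (\<theta> * (l / \<theta>))" using \<theta> by simp
    also have "\<dots> \<le> l * (\<eta> * \<phi> (l / \<theta>) + \<psi> (\<gamma> * (l / \<theta>)))"
      using gl[OF lt] l by (intro mult_left_mono) auto
    also have "\<dots> = q * (l / \<theta> * \<phi> (l / \<theta>)) + \<theta> / \<gamma> * (\<gamma> * (l / \<theta>) * \<psi> (\<gamma> * (l / \<theta>)))"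
      using \<theta> \<gamma> by (simp add: q_def field_simps)
    also have "\<dots> \<le> q * (l / \<theta> * \<phi> (l / \<theta>)) + \<theta> / \<gamma> * B"
      using B[OF mult_pos_pos[OF \<gamma> lt]] \<gamma> \<theta> by (intro add_left_mono mult_left_mono) auto
    finally show ?thesis by (simp add: b_def)
  qed
  \<comment> \<open>Letting \<open>l\<close> tend to 0 in the one-step estimate leaves
    \<open>0 \<le> b\<close>.\<close>
  have B0: "b \<ge> 0" 
  proof (rule ccontr)
    assume "\<not> b \<ge> 0"
    have ev: "l * \<phi> l \<ge> 0" if "l > 0" for l using that \<phi>0 by simp
    have "l * \<phi> l \<le> q * (l / \<theta> * W) + b" if l: "l > 0" for l
    proof -
      have "q * (l / \<theta> * \<phi> (l / \<theta>)) \<le> q * (l / \<theta> * W)" using q l \<theta> W by (intro mult_left_mono) auto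
      then show ?thesis using step[OF l] by linarith
    qed
    then have nn: "0 \<le> q * (l / \<theta> * W) + b" if "l > 0" for l using ev[OF that] that by (meson order.trans)
    have "((\<lambda>l. q * (l / \<theta> * W) + b) \<longlongrightarrow> q * (0 / \<theta> * W) + b) (at_right 0)"
      using \<theta> by (intro tendsto_intros) auto
    then have "0 \<le> q * (0 / \<theta> * W) + b"
      by (rule tendsto_lowerbound) (rule eventually_mono[OF eventually_at_right_less[of 0] nn], simp_all)
    then show False using \<open>\<not> b \<ge> 0\<close> by simp
  qed
  \<comment> \<open>After \<open>i\<close> steps the remainder is \<open>q ^ i * (l * W)\<close>,
    which vanishes in the limit.\<close>
  have it: "l * \<phi> l \<le> q ^ i * (l * W) + b / (1 - q)" if l: "l > 0" for i l
    using l
  proof (induction i arbitrary: l)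
    case 0
    have "l * \<phi> l \<le> l * W" using W 0 by (intro mult_left_mono) auto
    moreover have "b / (1 - q) \<ge> 0" using B0 q by simp
    ultimately show ?case by simp
  next
    case (Suc i)
    have lt: "l / \<theta> > 0" using Suc.prems \<theta> by simp
    have W0: "W \<ge> 0" using \<phi>0[of 0] W[of 0] by simp
    have "l / \<theta> \<le> l" using Suc.prems \<theta> by (simp add: field_simps)
    then have "l / \<theta> * W \<le> l * W" using W0 by (rule mult_right_mono)
    then have "q ^ i * (l / \<theta> * W) \<le> q ^ i * (l * W)" using q by (intro mult_left_mono) auto
    then have "l / \<theta> * \<phi> (l / \<theta>) \<le> q ^ i * (l * W) + b / (1 - q)" using Suc.IH[OF lt] by linarith
    then have "q * (l / \<theta> * \<phi> (l / \<theta>)) \<le> q * (q ^ i * (l * W) + b / (1 - q))"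
      using q by (intro mult_left_mono) auto
    then have "l * \<phi> l \<le> q * (q ^ i * (l * W) + b / (1 - q)) + b" using step[OF Suc.prems] by linarith
    also have "\<dots> = q ^ Suc i * (l * W) + b / (1 - q)" using q by (simp add: field_simps)
    finally show ?case .
  qed
  have "(\<lambda>i. q ^ i * (l * W) + b / (1 - q)) \<longlonglongrightarrow> 0 * (l * W) + b / (1 - q)"
    using q by (intro tendsto_intros LIMSEQ_realpow_zero) auto
  then have "l * \<phi> l \<le> 0 * (l * W) + b / (1 - q)"
    by (rule tendsto_lowerbound) (use it[OF l] in auto)
  then show ?thesis using \<gamma> by (simp add: b_def q_def)
qed

section \<open>Consequences of the \<open>A\<^sub>p\<close> condition\<close>

lemma Ap_dual_weight:
  assumes "Ap_weight p w" "p > 1"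
  shows "\<exists>K\<ge>1. \<forall>i j. i \<le> j \<longrightarrow>
    (\<Sum>k=i..j. w k) * (\<Sum>k=i..j. w k powr (-1 / (p - 1))) powr (p - 1) \<le> K * real (j - i + 1) powr p"
proof -
  obtain K where K: "\<And>n m. n \<le> m \<Longrightarrow> (1 / real (m - n + 1) powr p) * (\<Sum>k=n..m. w k)
             * (\<Sum>k=n..m. w k powr (-1 / (p - 1))) powr (p - 1) \<le> K"
    using assms unfolding Ap_weight_def by auto
  have "(\<Sum>k=i..j. w k) * (\<Sum>k=i..j. w k powr (-1 / (p - 1))) powr (p - 1) \<le> max K 1 * real (j - i + 1) powr p"
    if "i \<le> j" for i j
  proof -
    have pos: "real (j - i + 1) powr p > 0" by simp
    have "(\<Sum>k=i..j. w k) * (\<Sum>k=i..j. w k powr (-1 / (p - 1))) powr (p - 1) / real (j - i + 1) powr p \<le> max K 1"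
      using K[OF that] by simp
    then show ?thesis using pos by (simp only: pos_divide_le_eq)
  qed
  then show ?thesis by (intro exI[of _ "max K 1"]) auto
qed

lemma A1_pointwise:
  assumes "Ap_weight 1 w"
  shows "\<exists>K\<ge>1. \<forall>i j k. i \<le> k \<longrightarrow> k \<le> j \<longrightarrow> (\<Sum>m=i..j. w m) \<le> K * real (j - i + 1) * w k"
proof -
  have w: "w k > 0" for k using assms by (simp add: Ap_weight_def weight_def)
  have w0: "w k \<ge> 0" for k using w[of k] by simp
  obtain K where K: "\<And>n m. n \<le> m \<Longrightarrow> (1 / real (m - n + 1)) * (\<Sum>k=n..m. w k) * (MAX k\<in>{n..m}. inverse (w k)) \<le> K"
    using assms unfolding Ap_weight_def by auto
  have "(\<Sum>m=i..j. w m) \<le> max K 1 * real (j - i + 1) * w k" if "i \<le> k" "k \<le> j" for i j k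
  proof -
    have "inverse (w k) \<le> (MAX k\<in>{i..j}. inverse (w k))" using that by (intro Max_ge) auto
    then have "(1 / real (j - i + 1)) * (\<Sum>m=i..j. w m) * inverse (w k) \<le> (1 / real (j - i + 1)) * (\<Sum>m=i..j. w m) * (MAX k\<in>{i..j}. inverse (w k))"
      by (intro mult_left_mono) (auto intro!: divide_nonneg_nonneg sum_nonneg simp: w0)
    also have "\<dots> \<le> K" using that by (intro K) auto
    also have "\<dots> \<le> max K 1" by simp
    finally have "(\<Sum>m=i..j. w m) / (real (j - i + 1) * w k) \<le> max K 1"
      by (simp add: field_simps)
    then show ?thesis using w[of k] by (simp add: pos_divide_le_eq mult.assoc)
  qed
  then show ?thesis by (intro exI[of _ "max K 1"]) auto
qed

text \<open>Hoelder's inequality for the constant 1, written as \<open>w powr (1 / p)\<close> times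
  its reciprocal. It is derived from Young's inequality after both factors are normalised to have
  sum 1.\<close>

lemma card_powr_le_Holder:
  assumes w: "\<And>k. w k > (0::real)" and p: "p > 1" and E: "finite E" "E \<noteq> {}"
  shows "real (card E) powr p \<le> (\<Sum>k\<in>E. w k) * (\<Sum>k\<in>E. w k powr (-1 / (p - 1))) powr (p - 1)"
proof -
  define q where "q = p / (p - 1)"
  define s where "s k = w k powr (-1 / (p - 1))" for k
  define A where "A = (\<Sum>k\<in>E. w k)"
  define S where "S = (\<Sum>k\<in>E. s k)"
  have s: "s k > 0" for k using w[of k] by (simp add: s_def)
  have q: "q > 1" "1 / p + 1 / q = 1" using p by (auto simp: q_def field_simps)
  have AS: "A > 0" "S > 0" unfolding A_def S_def using w s E by (auto intro!: sum_pos)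
  have one: "w k powr (1 / p) * s k powr (1 / q) = 1" for k
  proof -
    have "s k powr (1 / q) = w k powr (- (1 / p))" using p by (simp add: s_def powr_powr q_def field_simps)
    then show ?thesis using w[of k] by (simp add: powr_minus)
  qed
  have "real (card E) / (A powr (1 / p) * S powr (1 / q)) = (\<Sum>k\<in>E. 1 / (A powr (1 / p) * S powr (1 / q)))" by simp
  also have "\<dots> = (\<Sum>k\<in>E. (w k / A) powr (1 / p) * (s k / S) powr (1 / q))"
    using w s AS by (intro sum.cong) (auto simp: powr_divide one less_imp_le)
  also have "\<dots> \<le> (\<Sum>k\<in>E. w k / A / p + s k / S / q)"
  proof (rule sum_mono)
    fix k
    have "(w k / A) powr (1 / p) * (s k / S) powr (1 / q) \<le> ((w k / A) powr (1 / p)) powr p / p + ((s k / S) powr (1 / q)) powr q / q"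
      using p q by (intro Youngs_inequality) auto
    then show "(w k / A) powr (1 / p) * (s k / S) powr (1 / q) \<le> w k / A / p + s k / S / q"
      using p q w[of k] s[of k] AS by (simp add: powr_powr)
  qed
  also have "\<dots> = 1" using AS q by (simp add: sum.distrib sum_divide_distrib[symmetric] A_def S_def)
  finally have "real (card E) \<le> A powr (1 / p) * S powr (1 / q)" using AS by (simp add: pos_divide_le_eq)
  then have "real (card E) powr p \<le> (A powr (1 / p) * S powr (1 / q)) powr p" using p by (intro powr_mono2) auto
  also have "\<dots> = A * S powr (p - 1)" using AS p by (simp add: powr_mult powr_powr q_def)
  finally show ?thesis by (simp add: A_def S_def s_def)
qed

text \<open>A set that is large in cardinality has large weight: Hoelder's inequality on
  \<open>E\<close>, with the dual sum enlarged to \<open>{i..j}\<close>, is combined with the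
  \<open>A\<^sub>p\<close> condition there. For \<open>p = 1\<close> the pointwise form of the
  condition is summed over \<open>E\<close>.\<close>

lemma Ap_card_ratio:
  assumes Ap: "Ap_weight p w" and p: "p \<ge> 1"
  shows "\<exists>K\<ge>1. \<forall>i j E. E \<subseteq> {i..j} \<longrightarrow> real (card E) powr p * (\<Sum>k=i..j. w k) \<le> K * real (j - i + 1) powr p * sum w E"
proof -
  have w: "w k > 0" for k using Ap by (simp add: Ap_weight_def weight_def)
  have w0: "w k \<ge> 0" for k using w[of k] by simp
  show ?thesis
  proof (cases "p = 1")
    case True
    then obtain K where K: "K \<ge> 1" "\<And>i j k. i \<le> k \<Longrightarrow> k \<le> j \<Longrightarrow> (\<Sum>m=i..j. w m) \<le> K * real (j - i + 1) * w k"
      using A1_pointwise[of w] Ap by auto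
    have "real (card E) * (\<Sum>k=i..j. w k) \<le> K * real (j - i + 1) * sum w E" if "E \<subseteq> {i..j}" for i j E
    proof -
      have "real (card E) * (\<Sum>k=i..j. w k) = (\<Sum>e\<in>E. \<Sum>k=i..j. w k)" by simp
      also have "\<dots> \<le> (\<Sum>e\<in>E. K * real (j - i + 1) * w e)" using that by (intro sum_mono K) auto
      finally show ?thesis by (simp only: sum_distrib_left)
    qed
    then show ?thesis using K(1) True by (intro exI[of _ K]) auto
  next
    case False
    then have p1: "p > 1" using p by simp
    obtain K where K: "K \<ge> 1" "\<And>i j. i \<le> j \<Longrightarrow>
      (\<Sum>k=i..j. w k) * (\<Sum>k=i..j. w k powr (-1 / (p - 1))) powr (p - 1) \<le> K * real (j - i + 1) powr p"
      using Ap_dual_weight[OF Ap p1] by blast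
    have "real (card E) powr p * (\<Sum>k=i..j. w k) \<le> K * real (j - i + 1) powr p * sum w E" if E: "E \<subseteq> {i..j}" for i j E
    proof (cases "E = {}")
      case True then show ?thesis using p1 by simp
    next
      case False
      then have ij: "i \<le> j" using E by auto
      have fE: "finite E" using E finite_subset by blast
      have "real (card E) powr p \<le> sum w E * (\<Sum>k\<in>E. w k powr (-1 / (p - 1))) powr (p - 1)"
        by (rule card_powr_le_Holder[OF w p1 fE False])
      also have "\<dots> \<le> sum w E * (\<Sum>k=i..j. w k powr (-1 / (p - 1))) powr (p - 1)"
        using E p1 by (intro mult_left_mono powr_mono2 sum_mono2) (auto intro!: sum_nonneg simp: w0)
      finally have "real (card E) powr p * (\<Sum>k=i..j. w k) \<le> sum w E * (\<Sum>k=i..j. w k powr (-1 / (p - 1))) powr (p - 1) * (\<Sum>k=i..j. w k)"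
        by (intro mult_right_mono) (auto intro!: sum_nonneg simp: w0)
      also have "\<dots> = sum w E * ((\<Sum>k=i..j. w k) * (\<Sum>k=i..j. w k powr (-1 / (p - 1))) powr (p - 1))" by simp
      also have "\<dots> \<le> sum w E * (K * real (j - i + 1) powr p)"
        using K(2)[OF ij] by (intro mult_left_mono) (auto intro!: sum_nonneg simp: w0)
      finally show ?thesis by (simp add: mult_ac)
    qed
    then show ?thesis using K(1) by blast
  qed
qed

text \<open>The ratio bound is applied to the complement of \<open>E\<close>, which contains at
  least half of the points, so \<open>E\<close> misses a fixed proportion
  \<open>1 / (2 powr p * K)\<close> of the weight. The bound \<open>1/2 \<le> \<eta>\<close> keeps
  the later choice of \<open>\<theta>\<close> below 2.\<close>

lemma Ap_half_ratio:
  assumes Ap: "Ap_weight p w" and p: "p \<ge> 1"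
  shows "\<exists>\<eta>. 1/2 \<le> \<eta> \<and> \<eta> < 1 \<and> (\<forall>i j E. E \<subseteq> {i..j} \<longrightarrow> 2 * card E \<le> card {i..j} \<longrightarrow> sum w E \<le> \<eta> * sum w {i..j})"
proof -
  have w: "w k > 0" for k using Ap by (simp add: Ap_weight_def weight_def)
  have w0: "w k \<ge> 0" for k using w[of k] by simp
  obtain K where K: "K \<ge> 1" "\<And>i j E. E \<subseteq> {i..j} \<Longrightarrow> real (card E) powr p * (\<Sum>k=i..j. w k) \<le> K * real (j - i + 1) powr p * sum w E"
    using Ap_card_ratio[OF Ap p] by blast
  define \<eta> where "\<eta> = 1 - 1 / (2 powr p * K)"
  have "2 powr p * K \<ge> 2 * 1" using K(1) powr_mono[of 1 p 2] p by (intro mult_mono) auto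
  then have e: "1/2 \<le> \<eta>" "\<eta> < 1" by (auto simp: \<eta>_def field_simps)
  have "sum w E \<le> \<eta> * sum w {i..j}" if E: "E \<subseteq> {i..j}" "2 * card E \<le> card {i..j}" for i j E
  proof (cases "i \<le> j")
    case False
    then have "{i..j} = {}" by simp
    then have "E = {}" using E by simp
    then show ?thesis using \<open>{i..j} = {}\<close> by simp
  next
    case ij: True
    define D where "D = {i..j} - E"
    define L where "L = real (j - i + 1)"
    have L: "L > 0" by (simp add: L_def)
    have fE: "finite E" using E finite_subset by blast
    have cD: "card D = card {i..j} - card E" unfolding D_def using E fE by (intro card_Diff_subset) auto
    then have "2 * card D \<ge> card {i..j}" using E by linarith
    then have "L \<le> 2 * real (card D)" using ij by (simp add: L_def)
    then have "(L / 2) powr p \<le> real (card D) powr p" using p L by (intro powr_mono2) auto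
    then have "(L / 2) powr p * sum w {i..j} \<le> real (card D) powr p * sum w {i..j}"
      by (intro mult_right_mono) (auto intro!: sum_nonneg simp: w0)
    also have "\<dots> \<le> K * L powr p * sum w D" unfolding L_def by (rule K(2)) (auto simp: D_def)
    finally have "L powr p * (sum w {i..j} / 2 powr p) \<le> L powr p * (K * sum w D)"
      using L by (simp add: powr_divide mult_ac)
    moreover have "L powr p > 0" using L by simp
    ultimately have "sum w {i..j} / 2 powr p \<le> K * sum w D" by (simp only: mult_le_cancel_left_pos)
    then have "sum w {i..j} / (2 powr p * K) \<le> sum w D" using K(1) by (simp add: field_simps)
    moreover have "sum w {i..j} = sum w E + sum w D" unfolding D_def using E by (simp add: sum.subset_diff add.commute)
    ultimately show ?thesis by (simp add: \<eta>_def left_diff_distrib)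
  qed
  then show ?thesis using e by blast
qed

section \<open>Weighted bounds for singular kernels\<close>

text \<open>On a covering interval \<open>l\<close> is below the average of \<open>f\<close>.
  Multiplying by the weight of the interval and moving its length over to the weight leaves averages
  of \<open>w\<close>, which the \<open>A\<^sub>1\<close> condition bounds by \<open>K * w k\<close>
  at each point.\<close>

lemma wmax_weak_type_A1:
  assumes w: "\<And>k. w k > (0::real)" and f: "\<And>k. f k \<ge> 0" and l: "l > 0" and K: "K \<ge> 0"
    and A1: "\<And>i j k. i \<le> k \<Longrightarrow> k \<le> j \<Longrightarrow> (\<Sum>m=i..j. w m) \<le> K * real (j - i + 1) * w k"
  shows "l * (\<Sum>n | n < N \<and> wmax N (\<lambda>_. 1) f n > l. w n) \<le> 2 * K * (\<Sum>n<N. w n * f n)"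
proof -
  define E where "E = {n. n < N \<and> wmax N (\<lambda>_. 1) f n > l}"
  obtain F where fF: "finite F" and un: "E = (\<Union>I\<in>F. {fst I..snd I})"
    and "\<forall>I\<in>F. fst I \<le> snd I \<and> (\<Sum>k=fst I..snd I. f k * 1) / (\<Sum>k=fst I..snd I. 1) > l"
    unfolding E_def by (rule wmax_superlevel_Union[where N = N and v = "\<lambda>_. 1" and f = f and l = l])
  note F = bspec[OF this(3)]
  have w0: "w k \<ge> 0" for k using w[of k] by simp
  have "l * (\<Sum>k\<in>E. w k) \<le> 2 * (\<Sum>k\<in>E. K * (w k * f k))"
  proof (rule interval_cover_sum[OF fF un])
    fix I assume I: "I \<in> F"
    obtain i j where ij: "I = (i, j)" by fastforce
    define L where "L = real (j - i + 1)"
    have le: "i \<le> j" using F[OF I] ij by simp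
    have L0: "L > 0" by (simp add: L_def)
    have "l < (\<Sum>k=i..j. f k) / L" using F[OF I] ij le by (simp add: L_def of_nat_diff Suc_diff_le)
    then have "l * (\<Sum>k=i..j. w k) \<le> (\<Sum>k=i..j. f k) / L * (\<Sum>k=i..j. w k)"
      by (intro mult_right_mono) (auto intro!: sum_nonneg simp: w0)
    also have "\<dots> = (\<Sum>k=i..j. f k) * ((\<Sum>k=i..j. w k) / L)" by simp
    also have "\<dots> = (\<Sum>k=i..j. f k * ((\<Sum>k=i..j. w k) / L))" by (rule sum_distrib_right)
    also have "\<dots> \<le> (\<Sum>k=i..j. f k * (K * w k))"
    proof (intro sum_mono mult_left_mono)
      fix k assume "k \<in> {i..j}"
      then have "(\<Sum>m=i..j. w m) \<le> K * L * w k" unfolding L_def by (intro A1) auto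
      then show "(\<Sum>m=i..j. w m) / L \<le> K * w k" using L0 by (simp add: pos_divide_le_eq mult_ac)
    qed (use f in auto)
    finally show "l * (\<Sum>k\<in>{fst I..snd I}. w k) \<le> (\<Sum>k\<in>{fst I..snd I}. K * (w k * f k))"
      by (simp add: ij mult_ac)
  qed (use w0 f l K in auto)
  also have "\<dots> \<le> 2 * (\<Sum>k<N. K * (w k * f k))"
    using w0 f K by (intro mult_left_mono sum_mono2) (auto simp: E_def)
  finally show ?thesis by (simp add: E_def sum_distrib_left mult_ac)
qed

text \<open>The good-lambda inequality is run with \<open>\<phi>\<close> the weight of the majority
  set; the maximal function on the right is then estimated by Muckenhoupt's theorem for
  \<open>p > 1\<close> and by weak type for \<open>p = 1\<close>. The output is restricted to the
  dyadic block that contains the support of \<open>f\<close>.\<close>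

lemma cz_weighted_dyadic:
  assumes cz: "cz_kernel A k" and A1: "A \<ge> 1" and Ap: "Ap_weight p w" and p: "p \<ge> 1"
  shows "\<exists>C\<ge>0. \<forall>J f. (\<forall>m\<ge>2 ^ J. f m = 0) \<longrightarrow>
     (p > 1 \<longrightarrow> (\<Sum>n<2 ^ J. w n * \<bar>\<Sum>m<2 ^ J. f m * k m n\<bar> powr p) \<le> C * (\<Sum>n<2 ^ J. w n * \<bar>f n\<bar> powr p)) \<and>
     (p = 1 \<longrightarrow> (\<forall>l>0. l * (\<Sum>n | n < 2 ^ J \<and> \<bar>\<Sum>m<2 ^ J. f m * k m n\<bar> > l. w n) \<le> C * (\<Sum>n<2 ^ J. w n * \<bar>f n\<bar>)))"
proof -
  have w: "w k > 0" for k using Ap by (simp add: Ap_weight_def weight_def)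
  have w0: "w k \<ge> 0" for k using w[of k] by simp
  obtain \<eta> where \<eta>: "1/2 \<le> \<eta>" "\<eta> < 1"
    and half: "\<And>i j E. E \<subseteq> {i..j} \<Longrightarrow> 2 * card E \<le> card {i..j} \<Longrightarrow> sum w E \<le> \<eta> * sum w {i..j}"
    using Ap_half_ratio[OF Ap p] by blast
  \<comment> \<open>Chosen so that \<open>\<theta> powr p * \<eta>\<close> equals
    \<open>\<eta> powr (1/2)\<close>, which is less than 1.\<close>
  define \<theta> where "\<theta> = \<eta> powr (- (1 / (2 * p)))"
  have t1: "1 < \<theta>" 
  proof -
    have "\<eta> powr (- (1 / (2 * p))) > \<eta> powr 0" using \<eta> p by (intro powr_less_mono') auto
    then show ?thesis using \<eta> by (simp add: \<theta>_def)
  qed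
  have t2: "\<theta> \<le> 2"
  proof -
    have "\<theta> \<le> (1/2) powr (- (1 / (2 * p)))" unfolding \<theta>_def using \<eta> p by (intro powr_mono2') auto
    also have "\<dots> = 2 powr (1 / (2 * p))" by (simp add: powr_divide powr_minus)
    also have "\<dots> \<le> 2 powr 1" using p by (intro powr_mono) auto
    finally show ?thesis by simp
  qed
  have q: "\<theta> powr p * \<eta> < 1"
  proof -
    have "\<theta> powr p * \<eta> = \<eta> powr (- (1/2)) * \<eta> powr 1" using \<eta> p by (simp add: \<theta>_def powr_powr)
    also have "\<dots> = \<eta> powr (1/2)" by (simp only: powr_add[symmetric]) simp
    also have "\<dots> < \<eta> powr 0" using \<eta> by (intro powr_less_mono') auto
    also have "\<dots> = 1" using \<eta> by simp
    finally show ?thesis .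
  qed
  define \<gamma> where "\<gamma> = (\<theta> - 1) / (100 * A)"
  have g0: "\<gamma> > 0" using t1 A1 by (simp add: \<gamma>_def)
  have e0: "\<eta> \<ge> 0" using \<eta> by simp
  define \<phi> where "\<phi> J g l = sum w (majority_set g l J 0)" for J g l
  have \<phi>0: "\<phi> J g l \<ge> 0" for J g l unfolding \<phi>_def by (intro sum_nonneg) (simp add: w0)
  have \<phi>W: "\<phi> J g l \<le> sum w (dyadic J 0)" for J g l
    unfolding \<phi>_def using majority_set_subset by (intro sum_mono2) (auto simp: w0)
  have D: "dyadic J 0 = {..<2 ^ J}" for J by (auto simp: dyadic_def)
  have gl: "\<phi> J (\<lambda>n. \<Sum>m<2 ^ J. f m * k m n) (\<theta> * l) \<le> \<eta> * \<phi> J (\<lambda>n. \<Sum>m<2 ^ J. f m * k m n) l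
     + sum w {n. n < 2 ^ J \<and> wmax (2 ^ J) (\<lambda>_. 1) (\<lambda>m. \<bar>f m\<bar>) n > \<gamma> * l}"
    if "\<And>m. m \<ge> 2 ^ J \<Longrightarrow> f m = 0" "l > 0" for J f l
    unfolding \<phi>_def \<gamma>_def using cz w0 e0 half t1 t2 that A1 by (intro cz_good_lambda) auto
  have lev: "sum w {n. n < 2 ^ J \<and> \<bar>g n\<bar> > l} \<le> \<phi> J g l" for J g l
    unfolding \<phi>_def using superlevel_subset_majority_set[where j = J and k = 0 and g = g and l = l] by (intro sum_mono2) (auto simp: w0 D)
  show ?thesis
  proof (cases "p = 1")
    case True
    obtain K where K: "K \<ge> 1" "\<And>i j k. i \<le> k \<Longrightarrow> k \<le> j \<Longrightarrow> (\<Sum>m=i..j. w m) \<le> K * real (j - i + 1) * w k"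
      using A1_pointwise[of w] Ap True by auto
    define C where "C = \<theta> / (\<gamma> * (1 - \<theta> * \<eta>)) * (2 * K)"
    have q1: "\<theta> * \<eta> < 1" using q True t1 by simp
    have C0: "C \<ge> 0" unfolding C_def using t1 g0 q1 K by (intro mult_nonneg_nonneg divide_nonneg_nonneg) auto
    have "l * (\<Sum>n | n < 2 ^ J \<and> \<bar>\<Sum>m<2 ^ J. f m * k m n\<bar> > l. w n) \<le> C * (\<Sum>n<2 ^ J. w n * \<bar>f n\<bar>)"
      if f: "\<And>m. m \<ge> 2 ^ J \<Longrightarrow> f m = 0" and l: "l > 0" for J f l
    proof -
      define g where "g n = (\<Sum>m<2 ^ J. f m * k m n)" for n
      have "l * sum w {n. n < 2 ^ J \<and> \<bar>g n\<bar> > l} \<le> l * \<phi> J g l"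
        using lev l by (intro mult_left_mono) auto
      also have "\<dots> \<le> \<theta> / (\<gamma> * (1 - \<theta> * \<eta>)) * (2 * K * (\<Sum>n<2 ^ J. w n * \<bar>f n\<bar>))"
      proof (rule weak_from_good_lambda[OF t1 g0 e0 q1])
        show "\<phi> J g (\<theta> * l) \<le> \<eta> * \<phi> J g l + sum w {n. n < 2 ^ J \<and> wmax (2 ^ J) (\<lambda>_. 1) (\<lambda>m. \<bar>f m\<bar>) n > \<gamma> * l}" if "l > 0" for l
          unfolding g_def by (rule gl[OF f that])
        show "l * sum w {n. n < 2 ^ J \<and> wmax (2 ^ J) (\<lambda>_. 1) (\<lambda>m. \<bar>f m\<bar>) n > l} \<le> 2 * K * (\<Sum>n<2 ^ J. w n * \<bar>f n\<bar>)" if "l > 0" for l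
          using w that K by (intro wmax_weak_type_A1) auto
      qed (use \<phi>0 \<phi>W l in auto)
      finally show ?thesis by (simp add: g_def C_def mult_ac)
    qed
    then show ?thesis using True C0 by (intro exI[of _ C]) auto
  next
    case False
    then have p1: "p > 1" using p by simp
    obtain K where K: "K \<ge> 1" "\<And>i j. i \<le> j \<Longrightarrow>
      (\<Sum>k=i..j. w k) * (\<Sum>k=i..j. w k powr (-1 / (p - 1))) powr (p - 1) \<le> K * real (j - i + 1) powr p"
      using Ap_dual_weight[OF Ap p1] by blast
    obtain B where B: "B \<ge> 0" "\<And>N f. (\<forall>n. f n \<ge> 0) \<Longrightarrow>
      (\<Sum>n<N. w n * wmax N (\<lambda>_. 1) f n powr p) \<le> B * (\<Sum>n<N. w n * f n powr p)"
      using muckenhoupt_maximal[of p w "\<lambda>k. w k powr (-1 / (p - 1))" K] p1 w K by auto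
    define C where "C = \<theta> powr p / (\<gamma> powr p * (1 - \<theta> powr p * \<eta>)) * B"
    have c0: "\<theta> powr p / (\<gamma> powr p * (1 - \<theta> powr p * \<eta>)) \<ge> 0"
      using q by (intro mult_nonneg_nonneg divide_nonneg_nonneg) auto
    have C0: "C \<ge> 0" unfolding C_def using c0 B by (intro mult_nonneg_nonneg) auto
    have "(\<Sum>n<2 ^ J. w n * \<bar>\<Sum>m<2 ^ J. f m * k m n\<bar> powr p) \<le> C * (\<Sum>n<2 ^ J. w n * \<bar>f n\<bar> powr p)"
      if f: "\<And>m. m \<ge> 2 ^ J \<Longrightarrow> f m = 0" for J f
    proof -
      define g where "g n = (\<Sum>m<2 ^ J. f m * k m n)" for n
      define N where "N = (2::nat) ^ J"
      \<comment> \<open>An upper bound for all \<open>\<bar>g n\<bar>\<close> below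
        \<open>N\<close>; beyond it the level sets and hence the majority sets are empty.\<close>
      define \<Lambda> where "\<Lambda> = (\<Sum>n<N. \<bar>g n\<bar>)"
      have "(\<Sum>n<N. w n * \<bar>g n\<bar> powr p) \<le> \<theta> powr p / (\<gamma> powr p * (1 - \<theta> powr p * \<eta>)) * (\<Sum>n<N. w n * wmax N (\<lambda>_. 1) (\<lambda>m. \<bar>f m\<bar>) n powr p)"
      proof (rule strong_from_good_lambda[where \<phi> = "\<phi> J g" and W = "sum w (dyadic J 0)" and \<Lambda> = \<Lambda>])
        show "\<phi> J g l' \<le> \<phi> J g l" if "l \<le> l'" for l l'
          unfolding \<phi>_def using majority_set_antimono[OF that] by (intro sum_mono2) (auto simp: w0)
        show "\<phi> J g l = 0" if "l \<ge> \<Lambda>" for l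
        proof -
          have "{n \<in> dyadic J 0. \<bar>g n\<bar> > l} = {}"
          proof (rule equals0I)
            fix n assume "n \<in> {n \<in> dyadic J 0. \<bar>g n\<bar> > l}"
            then have "n < N" "\<bar>g n\<bar> > l" by (auto simp: D N_def)
            moreover have "\<bar>g n\<bar> \<le> \<Lambda>" unfolding \<Lambda>_def using \<open>n < N\<close> by (intro member_le_sum) auto
            ultimately show False using that by linarith
          qed
          then have "card (majority_set g l J 0) \<le> 0" using card_majority_set_le[where g = g and l = l and j = J and k = 0] by (metis card.empty mult_0_right)
          then show ?thesis by (simp add: \<phi>_def)
        qed
        show "(\<Sum>n | n \<in> {..<N} \<and> \<bar>g n\<bar> > l. w n) \<le> \<phi> J g l" if "l > 0" for l
          using lev[where J = J and g = g and l = l] by (simp add: N_def)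
        show "\<phi> J g (\<theta> * l) \<le> \<eta> * \<phi> J g l + (\<Sum>n | n \<in> {..<N} \<and> \<gamma> * l < wmax N (\<lambda>_. 1) (\<lambda>m. \<bar>f m\<bar>) n. w n)" if "l > 0" for l
          using gl[OF f that] unfolding g_def N_def by simp
        show "0 \<le> wmax N (\<lambda>_. 1) (\<lambda>m. \<bar>f m\<bar>) n" if "n \<in> {..<N}" for n
          using that by (intro wmax_nonneg) auto
        show "0 \<le> \<Lambda>" by (simp add: \<Lambda>_def sum_nonneg)
      qed (use p1 w0 t1 g0 e0 q \<phi>0 \<phi>W in auto)
      also have "\<dots> \<le> \<theta> powr p / (\<gamma> powr p * (1 - \<theta> powr p * \<eta>)) * (B * (\<Sum>n<N. w n * \<bar>f n\<bar> powr p))"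
        using c0 by (intro mult_left_mono B(2)) auto
      finally show ?thesis by (simp add: g_def N_def C_def)
    qed
    then show ?thesis using False C0 by (intro exI[of _ C]) auto
  qed
qed

text \<open>\<open>f\<close> is extended by 0 to a dyadic block exceeding both \<open>N\<close> and
  \<open>L\<close>; restricting the output to \<open>{..<L}\<close> only decreases the left-hand
  sides.\<close>

lemma cz_weighted:
  assumes cz: "cz_kernel A k" and A1: "A \<ge> 1" and Ap: "Ap_weight p w" and p: "p \<ge> 1"
  shows "\<exists>C\<ge>0. \<forall>N L f.
     (p > 1 \<longrightarrow> (\<Sum>n<L. w n * \<bar>\<Sum>m<N. f m * k m n\<bar> powr p) \<le> C * (\<Sum>n<N. w n * \<bar>f n\<bar> powr p)) \<and>
     (p = 1 \<longrightarrow> (\<forall>l>0. l * (\<Sum>n | n < L \<and> \<bar>\<Sum>m<N. f m * k m n\<bar> > l. w n) \<le> C * (\<Sum>n<N. w n * \<bar>f n\<bar>)))"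
proof -
  have w0: "w k \<ge> 0" for k using Ap by (auto simp: Ap_weight_def weight_def less_imp_le)
  obtain C where C: "C \<ge> 0" 
    and s: "\<And>J f. (\<forall>m\<ge>2 ^ J. f m = 0) \<Longrightarrow> p > 1 \<Longrightarrow>
      (\<Sum>n<2 ^ J. w n * \<bar>\<Sum>m<2 ^ J. f m * k m n\<bar> powr p) \<le> C * (\<Sum>n<2 ^ J. w n * \<bar>f n\<bar> powr p)"
    and wk: "\<And>J f l. (\<forall>m\<ge>2 ^ J. f m = 0) \<Longrightarrow> p = 1 \<Longrightarrow> l > 0 \<Longrightarrow>
      l * (\<Sum>n | n < 2 ^ J \<and> \<bar>\<Sum>m<2 ^ J. f m * k m n\<bar> > l. w n) \<le> C * (\<Sum>n<2 ^ J. w n * \<bar>f n\<bar>)"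
    using cz_weighted_dyadic[OF assms] by blast
  have "(p > 1 \<longrightarrow> (\<Sum>n<L. w n * \<bar>\<Sum>m<N. f m * k m n\<bar> powr p) \<le> C * (\<Sum>n<N. w n * \<bar>f n\<bar> powr p)) \<and>
     (p = 1 \<longrightarrow> (\<forall>l>0. l * (\<Sum>n | n < L \<and> \<bar>\<Sum>m<N. f m * k m n\<bar> > l. w n) \<le> C * (\<Sum>n<N. w n * \<bar>f n\<bar>)))" for N L f
  proof -
    define J where "J = N + L"
    have "J < 2 ^ J" by (rule less_exp)
    then have J: "N \<le> 2 ^ J" "L \<le> 2 ^ J" unfolding J_def by linarith+
    define h where "h m = (if m < N then f m else 0)" for m
    have hz: "\<forall>m\<ge>2 ^ J. h m = 0" using J by (auto simp: h_def)
    have T: "(\<Sum>m<2 ^ J. h m * k m n) = (\<Sum>m<N. f m * k m n)" for n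
      using J by (intro sum.mono_neutral_cong_right) (auto simp: h_def)
    have S: "(\<Sum>n<2 ^ J. w n * \<bar>h n\<bar> powr p) = (\<Sum>n<N. w n * \<bar>f n\<bar> powr p)"
      using J by (intro sum.mono_neutral_cong_right) (auto simp: h_def)
    have S1: "(\<Sum>n<2 ^ J. w n * \<bar>h n\<bar>) = (\<Sum>n<N. w n * \<bar>f n\<bar>)"
      using J by (intro sum.mono_neutral_cong_right) (auto simp: h_def)
    have "(\<Sum>n<L. w n * \<bar>\<Sum>m<N. f m * k m n\<bar> powr p) \<le> C * (\<Sum>n<N. w n * \<bar>f n\<bar> powr p)" if "p > 1"
    proof -
      have "(\<Sum>n<L. w n * \<bar>\<Sum>m<N. f m * k m n\<bar> powr p) \<le> (\<Sum>n<2 ^ J. w n * \<bar>\<Sum>m<N. f m * k m n\<bar> powr p)"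
        using J w0 by (intro sum_mono2) auto
      also have "\<dots> \<le> C * (\<Sum>n<N. w n * \<bar>f n\<bar> powr p)" using s[OF hz that] unfolding T S .
      finally show ?thesis .
    qed
    moreover have "l * (\<Sum>n | n < L \<and> \<bar>\<Sum>m<N. f m * k m n\<bar> > l. w n) \<le> C * (\<Sum>n<N. w n * \<bar>f n\<bar>)" if "p = 1" "l > 0" for l
    proof -
      have "l * (\<Sum>n | n < L \<and> \<bar>\<Sum>m<N. f m * k m n\<bar> > l. w n) \<le> l * (\<Sum>n | n < 2 ^ J \<and> \<bar>\<Sum>m<N. f m * k m n\<bar> > l. w n)"
        using J w0 that by (intro mult_left_mono sum_mono2) auto
      also have "\<dots> \<le> C * (\<Sum>n<N. w n * \<bar>f n\<bar>)" using wk[OF hz that] unfolding T S1 .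
      finally show ?thesis .
    qed
    ultimately show ?thesis by blast
  qed
  then show ?thesis using C by blast
qed

section \<open>The Jacobi differential equation\<close>

text \<open>With \<open>a = \<alpha> + n\<close> and \<open>b = \<beta> + n\<close>, this is the polynomial factor of the \<open>k\<close>-th derivative in
  Rodrigues' formula.\<close>

fun rod_poly :: "real \<Rightarrow> real \<Rightarrow> nat \<Rightarrow> real poly" where
  "rod_poly a b 0 = 1"
| "rod_poly a b (Suc k) = [:1, 0, -1:] * pderiv (rod_poly a b k)
     + [:b - a, - (a + b - 2 * real k):] * rod_poly a b k"

lemma rodrigues_deriv:
  assumes "-1 < x" "x < 1"
  shows "(deriv ^^ k) (\<lambda>y. (1 - y) powr a * (1 + y) powr b) x
       = (1 - x) powr (a - real k) * (1 + x) powr (b - real k) * poly (rod_poly a b k) x"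
  using assms
proof (induction k arbitrary: x)
  case (Suc k)
  let ?f = "\<lambda>y::real. (1 - y) powr a * (1 + y) powr b"
  define G where "G y = (1 - y) powr (a - real k) * (1 + y) powr (b - real k) * poly (rod_poly a b k) y" for y
  define A where "A = (1 - x) powr (a - real k - 1)"
  define B where "B = (1 + x) powr (b - real k - 1)"
  define q where "q = poly (rod_poly a b k) x"
  define q' where "q' = poly (pderiv (rod_poly a b k)) x"
  have pw: "(1 - x) powr (a - real k) = A * (1 - x)" "(1 + x) powr (b - real k) = B * (1 + x)"
    using Suc.prems powr_add[of "1 - x" "a - real k - 1" 1] powr_add[of "1 + x" "b - real k - 1" 1]
    by (auto simp: A_def B_def)
  have d1: "((\<lambda>y. (1 - y) powr (a - real k)) has_real_derivative - ((a - real k) * A)) (at x)"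
    unfolding A_def using Suc.prems by (auto intro!: derivative_eq_intros)
  have d2: "((\<lambda>y. (1 + y) powr (b - real k)) has_real_derivative (b - real k) * B) (at x)"
    unfolding B_def using Suc.prems by (auto intro!: derivative_eq_intros)
  have "(G has_real_derivative ((- ((a - real k) * A)) * (B * (1 + x)) + ((b - real k) * B) * (A * (1 - x))) * q + q' * (A * (1 - x) * (B * (1 + x)))) (at x)"
    unfolding G_def[abs_def] q_def q'_def
    by (rule DERIV_cong[OF DERIV_mult[OF DERIV_mult[OF d1 d2] poly_DERIV]]) (simp add: pw algebra_simps)
  \<comment> \<open>The formula for the iterated derivative holds on the open interval, which
    suffices because differentiation is local.\<close>
  then have "((deriv ^^ k) ?f has_real_derivative ((- ((a - real k) * A)) * (B * (1 + x)) + ((b - real k) * B) * (A * (1 - x))) * q + q' * (A * (1 - x) * (B * (1 + x)))) (at x)"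
    by (rule has_field_derivative_transform_within_open[where S = "{-1<..<1}"]) (use Suc in \<open>auto simp: G_def\<close>)
  then have "(deriv ^^ Suc k) ?f x = ((- ((a - real k) * A)) * (B * (1 + x)) + ((b - real k) * B) * (A * (1 - x))) * q + q' * (A * (1 - x) * (B * (1 + x)))"
    by (simp add: DERIV_imp_deriv)
  also have "\<dots> = A * B * ((1 - x * x) * q' + (b - a - (a + b - 2 * real k) * x) * q)"
    by (simp add: algebra_simps)
  also have "\<dots> = A * B * poly (rod_poly a b (Suc k)) x"
    by (simp add: q_def q'_def algebra_simps)
  also have "A = (1 - x) powr (a - real (Suc k))" by (simp add: A_def algebra_simps)
  also have "B = (1 + x) powr (b - real (Suc k))" by (simp add: B_def algebra_simps)
  finally show ?case .
qed simp

text \<open>The equation at \<open>k\<close> says precisely that differentiating the recurrence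
  gives \<open>pderiv R = - \<nu> Q\<close>, a constant multiple of the previous polynomial.
  Inserting this and the recurrence itself into the equation at \<open>k + 1\<close> leaves an
  identity.\<close>

lemma rod_poly_ode:
  "(1 - x\<^sup>2) * poly (pderiv (pderiv (rod_poly a b k))) x
    + (b - a - (a + b - 2 * real k + 2) * x) * poly (pderiv (rod_poly a b k)) x
    + real k * (a + b - real k + 1) * poly (rod_poly a b k) x = 0"
proof (induction k arbitrary: x)
  case (Suc k)
  define Q where "Q = rod_poly a b k"
  define R where "R = rod_poly a b (Suc k)"
  define \<nu> where "\<nu> = real k * (a + b - real k + 1) + (a + b - 2 * real k)"
  have R: "R = [:1, 0, -1:] * pderiv Q + [:b - a, - (a + b - 2 * real k):] * Q"
    by (simp add: R_def Q_def)
  have "poly (pderiv R) x = poly (smult (- \<nu>) Q) x" for x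
  proof -
    have "poly (pderiv R) x = (1 - x\<^sup>2) * poly (pderiv (pderiv Q)) x
      + (b - a - (a + b - 2 * real k + 2) * x) * poly (pderiv Q) x - (a + b - 2 * real k) * poly Q x"
    proof -
      have "pderiv R = ([:1, 0, -1:] * pderiv (pderiv Q) + pderiv Q * pderiv [:1, 0, -1:])
        + ([:b - a, - (a + b - 2 * real k):] * pderiv Q + Q * pderiv [:b - a, - (a + b - 2 * real k):])"
        unfolding R pderiv_add pderiv_mult ..
      then show ?thesis by (simp only: poly_add poly_mult) (simp add: pderiv_pCons algebra_simps power2_eq_square)
    qed
    then show ?thesis using Suc[of x] by (simp add: Q_def[symmetric] \<nu>_def algebra_simps)
  qed
  then have "poly (pderiv R) = poly (smult (- \<nu>) Q)" by (rule ext)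
  then have pR: "pderiv R = smult (- \<nu>) Q" by (simp only: poly_eq_poly_eq_iff)
  have ppR: "pderiv (pderiv R) = smult (- \<nu>) (pderiv Q)" by (simp only: pR pderiv_smult)
  have Rx: "poly R x = (1 - x\<^sup>2) * poly (pderiv Q) x + (b - a - (a + b - 2 * real k) * x) * poly Q x"
    by (simp add: R algebra_simps power2_eq_square)
  have nu: "real (Suc k) * (a + b - real (Suc k) + 1) = \<nu>" by (simp add: \<nu>_def algebra_simps)
  show ?case unfolding R_def[symmetric] ppR unfolding pR unfolding nu Rx poly_smult by (simp add: algebra_simps)
qed simp

section \<open>Jacobi polynomials as polynomial solutions of the equation\<close>

definition jacobi_poly :: "real \<Rightarrow> real \<Rightarrow> nat \<Rightarrow> real poly" where
  "jacobi_poly \<alpha> \<beta> n = smult ((-1) ^ n / (2 ^ n * fact n)) (rod_poly (\<alpha> + real n) (\<beta> + real n) n)"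

text \<open>If the norm is \<open>0\<close> then \<open>1 / 0 = 0\<close> makes this the zero polynomial.\<close>

definition jacobi_on_poly :: "real \<Rightarrow> real \<Rightarrow> nat \<Rightarrow> real poly" where
  "jacobi_on_poly \<alpha> \<beta> n = smult (1 / jacobi_norm \<alpha> \<beta> n) (jacobi_poly \<alpha> \<beta> n)"

lemma jacobiP_eq:
  "jacobiP \<alpha> \<beta> n x = (if -1 < x \<and> x < 1 then poly (jacobi_poly \<alpha> \<beta> n) x else 0)"
  by (auto simp: jacobiP_def rodrigues_deriv jacobi_weight_def jacobi_poly_def)

lemma jacobi_on_eq:
  "jacobi_on \<alpha> \<beta> n x = (if -1 < x \<and> x < 1 then poly (jacobi_on_poly \<alpha> \<beta> n) x else 0)"
  by (auto simp: jacobi_on_def jacobiP_eq jacobi_on_poly_def)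

definition jacobi_ode :: "real \<Rightarrow> real \<Rightarrow> real \<Rightarrow> real poly \<Rightarrow> bool" where
  "jacobi_ode \<alpha> \<beta> \<mu> y \<longleftrightarrow> (\<forall>x. (1 - x\<^sup>2) * poly (pderiv (pderiv y)) x
     + (\<beta> - \<alpha> - (\<alpha> + \<beta> + 2) * x) * poly (pderiv y) x + \<mu> * poly y x = 0)"

lemma jacobi_ode_smult: "jacobi_ode \<alpha> \<beta> \<mu> y \<Longrightarrow> jacobi_ode \<alpha> \<beta> \<mu> (smult c y)"
proof -
  assume "jacobi_ode \<alpha> \<beta> \<mu> y"
  then have "c * ((1 - x\<^sup>2) * poly (pderiv (pderiv y)) x
     + (\<beta> - \<alpha> - (\<alpha> + \<beta> + 2) * x) * poly (pderiv y) x + \<mu> * poly y x) = 0" for x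
    by (simp add: jacobi_ode_def)
  then show ?thesis unfolding jacobi_ode_def by (simp add: pderiv_smult algebra_simps)
qed

lemma jacobi_on_poly_ode:
  "jacobi_ode \<alpha> \<beta> (real n * (real n + \<alpha> + \<beta> + 1)) (jacobi_on_poly \<alpha> \<beta> n)"
proof -
  have "jacobi_ode \<alpha> \<beta> (real n * (real n + \<alpha> + \<beta> + 1)) (rod_poly (\<alpha> + real n) (\<beta> + real n) n)"
    unfolding jacobi_ode_def using rod_poly_ode[where a = "\<alpha> + real n" and b = "\<beta> + real n" and k = n]
    by (simp add: algebra_simps)
  then show ?thesis unfolding jacobi_on_poly_def jacobi_poly_def by (intro jacobi_ode_smult)
qed

lemma jacobi_on_poly_0_pderiv: "pderiv (jacobi_on_poly \<alpha> \<beta> 0) = 0"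
  by (simp add: jacobi_on_poly_def jacobi_poly_def pderiv_smult pderiv_1)

section \<open>The trigonometric substitution and the oscillator equations\<close>

lemma trig_pos:
  assumes "0 < \<phi>" "\<phi> < pi / 2"
  shows "sin \<phi> > 0" "cos \<phi> > 0"
  using assms by (auto intro: sin_gt_zero cos_gt_zero)

text \<open>The substitution \<open>x = cos (2 * \<phi>)\<close>, \<open>a = \<alpha> + 1/2\<close>, \<open>b = \<beta> + 1/2\<close> turns the weighted polynomials into
  solutions of \<open>X'' = - Q X\<close>, and the pair \<open>U = jacobi_U a b y\<close>, \<open>Z = jacobi_U (a + 1) (b + 1) (pderiv y)\<close>
  satisfies the first-order system \<open>U' = r U - 4 Z\<close>, \<open>Z' = - r Z + \<mu> U\<close>.\<close>

definition jacobi_U :: "real \<Rightarrow> real \<Rightarrow> real poly \<Rightarrow> real \<Rightarrow> real" where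
  "jacobi_U a b y \<phi> = sin \<phi> powr a * cos \<phi> powr b * poly y (cos (2 * \<phi>))"

definition jacobi_r :: "real \<Rightarrow> real \<Rightarrow> real \<Rightarrow> real" where
  "jacobi_r a b \<phi> = a * cos \<phi> / sin \<phi> - b * sin \<phi> / cos \<phi>"

definition jacobi_Q :: "real \<Rightarrow> real \<Rightarrow> real \<Rightarrow> real \<Rightarrow> real" where
  "jacobi_Q A B \<nu> \<phi> = \<nu>\<^sup>2 - A / (sin \<phi>)\<^sup>2 - B / (cos \<phi>)\<^sup>2"

lemma jacobi_U_deriv:
  assumes \<phi>: "0 < \<phi>" "\<phi> < pi / 2"
  shows "(jacobi_U a b y has_real_derivative
     jacobi_r a b \<phi> * jacobi_U a b y \<phi> - 4 * jacobi_U (a + 1) (b + 1) (pderiv y) \<phi>) (at \<phi>)"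
proof -
  define S where "S = sin \<phi>"
  define C where "C = cos \<phi>"
  have sc: "S > 0" "C > 0" using trig_pos[OF \<phi>] by (auto simp: S_def C_def)
  have d1: "((\<lambda>x. sin x powr a) has_real_derivative a * (C / S) * S powr a) (at \<phi>)"
  proof -
    have "((\<lambda>x. sin x powr a) has_real_derivative a * sin \<phi> powr (a - 1) * cos \<phi>) (at \<phi>)"
      using sc unfolding S_def by (auto intro!: derivative_eq_intros)
    moreover have "S powr (a - 1) = S powr a / S" using sc by (simp add: powr_diff)
    ultimately show ?thesis by (simp add: S_def C_def mult_ac)
  qed
  have d2: "((\<lambda>x. cos x powr b) has_real_derivative - (b * (S / C) * C powr b)) (at \<phi>)"
  proof -
    have "((\<lambda>x. cos x powr b) has_real_derivative b * cos \<phi> powr (b - 1) * (- sin \<phi>)) (at \<phi>)"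
      using sc unfolding C_def by (auto intro!: derivative_eq_intros)
    moreover have "C powr (b - 1) = C powr b / C" using sc by (simp add: powr_diff)
    ultimately show ?thesis by (simp add: S_def C_def mult_ac)
  qed
  have d3: "((\<lambda>x. poly y (cos (2 * x))) has_real_derivative poly (pderiv y) (cos (2 * \<phi>)) * (- 4 * S * C)) (at \<phi>)"
  proof -
    have "((\<lambda>x. cos (2 * x)) has_real_derivative (- sin (2 * \<phi>) * 2)) (at \<phi>)"
      by (auto intro!: derivative_eq_intros)
    moreover have "- sin (2 * \<phi>) * 2 = - 4 * S * C" by (simp add: sin_double S_def C_def)
    ultimately have "((\<lambda>x. cos (2 * x)) has_real_derivative (- 4 * S * C)) (at \<phi>)" by (simp only:)
    from DERIV_chain2[OF poly_DERIV this] show ?thesis .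
  qed
  have p1: "S powr (1 + a) = S powr a * S" "C powr (1 + b) = C powr b * C"
    using sc by (auto simp: powr_add)
  show ?thesis unfolding jacobi_U_def[abs_def] jacobi_r_def
    by (rule DERIV_cong[OF DERIV_mult[OF DERIV_mult[OF d1 d2] d3]])
       (simp add: S_def[symmetric] C_def[symmetric] p1 algebra_simps)
qed

text \<open>With \<open>S = sin \<phi>\<close> and \<open>C = cos \<phi>\<close> the coefficients of
  the Jacobi equation become homogeneous: \<open>1 - x^2\<close> is \<open>4 S^2 C^2\<close>, and
  the coefficient of the first derivative is \<open>(2 b + 1) S^2 - (2 a + 1) C^2\<close>. The
  equation then eliminates the second derivative from the formula that \<open>jacobi_U_deriv\<close>
  gives for the shifted parameters.\<close>

lemma jacobi_Z_deriv:
  assumes \<phi>: "0 < \<phi>" "\<phi> < pi / 2" and ode: "jacobi_ode (a - 1/2) (b - 1/2) \<mu> y"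
  shows "(jacobi_U (a + 1) (b + 1) (pderiv y) has_real_derivative
     - jacobi_r a b \<phi> * jacobi_U (a + 1) (b + 1) (pderiv y) \<phi> + \<mu> * jacobi_U a b y \<phi>) (at \<phi>)"
proof -
  define S where "S = sin \<phi>"
  define C where "C = cos \<phi>"
  have sc: "S > 0" "C > 0" using trig_pos[OF \<phi>] by (auto simp: S_def C_def)
  have one: "S\<^sup>2 + C\<^sup>2 = 1" by (simp add: S_def C_def)
  define x where "x = cos (2 * \<phi>)"
  have x: "x = C\<^sup>2 - S\<^sup>2" by (simp add: x_def S_def C_def cos_double)
  have p1: "S powr (a + 1) = S powr a * S" "C powr (b + 1) = C powr b * C"
    "S powr (a + 1 + 1) = S powr a * S * S" "C powr (b + 1 + 1) = C powr b * C * C"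
    using sc powr_add[of S "a + 1" 1] powr_add[of C "b + 1" 1] powr_add[of S a 1] powr_add[of C b 1] by auto
  have "(1 - x\<^sup>2) * poly (pderiv (pderiv y)) x + (b - a - (a + b + 1) * x) * poly (pderiv y) x + \<mu> * poly y x = 0"
    using ode unfolding jacobi_ode_def by (auto simp: algebra_simps)
  moreover have "1 - x\<^sup>2 = 4 * S\<^sup>2 * C\<^sup>2"
  proof -
    have "1 - x\<^sup>2 = (S\<^sup>2 + C\<^sup>2)\<^sup>2 - x\<^sup>2" by (simp only: one) simp
    then show ?thesis by (simp add: x power2_eq_square algebra_simps)
  qed
  moreover have "b - a - (a + b + 1) * x = (2 * b + 1) * S\<^sup>2 - (2 * a + 1) * C\<^sup>2"
  proof -
    have "b - a - (a + b + 1) * x = (b - a) * (S\<^sup>2 + C\<^sup>2) - (a + b + 1) * x" by (simp only: one) simp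
    then show ?thesis by (simp add: x algebra_simps)
  qed
  ultimately have "4 * S\<^sup>2 * C\<^sup>2 * poly (pderiv (pderiv y)) x +
     ((2 * b + 1) * S\<^sup>2 - (2 * a + 1) * C\<^sup>2) * poly (pderiv y) x + \<mu> * poly y x = 0"
    by (simp only:)
  then have o: "4 * S\<^sup>2 * C\<^sup>2 * poly (pderiv (pderiv y)) x =
     ((2 * a + 1) * C\<^sup>2 - (2 * b + 1) * S\<^sup>2) * poly (pderiv y) x - \<mu> * poly y x"
    by (simp add: algebra_simps)
  define P where "P = S powr a * C powr b"
  define y0 where "y0 = poly y x"
  define y1 where "y1 = poly (pderiv y) x"
  define y2 where "y2 = poly (pderiv (pderiv y)) x"
  have l: "jacobi_r (a + 1) (b + 1) \<phi> * jacobi_U (a + 1) (b + 1) (pderiv y) \<phi>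
      - 4 * jacobi_U (a + 1 + 1) (b + 1 + 1) (pderiv (pderiv y)) \<phi>
      = P * (((a + 1) * C\<^sup>2 - (b + 1) * S\<^sup>2) * y1 - 4 * S\<^sup>2 * C\<^sup>2 * y2)"
    unfolding jacobi_r_def jacobi_U_def S_def[symmetric] C_def[symmetric] x_def[symmetric] p1 P_def y1_def y2_def
    using sc by (simp add: field_simps power2_eq_square)
  have r: "- jacobi_r a b \<phi> * jacobi_U (a + 1) (b + 1) (pderiv y) \<phi> + \<mu> * jacobi_U a b y \<phi>
      = P * (- (a * C\<^sup>2 - b * S\<^sup>2) * y1 + \<mu> * y0)"
    unfolding jacobi_r_def jacobi_U_def S_def[symmetric] C_def[symmetric] x_def[symmetric] p1 P_def y1_def y0_def
    using sc by (simp add: field_simps power2_eq_square)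
  have "((a + 1) * C\<^sup>2 - (b + 1) * S\<^sup>2) * y1 - 4 * S\<^sup>2 * C\<^sup>2 * y2 = - (a * C\<^sup>2 - b * S\<^sup>2) * y1 + \<mu> * y0"
    using o unfolding y0_def[symmetric] y1_def[symmetric] y2_def[symmetric] by (simp add: algebra_simps)
  then show ?thesis using jacobi_U_deriv[OF \<phi>, of "a + 1" "b + 1" "pderiv y"] unfolding l r by simp
qed

lemma jacobi_r_deriv:
  assumes \<phi>: "0 < \<phi>" "\<phi> < pi / 2"
  shows "(jacobi_r a b has_real_derivative - a / (sin \<phi>)\<^sup>2 - b / (cos \<phi>)\<^sup>2) (at \<phi>)"
proof -
  have sc: "sin \<phi> > 0" "cos \<phi> > 0" using trig_pos[OF \<phi>] .
  have one: "sin \<phi> * sin \<phi> + cos \<phi> * cos \<phi> = 1" using sin_cos_squared_add[of \<phi>] by (simp add: power2_eq_square)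
  have "(jacobi_r a b has_real_derivative
     ((- (a * sin \<phi>)) * sin \<phi> - a * cos \<phi> * cos \<phi>) / (sin \<phi>)\<^sup>2 - ((b * cos \<phi>) * cos \<phi> - b * sin \<phi> * (- sin \<phi>)) / (cos \<phi>)\<^sup>2) (at \<phi>)"
    unfolding jacobi_r_def[abs_def] using sc
    by (auto intro!: derivative_eq_intros simp: power2_eq_square mult_ac)
  moreover have "(- (a * sin \<phi>)) * sin \<phi> - a * cos \<phi> * cos \<phi> = - a * (sin \<phi> * sin \<phi> + cos \<phi> * cos \<phi>)"
    "(b * cos \<phi>) * cos \<phi> - b * sin \<phi> * (- sin \<phi>) = b * (sin \<phi> * sin \<phi> + cos \<phi> * cos \<phi>)" by algebra+
  ultimately show ?thesis by (simp only: one mult_1_right)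
qed

lemma jacobi_r_square:
  assumes \<phi>: "0 < \<phi>" "\<phi> < pi / 2"
  shows "(jacobi_r a b \<phi>)\<^sup>2 = a\<^sup>2 / (sin \<phi>)\<^sup>2 + b\<^sup>2 / (cos \<phi>)\<^sup>2 - (a + b)\<^sup>2"
proof -
  define S where "S = sin \<phi>"
  define C where "C = cos \<phi>"
  have sc: "S \<noteq> 0" "C \<noteq> 0" using trig_pos[OF \<phi>] by (auto simp: S_def C_def)
  have one: "C\<^sup>2 = 1 - S\<^sup>2" by (simp add: S_def C_def cos_squared_eq)
  have "(jacobi_r a b \<phi>)\<^sup>2 = a\<^sup>2 * (C\<^sup>2 / S\<^sup>2) + b\<^sup>2 * (S\<^sup>2 / C\<^sup>2) - 2 * a * b"
    using sc unfolding jacobi_r_def S_def[symmetric] C_def[symmetric]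
    by (simp add: power2_diff power_divide power_mult_distrib)
  also have "C\<^sup>2 / S\<^sup>2 = 1 / S\<^sup>2 - 1" using sc by (simp add: one diff_divide_distrib)
  also have "S\<^sup>2 / C\<^sup>2 = 1 / C\<^sup>2 - 1"
  proof -
    have "S\<^sup>2 = 1 - C\<^sup>2" using one by simp
    then show ?thesis using sc by (simp add: diff_divide_distrib)
  qed
  finally show ?thesis unfolding S_def[symmetric] C_def[symmetric] by (simp add: algebra_simps power2_eq_square)
qed

text \<open>The derivative \<open>X1\<close> is a separate argument because it is available in
  closed form and the energy functionals refer to it directly.\<close>

definition osc_eq :: "real \<Rightarrow> real \<Rightarrow> real \<Rightarrow> (real \<Rightarrow> real) \<Rightarrow> (real \<Rightarrow> real) \<Rightarrow> bool" where
  "osc_eq A B \<nu> X X1 \<longleftrightarrow> (\<forall>\<phi>. 0 < \<phi> \<longrightarrow> \<phi> < pi / 2 \<longrightarrow>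
     (X has_real_derivative X1 \<phi>) (at \<phi>) \<and>
     (X1 has_real_derivative - jacobi_Q A B \<nu> \<phi> * X \<phi>) (at \<phi>))"

text \<open>Eliminating \<open>Z\<close> from the first-order system gives
  \<open>U'' = (r' + r^2 - 4 \<mu>) U\<close>. The constant \<open>(a + b)^2\<close> contained in
  \<open>r^2\<close> joins \<open>4 \<mu>\<close> to form \<open>\<nu>^2\<close>.\<close>

lemma jacobi_U_osc_eq:
  assumes ode: "jacobi_ode (a - 1/2) (b - 1/2) \<mu> y" and \<nu>: "\<nu>\<^sup>2 = 4 * \<mu> + (a + b)\<^sup>2"
  shows "osc_eq (a * (a - 1)) (b * (b - 1)) \<nu> (jacobi_U a b y)
     (\<lambda>\<phi>. jacobi_r a b \<phi> * jacobi_U a b y \<phi> - 4 * jacobi_U (a + 1) (b + 1) (pderiv y) \<phi>)"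
  unfolding osc_eq_def
proof (intro allI impI conjI)
  fix \<phi> :: real assume \<phi>: "0 < \<phi>" "\<phi> < pi / 2"
  show "(jacobi_U a b y has_real_derivative
     jacobi_r a b \<phi> * jacobi_U a b y \<phi> - 4 * jacobi_U (a + 1) (b + 1) (pderiv y) \<phi>) (at \<phi>)"
    by (rule jacobi_U_deriv[OF \<phi>])
  define S2 where "S2 = (sin \<phi>)\<^sup>2"
  define C2 where "C2 = (cos \<phi>)\<^sup>2"
  define r where "r = jacobi_r a b \<phi>"
  define u where "u = jacobi_U a b y \<phi>"
  define z where "z = jacobi_U (a + 1) (b + 1) (pderiv y) \<phi>"
  note d = jacobi_U_deriv[OF \<phi>, of a b y] jacobi_r_deriv[OF \<phi>, of a b] jacobi_Z_deriv[OF \<phi> ode]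
  have "((\<lambda>\<phi>. jacobi_r a b \<phi> * jacobi_U a b y \<phi> - 4 * jacobi_U (a + 1) (b + 1) (pderiv y) \<phi>) has_real_derivative
     (- a / S2 - b / C2) * u + (r * u - 4 * z) * r - 4 * (- r * z + \<mu> * u)) (at \<phi>)"
    unfolding S2_def C2_def r_def u_def z_def
    by (rule DERIV_diff[OF DERIV_mult[OF d(2) d(1)] DERIV_cmult[OF d(3)]])
  moreover have "(- a / S2 - b / C2) * u + (r * u - 4 * z) * r - 4 * (- r * z + \<mu> * u) = - jacobi_Q (a * (a - 1)) (b * (b - 1)) \<nu> \<phi> * u"
  proof -
    have "(- a / S2 - b / C2) * u + (r * u - 4 * z) * r - 4 * (- r * z + \<mu> * u) = (- a / S2 - b / C2 + r\<^sup>2 - 4 * \<mu>) * u"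
      by (simp add: algebra_simps power2_eq_square)
    also have "r\<^sup>2 = a\<^sup>2 / S2 + b\<^sup>2 / C2 - (a + b)\<^sup>2" unfolding r_def S2_def C2_def by (rule jacobi_r_square[OF \<phi>])
    also have "- a / S2 - b / C2 + (a\<^sup>2 / S2 + b\<^sup>2 / C2 - (a + b)\<^sup>2) - 4 * \<mu> = - jacobi_Q (a * (a - 1)) (b * (b - 1)) \<nu> \<phi>"
      unfolding jacobi_Q_def S2_def[symmetric] C2_def[symmetric] \<nu>
      by (simp add: right_diff_distrib diff_divide_distrib power2_eq_square)
    finally show ?thesis .
  qed
  ultimately show "((\<lambda>\<phi>. jacobi_r a b \<phi> * jacobi_U a b y \<phi> - 4 * jacobi_U (a + 1) (b + 1) (pderiv y) \<phi>) has_real_derivative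
     - jacobi_Q (a * (a - 1)) (b * (b - 1)) \<nu> \<phi> * jacobi_U a b y \<phi>) (at \<phi>)"
    by (simp add: u_def)
qed

text \<open>Eliminating \<open>U\<close> instead gives
  \<open>Z'' = (- r' + r^2 - 4 \<mu>) Z\<close>. The sign change of \<open>r'\<close> replaces
  \<open>a (a - 1)\<close> by \<open>a (a + 1)\<close>.\<close>

lemma jacobi_Z_osc_eq:
  assumes ode: "jacobi_ode (a - 1/2) (b - 1/2) \<mu> y" and \<nu>: "\<nu>\<^sup>2 = 4 * \<mu> + (a + b)\<^sup>2"
  shows "osc_eq (a * (a + 1)) (b * (b + 1)) \<nu> (jacobi_U (a + 1) (b + 1) (pderiv y))
     (\<lambda>\<phi>. - jacobi_r a b \<phi> * jacobi_U (a + 1) (b + 1) (pderiv y) \<phi> + \<mu> * jacobi_U a b y \<phi>)"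
  unfolding osc_eq_def
proof (intro allI impI conjI)
  fix \<phi> :: real assume \<phi>: "0 < \<phi>" "\<phi> < pi / 2"
  show "(jacobi_U (a + 1) (b + 1) (pderiv y) has_real_derivative
     - jacobi_r a b \<phi> * jacobi_U (a + 1) (b + 1) (pderiv y) \<phi> + \<mu> * jacobi_U a b y \<phi>) (at \<phi>)"
    by (rule jacobi_Z_deriv[OF \<phi> ode])
  define S2 where "S2 = (sin \<phi>)\<^sup>2"
  define C2 where "C2 = (cos \<phi>)\<^sup>2"
  define r where "r = jacobi_r a b \<phi>"
  define u where "u = jacobi_U a b y \<phi>"
  define z where "z = jacobi_U (a + 1) (b + 1) (pderiv y) \<phi>"
  note d = jacobi_U_deriv[OF \<phi>, of a b y] jacobi_r_deriv[OF \<phi>, of a b] jacobi_Z_deriv[OF \<phi> ode]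
  have "((\<lambda>\<phi>. - jacobi_r a b \<phi> * jacobi_U (a + 1) (b + 1) (pderiv y) \<phi> + \<mu> * jacobi_U a b y \<phi>) has_real_derivative
     (- (- a / S2 - b / C2)) * z + (- r * z + \<mu> * u) * (- r) + \<mu> * (r * u - 4 * z)) (at \<phi>)"
    unfolding S2_def C2_def r_def u_def z_def
    by (rule DERIV_add[OF DERIV_mult[OF DERIV_minus[OF d(2)] d(3)] DERIV_cmult[OF d(1)]])
  moreover have "(- (- a / S2 - b / C2)) * z + (- r * z + \<mu> * u) * (- r) + \<mu> * (r * u - 4 * z) = - jacobi_Q (a * (a + 1)) (b * (b + 1)) \<nu> \<phi> * z"
  proof -
    have "(- (- a / S2 - b / C2)) * z + (- r * z + \<mu> * u) * (- r) + \<mu> * (r * u - 4 * z) = (a / S2 + b / C2 + r\<^sup>2 - 4 * \<mu>) * z"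
      by (simp add: algebra_simps power2_eq_square)
    also have "r\<^sup>2 = a\<^sup>2 / S2 + b\<^sup>2 / C2 - (a + b)\<^sup>2" unfolding r_def S2_def C2_def by (rule jacobi_r_square[OF \<phi>])
    also have "a / S2 + b / C2 + (a\<^sup>2 / S2 + b\<^sup>2 / C2 - (a + b)\<^sup>2) - 4 * \<mu> = - jacobi_Q (a * (a + 1)) (b * (b + 1)) \<nu> \<phi>"
      unfolding jacobi_Q_def S2_def[symmetric] C2_def[symmetric] \<nu>
      by (simp add: distrib_left add_divide_distrib power2_eq_square)
    finally show ?thesis .
  qed
  ultimately show "((\<lambda>\<phi>. - jacobi_r a b \<phi> * jacobi_U (a + 1) (b + 1) (pderiv y) \<phi> + \<mu> * jacobi_U a b y \<phi>) has_real_derivative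
     - jacobi_Q (a * (a + 1)) (b * (b + 1)) \<nu> \<phi> * jacobi_U (a + 1) (b + 1) (pderiv y) \<phi>) (at \<phi>)"
    by (simp add: z_def)
qed

text \<open>Exchanging sine and cosine exchanges \<open>A\<close> and \<open>B\<close>, so that
  estimates near 0 also serve near \<open>pi / 2\<close>.\<close>

lemma osc_eq_reflect:
  assumes "osc_eq A B \<nu> X X1"
  shows "osc_eq B A \<nu> (\<lambda>\<phi>. X (pi / 2 - \<phi>)) (\<lambda>\<phi>. - X1 (pi / 2 - \<phi>))"
  unfolding osc_eq_def
proof (intro allI impI conjI)
  fix \<phi> :: real assume \<phi>: "0 < \<phi>" "\<phi> < pi / 2"
  then have \<phi>': "0 < pi / 2 - \<phi>" "pi / 2 - \<phi> < pi / 2" by auto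
  have d: "((\<lambda>\<phi>. pi / 2 - \<phi>) has_real_derivative - 1) (at \<phi>)" by (auto intro!: derivative_eq_intros)
  have a: "(X has_real_derivative X1 (pi / 2 - \<phi>)) (at (pi / 2 - \<phi>))"
    "(X1 has_real_derivative - jacobi_Q A B \<nu> (pi / 2 - \<phi>) * X (pi / 2 - \<phi>)) (at (pi / 2 - \<phi>))"
    using assms \<phi>' unfolding osc_eq_def by auto
  show "((\<lambda>\<phi>. X (pi / 2 - \<phi>)) has_real_derivative - X1 (pi / 2 - \<phi>)) (at \<phi>)"
    using DERIV_chain2[OF a(1) d] by simp
  have q: "jacobi_Q A B \<nu> (pi / 2 - \<phi>) = jacobi_Q B A \<nu> \<phi>"
    by (simp add: jacobi_Q_def sin_diff cos_diff)
  show "((\<lambda>\<phi>. - X1 (pi / 2 - \<phi>)) has_real_derivative - jacobi_Q B A \<nu> \<phi> * X (pi / 2 - \<phi>)) (at \<phi>)"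
    using DERIV_minus[OF DERIV_chain2[OF a(2) d]] by (simp add: q)
qed

section \<open>Uniform bounds for Jacobi polynomials\<close>

lemma jacobi_Q_deriv:
  assumes \<phi>: "0 < \<phi>" "\<phi> < pi / 2"
  shows "(jacobi_Q A B \<nu> has_real_derivative
     2 * (A * cos \<phi> ^ 4 - B * sin \<phi> ^ 4) / (sin \<phi> ^ 3 * cos \<phi> ^ 3)) (at \<phi>)"
proof -
  have sc: "sin \<phi> > 0" "cos \<phi> > 0" using trig_pos[OF \<phi>] .
  have "(jacobi_Q A B \<nu> has_real_derivative
     (2 * sin \<phi> * cos \<phi> * A) / ((sin \<phi>)\<^sup>2 * (sin \<phi>)\<^sup>2) - (2 * cos \<phi> * sin \<phi> * B) / ((cos \<phi>)\<^sup>2 * (cos \<phi>)\<^sup>2)) (at \<phi>)"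
    unfolding jacobi_Q_def[abs_def] using sc
    by (auto intro!: derivative_eq_intros simp: power2_eq_square mult_ac)
  moreover have "(2 * sin \<phi> * cos \<phi> * A) / ((sin \<phi>)\<^sup>2 * (sin \<phi>)\<^sup>2) - (2 * cos \<phi> * sin \<phi> * B) / ((cos \<phi>)\<^sup>2 * (cos \<phi>)\<^sup>2)
    = 2 * (A * cos \<phi> ^ 4 - B * sin \<phi> ^ 4) / (sin \<phi> ^ 3 * cos \<phi> ^ 3)"
  proof -
    define s where "s = sin \<phi>"
    define c where "c = cos \<phi>"
    have "s \<noteq> 0" "c \<noteq> 0" using sc by (auto simp: s_def c_def)
    then show ?thesis unfolding s_def[symmetric] c_def[symmetric]
      by (simp add: divide_simps) algebra
  qed
  ultimately show ?thesis by simp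
qed

text \<open>The expression is the numerator of the derivative of \<open>jacobi_Q\<close>. Its sign
  near 0 is that of \<open>A\<close>, and that of \<open>- B\<close> if \<open>A = 0\<close>, so
  \<open>jacobi_Q\<close> is monotone on a one-sided neighbourhood of 0. In the second case
  \<open>A \<ge> 0\<close> is recorded because the growing singular term then needs its own
  treatment.\<close>

lemma trig_sign_near_zero:
  obtains \<delta> where "0 < \<delta>" "\<delta> \<le> pi / 8"
    "(\<forall>\<phi>. 0 < \<phi> \<longrightarrow> \<phi> \<le> \<delta> \<longrightarrow> A * cos \<phi> ^ 4 - B * sin \<phi> ^ 4 \<le> (0::real)) \<or>
     (A \<ge> 0 \<and> (\<forall>\<phi>. 0 < \<phi> \<longrightarrow> \<phi> \<le> \<delta> \<longrightarrow> A * cos \<phi> ^ 4 - B * sin \<phi> ^ 4 \<ge> 0))"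
proof (cases "A = 0")
  case True
  have "- (B * sin \<phi> ^ 4) \<le> 0" if "B \<ge> 0" for \<phi> :: real
    using that by simp
  moreover have "- (B * sin \<phi> ^ 4) \<ge> 0" if "\<not> B \<ge> 0" for \<phi> :: real
    using that by (simp add: mult_nonpos_nonneg)
  ultimately show ?thesis using True by (intro that[of "pi / 8"]) (cases "B \<ge> 0"; auto)+
next
  case False
  have t: "((\<lambda>\<phi>. A * cos \<phi> ^ 4 - B * sin \<phi> ^ 4) \<longlongrightarrow> A * cos 0 ^ 4 - B * sin 0 ^ 4) (at (0::real))"
    by (intro tendsto_intros)
  show ?thesis
  proof (cases "A > 0")
    case True
    have "\<forall>\<^sub>F \<phi> in at (0::real). A * cos \<phi> ^ 4 - B * sin \<phi> ^ 4 > 0"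
      by (rule order_tendstoD(1)[OF t]) (use True in simp)
    then obtain d where d: "d > 0" "\<And>\<phi>. \<phi> \<noteq> 0 \<Longrightarrow> dist \<phi> 0 < d \<Longrightarrow> A * cos \<phi> ^ 4 - B * sin \<phi> ^ 4 > 0"
      unfolding eventually_at by blast
    have "A * cos \<phi> ^ 4 - B * sin \<phi> ^ 4 \<ge> 0" if "0 < \<phi>" "\<phi> \<le> min (d / 2) (pi / 8)" for \<phi>
      using d(2)[of \<phi>] that d(1) by (force simp: dist_real_def)
    then show ?thesis using True d(1) by (intro that[of "min (d / 2) (pi / 8)"]) auto
  next
    case neg: False
    have "\<forall>\<^sub>F \<phi> in at (0::real). A * cos \<phi> ^ 4 - B * sin \<phi> ^ 4 < 0"
      by (rule order_tendstoD(2)[OF t]) (use neg False in simp)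
    then obtain d where d: "d > 0" "\<And>\<phi>. \<phi> \<noteq> 0 \<Longrightarrow> dist \<phi> 0 < d \<Longrightarrow> A * cos \<phi> ^ 4 - B * sin \<phi> ^ 4 < 0"
      unfolding eventually_at by blast
    have "A * cos \<phi> ^ 4 - B * sin \<phi> ^ 4 \<le> 0" if "0 < \<phi>" "\<phi> \<le> min (d / 2) (pi / 8)" for \<phi>
      using d(2)[of \<phi>] that d(1) by (force simp: dist_real_def)
    then show ?thesis using d(1) by (intro that[of "min (d / 2) (pi / 8)"]) auto
  qed
qed

lemma sin_ge_half:
  assumes "0 \<le> \<phi>" "\<phi> \<le> pi / 8"
  shows "\<phi> / 2 \<le> sin \<phi>"
proof -
  have "sin 0 - 0 / 2 \<le> sin \<phi> - \<phi> / 2"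
  proof (rule DERIV_nonneg_imp_nondecreasing[OF assms(1)])
    fix x assume x: "0 \<le> x" "x \<le> \<phi>"
    have "cos (pi / 3) \<le> cos x" using x assms pi_gt_zero by (intro cos_monotone_0_pi_le) auto
    then have "cos x - 1 / 2 \<ge> 0" by (simp add: cos_60)
    moreover have "((\<lambda>x. sin x - x / 2) has_real_derivative cos x - 1 / 2) (at x)"
      by (auto intro!: derivative_eq_intros)
    ultimately show "\<exists>y. ((\<lambda>x. sin x - x / 2) has_real_derivative y) (at x) \<and> 0 \<le> y" by blast
  qed
  then show ?thesis by simp
qed

lemma cos_square_ge_half:
  assumes "0 \<le> \<phi>" "\<phi> \<le> pi / 8"
  shows "(cos \<phi>)\<^sup>2 \<ge> 1 / 2"
proof -
  have "cos (2 * \<phi>) \<ge> 0" using assms by (intro cos_ge_zero) auto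
  then show ?thesis by (simp add: cos_double_cos)
qed

text \<open>Sonin's argument: \<open>X\<^sup>2 + X'\<^sup>2 / Q\<close> is increasing where \<open>Q\<close> is decreasing.\<close>

lemma osc_endpoint_decreasing:
  assumes eq: "osc_eq A B \<nu> X X1" and \<delta>: "0 < \<delta>" "\<delta> \<le> pi / 8"
    and sgn: "\<And>\<phi>. 0 < \<phi> \<Longrightarrow> \<phi> \<le> \<delta> \<Longrightarrow> A * cos \<phi> ^ 4 - B * sin \<phi> ^ 4 \<le> 0"
    and Qd: "jacobi_Q A B \<nu> \<delta> \<ge> \<nu>\<^sup>2 / 2" and \<nu>: "\<nu> > 0"
    and M: "\<bar>X \<delta>\<bar> \<le> M" "\<bar>X1 \<delta>\<bar> \<le> M * \<nu>" and \<phi>: "0 < \<phi>" "\<phi> \<le> \<delta>"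
  shows "\<bar>X \<phi>\<bar> \<le> 2 * M"
proof -
  define Q where "Q = jacobi_Q A B \<nu>"
  define Q' where "Q' x = 2 * (A * cos x ^ 4 - B * sin x ^ 4) / (sin x ^ 3 * cos x ^ 3)" for x
  have dQ: "(Q has_real_derivative Q' x) (at x)" if "0 < x" "x \<le> \<delta>" for x
    unfolding Q_def Q'_def using that \<delta> pi_gt_zero by (intro jacobi_Q_deriv) auto
  have Q'0: "Q' x \<le> 0" if "0 < x" "x \<le> \<delta>" for x
  proof -
    have "sin x > 0" "cos x > 0" using that \<delta> pi_gt_zero by (auto intro!: trig_pos)
    then show ?thesis unfolding Q'_def using sgn[OF that] by (intro divide_nonpos_nonneg) auto
  qed
  have Qpos: "Q x \<ge> \<nu>\<^sup>2 / 2" if x: "0 < x" "x \<le> \<delta>" for x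
  proof -
    have "Q \<delta> \<le> Q x"
      by (rule DERIV_nonpos_imp_nonincreasing[OF x(2)]) (use dQ Q'0 x in fastforce)
    then show ?thesis using Qd unfolding Q_def by linarith
  qed
  have n2: "\<nu>\<^sup>2 / 2 > 0" using \<nu> by simp
  define W where "W x = (X x)\<^sup>2 + (X1 x)\<^sup>2 / Q x" for x
  have "W \<phi> \<le> W \<delta>"
  proof (rule DERIV_nonneg_imp_nondecreasing[OF \<phi>(2)])
    fix x assume "\<phi> \<le> x" "x \<le> \<delta>"
    then have x: "0 < x" "x \<le> \<delta>" using \<phi> by auto
    have Qx: "Q x > 0" using Qpos[OF x] n2 by linarith
    have d: "(X has_real_derivative X1 x) (at x)" "(X1 has_real_derivative - Q x * X x) (at x)"
      using eq x \<delta> pi_gt_zero unfolding osc_eq_def Q_def by auto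
    have "(W has_real_derivative (2 * X x * X1 x) + (2 * X1 x * (- Q x * X x) * Q x - (X1 x)\<^sup>2 * Q' x) / (Q x * Q x)) (at x)"
      unfolding W_def[abs_def] using Qx d dQ[OF x]
      by (auto intro!: derivative_eq_intros simp: power2_eq_square mult_ac)
    moreover have "(2 * X x * X1 x) + (2 * X1 x * (- Q x * X x) * Q x - (X1 x)\<^sup>2 * Q' x) / (Q x * Q x) = (X1 x)\<^sup>2 * (- Q' x) / (Q x * Q x)"
      using Qx by (simp add: field_simps)
    moreover have "\<dots> \<ge> 0" using Q'0[OF x] Qx by (intro divide_nonneg_nonneg mult_nonneg_nonneg) auto
    ultimately show "\<exists>y. (W has_real_derivative y) (at x) \<and> 0 \<le> y" by metis
  qed
  moreover have "(X \<phi>)\<^sup>2 \<le> W \<phi>" 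
  proof -
    have "Q \<phi> > 0" using Qpos[OF \<phi>] n2 by linarith
    then show ?thesis unfolding W_def by simp
  qed
  moreover have "W \<delta> \<le> M\<^sup>2 + (M * \<nu>)\<^sup>2 / (\<nu>\<^sup>2 / 2)"
    unfolding W_def
  proof (rule add_mono)
    show "(X \<delta>)\<^sup>2 \<le> M\<^sup>2" using M(1) by (simp add: abs_le_square_iff[symmetric])
    have "(X1 \<delta>)\<^sup>2 \<le> (M * \<nu>)\<^sup>2" using M(2) by (simp add: abs_le_square_iff[symmetric])
    then show "(X1 \<delta>)\<^sup>2 / Q \<delta> \<le> (M * \<nu>)\<^sup>2 / (\<nu>\<^sup>2 / 2)"
      using Qpos[of \<delta>] \<delta> n2 by (intro frac_le) auto
  qed
  moreover have "M\<^sup>2 + (M * \<nu>)\<^sup>2 / (\<nu>\<^sup>2 / 2) = 3 * M\<^sup>2" using \<nu> by (simp add: power_mult_distrib)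
  moreover have "3 * M\<^sup>2 \<le> (2 * M)\<^sup>2" by (simp add: power_mult_distrib)
  ultimately have "(X \<phi>)\<^sup>2 \<le> (2 * M)\<^sup>2" by linarith
  then have "\<bar>X \<phi>\<bar> \<le> \<bar>2 * M\<bar>" by (simp only: abs_le_square_iff)
  moreover have "M \<ge> 0" using M(1) by linarith
  ultimately show ?thesis by simp
qed

text \<open>Where \<open>q \<le> 0\<close> the function \<open>X^2\<close> is convex. If it were
  larger at \<open>\<phi>\<close> than at \<open>\<psi>\<close>, its slope would be negative
  somewhere in between and hence everywhere further left, so \<open>X^2\<close> could not tend to 0
  at 0.\<close>

lemma osc_nonoscillatory:
  assumes d: "\<And>x. 0 < x \<Longrightarrow> x \<le> \<psi> \<Longrightarrow> (X has_real_derivative X1 x) (at x)"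
      "\<And>x. 0 < x \<Longrightarrow> x \<le> \<psi> \<Longrightarrow> (X1 has_real_derivative - q x * X x) (at x)"
    and q: "\<And>x. 0 < x \<Longrightarrow> x \<le> \<psi> \<Longrightarrow> q x \<le> (0::real)"
    and lim: "(X \<longlongrightarrow> 0) (at_right 0)" and \<phi>: "0 < \<phi>" "\<phi> \<le> \<psi>"
  shows "\<bar>X \<phi>\<bar> \<le> \<bar>X \<psi>\<bar>"
proof (rule ccontr)
  assume "\<not> ?thesis"
  then have less: "(X \<psi>)\<^sup>2 < (X \<phi>)\<^sup>2" using abs_le_square_iff[of "X \<phi>" "X \<psi>"] by linarith
  then have "\<phi> < \<psi>" using \<phi> by (cases "\<phi> = \<psi>") auto
  define Y where "Y x = (X x)\<^sup>2" for x
  define Y1 where "Y1 x = 2 * X x * X1 x" for x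
  have dY: "(Y has_real_derivative Y1 x) (at x)" if "0 < x" "x \<le> \<psi>" for x
    unfolding Y_def[abs_def] Y1_def using d(1)[OF that] by (auto intro!: derivative_eq_intros)
  have dY1: "(Y1 has_real_derivative 2 * (X1 x)\<^sup>2 - 2 * q x * (X x)\<^sup>2) (at x)" if "0 < x" "x \<le> \<psi>" for x
    unfolding Y1_def[abs_def] using d(1)[OF that] d(2)[OF that]
    by (auto intro!: derivative_eq_intros simp: power2_eq_square algebra_simps)
  have mono: "Y1 x \<le> Y1 z" if "0 < x" "x \<le> z" "z \<le> \<psi>" for x z
  proof (rule DERIV_nonneg_imp_nondecreasing[OF that(2)])
    fix t assume "x \<le> t" "t \<le> z"
    then have t: "0 < t" "t \<le> \<psi>" using that by auto
    have "2 * (X1 t)\<^sup>2 - 2 * q t * (X t)\<^sup>2 \<ge> 0" using mult_nonpos_nonneg[OF q[OF t] zero_le_power2[of "X t"]] zero_le_power2[of "X1 t"] by (simp only: mult.assoc)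
    then show "\<exists>y. (Y1 has_real_derivative y) (at t) \<and> 0 \<le> y" using dY1[OF t] by blast
  qed
  obtain z where z: "\<phi> < z" "z < \<psi>" "Y \<psi> - Y \<phi> = (\<psi> - \<phi>) * Y1 z"
    using MVT2[OF \<open>\<phi> < \<psi>\<close>, of Y Y1] dY \<phi> by force
  have "Y1 z < 0" using z less \<open>\<phi> < \<psi>\<close> by (simp add: Y_def) (smt (verit) mult_nonneg_nonneg)
  have dec: "Y \<phi> \<le> Y x" if x: "0 < x" "x \<le> \<phi>" for x
  proof (rule DERIV_nonpos_imp_nonincreasing[OF x(2)])
    fix t assume "x \<le> t" "t \<le> \<phi>"
    then have t: "0 < t" "t \<le> z" "t \<le> \<psi>" using x z by auto
    have "Y1 t \<le> 0" using mono[of t z] t z \<open>Y1 z < 0\<close> by auto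
    then show "\<exists>y. (Y has_real_derivative y) (at t) \<and> y \<le> 0" using dY[OF t(1,3)] by blast
  qed
  have "(Y \<longlongrightarrow> 0\<^sup>2) (at_right 0)" unfolding Y_def[abs_def] by (intro tendsto_intros lim)
  moreover have "\<forall>\<^sub>F x in at_right 0. Y \<phi> \<le> Y x"
    unfolding eventually_at_right_field using \<phi> dec by (intro exI[of _ \<phi>]) auto
  ultimately have "Y \<phi> \<le> 0\<^sup>2" by (rule tendsto_lowerbound) simp
  then show False using less by (simp add: Y_def)
qed

text \<open>Here \<open>X'\<^sup>2 + Q X\<^sup>2\<close> is increasing. This bounds \<open>X\<close> as long as \<open>Q \<ge> \<nu>\<^sup>2 / 2\<close> and \<open>X'\<close> as long as
  \<open>Q \<ge> 0\<close>; the region in between has length \<open>O(1 / \<nu>)\<close>, and beyond the turning point \<open>X\<^sup>2\<close> is convex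
  and vanishes at \<open>0\<close>.\<close>

lemma osc_endpoint_increasing:
  assumes eq: "osc_eq A B \<nu> X X1" and \<delta>: "0 < \<delta>" "\<delta> \<le> pi / 8" and A: "A \<ge> 0"
    and sgn: "\<And>\<phi>. 0 < \<phi> \<Longrightarrow> \<phi> \<le> \<delta> \<Longrightarrow> A * cos \<phi> ^ 4 - B * sin \<phi> ^ 4 \<ge> 0"
    and Qd: "jacobi_Q A B \<nu> \<delta> \<ge> \<nu>\<^sup>2 / 2" "jacobi_Q A B \<nu> \<delta> \<le> 2 * \<nu>\<^sup>2" and \<nu>: "\<nu> > 0" "8 * \<bar>B\<bar> \<le> \<nu>\<^sup>2"
    and lim: "A > 0 \<Longrightarrow> (X \<longlongrightarrow> 0) (at_right 0)"
    and M: "\<bar>X \<delta>\<bar> \<le> M" "\<bar>X1 \<delta>\<bar> \<le> M * \<nu>" and \<phi>: "0 < \<phi>" "\<phi> \<le> \<delta>"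
  shows "\<bar>X \<phi>\<bar> \<le> (3 + 8 * sqrt A) * M"
proof -
  define Q where "Q = jacobi_Q A B \<nu>"
  define Q' where "Q' x = 2 * (A * cos x ^ 4 - B * sin x ^ 4) / (sin x ^ 3 * cos x ^ 3)" for x
  have M0: "M \<ge> 0" using M(1) by linarith
  have rng: "0 < x \<and> x < pi / 2" if "0 < x" "x \<le> \<delta>" for x using that \<delta> pi_gt_zero by auto
  have dQ: "(Q has_real_derivative Q' x) (at x)" if "0 < x" "x \<le> \<delta>" for x
    unfolding Q_def Q'_def using rng[OF that] by (intro jacobi_Q_deriv) auto
  have Q'0: "Q' x \<ge> 0" if "0 < x" "x \<le> \<delta>" for x
  proof -
    have "sin x > 0" "cos x > 0" using rng[OF that] by (auto intro!: trig_pos)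
    then show ?thesis unfolding Q'_def using sgn[OF that] by (intro divide_nonneg_nonneg) auto
  qed
  have Qmono: "Q x \<le> Q z" if x: "0 < x" "x \<le> z" "z \<le> \<delta>" for x z
    by (rule DERIV_nonneg_imp_nondecreasing[OF x(2)]) (use dQ Q'0 x in fastforce)
  have d: "(X has_real_derivative X1 x) (at x)" "(X1 has_real_derivative - Q x * X x) (at x)"
    if "0 < x" "x \<le> \<delta>" for x
    using eq rng[OF that] unfolding osc_eq_def Q_def by auto
  define V where "V x = (X1 x)\<^sup>2 + Q x * (X x)\<^sup>2" for x
  have V: "V x \<le> 3 * (M * \<nu>)\<^sup>2" if x: "0 < x" "x \<le> \<delta>" for x
  proof -
    have "V x \<le> V \<delta>"
    proof (rule DERIV_nonneg_imp_nondecreasing[OF x(2)])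
      fix t assume "x \<le> t" "t \<le> \<delta>"
      then have t: "0 < t" "t \<le> \<delta>" using x by auto
      have "(V has_real_derivative 2 * X1 t * (- Q t * X t) + (Q' t * (X t)\<^sup>2 + 2 * X t * X1 t * Q t)) (at t)"
        unfolding V_def[abs_def] using d[OF t] dQ[OF t]
        by (auto intro!: derivative_eq_intros simp: power2_eq_square mult_ac)
      moreover have "2 * X1 t * (- Q t * X t) + (Q' t * (X t)\<^sup>2 + 2 * X t * X1 t * Q t) = Q' t * (X t)\<^sup>2"
        by (simp add: algebra_simps)
      moreover have "\<dots> \<ge> 0" using Q'0[OF t] by simp
      ultimately show "\<exists>y. (V has_real_derivative y) (at t) \<and> 0 \<le> y" by metis
    qed
    also have "V \<delta> \<le> (M * \<nu>)\<^sup>2 + (2 * \<nu>\<^sup>2) * M\<^sup>2"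
      unfolding V_def
    proof (rule add_mono)
      show "(X1 \<delta>)\<^sup>2 \<le> (M * \<nu>)\<^sup>2" using M(2) by (simp add: abs_le_square_iff[symmetric])
      show "Q \<delta> * (X \<delta>)\<^sup>2 \<le> (2 * \<nu>\<^sup>2) * M\<^sup>2" using Qd(2) M(1)
        by (intro mult_mono) (auto simp: Q_def abs_le_square_iff[symmetric])
    qed
    also have "\<dots> = 3 * (M * \<nu>)\<^sup>2" by (simp add: power_mult_distrib)
    finally show ?thesis .
  qed
  have X1b: "\<bar>X1 x\<bar> \<le> 2 * M * \<nu>" if x: "0 < x" "x \<le> \<delta>" "Q x \<ge> 0" for x
  proof -
    have "0 \<le> Q x * (X x)\<^sup>2" using x by simp
    then have "(X1 x)\<^sup>2 \<le> 3 * (M * \<nu>)\<^sup>2" using V[OF x(1,2)] unfolding V_def by linarith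
    also have "\<dots> \<le> (2 * M * \<nu>)\<^sup>2" by (simp add: power_mult_distrib)
    finally show ?thesis using M0 \<nu> by (simp add: abs_le_square_iff[symmetric] abs_mult)
  qed
  have Xb: "\<bar>X x\<bar> \<le> 3 * M" if x: "0 < x" "x \<le> \<delta>" "Q x \<ge> \<nu>\<^sup>2 / 2" for x
  proof -
    have "\<nu>\<^sup>2 / 2 * (X x)\<^sup>2 \<le> Q x * (X x)\<^sup>2" using x by (intro mult_right_mono) auto
    also have "\<dots> \<le> 3 * (M * \<nu>)\<^sup>2" using V[OF x(1,2)] unfolding V_def by (smt (verit) zero_le_power2)
    finally have "\<nu>\<^sup>2 * (X x)\<^sup>2 \<le> \<nu>\<^sup>2 * (6 * M\<^sup>2)" by (simp add: power_mult_distrib mult_ac)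
    then have "(X x)\<^sup>2 \<le> 6 * M\<^sup>2" using \<nu> by simp
    also have "\<dots> \<le> (3 * M)\<^sup>2" by (simp add: power_mult_distrib)
    finally have "\<bar>X x\<bar> \<le> \<bar>3 * M\<bar>" by (simp only: abs_le_square_iff)
    then show ?thesis using M0 by simp
  qed
  have key: "\<bar>X x\<bar> \<le> (3 + 8 * sqrt A) * M" if x: "0 < x" "x \<le> \<delta>" "Q x \<ge> 0" for x
  proof (cases "Q x \<ge> \<nu>\<^sup>2 / 2")
    case True
    have "3 * M \<le> (3 + 8 * sqrt A) * M" using M0 A by (intro mult_right_mono) auto
    then show ?thesis using Xb[OF x(1,2) True] by linarith
  next
    case False
    have cb: "\<bar>B\<bar> / (cos t)\<^sup>2 \<le> \<nu>\<^sup>2 / 4" if "0 < t" "t \<le> \<delta>" for t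
    proof -
      have "\<bar>B\<bar> / (cos t)\<^sup>2 \<le> \<bar>B\<bar> / (1 / 2)" using cos_square_ge_half[of t] that \<delta> by (intro divide_left_mono) auto
      moreover have "\<bar>B\<bar> / (1 / 2) \<le> \<nu>\<^sup>2 / 4" using \<nu> by simp
      ultimately show ?thesis by linarith
    qed
    have Qlow: "\<nu>\<^sup>2 - A / (sin t)\<^sup>2 - \<nu>\<^sup>2 / 4 \<le> Q t" if t: "0 < t" "t \<le> \<delta>" for t
    proof -
      have "B / (cos t)\<^sup>2 \<le> \<bar>B\<bar> / (cos t)\<^sup>2" by (intro divide_right_mono) auto
      then show ?thesis unfolding Q_def jacobi_Q_def using cb[OF t] by linarith
    qed
    \<comment> \<open>At distance \<open>4 * sqrt A / \<nu>\<close> from 0 the bound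
      \<open>sin y \<ge> y / 2\<close> makes the singular term at most \<open>\<nu>^2 / 4\<close>;
      the term with \<open>B\<close> costs another \<open>\<nu>^2 / 4\<close>, which leaves
      \<open>Q y \<ge> \<nu>^2 / 2\<close>. The minimum keeps \<open>y\<close> within
      \<open>\<delta>\<close>, where this lower bound is a hypothesis.\<close>
    define y where "y = min \<delta> (4 * sqrt A / \<nu>)"
    have "A \<noteq> 0"
    proof
      assume "A = 0"
      then show False using Qlow[OF x(1,2)] False \<nu> by simp
    qed
    then have Apos: "A > 0" using A by simp
    have y: "0 < y" "y \<le> \<delta>" "y \<le> 4 * sqrt A / \<nu>" using \<delta> Apos \<nu> by (auto simp: y_def)
    have Qy: "Q y \<ge> \<nu>\<^sup>2 / 2"
    proof (cases "y = \<delta>")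
      case True then show ?thesis using Qd by (simp add: Q_def)
    next
      case False
      then have "y = 4 * sqrt A / \<nu>" by (auto simp: y_def min_def split: if_splits)
      then have "2 * sqrt A / \<nu> \<le> sin y" using sin_ge_half[of y] y \<delta> by simp
      then have "(2 * sqrt A / \<nu>)\<^sup>2 \<le> (sin y)\<^sup>2" using Apos \<nu> by (intro power_mono) auto
      then have s: "4 * A / \<nu>\<^sup>2 \<le> (sin y)\<^sup>2" using A by (simp add: power_divide power_mult_distrib)
      have "A / (sin y)\<^sup>2 \<le> A / (4 * A / \<nu>\<^sup>2)"
        using s Apos \<nu> by (intro divide_left_mono) (auto intro!: mult_pos_pos divide_pos_pos order.strict_trans2[OF _ s])
      also have "\<dots> = \<nu>\<^sup>2 / 4" using Apos by simp
      finally show ?thesis using Qlow[OF y(1,2)] by linarith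
    qed
    have xy: "x < y"
    proof (rule ccontr)
      assume "\<not> x < y"
      then have "Q y \<le> Q x" using Qmono y x by auto
      then show False using Qy False by linarith
    qed
    obtain z where z: "x < z" "z < y" "X y - X x = (y - x) * X1 z"
      using MVT2[OF xy, of X X1] d(1) x y by force
    have zr: "0 < z" "z \<le> \<delta>" "Q z \<ge> 0" using z x y Qmono[of x z] by auto
    \<comment> \<open>Distance at most \<open>4 * sqrt A / \<nu>\<close> times slope at most
      \<open>2 * M * \<nu>\<close>.\<close>
    have "\<bar>X y - X x\<bar> = (y - x) * \<bar>X1 z\<bar>" using z xy by (simp add: abs_mult)
    also have "\<dots> \<le> (4 * sqrt A / \<nu>) * (2 * M * \<nu>)"
      using X1b[OF zr] y x xy A \<nu> by (intro mult_mono) auto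
    also have "\<dots> = 8 * sqrt A * M" using \<nu> by simp
    finally have "\<bar>X x\<bar> \<le> \<bar>X y\<bar> + 8 * sqrt A * M" by linarith
    then show ?thesis using Xb[OF y(1,2) Qy] by (simp add: algebra_simps)
  qed
  show ?thesis
  proof (cases "Q \<phi> \<ge> 0")
    case True then show ?thesis using key \<phi> by auto
  next
    case False
    have "Q \<delta> \<ge> 0" using Qd(1) unfolding Q_def by (meson order.trans zero_le_divide_iff zero_le_power2 zero_le_numeral)
    moreover have "isCont Q x" if "0 < x" "x \<le> \<delta>" for x using dQ[OF that] by (rule DERIV_isCont)
    ultimately have "\<exists>x\<ge>\<phi>. x \<le> \<delta> \<and> Q x = 0"
      using False \<phi> by (intro IVT) auto
    then obtain \<psi> where \<psi>: "\<phi> \<le> \<psi>" "\<psi> \<le> \<delta>" "Q \<psi> = 0" by auto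
    have Qneg: "Q x \<le> 0" if "0 < x" "x \<le> \<psi>" for x using Qmono[of x \<psi>] that \<psi> by auto
    have "A \<noteq> 0"
    proof
      assume "A = 0"
      have "B / (cos \<phi>)\<^sup>2 \<le> \<bar>B\<bar> / (cos \<phi>)\<^sup>2" by (intro divide_right_mono) auto
      also have "\<dots> \<le> \<bar>B\<bar> / (1 / 2)" using cos_square_ge_half[of \<phi>] \<phi> \<delta> by (intro divide_left_mono) auto
      finally have "Q \<phi> \<ge> \<nu>\<^sup>2 - 2 * \<bar>B\<bar>" using \<open>A = 0\<close> by (simp add: Q_def jacobi_Q_def)
      then show False using False \<nu> zero_le_power2[of \<nu>] by linarith
    qed
    then have l: "(X \<longlongrightarrow> 0) (at_right 0)" using lim A by simp
    have "\<bar>X \<phi>\<bar> \<le> \<bar>X \<psi>\<bar>"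
      by (rule osc_nonoscillatory[of \<psi> X X1 Q]) (use d Qneg l \<phi> \<psi> in auto)
    also have "\<dots> \<le> (3 + 8 * sqrt A) * M" using key[of \<psi>] \<phi> \<psi> by simp
    finally show ?thesis .
  qed
qed

text \<open>The endpoint estimate as a predicate, because it is instantiated four times: for
  \<open>U\<close> and for \<open>Z\<close>, each at both ends. \<open>M\<close> measures the data
  at \<open>\<delta>\<close> with the derivative scaled by \<open>\<nu>\<close>.\<close>

definition osc_endpoint :: "real \<Rightarrow> real \<Rightarrow> real \<Rightarrow> real \<Rightarrow> real \<Rightarrow> bool" where
  "osc_endpoint A B \<delta> \<nu>0 K \<longleftrightarrow> (\<forall>\<nu> X X1 M \<phi>. \<nu> \<ge> \<nu>0 \<longrightarrow> osc_eq A B \<nu> X X1 \<longrightarrow>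
       (A > 0 \<longrightarrow> (X \<longlongrightarrow> 0) (at_right 0)) \<longrightarrow> \<bar>X \<delta>\<bar> \<le> M \<longrightarrow> \<bar>X1 \<delta>\<bar> \<le> M * \<nu> \<longrightarrow>
       0 < \<phi> \<longrightarrow> \<phi> \<le> \<delta> \<longrightarrow> \<bar>X \<phi>\<bar> \<le> K * M)"

lemma osc_endpointD:
  assumes "osc_endpoint A B \<delta> \<nu>0 K" "\<nu> \<ge> \<nu>0" "osc_eq A B \<nu> X X1" "A > 0 \<longrightarrow> (X \<longlongrightarrow> 0) (at_right 0)"
    "\<bar>X \<delta>\<bar> \<le> M" "\<bar>X1 \<delta>\<bar> \<le> M * \<nu>" "0 < \<phi>" "\<phi> \<le> \<delta>"
  shows "\<bar>X \<phi>\<bar> \<le> K * M"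
  using assms unfolding osc_endpoint_def by blast

text \<open>Whether \<open>jacobi_Q\<close> decreases or increases near 0 decides between the two
  endpoint arguments. The statement holds for every small \<open>\<delta>\<close> so that a single
  \<open>\<delta>\<close> can later serve four equations at once.\<close>

lemma osc_endpoint_bound:
  "\<exists>\<delta>0. 0 < \<delta>0 \<and> \<delta>0 \<le> pi / 8 \<and> (\<forall>\<delta>. 0 < \<delta> \<longrightarrow> \<delta> \<le> \<delta>0 \<longrightarrow> (\<exists>\<nu>0 K. osc_endpoint A B \<delta> \<nu>0 K))"
proof -
  obtain \<delta>0 where \<delta>0: "0 < \<delta>0" "\<delta>0 \<le> pi / 8"
    and sgn: "(\<forall>\<phi>. 0 < \<phi> \<longrightarrow> \<phi> \<le> \<delta>0 \<longrightarrow> A * cos \<phi> ^ 4 - B * sin \<phi> ^ 4 \<le> 0) \<or>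
     (A \<ge> 0 \<and> (\<forall>\<phi>. 0 < \<phi> \<longrightarrow> \<phi> \<le> \<delta>0 \<longrightarrow> A * cos \<phi> ^ 4 - B * sin \<phi> ^ 4 \<ge> 0))"
    by (rule trig_sign_near_zero[of A B])
  show ?thesis
  proof (rule exI[of _ \<delta>0], intro conjI allI impI \<delta>0)
    fix \<delta> assume \<delta>: "0 < \<delta>" "\<delta> \<le> \<delta>0"
    have \<delta>8: "\<delta> \<le> pi / 8" using \<delta> \<delta>0 by simp
    \<comment> \<open>\<open>D\<close> bounds the potential at \<open>\<delta>\<close>. For
      \<open>\<nu> \<ge> 1 + 4 * D\<close> this is at most \<open>\<nu>^2 / 4\<close>, which places
      \<open>jacobi_Q\<close> between \<open>\<nu>^2 / 2\<close> and \<open>2 * \<nu>^2\<close>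
      there.\<close>
    define D where "D = \<bar>A\<bar> / (sin \<delta>)\<^sup>2 + 2 * \<bar>B\<bar>"
    have D0: "D \<ge> 2 * \<bar>B\<bar>" by (simp add: D_def)
    have D1: "D \<ge> 0" using D0 by linarith
    have "\<bar>X \<phi>\<bar> \<le> (3 + 8 * sqrt \<bar>A\<bar>) * M"
      if \<nu>: "\<nu> \<ge> 1 + 4 * D" and eq: "osc_eq A B \<nu> X X1" and lim: "A > 0 \<longrightarrow> (X \<longlongrightarrow> 0) (at_right 0)"
        and M: "\<bar>X \<delta>\<bar> \<le> M" "\<bar>X1 \<delta>\<bar> \<le> M * \<nu>" and \<phi>: "0 < \<phi>" "\<phi> \<le> \<delta>" for \<nu> X X1 M \<phi>
    proof -
      have n1: "\<nu> \<ge> 1" using \<nu> D1 by linarith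
      have "\<nu> * 1 \<le> \<nu> * \<nu>" using n1 by (intro mult_left_mono) auto
      then have n2: "4 * D \<le> \<nu>\<^sup>2" using \<nu> by (simp add: power2_eq_square)
      have "\<bar>B\<bar> / (cos \<delta>)\<^sup>2 \<le> \<bar>B\<bar> / (1 / 2)" using cos_square_ge_half[of \<delta>] \<delta> \<delta>8 by (intro divide_left_mono) auto
      then have "\<bar>A / (sin \<delta>)\<^sup>2\<bar> + \<bar>B / (cos \<delta>)\<^sup>2\<bar> \<le> D" by (simp add: D_def abs_divide)
      then have Qd: "jacobi_Q A B \<nu> \<delta> \<ge> \<nu>\<^sup>2 / 2" "jacobi_Q A B \<nu> \<delta> \<le> 2 * \<nu>\<^sup>2"
        unfolding jacobi_Q_def using n2 D1 by linarith+
      have M0: "M \<ge> 0" using M(1) by linarith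
      from sgn show ?thesis
      proof
        assume s: "\<forall>\<phi>. 0 < \<phi> \<longrightarrow> \<phi> \<le> \<delta>0 \<longrightarrow> A * cos \<phi> ^ 4 - B * sin \<phi> ^ 4 \<le> 0"
        have "\<bar>X \<phi>\<bar> \<le> 2 * M"
          by (rule osc_endpoint_decreasing[OF eq \<delta>(1) \<delta>8 _ Qd(1) _ M \<phi>]) (use s \<delta> n1 in auto)
        also have "\<dots> \<le> (3 + 8 * sqrt \<bar>A\<bar>) * M" using M0 by (intro mult_right_mono) (auto intro: order.trans[of _ 3])
        finally show ?thesis .
      next
        assume s: "A \<ge> 0 \<and> (\<forall>\<phi>. 0 < \<phi> \<longrightarrow> \<phi> \<le> \<delta>0 \<longrightarrow> A * cos \<phi> ^ 4 - B * sin \<phi> ^ 4 \<ge> 0)"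
        have "\<bar>X \<phi>\<bar> \<le> (3 + 8 * sqrt A) * M"
        proof (rule osc_endpoint_increasing[OF eq \<delta>(1) \<delta>8 _ _ Qd _ _ _ M \<phi>])
          show "8 * \<bar>B\<bar> \<le> \<nu>\<^sup>2" using n2 D0 by linarith
        qed (use s \<delta> n1 lim in auto)
        then show ?thesis using s by simp
      qed
    qed
    then show "\<exists>\<nu>0 K. osc_endpoint A B \<delta> \<nu>0 K" unfolding osc_endpoint_def by blast
  qed
qed

text \<open>The energy \<open>E = X'\<^sup>2 + \<nu>\<^sup>2 X\<^sup>2\<close> varies by a bounded factor, and \<open>(X X')' = X'\<^sup>2 - Q X\<^sup>2\<close> shows that
  its integral is controlled by \<open>\<nu>\<^sup>2 \<integral>X\<^sup>2\<close> up to boundary terms of size \<open>E / \<nu>\<close>.\<close>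

lemma osc_bulk_bound:
  assumes \<delta>: "0 < \<delta>" "\<delta> \<le> pi / 8"
  shows "\<exists>\<nu>0 K. \<forall>\<nu> X X1 J \<phi>. \<nu> \<ge> \<nu>0 \<longrightarrow> osc_eq A B \<nu> X X1 \<longrightarrow>
     (\<forall>\<phi>. \<delta> \<le> \<phi> \<longrightarrow> \<phi> \<le> pi / 2 - \<delta> \<longrightarrow> (J has_real_derivative (X \<phi>)\<^sup>2) (at \<phi>)) \<longrightarrow>
     J (pi / 2 - \<delta>) - J \<delta> \<le> 1 \<longrightarrow> \<delta> \<le> \<phi> \<longrightarrow> \<phi> \<le> pi / 2 - \<delta> \<longrightarrow> (X1 \<phi>)\<^sup>2 + \<nu>\<^sup>2 * (X \<phi>)\<^sup>2 \<le> K * \<nu>\<^sup>2"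
proof -
  define t where "t = pi / 2 - \<delta>"
  define D where "D = (\<bar>A\<bar> + \<bar>B\<bar>) / (sin \<delta>)\<^sup>2"
  \<comment> \<open>Gronwall factor: the energy satisfies \<open>\<bar>E'\<bar> \<le> D * E\<close>
    on an interval of length at most 2.\<close>
  define G where "G = exp (2 * D)"
  have D0: "D \<ge> 0" by (simp add: D_def)
  have G1: "G \<ge> 1" using D0 by (simp add: G_def)
  have sd: "sin \<delta> > 0" using \<delta> pi_gt_zero by (intro sin_gt_zero) auto
  have len: "t - \<delta> \<ge> 1 / 2" "t \<le> 2" "\<delta> \<le> t" using \<delta> pi_gt3 pi_less_4 by (auto simp: t_def)
  have "(X1 \<phi>)\<^sup>2 + \<nu>\<^sup>2 * (X \<phi>)\<^sup>2 \<le> 12 * G * \<nu>\<^sup>2"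
    if \<nu>: "\<nu> \<ge> 1 + D + 4 * G\<^sup>2" and eq: "osc_eq A B \<nu> X X1"
      and J: "\<forall>\<phi>. \<delta> \<le> \<phi> \<longrightarrow> \<phi> \<le> t \<longrightarrow> (J has_real_derivative (X \<phi>)\<^sup>2) (at \<phi>)"
      and J1: "J t - J \<delta> \<le> 1" and \<phi>: "\<delta> \<le> \<phi>" "\<phi> \<le> t" for \<nu> X X1 J \<phi>
  proof -
    define E where "E x = (X1 x)\<^sup>2 + \<nu>\<^sup>2 * (X x)\<^sup>2" for x
    define Q where "Q = jacobi_Q A B \<nu>"
    have n1: "\<nu> \<ge> 1" "\<nu> \<ge> D" "\<nu> \<ge> 4 * G\<^sup>2" using \<nu> D0 zero_le_power2[of G] by linarith+
    have n2: "\<nu>\<^sup>2 \<ge> \<nu>" using mult_left_mono[of 1 \<nu> \<nu>] n1 by (simp add: power2_eq_square)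
    have E0: "E x \<ge> 0" for x by (simp add: E_def)
    have rng: "0 < x" "x < pi / 2" if "\<delta> \<le> x" "x \<le> t" for x using that \<delta> by (auto simp: t_def)
    have QD: "\<bar>\<nu>\<^sup>2 - Q x\<bar> \<le> D" if x: "\<delta> \<le> x" "x \<le> t" for x
    proof -
      have s: "sin \<delta> \<le> sin x" using x \<delta> pi_gt_zero by (intro sin_monotone_2pi_le) (auto simp: t_def)
      have "sin \<delta> = cos (pi / 2 - \<delta>)" by (simp add: cos_diff)
      also have "\<dots> \<le> cos x" using x \<delta> pi_gt_zero by (intro cos_monotone_0_pi_le) (auto simp: t_def)
      finally have c: "sin \<delta> \<le> cos x" .
      have s2: "(sin \<delta>)\<^sup>2 \<le> (sin x)\<^sup>2" "(sin \<delta>)\<^sup>2 \<le> (cos x)\<^sup>2" using s c sd by (auto intro!: power_mono)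
      have sp: "(sin \<delta>)\<^sup>2 > 0" using sd by simp
      have "\<nu>\<^sup>2 - Q x = A / (sin x)\<^sup>2 + B / (cos x)\<^sup>2" by (simp add: Q_def jacobi_Q_def)
      moreover have "\<bar>A / (sin x)\<^sup>2\<bar> \<le> \<bar>A\<bar> / (sin \<delta>)\<^sup>2" using s2 sp by (simp only: abs_divide) (intro frac_le, auto)
      moreover have "\<bar>B / (cos x)\<^sup>2\<bar> \<le> \<bar>B\<bar> / (sin \<delta>)\<^sup>2" using s2 sp by (simp only: abs_divide) (intro frac_le, auto)
      ultimately show ?thesis unfolding D_def add_divide_distrib by linarith
    qed
    have d: "(X has_real_derivative X1 x) (at x)" "(X1 has_real_derivative - Q x * X x) (at x)"
      if "\<delta> \<le> x" "x \<le> t" for x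
      using eq rng[OF that] unfolding osc_eq_def Q_def by auto
    have XX1: "2 * \<bar>X x * X1 x\<bar> * \<nu> \<le> E x" for x
    proof -
      have "0 \<le> (\<bar>X1 x\<bar> - \<nu> * \<bar>X x\<bar>)\<^sup>2" by simp
      then show ?thesis by (simp add: E_def power2_diff power_mult_distrib abs_mult mult_ac)
    qed
    have XX2: "2 * \<bar>X x * X1 x\<bar> \<le> E x" for x
    proof -
      have "2 * \<bar>X x * X1 x\<bar> * 1 \<le> 2 * \<bar>X x * X1 x\<bar> * \<nu>" using n1 by (intro mult_left_mono) auto
      then show ?thesis using XX1[of x] by simp
    qed
    define E' where "E' x = 2 * X x * X1 x * (\<nu>\<^sup>2 - Q x)" for x
    have dE: "(E has_real_derivative E' x) (at x)" if x: "\<delta> \<le> x" "x \<le> t" for x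
    proof -
      have "(E has_real_derivative 2 * X1 x * (- Q x * X x) + \<nu>\<^sup>2 * (2 * X x * X1 x)) (at x)"
        unfolding E_def[abs_def] using d[OF x] by (auto intro!: derivative_eq_intros simp: mult_ac)
      then show ?thesis by (simp add: E'_def algebra_simps)
    qed
    have E'b: "\<bar>E' x\<bar> \<le> D * E x" if x: "\<delta> \<le> x" "x \<le> t" for x
    proof -
      have "\<bar>E' x\<bar> = (2 * \<bar>X x * X1 x\<bar>) * \<bar>\<nu>\<^sup>2 - Q x\<bar>" by (simp add: E'_def abs_mult)
      also have "\<dots> \<le> E x * D" using XX2 QD[OF x] E0 by (intro mult_mono) auto
      finally show ?thesis by (simp add: mult.commute)
    qed
    have gr: "E x \<le> G * E z" if x: "\<delta> \<le> x" "x \<le> t" and z: "\<delta> \<le> z" "z \<le> t" for x z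
    proof (cases "x \<le> z")
      case True
      have "E x * exp (D * x) \<le> E z * exp (D * z)"
      proof (rule DERIV_nonneg_imp_nondecreasing[OF True])
        fix s assume "x \<le> s" "s \<le> z"
        then have s: "\<delta> \<le> s" "s \<le> t" using x z by auto
        have "((\<lambda>x. E x * exp (D * x)) has_real_derivative (E' s + D * E s) * exp (D * s)) (at s)"
          using dE[OF s] by (auto intro!: derivative_eq_intros simp: algebra_simps)
        moreover have "(E' s + D * E s) * exp (D * s) \<ge> 0" using E'b[OF s] by (intro mult_nonneg_nonneg) auto
        ultimately show "\<exists>y. ((\<lambda>x. E x * exp (D * x)) has_real_derivative y) (at s) \<and> 0 \<le> y" by blast
      qed
      then have "E x \<le> E z * exp (D * z) / exp (D * x)" by (simp add: pos_le_divide_eq)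
      also have "\<dots> = E z * exp (D * (z - x))" by (simp add: exp_diff right_diff_distrib)
      also have "\<dots> \<le> E z * G" unfolding G_def using x z len \<delta> D0 E0
        by (intro mult_left_mono) (auto intro!: mult_left_mono simp: mult.commute)
      finally show ?thesis by (simp add: mult.commute)
    next
      case False
      then have zx: "z \<le> x" by simp
      have "E x * exp (- D * x) \<le> E z * exp (- D * z)"
      proof (rule DERIV_nonpos_imp_nonincreasing[OF zx])
        fix s assume "z \<le> s" "s \<le> x"
        then have s: "\<delta> \<le> s" "s \<le> t" using x z by auto
        have "((\<lambda>x. E x * exp (- D * x)) has_real_derivative (E' s - D * E s) * exp (- D * s)) (at s)"
          using dE[OF s] by (auto intro!: derivative_eq_intros simp: algebra_simps)
        moreover have "(E' s - D * E s) * exp (- D * s) \<le> 0" using E'b[OF s] by (intro mult_nonpos_nonneg) auto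
        ultimately show "\<exists>y. ((\<lambda>x. E x * exp (- D * x)) has_real_derivative y) (at s) \<and> y \<le> 0" by blast
      qed
      then have "E x \<le> E z * exp (- D * z) / exp (- D * x)" by (simp add: pos_le_divide_eq)
      also have "\<dots> = E z * exp (D * (x - z))"
        unfolding times_divide_eq_right[symmetric] exp_diff[symmetric] by (simp add: algebra_simps)
      also have "\<dots> \<le> E z * G" unfolding G_def using x z len \<delta> D0 E0
        by (intro mult_left_mono) (auto intro!: mult_left_mono simp: mult.commute)
      finally show ?thesis by (simp add: mult.commute)
    qed
    \<comment> \<open>A lower bound for the energy on the whole interval, comparable with its value
      at \<open>\<phi>\<close>; it remains to bound \<open>e\<close> by a multiple of
      \<open>\<nu>^2\<close>.\<close>
    define e where "e = E \<phi> / G"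
    have e0: "e \<ge> 0" using E0[of \<phi>] G1 by (simp add: e_def)
    have elow: "e \<le> E x" if "\<delta> \<le> x" "x \<le> t" for x
      using gr[OF \<phi> that] G1 by (simp add: e_def pos_divide_le_eq mult.commute)
    have eup: "E x \<le> G\<^sup>2 * e" if "\<delta> \<le> x" "x \<le> t" for x
      using gr[OF that \<phi>] G1 by (simp add: e_def power2_eq_square)
    \<comment> \<open>The comparison of integrals is phrased as monotonicity: the derivative of
      \<open>H\<close> is \<open>E - e\<close> plus a nonnegative multiple of
      \<open>X^2\<close>.\<close>
    define H where "H x = X x * X1 x - e * x + (2 * \<nu>\<^sup>2 + D) * J x" for x
    have "H \<delta> \<le> H t"
    proof (rule DERIV_nonneg_imp_nondecreasing[OF len(3)])
      fix x assume x: "\<delta> \<le> x" "x \<le> t"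
      have "(H has_real_derivative (X1 x * X1 x + (- Q x * X x) * X x) - e + (2 * \<nu>\<^sup>2 + D) * (X x)\<^sup>2) (at x)"
        unfolding H_def[abs_def] using d[OF x] J x by (auto intro!: derivative_eq_intros simp: mult_ac)
      moreover have "(X1 x * X1 x + (- Q x * X x) * X x) - e + (2 * \<nu>\<^sup>2 + D) * (X x)\<^sup>2 = E x - e + (\<nu>\<^sup>2 - Q x + D) * (X x)\<^sup>2"
        by (simp add: E_def algebra_simps power2_eq_square)
      moreover have "\<dots> \<ge> 0"
      proof -
        have "\<nu>\<^sup>2 - Q x + D \<ge> 0" using QD[OF x] by linarith
        then have "(\<nu>\<^sup>2 - Q x + D) * (X x)\<^sup>2 \<ge> 0" by simp
        then show ?thesis using elow[OF x] by linarith
      qed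
      ultimately show "\<exists>y. (H has_real_derivative y) (at x) \<and> 0 \<le> y" by metis
    qed
    then have h: "e * (t - \<delta>) \<le> X t * X1 t - X \<delta> * X1 \<delta> + (2 * \<nu>\<^sup>2 + D) * (J t - J \<delta>)"
      by (simp add: H_def algebra_simps)
    \<comment> \<open>The condition \<open>\<nu> \<ge> 4 * G^2\<close> makes each boundary term at
      most \<open>e / 8\<close>, so the two together take only half of the \<open>e / 2\<close> that
      the length of the interval contributes.\<close>
    have b: "\<bar>X x * X1 x\<bar> \<le> e / 8" if x: "\<delta> \<le> x" "x \<le> t" for x
    proof -
      have "2 * \<bar>X x * X1 x\<bar> * (4 * G\<^sup>2) \<le> 2 * \<bar>X x * X1 x\<bar> * \<nu>" using n1 by (intro mult_left_mono) auto
      also have "\<dots> \<le> G\<^sup>2 * e" using XX1[of x] eup[OF x] by linarith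
      finally have "G\<^sup>2 * (8 * \<bar>X x * X1 x\<bar>) \<le> G\<^sup>2 * e" by (simp add: mult_ac)
      then show ?thesis using G1 by simp
    qed
    have "(2 * \<nu>\<^sup>2 + D) * (J t - J \<delta>) \<le> (2 * \<nu>\<^sup>2 + D) * 1" using J1 D0 by (intro mult_left_mono) auto
    moreover have "e * (1 / 2) \<le> e * (t - \<delta>)" using len e0 by (intro mult_left_mono) auto
    ultimately have "e * (1 / 2) \<le> X t * X1 t - X \<delta> * X1 \<delta> + (2 * \<nu>\<^sup>2 + D) * 1" using h by linarith
    moreover have "X t * X1 t \<le> e / 8" "- (X \<delta> * X1 \<delta>) \<le> e / 8"
      using b[OF len(3) order_refl] b[OF order_refl len(3)] by (auto simp: abs_le_iff)
    moreover have "e / 4 \<le> c" if "e * (1 / 2) \<le> x - y + c * 1" "x \<le> e / 8" "- y \<le> e / 8" for x y c :: real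
      using that by linarith
    ultimately have "e / 4 \<le> 2 * \<nu>\<^sup>2 + D" by blast
    then have "e \<le> 12 * \<nu>\<^sup>2" using n1 n2 by linarith
    then have "G * e \<le> G * (12 * \<nu>\<^sup>2)" using G1 by (intro mult_left_mono) auto
    then show ?thesis using G1 by (simp add: e_def E_def mult_ac)
  qed
  then show ?thesis unfolding t_def by blast
qed

section \<open>Endpoint behaviour and normalisation of the weighted polynomials\<close>

lemma poly_bounded_Icc: "\<exists>M\<ge>0. \<forall>x\<in>{-1..1}. \<bar>poly p x\<bar> \<le> (M::real)"
proof -
  have "compact (poly p ` {-1..1})" by (intro compact_continuous_image continuous_intros) auto
  then have "bounded (poly p ` {-1..1})" by (rule compact_imp_bounded)
  then obtain M where "\<forall>x\<in>{-1..1}. \<bar>poly p x\<bar> \<le> M" unfolding bounded_iff by auto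
  then show ?thesis by (intro exI[of _ "max M 0"]) force
qed

lemma jacobi_U_le:
  assumes ab: "a \<ge> 0" "b \<ge> 0" and M: "M \<ge> 0" "\<forall>x\<in>{-1..1}. \<bar>poly p x\<bar> \<le> M" and \<phi>: "0 < \<phi>" "\<phi> < pi / 2"
  shows "\<bar>jacobi_U a b p \<phi>\<bar> \<le> M * sin \<phi> powr a" "\<bar>jacobi_U a b p \<phi>\<bar> \<le> M * cos \<phi> powr b" "\<bar>jacobi_U a b p \<phi>\<bar> \<le> M"
proof -
  have sc: "sin \<phi> > 0" "cos \<phi> > 0" using trig_pos[OF \<phi>] .
  have s1: "sin \<phi> powr a \<le> 1" using ab sc by (intro powr_le1) auto
  have c1: "cos \<phi> powr b \<le> 1" using ab sc by (intro powr_le1) auto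
  have p: "\<bar>poly p (cos (2 * \<phi>))\<bar> \<le> M" using M by simp
  have e: "\<bar>jacobi_U a b p \<phi>\<bar> = sin \<phi> powr a * cos \<phi> powr b * \<bar>poly p (cos (2 * \<phi>))\<bar>"
    by (simp add: jacobi_U_def abs_mult)
  have "\<bar>jacobi_U a b p \<phi>\<bar> \<le> sin \<phi> powr a * cos \<phi> powr b * M" unfolding e using p by (intro mult_left_mono) auto
  moreover have "sin \<phi> powr a * cos \<phi> powr b * M \<le> sin \<phi> powr a * 1 * M" using c1 M by (intro mult_right_mono mult_left_mono) auto
  moreover have "sin \<phi> powr a * cos \<phi> powr b * M \<le> 1 * cos \<phi> powr b * M" using s1 M by (intro mult_right_mono) auto
  moreover have "sin \<phi> powr a * 1 * M \<le> 1 * 1 * M" using s1 M by (intro mult_right_mono) auto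
  ultimately show "\<bar>jacobi_U a b p \<phi>\<bar> \<le> M * sin \<phi> powr a" "\<bar>jacobi_U a b p \<phi>\<bar> \<le> M * cos \<phi> powr b" "\<bar>jacobi_U a b p \<phi>\<bar> \<le> M"
    by (simp_all add: mult.commute)
qed

lemma tendsto_sin_powr_0:
  assumes "a > 0"
  shows "((\<lambda>\<phi>. M * sin \<phi> powr a) \<longlongrightarrow> 0) (at_right (0::real))"
proof -
  have "((\<lambda>\<phi>. sin \<phi> powr a) \<longlongrightarrow> 0) (at_right (0::real))"
  proof (rule tendsto_zero_powrI)
    have "((\<lambda>\<phi>. sin \<phi>) \<longlongrightarrow> sin 0) (at_right (0::real))" by (intro tendsto_intros)
    then show "((\<lambda>\<phi>. sin \<phi>) \<longlongrightarrow> 0) (at_right (0::real))" by simp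
    show "\<forall>\<^sub>F \<phi> in at_right (0::real). 0 \<le> sin \<phi>"
      unfolding eventually_at_right_field by (intro exI[of _ pi]) (auto intro: sin_ge_zero)
  qed (use assms in auto)
  then have "((\<lambda>\<phi>. M * sin \<phi> powr a) \<longlongrightarrow> M * 0) (at_right (0::real))" by (intro tendsto_intros)
  then show ?thesis by simp
qed

lemma jacobi_U_tendsto_0:
  assumes ab: "a > 0" "b \<ge> 0"
  shows "(jacobi_U a b p \<longlongrightarrow> 0) (at_right 0)"
proof -
  obtain M where M: "M \<ge> 0" "\<forall>x\<in>{-1..1}. \<bar>poly p x\<bar> \<le> M" using poly_bounded_Icc by blast
  show ?thesis
  proof (rule tendsto_rabs_zero_cancel, rule tendsto_sandwich[OF _ _ tendsto_const tendsto_sin_powr_0[OF ab(1), of M]])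
    show "\<forall>\<^sub>F \<phi> in at_right 0. \<bar>jacobi_U a b p \<phi>\<bar> \<le> M * sin \<phi> powr a"
      unfolding eventually_at_right_field using pi_gt_zero ab
      by (intro exI[of _ "pi / 2"]) (auto intro!: jacobi_U_le(1)[OF _ _ M])
  qed auto
qed

lemma jacobi_U_reflect_tendsto_0:
  assumes ab: "a \<ge> 0" "b > 0"
  shows "((\<lambda>\<phi>. jacobi_U a b p (pi / 2 - \<phi>)) \<longlongrightarrow> 0) (at_right 0)"
proof -
  obtain M where M: "M \<ge> 0" "\<forall>x\<in>{-1..1}. \<bar>poly p x\<bar> \<le> M" using poly_bounded_Icc by blast
  show ?thesis
  proof (rule tendsto_rabs_zero_cancel, rule tendsto_sandwich[OF _ _ tendsto_const tendsto_sin_powr_0[OF ab(2), of M]])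
    have "\<bar>jacobi_U a b p (pi / 2 - \<phi>)\<bar> \<le> M * sin \<phi> powr b" if "0 < \<phi>" "\<phi> < pi / 2" for \<phi>
      using jacobi_U_le(2)[of a b M p "pi / 2 - \<phi>"] that ab M by (simp add: cos_diff)
    then show "\<forall>\<^sub>F \<phi> in at_right 0. \<bar>jacobi_U a b p (pi / 2 - \<phi>)\<bar> \<le> M * sin \<phi> powr b"
      unfolding eventually_at_right_field using pi_gt_zero
      by (intro exI[of _ "pi / 2"]) auto
  qed auto
qed

text \<open>Under \<open>x = cos (2 * \<phi>)\<close> the weight and the Jacobian
  \<open>4 sin \<phi> cos \<phi>\<close> combine to \<open>sin^(2 a) cos^(2 b)\<close> up to the
  factor \<open>k = 2 powr (- (a + b + 1))\<close>, which is at most 1. The L^2 normalisation in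
  \<open>x\<close> thus passes to \<open>jacobi_U\<close>. An antiderivative is produced because the
  energy argument differentiates it.\<close>

lemma jacobi_U_square_antiderivative:
  fixes p :: "real poly"
  assumes ab: "a \<ge> 0" "b \<ge> 0" and \<delta>: "0 < \<delta>" "\<delta> \<le> pi / 8"
    and int: "(\<lambda>x. (poly p x)\<^sup>2 * jacobi_weight (a - 1/2) (b - 1/2) x) integrable_on {-1..1}"
      "integral {-1..1} (\<lambda>x. (poly p x)\<^sup>2 * jacobi_weight (a - 1/2) (b - 1/2) x) \<le> 1"
  shows "\<exists>J. (\<forall>\<phi>. \<delta> \<le> \<phi> \<longrightarrow> \<phi> \<le> pi / 2 - \<delta> \<longrightarrow> (J has_real_derivative (jacobi_U a b p \<phi>)\<^sup>2) (at \<phi>))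
     \<and> J (pi / 2 - \<delta>) - J \<delta> \<le> 1"
proof -
  define g where "g x = (poly p x)\<^sup>2 * jacobi_weight (a - 1/2) (b - 1/2) x" for x
  have g0: "g x \<ge> 0" for x by (simp add: g_def jacobi_weight_def)
  \<comment> \<open>For \<open>\<phi>\<close> in the range considered, \<open>\<bar>cos (2 *
    \<phi>)\<bar> \<le> cos (2 * \<delta>) < cos \<delta>\<close>. On \<open>{-c..c}\<close> the
    integrand is continuous, and the points that matter are interior, so the derivative of
    \<open>I\<close> is two-sided.\<close>
  define c where "c = cos \<delta>"
  have c: "0 < c" "c < 1"
  proof -
    show "0 < c" unfolding c_def using \<delta> pi_gt_zero by (intro cos_gt_zero) auto
    have "cos \<delta> < cos 0" using \<delta> pi_gt_zero by (intro cos_monotone_0_pi) auto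
    then show "c < 1" by (simp add: c_def)
  qed
  have cont: "continuous_on {-c..c} g"
    unfolding g_def jacobi_weight_def using c by (intro continuous_intros) auto
  define I where "I x = integral {-c..x} g" for x
  define k where "k = 2 powr (- (a + b + 1))"
  have k: "0 < k" "k \<le> 1"
  proof -
    show "0 < k" by (simp add: k_def)
    have "k \<le> 2 powr 0" unfolding k_def using ab by (intro powr_mono) auto
    then show "k \<le> 1" by simp
  qed
  define J where "J \<phi> = - k * I (cos (2 * \<phi>))" for \<phi>
  have rng: "- c < cos (2 * \<phi>) \<and> cos (2 * \<phi>) < c" if \<phi>: "\<delta> \<le> \<phi>" "\<phi> \<le> pi / 2 - \<delta>" for \<phi>
  proof
    have "cos (pi - \<delta>) < cos (2 * \<phi>)" using \<phi> \<delta> pi_gt_zero by (intro cos_monotone_0_pi) auto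
    then show "- c < cos (2 * \<phi>)" by (simp add: c_def)
    show "cos (2 * \<phi>) < c" unfolding c_def using \<phi> \<delta> pi_gt_zero by (intro cos_monotone_0_pi) auto
  qed
  have dI: "(I has_real_derivative g x) (at x)" if x: "- c < x" "x < c" for x
  proof -
    have "(I has_real_derivative g x) (at x within {-c..c})"
      unfolding I_def using x by (intro integral_has_real_derivative cont) auto
    moreover have "at x within {-c..c} = at x" using x by (intro at_within_interior) auto
    ultimately show ?thesis by simp
  qed
  have d: "(J has_real_derivative (jacobi_U a b p \<phi>)\<^sup>2) (at \<phi>)" if \<phi>: "\<delta> \<le> \<phi>" "\<phi> \<le> pi / 2 - \<delta>" for \<phi>
  proof -
    have \<phi>': "0 < \<phi>" "\<phi> < pi / 2" using \<phi> \<delta> by auto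
    define S where "S = sin \<phi>"
    define C where "C = cos \<phi>"
    have sc: "S > 0" "C > 0" using trig_pos[OF \<phi>'] by (auto simp: S_def C_def)
    have "((\<lambda>x. cos (2 * x)) has_real_derivative (- sin (2 * \<phi>) * 2)) (at \<phi>)"
      by (auto intro!: derivative_eq_intros)
    moreover have "- sin (2 * \<phi>) * 2 = - 4 * S * C" by (simp add: sin_double S_def C_def)
    ultimately have dc: "((\<lambda>x. cos (2 * x)) has_real_derivative (- 4 * S * C)) (at \<phi>)" by (simp only:)
    have "(J has_real_derivative - k * (g (cos (2 * \<phi>)) * (- 4 * S * C))) (at \<phi>)"
      unfolding J_def[abs_def] using rng[OF \<phi>] by (intro DERIV_cmult DERIV_chain2[OF dI dc]) auto
    moreover have "- k * (g (cos (2 * \<phi>)) * (- 4 * S * C)) = (jacobi_U a b p \<phi>)\<^sup>2"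
    proof -
      have x1: "1 - cos (2 * \<phi>) = 2 * S\<^sup>2" by (simp add: S_def cos_double_sin)
      have x2: "1 + cos (2 * \<phi>) = 2 * C\<^sup>2" by (simp add: C_def cos_double_cos)
      have e1: "(2 * S\<^sup>2) powr (a - 1/2) * S = 2 powr (a - 1/2) * (S powr a)\<^sup>2"
      proof -
        have "(2 * S\<^sup>2) powr (a - 1/2) = 2 powr (a - 1/2) * (S powr 2) powr (a - 1/2)"
          using sc by (simp add: powr_mult powr_numeral)
        also have "(S powr 2) powr (a - 1/2) = S powr (2 * a - 1)"
          unfolding powr_powr by (simp add: algebra_simps)
        finally have "(2 * S\<^sup>2) powr (a - 1/2) * S = 2 powr (a - 1/2) * (S powr (2 * a - 1) * S powr 1)" using sc by simp
        also have "S powr (2 * a - 1) * S powr 1 = (S powr a)\<^sup>2"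
          using sc by (simp only: powr_add[symmetric] power2_eq_square) simp
        finally show ?thesis .
      qed
      have e2: "(2 * C\<^sup>2) powr (b - 1/2) * C = 2 powr (b - 1/2) * (C powr b)\<^sup>2"
      proof -
        have "(2 * C\<^sup>2) powr (b - 1/2) = 2 powr (b - 1/2) * (C powr 2) powr (b - 1/2)"
          using sc by (simp add: powr_mult powr_numeral)
        also have "(C powr 2) powr (b - 1/2) = C powr (2 * b - 1)"
          unfolding powr_powr by (simp add: algebra_simps)
        finally have "(2 * C\<^sup>2) powr (b - 1/2) * C = 2 powr (b - 1/2) * (C powr (2 * b - 1) * C powr 1)" using sc by simp
        also have "C powr (2 * b - 1) * C powr 1 = (C powr b)\<^sup>2"
          using sc by (simp only: powr_add[symmetric] power2_eq_square) simp
        finally show ?thesis .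
      qed
      have e3: "k * 4 * (2 powr (a - 1/2) * 2 powr (b - 1/2)) = 1"
      proof -
        have "k * 4 * (2 powr (a - 1/2) * 2 powr (b - 1/2)) = 2 powr (- (a + b + 1)) * 2 powr 2 * (2 powr (a - 1/2) * 2 powr (b - 1/2))"
          by (simp add: k_def)
        also have "\<dots> = 2 powr 0" by (simp only: powr_add[symmetric]) simp
        finally show ?thesis by simp
      qed
      have "- k * (g (cos (2 * \<phi>)) * (- 4 * S * C)) = k * 4 * (poly p (cos (2 * \<phi>)))\<^sup>2 * (((2 * S\<^sup>2) powr (a - 1/2) * S) * ((2 * C\<^sup>2) powr (b - 1/2) * C))"
        by (simp add: g_def jacobi_weight_def x1 x2)
      also have "\<dots> = (k * 4 * (2 powr (a - 1/2) * 2 powr (b - 1/2))) * ((S powr a)\<^sup>2 * (C powr b)\<^sup>2 * (poly p (cos (2 * \<phi>)))\<^sup>2)"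
        unfolding e1 e2 by (simp only: mult_ac)
      also have "\<dots> = (jacobi_U a b p \<phi>)\<^sup>2"
        unfolding e3 by (simp add: jacobi_U_def S_def C_def power_mult_distrib)
      finally show ?thesis .
    qed
    ultimately show ?thesis by simp
  qed
  have Ib: "0 \<le> I x \<and> I x \<le> 1" if x: "- c < x" "x < c" for x
  proof
    have gi: "g integrable_on {-c..x}"
      by (rule integrable_continuous_real, rule continuous_on_subset[OF cont]) (use x in auto)
    show "0 \<le> I x" unfolding I_def using g0 gi by (intro integral_nonneg) auto
    have "I x \<le> integral {-1..1} g" unfolding I_def
      using int(1) gi g0 c x by (intro integral_subset_le) (auto simp: g_def[abs_def])
    then show "I x \<le> 1" using int(2) by (simp add: g_def[abs_def])
  qed
  have "J (pi / 2 - \<delta>) - J \<delta> = k * (I (cos (2 * \<delta>)) - I (cos (2 * (pi / 2 - \<delta>))))"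
    by (simp add: J_def algebra_simps)
  also have "\<dots> \<le> k * 1"
    using Ib[of "cos (2 * \<delta>)"] Ib[of "cos (2 * (pi / 2 - \<delta>))"] rng[of \<delta>] rng[of "pi / 2 - \<delta>"] \<delta> pi_gt_zero k
    by (intro mult_left_mono) auto
  finally have "J (pi / 2 - \<delta>) - J \<delta> \<le> 1" using k by linarith
  then show ?thesis using d by blast
qed

text \<open>The energy bound controls \<open>U\<close> and \<open>U1\<close> in the middle. There
  \<open>r\<close> is bounded, so the first-order system transfers the control to \<open>Z\<close>
  and \<open>Z1\<close> at the cost of one factor \<open>\<nu>\<close>. These values at
  \<open>\<delta>\<close> and \<open>pi / 2 - \<delta>\<close> are the data for the four endpoint
  estimates.\<close>

lemma jacobi_large_bound:
  assumes ab: "a \<ge> 0" "b \<ge> 0"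
  shows "\<exists>\<nu>0 K. \<forall>\<nu> \<mu> y \<phi>. \<nu> \<ge> \<nu>0 \<longrightarrow> \<nu>\<^sup>2 = 4 * \<mu> + (a + b)\<^sup>2 \<longrightarrow> \<mu> \<ge> 0 \<longrightarrow>
     jacobi_ode (a - 1/2) (b - 1/2) \<mu> y \<longrightarrow>
     (\<lambda>x. (poly y x)\<^sup>2 * jacobi_weight (a - 1/2) (b - 1/2) x) integrable_on {-1..1} \<longrightarrow>
     integral {-1..1} (\<lambda>x. (poly y x)\<^sup>2 * jacobi_weight (a - 1/2) (b - 1/2) x) \<le> 1 \<longrightarrow>
     0 < \<phi> \<longrightarrow> \<phi> < pi / 2 \<longrightarrow>
     \<bar>jacobi_U a b y \<phi>\<bar> \<le> K \<and> \<bar>jacobi_U (a + 1) (b + 1) (pderiv y) \<phi>\<bar> \<le> K * \<nu>"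
proof -
  define A where "A = a * (a - 1)"
  define B where "B = b * (b - 1)"
  define A' where "A' = a * (a + 1)"
  define B' where "B' = b * (b + 1)"
  obtain \<delta>1 where \<delta>1: "0 < \<delta>1" "\<delta>1 \<le> pi / 8" "\<And>\<delta>. 0 < \<delta> \<Longrightarrow> \<delta> \<le> \<delta>1 \<Longrightarrow> \<exists>\<nu>0 K. osc_endpoint A B \<delta> \<nu>0 K"
    using osc_endpoint_bound[of A B] by blast
  obtain \<delta>2 where \<delta>2: "0 < \<delta>2" "\<And>\<delta>. 0 < \<delta> \<Longrightarrow> \<delta> \<le> \<delta>2 \<Longrightarrow> \<exists>\<nu>0 K. osc_endpoint B A \<delta> \<nu>0 K"
    using osc_endpoint_bound[of B A] by blast
  obtain \<delta>3 where \<delta>3: "0 < \<delta>3" "\<And>\<delta>. 0 < \<delta> \<Longrightarrow> \<delta> \<le> \<delta>3 \<Longrightarrow> \<exists>\<nu>0 K. osc_endpoint A' B' \<delta> \<nu>0 K"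
    using osc_endpoint_bound[of A' B'] by blast
  obtain \<delta>4 where \<delta>4: "0 < \<delta>4" "\<And>\<delta>. 0 < \<delta> \<Longrightarrow> \<delta> \<le> \<delta>4 \<Longrightarrow> \<exists>\<nu>0 K. osc_endpoint B' A' \<delta> \<nu>0 K"
    using osc_endpoint_bound[of B' A'] by blast
  define \<delta> where "\<delta> = min (min \<delta>1 \<delta>2) (min \<delta>3 \<delta>4)"
  have \<delta>: "0 < \<delta>" "\<delta> \<le> pi / 8" "\<delta> \<le> \<delta>1" "\<delta> \<le> \<delta>2" "\<delta> \<le> \<delta>3" "\<delta> \<le> \<delta>4"
    using \<delta>1(1,2) \<delta>2(1) \<delta>3(1) \<delta>4(1) by (auto simp: \<delta>_def)
  obtain \<nu>1 K1 where "osc_endpoint A B \<delta> \<nu>1 K1" using \<delta>1(3)[OF \<delta>(1,3)] by blast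
  note b1 = osc_endpointD[OF this]
  obtain \<nu>2 K2 where "osc_endpoint B A \<delta> \<nu>2 K2" using \<delta>2(2)[OF \<delta>(1,4)] by blast
  note b2 = osc_endpointD[OF this]
  obtain \<nu>3 K3 where "osc_endpoint A' B' \<delta> \<nu>3 K3" using \<delta>3(2)[OF \<delta>(1,5)] by blast
  note b3 = osc_endpointD[OF this]
  obtain \<nu>4 K4 where "osc_endpoint B' A' \<delta> \<nu>4 K4" using \<delta>4(2)[OF \<delta>(1,6)] by blast
  note b4 = osc_endpointD[OF this]
  obtain \<nu>5 K5 where b5: "\<And>\<nu> X X1 J \<phi>. \<nu> \<ge> \<nu>5 \<Longrightarrow> osc_eq A B \<nu> X X1 \<Longrightarrow>
     (\<forall>\<phi>. \<delta> \<le> \<phi> \<longrightarrow> \<phi> \<le> pi / 2 - \<delta> \<longrightarrow> (J has_real_derivative (X \<phi>)\<^sup>2) (at \<phi>)) \<Longrightarrow>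
     J (pi / 2 - \<delta>) - J \<delta> \<le> 1 \<Longrightarrow> \<delta> \<le> \<phi> \<Longrightarrow> \<phi> \<le> pi / 2 - \<delta> \<Longrightarrow> (X1 \<phi>)\<^sup>2 + \<nu>\<^sup>2 * (X \<phi>)\<^sup>2 \<le> K5 * \<nu>\<^sup>2"
    using osc_bulk_bound[OF \<delta>(1,2), of A B] by blast
  define \<nu>0 where "\<nu>0 = Max {1, \<nu>1, \<nu>2, \<nu>3, \<nu>4, \<nu>5}"
  define L where "L = sqrt (max K5 0)"
  define R where "R = (a + b) / sin \<delta>"
  define L2 where "L2 = R * L + L"
  define L3 where "L3 = R * L2 + L"
  define K where "K = (\<bar>K1\<bar> + \<bar>K2\<bar> + 1) * L + (\<bar>K3\<bar> + \<bar>K4\<bar> + 1) * (L2 + L3)"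
  have sd: "sin \<delta> > 0" using \<delta> pi_gt_zero by (intro sin_gt_zero) auto
  have nn: "L \<ge> 0" "R \<ge> 0" "L2 \<ge> 0" "L3 \<ge> 0"
    using ab sd by (auto simp: L_def R_def L2_def L3_def)
  have K: "\<bar>K1\<bar> * L \<le> K" "\<bar>K2\<bar> * L \<le> K" "L \<le> K" "\<bar>K3\<bar> * (L2 + L3) \<le> K" "\<bar>K4\<bar> * (L2 + L3) \<le> K" "L2 \<le> K"
    using nn unfolding K_def by (auto simp: algebra_simps intro!: add_nonneg_nonneg)
  have main: "\<bar>jacobi_U a b y \<phi>\<bar> \<le> K \<and> \<bar>jacobi_U (a + 1) (b + 1) (pderiv y) \<phi>\<bar> \<le> K * \<nu>"
    if \<nu>0: "\<nu> \<ge> \<nu>0" and \<nu>: "\<nu>\<^sup>2 = 4 * \<mu> + (a + b)\<^sup>2" and \<mu>: "\<mu> \<ge> 0" and ode: "jacobi_ode (a - 1/2) (b - 1/2) \<mu> y"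
      and int: "(\<lambda>x. (poly y x)\<^sup>2 * jacobi_weight (a - 1/2) (b - 1/2) x) integrable_on {-1..1}"
        "integral {-1..1} (\<lambda>x. (poly y x)\<^sup>2 * jacobi_weight (a - 1/2) (b - 1/2) x) \<le> 1"
      and \<phi>: "0 < \<phi>" "\<phi> < pi / 2" for \<nu> \<mu> y \<phi>
  proof -
    have ns: "\<nu> \<ge> 1" "\<nu> \<ge> \<nu>1" "\<nu> \<ge> \<nu>2" "\<nu> \<ge> \<nu>3" "\<nu> \<ge> \<nu>4" "\<nu> \<ge> \<nu>5"
      using \<nu>0 by (auto simp: \<nu>0_def)
    define U where "U = jacobi_U a b y"
    define Z where "Z = jacobi_U (a + 1) (b + 1) (pderiv y)"
    define U1 where "U1 \<phi> = jacobi_r a b \<phi> * U \<phi> - 4 * Z \<phi>" for \<phi>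
    define Z1 where "Z1 \<phi> = - jacobi_r a b \<phi> * Z \<phi> + \<mu> * U \<phi>" for \<phi>
    have oU: "osc_eq A B \<nu> U U1" using jacobi_U_osc_eq[OF ode \<nu>] unfolding U_def Z_def U1_def A_def B_def .
    have oZ: "osc_eq A' B' \<nu> Z Z1" using jacobi_Z_osc_eq[OF ode \<nu>] unfolding U_def Z_def Z1_def A'_def B'_def .
    obtain J where J: "\<forall>\<phi>. \<delta> \<le> \<phi> \<longrightarrow> \<phi> \<le> pi / 2 - \<delta> \<longrightarrow> (J has_real_derivative (U \<phi>)\<^sup>2) (at \<phi>)"
      "J (pi / 2 - \<delta>) - J \<delta> \<le> 1" using jacobi_U_square_antiderivative[OF ab \<delta>(1,2) int] unfolding U_def by blast
    have bulk: "\<bar>U x\<bar> \<le> L \<and> \<bar>U1 x\<bar> \<le> L * \<nu> \<and> \<bar>Z x\<bar> \<le> L2 * \<nu> \<and> \<bar>Z1 x\<bar> \<le> L3 * \<nu> * \<nu>"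
      if x: "\<delta> \<le> x" "x \<le> pi / 2 - \<delta>" for x
    proof -
      have E: "(U1 x)\<^sup>2 + \<nu>\<^sup>2 * (U x)\<^sup>2 \<le> L\<^sup>2 * \<nu>\<^sup>2"
      proof -
        have "(U1 x)\<^sup>2 + \<nu>\<^sup>2 * (U x)\<^sup>2 \<le> K5 * \<nu>\<^sup>2" by (rule b5[OF ns(6) oU J x])
        also have "\<dots> \<le> L\<^sup>2 * \<nu>\<^sup>2" by (intro mult_right_mono) (auto simp: L_def)
        finally show ?thesis .
      qed
      have "\<nu>\<^sup>2 * (U x)\<^sup>2 \<le> \<nu>\<^sup>2 * L\<^sup>2" using E zero_le_power2[of "U1 x"] by (simp only: mult.commute)
      then have "(U x)\<^sup>2 \<le> L\<^sup>2" using ns by simp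
      then have u: "\<bar>U x\<bar> \<le> L" using nn abs_le_square_iff[of "U x" L] by simp
      have "0 \<le> \<nu>\<^sup>2 * (U x)\<^sup>2" by simp
      then have "(U1 x)\<^sup>2 \<le> (L * \<nu>)\<^sup>2" using E by (simp only: power_mult_distrib)
      then have "\<bar>U1 x\<bar> \<le> \<bar>L * \<nu>\<bar>" by (simp only: abs_le_square_iff)
      then have u1: "\<bar>U1 x\<bar> \<le> L * \<nu>" using nn ns by simp
      have r: "\<bar>jacobi_r a b x\<bar> \<le> R"
      proof -
        have s: "sin \<delta> \<le> sin x" using x \<delta> pi_gt_zero by (intro sin_monotone_2pi_le) auto
        have "sin \<delta> = cos (pi / 2 - \<delta>)" by (simp add: cos_diff)
        also have "\<dots> \<le> cos x" using x \<delta> pi_gt_zero by (intro cos_monotone_0_pi_le) auto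
        finally have c: "sin \<delta> \<le> cos x" .
        have p: "sin x > 0" "cos x > 0" using s c sd by auto
        have "a * cos x / sin x \<le> a * 1 / sin \<delta>" using ab s sd p by (intro frac_le mult_left_mono) auto
        moreover have "b * sin x / cos x \<le> b * 1 / sin \<delta>" using ab c sd p by (intro frac_le mult_left_mono) auto
        moreover have "0 \<le> a * cos x / sin x" "0 \<le> b * sin x / cos x" "0 \<le> a / sin \<delta>" "0 \<le> b / sin \<delta>" using ab p sd by auto
        ultimately show ?thesis unfolding jacobi_r_def R_def add_divide_distrib by simp
      qed
      have ru: "\<bar>jacobi_r a b x * U x\<bar> \<le> R * L * \<nu>"
      proof -
        have "\<bar>jacobi_r a b x * U x\<bar> \<le> R * L" unfolding abs_mult using r u nn by (intro mult_mono) auto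
        also have "\<dots> \<le> R * L * \<nu>" using mult_left_mono[of 1 \<nu> "R * L"] nn ns by simp
        finally show ?thesis .
      qed
      \<comment> \<open>The definition of \<open>U1\<close> is solved for \<open>Z\<close>.\<close>
      have "4 * Z x = jacobi_r a b x * U x - U1 x" by (simp add: U1_def)
      then have z: "\<bar>Z x\<bar> \<le> L2 * \<nu>" using ru u1 unfolding L2_def distrib_right by linarith
      have "\<bar>- jacobi_r a b x * Z x\<bar> \<le> R * (L2 * \<nu>)" unfolding abs_mult using r z nn ns by (intro mult_mono) auto
      also have "\<dots> \<le> R * (L2 * \<nu>) * \<nu>" using mult_left_mono[of 1 \<nu> "R * (L2 * \<nu>)"] nn ns by simp
      finally have z1: "\<bar>- jacobi_r a b x * Z x\<bar> \<le> R * (L2 * \<nu>) * \<nu>" .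
      have "\<mu> \<le> \<nu> * \<nu>" using \<nu> \<mu> zero_le_power2[of "a + b"] by (simp add: power2_eq_square)
      then have "\<bar>\<mu> * U x\<bar> \<le> \<nu> * \<nu> * L" unfolding abs_mult using u \<mu> nn by (intro mult_mono) auto
      then have "\<bar>Z1 x\<bar> \<le> R * (L2 * \<nu>) * \<nu> + \<nu> * \<nu> * L" unfolding Z1_def using z1 by linarith
      also have "\<dots> = L3 * \<nu> * \<nu>" by (simp add: L3_def algebra_simps)
      finally show ?thesis using u u1 z by simp
    qed
    have d1: "\<delta> \<le> \<delta>" "\<delta> \<le> pi / 2 - \<delta>" and d2: "\<delta> \<le> pi / 2 - \<delta>" "pi / 2 - \<delta> \<le> pi / 2 - \<delta>"
      using \<delta> pi_gt_zero by auto
    \<comment> \<open>\<open>Z\<close> and \<open>Z1\<close> have sizes \<open>\<nu>\<close> and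
      \<open>\<nu>^2\<close> respectively; this \<open>M\<close> brings them into the form that the
      endpoint estimate expects.\<close>
    define M where "M = (L2 + L3) * \<nu>"
    have M: "L2 * \<nu> \<le> M" "L3 * \<nu> * \<nu> \<le> M * \<nu>" using nn ns by (auto simp: M_def algebra_simps)
    have Ub: "\<bar>U \<phi>\<bar> \<le> K"
    proof -
      consider "\<phi> \<le> \<delta>" | "\<delta> \<le> \<phi>" "\<phi> \<le> pi / 2 - \<delta>" | "pi / 2 - \<delta> \<le> \<phi>" by linarith
      then show ?thesis
      proof cases
        case 1
        have "\<bar>U \<phi>\<bar> \<le> K1 * L"
        proof (rule b1[OF ns(2) oU _ _ _ \<phi>(1) 1])
          show "A > 0 \<longrightarrow> (U \<longlongrightarrow> 0) (at_right 0)"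
          proof
            assume "A > 0"
            then have "a > 0" using ab by (cases "a = 0") (auto simp: A_def)
            then show "(U \<longlongrightarrow> 0) (at_right 0)" unfolding U_def using ab by (intro jacobi_U_tendsto_0)
          qed
        qed (use bulk[OF d1] in auto)
        also have "\<dots> \<le> \<bar>K1\<bar> * L" using nn by (intro mult_right_mono) auto
        finally show ?thesis using K by linarith
      next
        case 2
        then show ?thesis using bulk[OF 2] K by linarith
      next
        case 3
        have "\<bar>U (pi / 2 - (pi / 2 - \<phi>))\<bar> \<le> K2 * L"
        proof (rule b2[OF ns(3) osc_eq_reflect[OF oU]])
          show "B > 0 \<longrightarrow> ((\<lambda>\<phi>. U (pi / 2 - \<phi>)) \<longlongrightarrow> 0) (at_right 0)"
          proof
            assume "B > 0"
            then have "b > 0" using ab by (cases "b = 0") (auto simp: B_def)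
            then show "((\<lambda>\<phi>. U (pi / 2 - \<phi>)) \<longlongrightarrow> 0) (at_right 0)" unfolding U_def using ab by (intro jacobi_U_reflect_tendsto_0)
          qed
        qed (use bulk[OF d2] \<phi> 3 in auto)
        also have "\<dots> \<le> \<bar>K2\<bar> * L" using nn by (intro mult_right_mono) auto
        finally show ?thesis using K by simp
      qed
    qed
    have Zb: "\<bar>Z \<phi>\<bar> \<le> K * \<nu>"
    proof -
      consider "\<phi> \<le> \<delta>" | "\<delta> \<le> \<phi>" "\<phi> \<le> pi / 2 - \<delta>" | "pi / 2 - \<delta> \<le> \<phi>" by linarith
      then show ?thesis
      proof cases
        case 1
        have "\<bar>Z \<phi>\<bar> \<le> K3 * M"
        proof (rule b3[OF ns(4) oZ _ _ _ \<phi>(1) 1])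
          show "A' > 0 \<longrightarrow> (Z \<longlongrightarrow> 0) (at_right 0)" unfolding Z_def using ab by (auto intro!: jacobi_U_tendsto_0)
        qed (use bulk[OF d1] M in auto)
        also have "\<dots> \<le> \<bar>K3\<bar> * M" using nn ns by (intro mult_right_mono) (auto simp: M_def)
        also have "\<dots> = (\<bar>K3\<bar> * (L2 + L3)) * \<nu>" by (simp add: M_def)
        also have "\<dots> \<le> K * \<nu>" using K ns by (intro mult_right_mono) auto
        finally show ?thesis .
      next
        case 2
        have "L2 * \<nu> \<le> K * \<nu>" using K ns by (intro mult_right_mono) auto
        then show ?thesis using bulk[OF 2] by linarith
      next
        case 3
        have "\<bar>Z (pi / 2 - (pi / 2 - \<phi>))\<bar> \<le> K4 * M"
        proof (rule b4[OF ns(5) osc_eq_reflect[OF oZ]])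
          show "B' > 0 \<longrightarrow> ((\<lambda>\<phi>. Z (pi / 2 - \<phi>)) \<longlongrightarrow> 0) (at_right 0)" unfolding Z_def using ab by (auto intro!: jacobi_U_reflect_tendsto_0)
        qed (use bulk[OF d2] \<phi> 3 M in auto)
        also have "\<dots> \<le> \<bar>K4\<bar> * M" using nn ns by (intro mult_right_mono) (auto simp: M_def)
        also have "\<dots> = (\<bar>K4\<bar> * (L2 + L3)) * \<nu>" by (simp add: M_def)
        also have "\<dots> \<le> K * \<nu>" using K ns by (intro mult_right_mono) auto
        finally show ?thesis by simp
      qed
    qed
    show ?thesis using Ub Zb by (simp add: U_def Z_def)
  qed
  show ?thesis by (intro exI[of _ \<nu>0] exI[of _ K]) (use main in blast)
qed

text \<open>For the eigenvalue of index \<open>n\<close> the frequency is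
  \<open>\<nu> = 2 * n + a + b\<close>, which is large for all but finitely many \<open>n\<close>.
  The finitely many remaining polynomials are bounded by compactness. The additional 1 keeps the
  factor at least 1 when \<open>n = 0\<close>.\<close>

lemma jacobi_uniform_bound:
  fixes y :: "nat \<Rightarrow> real poly"
  assumes ab: "a \<ge> 0" "b \<ge> 0"
    and ode: "\<And>n. jacobi_ode (a - 1/2) (b - 1/2) (real n * (real n + a + b)) (y n)"
    and int: "\<And>n. (\<lambda>x. (poly (y n) x)\<^sup>2 * jacobi_weight (a - 1/2) (b - 1/2) x) integrable_on {-1..1}"
      "\<And>n. integral {-1..1} (\<lambda>x. (poly (y n) x)\<^sup>2 * jacobi_weight (a - 1/2) (b - 1/2) x) \<le> 1"
  shows "\<exists>K\<ge>0. \<forall>n \<phi>. 0 < \<phi> \<longrightarrow> \<phi> < pi / 2 \<longrightarrow> \<bar>jacobi_U a b (y n) \<phi>\<bar> \<le> K \<and>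
     \<bar>jacobi_U (a + 1) (b + 1) (pderiv (y n)) \<phi>\<bar> \<le> K * (2 * real n + a + b + 1)"
proof -
  obtain \<nu>0 K where big: "\<And>\<nu> \<mu> y \<phi>. \<nu> \<ge> \<nu>0 \<Longrightarrow> \<nu>\<^sup>2 = 4 * \<mu> + (a + b)\<^sup>2 \<Longrightarrow> \<mu> \<ge> 0 \<Longrightarrow>
     jacobi_ode (a - 1/2) (b - 1/2) \<mu> y \<Longrightarrow>
     (\<lambda>x. (poly y x)\<^sup>2 * jacobi_weight (a - 1/2) (b - 1/2) x) integrable_on {-1..1} \<Longrightarrow>
     integral {-1..1} (\<lambda>x. (poly y x)\<^sup>2 * jacobi_weight (a - 1/2) (b - 1/2) x) \<le> 1 \<Longrightarrow>
     0 < \<phi> \<Longrightarrow> \<phi> < pi / 2 \<Longrightarrow>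
     \<bar>jacobi_U a b y \<phi>\<bar> \<le> K \<and> \<bar>jacobi_U (a + 1) (b + 1) (pderiv y) \<phi>\<bar> \<le> K * \<nu>"
    using jacobi_large_bound[OF ab] by blast
  have "\<exists>M\<ge>0. \<forall>\<phi>. 0 < \<phi> \<longrightarrow> \<phi> < pi / 2 \<longrightarrow> \<bar>jacobi_U a b (y n) \<phi>\<bar> \<le> M \<and> \<bar>jacobi_U (a + 1) (b + 1) (pderiv (y n)) \<phi>\<bar> \<le> M" for n
  proof -
    obtain M1 where M1: "M1 \<ge> 0" "\<forall>x\<in>{-1..1}. \<bar>poly (y n) x\<bar> \<le> M1" using poly_bounded_Icc by blast
    obtain M2 where M2: "M2 \<ge> 0" "\<forall>x\<in>{-1..1}. \<bar>poly (pderiv (y n)) x\<bar> \<le> M2" using poly_bounded_Icc by blast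
    have "\<bar>jacobi_U a b (y n) \<phi>\<bar> \<le> M1 + M2 \<and> \<bar>jacobi_U (a + 1) (b + 1) (pderiv (y n)) \<phi>\<bar> \<le> M1 + M2" if "0 < \<phi>" "\<phi> < pi / 2" for \<phi>
      using jacobi_U_le(3)[OF ab M1 that] jacobi_U_le(3)[of "a + 1" "b + 1" M2 "pderiv (y n)" \<phi>] ab M1(1) M2 that by auto
    then show ?thesis using M1(1) M2(1) by (intro exI[of _ "M1 + M2"]) auto
  qed
  then obtain M where M: "\<And>n. M n \<ge> 0" "\<And>n \<phi>. 0 < \<phi> \<Longrightarrow> \<phi> < pi / 2 \<Longrightarrow> \<bar>jacobi_U a b (y n) \<phi>\<bar> \<le> M n \<and> \<bar>jacobi_U (a + 1) (b + 1) (pderiv (y n)) \<phi>\<bar> \<le> M n"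
    by metis
  define N where "N = nat \<lceil>\<nu>0\<rceil>"
  define C where "C = \<bar>K\<bar> + (\<Sum>n<N. M n)"
  have SM: "(\<Sum>n<N. M n) \<ge> 0" using M(1) by (simp add: sum_nonneg)
  have C: "C \<ge> 0" "K \<le> C" using SM by (auto simp: C_def)
  have "\<bar>jacobi_U a b (y n) \<phi>\<bar> \<le> C \<and> \<bar>jacobi_U (a + 1) (b + 1) (pderiv (y n)) \<phi>\<bar> \<le> C * (2 * real n + a + b + 1)"
    if \<phi>: "0 < \<phi>" "\<phi> < pi / 2" for n \<phi>
  proof (cases "n < N")
    case True
    have "M n \<le> (\<Sum>n<N. M n)" using True M(1) by (intro member_le_sum) auto
    then have "M n \<le> C" by (simp add: C_def)
    moreover have "C * 1 \<le> C * (2 * real n + a + b + 1)" using C ab by (intro mult_left_mono) auto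
    ultimately show ?thesis using M(2)[OF \<phi>, of n] by auto
  next
    case False
    then have "\<nu>0 \<le> real n" unfolding N_def by linarith
    then have n: "\<nu>0 \<le> 2 * real n + a + b" using ab by linarith
    have "\<bar>jacobi_U a b (y n) \<phi>\<bar> \<le> K \<and> \<bar>jacobi_U (a + 1) (b + 1) (pderiv (y n)) \<phi>\<bar> \<le> K * (2 * real n + a + b)"
      by (rule big[OF n _ _ ode int \<phi>]) (use ab in \<open>auto simp: power2_eq_square algebra_simps\<close>)
    moreover have "K * (2 * real n + a + b) \<le> C * (2 * real n + a + b + 1)" using C ab by (intro mult_mono) auto
    ultimately show ?thesis using C by linarith
  qed
  then show ?thesis using C(1) by blast
qed

section \<open>The kernel of the interval multiplier\<close>

lemma has_integral_inverse_sqrt: "((\<lambda>x. 1 / sqrt (1 - x\<^sup>2)) has_integral pi) {-1..1}"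
proof -
  have "((\<lambda>x. 1 / sqrt (1 - x\<^sup>2)) has_integral (arcsin 1 - arcsin (- 1))) {-1..1}"
  proof (rule fundamental_theorem_of_calculus_interior)
    show "continuous_on {- 1..1} arcsin" by (rule continuous_on_arcsin')
    show "(arcsin has_vector_derivative 1 / sqrt (1 - x\<^sup>2)) (at x)" if "x \<in> {- 1<..<1}" for x
      using DERIV_arcsin[of x] that by (simp add: has_real_derivative_iff_has_vector_derivative[symmetric] inverse_eq_divide)
  qed simp
  then show ?thesis by simp
qed

section \<open>The Jacobi measure and the orthonormalised polynomials\<close>

lemma jacobi_weight_measurable [measurable]: "jacobi_weight \<alpha> \<beta> \<in> borel_measurable borel"
  unfolding jacobi_weight_def by measurable

lemma jacobi_weight_nonneg [simp]: "jacobi_weight \<alpha> \<beta> x \<ge> 0"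
  by (simp add: jacobi_weight_def)

text \<open>For exponents at least \<open>-1/2\<close> the weight is a bounded multiple of the
  Chebyshev weight \<open>1 / sqrt (1 - x^2)\<close>, whose integral is \<open>pi\<close>.\<close>

lemma jacobi_weight_integrable:
  assumes ab: "\<alpha> \<ge> -1/2" "\<beta> \<ge> -1/2"
  shows "integrable lborel (\<lambda>x. indicator {-1..1} x * jacobi_weight \<alpha> \<beta> x)"
proof -
  define g where "g x = (if x \<in> {-1..1} then 1 / sqrt (1 - x\<^sup>2) else 0)" for x :: real
  have gm [measurable]: "g \<in> borel_measurable borel" unfolding g_def by measurable
  have g0: "g x \<ge> 0" for x
  proof -
    have "x\<^sup>2 \<le> 1" if "x \<in> {-1..1}" using that by (auto simp: abs_square_le_1 abs_le_iff)
    then show ?thesis by (auto simp: g_def)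
  qed
  have "(g has_integral pi) UNIV"
    unfolding g_def has_integral_restrict_UNIV by (rule has_integral_inverse_sqrt)
  then have "(\<integral>\<^sup>+ x. ennreal (g x) \<partial>lborel) = ennreal pi"
    by (intro nn_integral_has_integral_lborel) (auto simp: g0)
  then have gi: "integrable lborel g" by (intro integrableI_nonneg) (auto simp: g0)
  define c where "c = 2 powr (\<alpha> + 1/2) * 2 powr (\<beta> + 1/2)"
  have b: "norm (indicator {-1..1} x * jacobi_weight \<alpha> \<beta> x) \<le> c * g x" for x
  proof (cases "-1 < x \<and> x < 1")
    case True
    have e: "(1 - x) powr \<alpha> = (1 - x) powr (\<alpha> + 1/2) / sqrt (1 - x)" "(1 + x) powr \<beta> = (1 + x) powr (\<beta> + 1/2) / sqrt (1 + x)"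
      using True powr_diff[of "1 - x" "\<alpha> + 1/2" "1/2"] powr_diff[of "1 + x" "\<beta> + 1/2" "1/2"] by (auto simp: powr_half_sqrt)
    have s: "sqrt (1 - x) * sqrt (1 + x) = sqrt (1 - x\<^sup>2)"
      by (simp add: real_sqrt_mult[symmetric] algebra_simps power2_eq_square)
    have "jacobi_weight \<alpha> \<beta> x = (1 - x) powr (\<alpha> + 1/2) * (1 + x) powr (\<beta> + 1/2) * (1 / sqrt (1 - x\<^sup>2))"
      unfolding jacobi_weight_def e s[symmetric] by simp
    also have "\<dots> \<le> c * (1 / sqrt (1 - x\<^sup>2))"
    proof (rule mult_right_mono)
      show "(1 - x) powr (\<alpha> + 1/2) * (1 + x) powr (\<beta> + 1/2) \<le> c"
        unfolding c_def using True ab by (intro mult_mono powr_mono2) auto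
      show "0 \<le> 1 / sqrt (1 - x\<^sup>2)" using g0[of x] True by (simp add: g_def)
    qed
    finally show ?thesis using True by (simp add: g_def)
  next
    case False
    \<comment> \<open>At the endpoints both sides are 0, since \<open>0 powr \<alpha> = 0\<close>
      and \<open>1 / 0 = 0\<close>.\<close>
    have "x \<in> {-1..1} \<Longrightarrow> x = 1 \<or> x = -1" using False by auto
    then show ?thesis using g0[of x] by (cases "x \<in> {-1..1}") (auto simp: jacobi_weight_def c_def)
  qed
  show ?thesis
  proof (rule Bochner_Integration.integrable_bound[where f = "\<lambda>x. c * g x"])
    show "integrable lborel (\<lambda>x. c * g x)" using gi by simp
    show "AE x in lborel. norm (indicator {-1..1} x * jacobi_weight \<alpha> \<beta> x) \<le> norm (c * g x)"
      using order.trans[OF b abs_ge_self] by (intro AE_I2) (simp only: real_norm_def)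
  qed measurable
qed

lemma jacobi_measure_finite:
  assumes ab: "\<alpha> \<ge> -1/2" "\<beta> \<ge> -1/2"
  shows "finite_measure (jacobi_measure \<alpha> \<beta>)"
proof
  have "(\<integral>\<^sup>+ x. ennreal (indicator {-1..1} x * jacobi_weight \<alpha> \<beta> x) \<partial>lborel) < \<infinity>"
    using jacobi_weight_integrable[OF ab] by (subst (asm) integrable_iff_bounded) (auto simp: abs_mult)
  then show "emeasure (jacobi_measure \<alpha> \<beta>) (space (jacobi_measure \<alpha> \<beta>)) \<noteq> \<infinity>"
    by (simp add: jacobi_measure_def emeasure_density)
qed

lemma sets_jacobi_measure [simp, measurable_cong]: "sets (jacobi_measure \<alpha> \<beta>) = sets borel"
  by (simp add: jacobi_measure_def)

lemma space_jacobi_measure [simp]: "space (jacobi_measure \<alpha> \<beta>) = UNIV"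
  by (simp add: jacobi_measure_def)

lemma jacobi_on_measurable [measurable]: "jacobi_on \<alpha> \<beta> n \<in> borel_measurable borel"
proof -
  have "(\<lambda>x. if -1 < x \<and> x < 1 then poly (jacobi_on_poly \<alpha> \<beta> n) x else 0) \<in> borel_measurable borel"
    by measurable (auto intro!: borel_measurable_continuous_onI continuous_intros)
  then show ?thesis by (simp add: jacobi_on_eq[abs_def])
qed

lemma jacobi_on_bounded: "\<exists>M\<ge>0. \<forall>x. \<bar>jacobi_on \<alpha> \<beta> n x\<bar> \<le> M"
proof -
  obtain M where "M \<ge> 0" "\<forall>x\<in>{-1..1}. \<bar>poly (jacobi_on_poly \<alpha> \<beta> n) x\<bar> \<le> M" using poly_bounded_Icc by blast
  then show ?thesis by (intro exI[of _ M]) (auto simp: jacobi_on_eq)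
qed

lemma jacobi_measure_integrable_bounded:
  fixes F :: "real \<Rightarrow> real"
  assumes ab: "\<alpha> \<ge> -1/2" "\<beta> \<ge> -1/2" and F: "F \<in> borel_measurable borel" "\<And>x. \<bar>F x\<bar> \<le> M"
  shows "integrable (jacobi_measure \<alpha> \<beta>) F"
proof -
  interpret finite_measure "jacobi_measure \<alpha> \<beta>" by (rule jacobi_measure_finite[OF ab])
  show ?thesis using F by (intro integrable_const_bound[where B = M]) auto
qed

lemma jacobi_on_mult_integrable:
  assumes ab: "\<alpha> \<ge> -1/2" "\<beta> \<ge> -1/2"
  shows "integrable (jacobi_measure \<alpha> \<beta>) (\<lambda>x. jacobi_on \<alpha> \<beta> m x * jacobi_on \<alpha> \<beta> n x)"
proof -
  obtain M1 where M1: "M1 \<ge> 0" "\<forall>x. \<bar>jacobi_on \<alpha> \<beta> m x\<bar> \<le> M1" using jacobi_on_bounded by blast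
  obtain M2 where M2: "M2 \<ge> 0" "\<forall>x. \<bar>jacobi_on \<alpha> \<beta> n x\<bar> \<le> M2" using jacobi_on_bounded by blast
  show ?thesis
    by (rule jacobi_measure_integrable_bounded[OF ab, where M = "M1 * M2"])
       (use M1 M2 in \<open>auto simp: abs_mult intro!: mult_mono\<close>)
qed

text \<open>The bridge from the density measure of the definitions to the gauge integral, for which
  the fundamental theorem of calculus is available.\<close>

lemma jacobi_integral_Icc:
  fixes F :: "real \<Rightarrow> real"
  assumes ab: "\<alpha> \<ge> -1/2" "\<beta> \<ge> -1/2" and F: "F \<in> borel_measurable borel" "\<And>x. \<bar>F x\<bar> \<le> M"
    and cd: "-1 \<le> c" "d \<le> 1"
  shows "(\<lambda>x. F x * jacobi_weight \<alpha> \<beta> x) integrable_on {c..d}"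
    "set_lebesgue_integral (jacobi_measure \<alpha> \<beta>) {c..d} F = integral {c..d} (\<lambda>x. F x * jacobi_weight \<alpha> \<beta> x)"
proof -
  have i: "integrable (jacobi_measure \<alpha> \<beta>) (\<lambda>x. indicator {c..d} x *\<^sub>R F x)"
  proof (rule jacobi_measure_integrable_bounded[OF ab])
    show "(\<lambda>x. indicator {c..d} x *\<^sub>R F x) \<in> borel_measurable borel" using F(1) by measurable
    show "\<bar>indicator {c..d} x *\<^sub>R F x\<bar> \<le> M" for x
      using F(2)[of x] abs_ge_zero[of "F x"] by (auto simp: indicator_def)
  qed
  have e: "(indicator {-1..1} x * jacobi_weight \<alpha> \<beta> x) *\<^sub>R (indicator {c..d} x *\<^sub>R F x) = indicator {c..d} x *\<^sub>R (F x * jacobi_weight \<alpha> \<beta> x)" for x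
    using cd by (auto simp: indicator_def)
  have "integrable lborel (\<lambda>x. (indicator {-1..1} x * jacobi_weight \<alpha> \<beta> x) *\<^sub>R (indicator {c..d} x *\<^sub>R F x))"
    using i F(1) unfolding jacobi_measure_def by (subst (asm) integrable_density) auto
  then have s: "set_integrable lborel {c..d} (\<lambda>x. F x * jacobi_weight \<alpha> \<beta> x)"
    unfolding set_integrable_def e .
  show "(\<lambda>x. F x * jacobi_weight \<alpha> \<beta> x) integrable_on {c..d}" by (rule set_borel_integral_eq_integral(1)[OF s])
  have "set_lebesgue_integral (jacobi_measure \<alpha> \<beta>) {c..d} F = (\<integral>x. (indicator {-1..1} x * jacobi_weight \<alpha> \<beta> x) *\<^sub>R (indicator {c..d} x *\<^sub>R F x) \<partial>lborel)"
    unfolding set_lebesgue_integral_def jacobi_measure_def using F(1) by (intro integral_density) auto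
  also have "\<dots> = set_lebesgue_integral lborel {c..d} (\<lambda>x. F x * jacobi_weight \<alpha> \<beta> x)"
    unfolding set_lebesgue_integral_def e ..
  also have "\<dots> = integral {c..d} (\<lambda>x. F x * jacobi_weight \<alpha> \<beta> x)" by (rule set_borel_integral_eq_integral(2)[OF s])
  finally show "set_lebesgue_integral (jacobi_measure \<alpha> \<beta>) {c..d} F = integral {c..d} (\<lambda>x. F x * jacobi_weight \<alpha> \<beta> x)" .
qed

lemma jacobi_integral_total:
  fixes F :: "real \<Rightarrow> real"
  assumes [measurable]: "F \<in> borel_measurable borel"
  shows "(\<integral>x. F x \<partial>jacobi_measure \<alpha> \<beta>) = set_lebesgue_integral (jacobi_measure \<alpha> \<beta>) {-1..1} F"
proof -
  have d: "(\<integral>x. G x \<partial>jacobi_measure \<alpha> \<beta>) = (\<integral>x. (indicator {-1..1} x * jacobi_weight \<alpha> \<beta> x) *\<^sub>R G x \<partial>lborel)"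
    if "G \<in> borel_measurable borel" for G :: "real \<Rightarrow> real"
    unfolding jacobi_measure_def using that by (intro integral_density) auto
  have "(\<lambda>x. indicator {-1..1} x *\<^sub>R F x) \<in> borel_measurable borel" by measurable
  then show ?thesis unfolding set_lebesgue_integral_def d[OF assms] d[OF \<open>(\<lambda>x. indicator {-1..1} x *\<^sub>R F x) \<in> borel_measurable borel\<close>]
    by (intro Bochner_Integration.integral_cong) (auto simp: indicator_def)
qed

text \<open>The integral is a quotient of a number by itself, which is 1, or 0 by the convention for
  division by 0; the inequality covers both cases.\<close>

lemma jacobi_on_square_integral_le_1:
  "(\<integral>x. (jacobi_on \<alpha> \<beta> n x)\<^sup>2 \<partial>jacobi_measure \<alpha> \<beta>) \<le> 1"
proof -
  have "(\<integral>x. (jacobi_on \<alpha> \<beta> n x)\<^sup>2 \<partial>jacobi_measure \<alpha> \<beta>) = (\<integral>x. (jacobiP \<alpha> \<beta> n x)\<^sup>2 \<partial>jacobi_measure \<alpha> \<beta>) / (jacobi_norm \<alpha> \<beta> n)\<^sup>2"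
    by (simp add: jacobi_on_def power_divide)
  also have "(jacobi_norm \<alpha> \<beta> n)\<^sup>2 = (\<integral>x. (jacobiP \<alpha> \<beta> n x)\<^sup>2 \<partial>jacobi_measure \<alpha> \<beta>)"
    unfolding jacobi_norm_def by (intro real_sqrt_pow2 integral_nonneg_AE) auto
  finally show ?thesis by simp
qed

section \<open>Wronskians, orthogonality and boundary terms\<close>

definition jacobi_wronskian :: "real \<Rightarrow> real \<Rightarrow> real poly \<Rightarrow> real poly \<Rightarrow> real \<Rightarrow> real" where
  "jacobi_wronskian \<alpha> \<beta> y z x = (1 - x) powr (\<alpha> + 1) * (1 + x) powr (\<beta> + 1) *
     (poly y x * poly (pderiv z) x - poly (pderiv y) x * poly z x)"

text \<open>Lagrange's identity for the Sturm-Liouville form of the Jacobi equation: the derivative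
  of the factor \<open>(1 - x)^(\<alpha>+1) (1 + x)^(\<beta>+1)\<close> combines with the
  first-order coefficients.\<close>

lemma jacobi_wronskian_deriv:
  assumes x: "-1 < x" "x < 1" and y: "jacobi_ode \<alpha> \<beta> \<mu> y" and z: "jacobi_ode \<alpha> \<beta> \<nu> z"
  shows "(jacobi_wronskian \<alpha> \<beta> y z has_real_derivative
     (\<mu> - \<nu>) * (poly y x * poly z x * jacobi_weight \<alpha> \<beta> x)) (at x)"
proof -
  define A where "A = (1 - x) powr \<alpha>"
  define B where "B = (1 + x) powr \<beta>"
  have pw: "(1 - x) powr (\<alpha> + 1) = A * (1 - x)" "(1 + x) powr (\<beta> + 1) = B * (1 + x)"
    using x powr_add[of "1 - x" \<alpha> 1] powr_add[of "1 + x" \<beta> 1] by (auto simp: A_def B_def)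
  have d1: "((\<lambda>t. (1 - t) powr (\<alpha> + 1)) has_real_derivative - ((\<alpha> + 1) * A)) (at x)"
    unfolding A_def using x by (auto intro!: derivative_eq_intros)
  have d2: "((\<lambda>t. (1 + t) powr (\<beta> + 1)) has_real_derivative (\<beta> + 1) * B) (at x)"
    unfolding B_def using x by (auto intro!: derivative_eq_intros)
  define y0 where "y0 = poly y x"
  define y1 where "y1 = poly (pderiv y) x"
  define y2 where "y2 = poly (pderiv (pderiv y)) x"
  define z0 where "z0 = poly z x"
  define z1 where "z1 = poly (pderiv z) x"
  define z2 where "z2 = poly (pderiv (pderiv z)) x"
  have oy: "(1 - x\<^sup>2) * y2 + (\<beta> - \<alpha> - (\<alpha> + \<beta> + 2) * x) * y1 + \<mu> * y0 = 0"
    using y unfolding jacobi_ode_def y0_def y1_def y2_def by blast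
  have oz: "(1 - x\<^sup>2) * z2 + (\<beta> - \<alpha> - (\<alpha> + \<beta> + 2) * x) * z1 + \<nu> * z0 = 0"
    using z unfolding jacobi_ode_def z0_def z1_def z2_def by blast
  have "(jacobi_wronskian \<alpha> \<beta> y z has_real_derivative
     ((- ((\<alpha> + 1) * A)) * (B * (1 + x)) + ((\<beta> + 1) * B) * (A * (1 - x))) * (y0 * z1 - y1 * z0)
     + ((y1 * z1 + z2 * y0) - (y2 * z0 + z1 * y1)) * (A * (1 - x) * (B * (1 + x)))) (at x)"
    unfolding jacobi_wronskian_def[abs_def] pw[symmetric] y0_def y1_def y2_def z0_def z1_def z2_def
    by (intro DERIV_mult[OF DERIV_mult[OF d1 d2]] DERIV_diff DERIV_mult poly_DERIV)
  moreover have "((- ((\<alpha> + 1) * A)) * (B * (1 + x)) + ((\<beta> + 1) * B) * (A * (1 - x))) * (y0 * z1 - y1 * z0)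
     + ((y1 * z1 + z2 * y0) - (y2 * z0 + z1 * y1)) * (A * (1 - x) * (B * (1 + x)))
    = A * B * (y0 * ((1 - x\<^sup>2) * z2 + (\<beta> - \<alpha> - (\<alpha> + \<beta> + 2) * x) * z1)
       - z0 * ((1 - x\<^sup>2) * y2 + (\<beta> - \<alpha> - (\<alpha> + \<beta> + 2) * x) * y1))"
    by (simp add: algebra_simps power2_eq_square)
  moreover have "(1 - x\<^sup>2) * z2 + (\<beta> - \<alpha> - (\<alpha> + \<beta> + 2) * x) * z1 = - \<nu> * z0" using oz by simp
  moreover have "(1 - x\<^sup>2) * y2 + (\<beta> - \<alpha> - (\<alpha> + \<beta> + 2) * x) * y1 = - \<mu> * y0" using oy by simp
  moreover have "A * B * (y0 * (- \<nu> * z0) - z0 * (- \<mu> * y0)) = (\<mu> - \<nu>) * (y0 * z0 * (A * B))" by (simp add: algebra_simps)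
  ultimately show ?thesis by (simp only: y0_def z0_def A_def B_def jacobi_weight_def)
qed

text \<open>Lagrange's identity holds in the open interval, and the Wronskian is continuous up to
  \<open>-1\<close> and \<open>1\<close> because the exponents \<open>\<alpha> + 1\<close> and
  \<open>\<beta> + 1\<close> are positive, so the fundamental theorem applies up to the
  endpoints.\<close>

lemma jacobi_kernel_wronskian:
  assumes ab: "\<alpha> \<ge> -1/2" "\<beta> \<ge> -1/2" and cd: "-1 \<le> c" "c \<le> d" "d \<le> 1"
  shows "(real m * (real m + \<alpha> + \<beta> + 1) - real n * (real n + \<alpha> + \<beta> + 1)) * jacobi_kernel \<alpha> \<beta> c d m n
    = jacobi_wronskian \<alpha> \<beta> (jacobi_on_poly \<alpha> \<beta> m) (jacobi_on_poly \<alpha> \<beta> n) d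
      - jacobi_wronskian \<alpha> \<beta> (jacobi_on_poly \<alpha> \<beta> m) (jacobi_on_poly \<alpha> \<beta> n) c"
proof -
  define y where "y = jacobi_on_poly \<alpha> \<beta> m"
  define z where "z = jacobi_on_poly \<alpha> \<beta> n"
  define k where "k = real m * (real m + \<alpha> + \<beta> + 1) - real n * (real n + \<alpha> + \<beta> + 1)"
  define W where "W = jacobi_wronskian \<alpha> \<beta> y z"
  have "((\<lambda>x. k * (poly y x * poly z x * jacobi_weight \<alpha> \<beta> x)) has_integral (W d - W c)) {c..d}"
  proof (rule fundamental_theorem_of_calculus_interior[OF cd(2)])
    show "continuous_on {c..d} W" unfolding W_def jacobi_wronskian_def[abs_def]
      using ab cd by (intro continuous_intros continuous_on_powr') auto
    fix x assume "x \<in> {c<..<d}"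
    then have "-1 < x" "x < 1" using cd by auto
    from jacobi_wronskian_deriv[OF this jacobi_on_poly_ode[of \<alpha> \<beta> m] jacobi_on_poly_ode[of \<alpha> \<beta> n]]
    show "(W has_vector_derivative k * (poly y x * poly z x * jacobi_weight \<alpha> \<beta> x)) (at x)"
      unfolding W_def y_def z_def k_def by (simp add: has_real_derivative_iff_has_vector_derivative)
  qed
  \<comment> \<open>\<open>jacobi_on\<close> is set to 0 at \<open>-1\<close> and \<open>1\<close>,
    so it may differ from the polynomial at these two points.\<close>
  then have hi: "((\<lambda>x. k * (jacobi_on \<alpha> \<beta> m x * jacobi_on \<alpha> \<beta> n x * jacobi_weight \<alpha> \<beta> x)) has_integral (W d - W c)) {c..d}"
    by (rule has_integral_spike_finite[of "{-1, 1}", rotated 2]) (use cd in \<open>auto simp: jacobi_on_eq y_def z_def\<close>)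
  obtain M1 where M1: "M1 \<ge> 0" "\<forall>x. \<bar>jacobi_on \<alpha> \<beta> m x\<bar> \<le> M1" using jacobi_on_bounded by blast
  obtain M2 where M2: "M2 \<ge> 0" "\<forall>x. \<bar>jacobi_on \<alpha> \<beta> n x\<bar> \<le> M2" using jacobi_on_bounded by blast
  have "jacobi_kernel \<alpha> \<beta> c d m n = integral {c..d} (\<lambda>x. jacobi_on \<alpha> \<beta> m x * jacobi_on \<alpha> \<beta> n x * jacobi_weight \<alpha> \<beta> x)"
    unfolding jacobi_kernel_def
    by (rule jacobi_integral_Icc(2)[OF ab _ _ cd(1) cd(3), where M = "M1 * M2"])
       (use M1 M2 in \<open>auto simp: abs_mult intro!: mult_mono\<close>)
  then have "k * jacobi_kernel \<alpha> \<beta> c d m n = integral {c..d} (\<lambda>x. k * (jacobi_on \<alpha> \<beta> m x * jacobi_on \<alpha> \<beta> n x * jacobi_weight \<alpha> \<beta> x))"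
    by simp
  also have "\<dots> = W d - W c" using hi by (rule integral_unique)
  finally show ?thesis unfolding k_def W_def y_def z_def .
qed

lemma jacobi_kernel_diagonal:
  assumes ab: "\<alpha> \<ge> -1/2" "\<beta> \<ge> -1/2"
  shows "\<bar>jacobi_kernel \<alpha> \<beta> c d n n\<bar> \<le> 1"
proof -
  have i: "integrable (jacobi_measure \<alpha> \<beta>) (\<lambda>x. (jacobi_on \<alpha> \<beta> n x)\<^sup>2)"
    using jacobi_on_mult_integrable[OF ab, of n n] by (simp add: power2_eq_square)
  have "\<bar>jacobi_kernel \<alpha> \<beta> c d n n\<bar> \<le> (\<integral>x. (jacobi_on \<alpha> \<beta> n x)\<^sup>2 \<partial>jacobi_measure \<alpha> \<beta>)"
    unfolding jacobi_kernel_def set_lebesgue_integral_def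
  proof (rule integral_abs_bound_integral[OF _ i])
    show "integrable (jacobi_measure \<alpha> \<beta>) (\<lambda>x. indicator {c..d} x *\<^sub>R (jacobi_on \<alpha> \<beta> n x * jacobi_on \<alpha> \<beta> n x))"
      by (intro integrable_mult_indicator jacobi_on_mult_integrable[OF ab]) simp
  qed (auto simp: indicator_def power2_eq_square)
  then show ?thesis using jacobi_on_square_integral_le_1[of \<alpha> \<beta> n] by linarith
qed

text \<open>On the full interval the boundary terms vanish, while the eigenvalue difference
  \<open>(m - n) (m + n + \<alpha> + \<beta> + 1)\<close> is nonzero: for
  \<open>m \<noteq> n\<close> one has \<open>m + n \<ge> 1\<close>, and
  \<open>\<alpha> + \<beta> + 1 \<ge> 0\<close>.\<close>

lemma jacobi_on_orthogonal:
  assumes ab: "\<alpha> \<ge> -1/2" "\<beta> \<ge> -1/2" and mn: "m \<noteq> n"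
  shows "(\<integral>x. jacobi_on \<alpha> \<beta> m x * jacobi_on \<alpha> \<beta> n x \<partial>jacobi_measure \<alpha> \<beta>) = 0"
proof -
  have "(\<integral>x. jacobi_on \<alpha> \<beta> m x * jacobi_on \<alpha> \<beta> n x \<partial>jacobi_measure \<alpha> \<beta>) = jacobi_kernel \<alpha> \<beta> (-1) 1 m n"
    unfolding jacobi_kernel_def by (rule jacobi_integral_total) measurable
  moreover have "(real m * (real m + \<alpha> + \<beta> + 1) - real n * (real n + \<alpha> + \<beta> + 1)) * jacobi_kernel \<alpha> \<beta> (-1) 1 m n = 0"
    using jacobi_kernel_wronskian[OF ab, of "-1" 1 m n] ab by (simp add: jacobi_wronskian_def)
  moreover have "real m * (real m + \<alpha> + \<beta> + 1) - real n * (real n + \<alpha> + \<beta> + 1) = (real m - real n) * (real m + real n + (\<alpha> + \<beta> + 1))"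
    by (simp add: algebra_simps)
  moreover have "real m + real n + (\<alpha> + \<beta> + 1) > 0" using mn ab by (cases "m = 0"; cases "n = 0") auto
  ultimately show ?thesis using mn by simp
qed

text \<open>The factor \<open>(1 - x)^(\<alpha>+1) (1 + x)^(\<beta>+1)\<close> splits into the
  weights of \<open>U\<close> and \<open>Z\<close>, since
  \<open>2 (\<alpha> + 1) = a + (a + 1)\<close> and likewise for \<open>\<beta>\<close>. Thus
  \<open>u\<close> is a multiple of \<open>U\<close>, while the linear growth of \<open>Z\<close> is
  pulled out as \<open>n + (\<alpha> + \<beta> + 1) / 2\<close>, the mean of the two terms appearing
  when the eigenvalue difference is factored. The bound \<open>B\<close> does not depend on
  \<open>x\<close>.\<close>

lemma jacobi_wronskian_bound:
  assumes ab: "\<alpha> \<ge> -1/2" "\<beta> \<ge> -1/2"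
  shows "\<exists>B\<ge>0. \<forall>x. -1 \<le> x \<longrightarrow> x \<le> 1 \<longrightarrow> (\<exists>u v :: nat \<Rightarrow> real. (\<forall>n. \<bar>u n\<bar> \<le> B \<and> \<bar>v n\<bar> \<le> B) \<and>
     (\<forall>m n. jacobi_wronskian \<alpha> \<beta> (jacobi_on_poly \<alpha> \<beta> m) (jacobi_on_poly \<alpha> \<beta> n) x
       = u m * ((real n + (\<alpha> + \<beta> + 1) / 2) * v n) - ((real m + (\<alpha> + \<beta> + 1) / 2) * v m) * u n))"
proof -
  define a where "a = \<alpha> + 1/2"
  define b where "b = \<beta> + 1/2"
  define c where "c = \<alpha> + \<beta> + 1"
  have ab0: "a \<ge> 0" "b \<ge> 0" "c \<ge> 0" "c = a + b" using ab by (auto simp: a_def b_def c_def)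
  define y where "y = jacobi_on_poly \<alpha> \<beta>"
  have al: "a - 1/2 = \<alpha>" "b - 1/2 = \<beta>" by (auto simp: a_def b_def)
  have "\<exists>K\<ge>0. \<forall>n \<phi>. 0 < \<phi> \<longrightarrow> \<phi> < pi / 2 \<longrightarrow> \<bar>jacobi_U a b (y n) \<phi>\<bar> \<le> K \<and>
     \<bar>jacobi_U (a + 1) (b + 1) (pderiv (y n)) \<phi>\<bar> \<le> K * (2 * real n + a + b + 1)"
  proof (rule jacobi_uniform_bound[OF ab0(1,2)])
    fix n
    show "jacobi_ode (a - 1/2) (b - 1/2) (real n * (real n + a + b)) (y n)"
      unfolding al y_def using jacobi_on_poly_ode[of \<alpha> \<beta> n] by (simp add: a_def b_def algebra_simps)
    obtain M where M: "M \<ge> 0" "\<forall>x. \<bar>jacobi_on \<alpha> \<beta> n x\<bar> \<le> M" using jacobi_on_bounded by blast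
    have bd: "\<bar>(jacobi_on \<alpha> \<beta> n x)\<^sup>2\<bar> \<le> M\<^sup>2" for x using M by (simp add: abs_le_square_iff[symmetric])
    have meas: "(\<lambda>x. (jacobi_on \<alpha> \<beta> n x)\<^sup>2) \<in> borel_measurable borel" by measurable
    note JI = jacobi_integral_Icc[OF ab meas bd, of "-1" 1, simplified]
    have "((\<lambda>x. (jacobi_on \<alpha> \<beta> n x)\<^sup>2 * jacobi_weight \<alpha> \<beta> x) has_integral integral {-1..1} (\<lambda>x. (jacobi_on \<alpha> \<beta> n x)\<^sup>2 * jacobi_weight \<alpha> \<beta> x)) {-1..1}"
      using JI(1) by (rule integrable_integral)
    then have hi: "((\<lambda>x. (poly (y n) x)\<^sup>2 * jacobi_weight \<alpha> \<beta> x) has_integral integral {-1..1} (\<lambda>x. (jacobi_on \<alpha> \<beta> n x)\<^sup>2 * jacobi_weight \<alpha> \<beta> x)) {-1..1}"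
      by (rule has_integral_spike_finite[of "{-1, 1}", rotated 2]) (auto simp: jacobi_on_eq y_def)
    show "(\<lambda>x. (poly (y n) x)\<^sup>2 * jacobi_weight (a - 1/2) (b - 1/2) x) integrable_on {-1..1}"
      unfolding al using hi by (rule has_integral_integrable)
    have "integral {-1..1} (\<lambda>x. (poly (y n) x)\<^sup>2 * jacobi_weight \<alpha> \<beta> x) = integral {-1..1} (\<lambda>x. (jacobi_on \<alpha> \<beta> n x)\<^sup>2 * jacobi_weight \<alpha> \<beta> x)"
      using hi by (rule integral_unique)
    also have "\<dots> = (\<integral>x. (jacobi_on \<alpha> \<beta> n x)\<^sup>2 \<partial>jacobi_measure \<alpha> \<beta>)"
      using JI(2) jacobi_integral_total[OF meas] by simp
    also have "\<dots> \<le> 1" by (rule jacobi_on_square_integral_le_1)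
    finally show "integral {-1..1} (\<lambda>x. (poly (y n) x)\<^sup>2 * jacobi_weight (a - 1/2) (b - 1/2) x) \<le> 1" unfolding al .
  qed
  then obtain K where K: "K \<ge> 0" "\<And>n \<phi>. 0 < \<phi> \<Longrightarrow> \<phi> < pi / 2 \<Longrightarrow> \<bar>jacobi_U a b (y n) \<phi>\<bar> \<le> K"
    "\<And>n \<phi>. 0 < \<phi> \<Longrightarrow> \<phi> < pi / 2 \<Longrightarrow> \<bar>jacobi_U (a + 1) (b + 1) (pderiv (y n)) \<phi>\<bar> \<le> K * (2 * real n + a + b + 1)" by blast
  define k where "k = 2 powr (c + 1)"
  have k0: "k > 0" by (simp add: k_def)
  define B where "B = max (k * K) (3 * K)"
  have B0: "B \<ge> 0" unfolding B_def using K by simp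
  have "\<exists>u v :: nat \<Rightarrow> real. (\<forall>n. \<bar>u n\<bar> \<le> B \<and> \<bar>v n\<bar> \<le> B) \<and>
     (\<forall>m n. jacobi_wronskian \<alpha> \<beta> (y m) (y n) x = u m * ((real n + c / 2) * v n) - ((real m + c / 2) * v m) * u n)"
    if x: "-1 \<le> x" "x \<le> 1" for x
  proof (cases "-1 < x \<and> x < 1")
    case False
    then have "x = -1 \<or> x = 1" using x by auto
    \<comment> \<open>At the endpoints the Wronskian vanishes and zero sequences represent
      it.\<close>
    then have "jacobi_wronskian \<alpha> \<beta> (y m) (y n) x = 0" for m n using ab by (auto simp: jacobi_wronskian_def)
    then show ?thesis using B0 by (intro exI[of _ "\<lambda>_. 0"]) auto
  next
    case True
    define \<phi> where "\<phi> = arccos x / 2"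
    have \<phi>: "0 < \<phi>" "\<phi> < pi / 2" using arccos_lt_bounded[of x] True by (auto simp: \<phi>_def)
    have cx: "cos (2 * \<phi>) = x" using True by (simp add: \<phi>_def)
    define S where "S = sin \<phi>"
    define C where "C = cos \<phi>"
    have sc: "S > 0" "C > 0" using trig_pos[OF \<phi>] by (auto simp: S_def C_def)
    have x1: "1 - x = 2 * S\<^sup>2" unfolding cx[symmetric] by (simp add: S_def cos_double_sin)
    have x2: "1 + x = 2 * C\<^sup>2" unfolding cx[symmetric] by (simp add: C_def cos_double_cos)
    define U where "U n = jacobi_U a b (y n) \<phi>" for n
    define Z where "Z n = jacobi_U (a + 1) (b + 1) (pderiv (y n)) \<phi>" for n
    have Wr: "jacobi_wronskian \<alpha> \<beta> (y m) (y n) x = k * (U m * Z n - Z m * U n)" for m n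
    proof -
      have e1: "(1 - x) powr (\<alpha> + 1) = 2 powr (\<alpha> + 1) * (S powr a * S powr (a + 1))"
      proof -
        have "(1 - x) powr (\<alpha> + 1) = 2 powr (\<alpha> + 1) * (S powr 2) powr (\<alpha> + 1)"
          unfolding x1 using sc by (simp add: powr_mult powr_numeral)
        also have "(S powr 2) powr (\<alpha> + 1) = S powr (a + (a + 1))" unfolding powr_powr by (simp add: a_def algebra_simps)
        finally show ?thesis by (simp only: powr_add)
      qed
      have e2: "(1 + x) powr (\<beta> + 1) = 2 powr (\<beta> + 1) * (C powr b * C powr (b + 1))"
      proof -
        have "(1 + x) powr (\<beta> + 1) = 2 powr (\<beta> + 1) * (C powr 2) powr (\<beta> + 1)"
          unfolding x2 using sc by (simp add: powr_mult powr_numeral)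
        also have "(C powr 2) powr (\<beta> + 1) = C powr (b + (b + 1))" unfolding powr_powr by (simp add: b_def algebra_simps)
        finally show ?thesis by (simp only: powr_add)
      qed
      have e3: "k = 2 powr (\<alpha> + 1) * 2 powr (\<beta> + 1)" unfolding k_def powr_add[symmetric] by (simp add: c_def algebra_simps)
      show ?thesis unfolding jacobi_wronskian_def e1 e2 e3 U_def Z_def jacobi_U_def cx S_def[symmetric] C_def[symmetric]
        by (simp only: algebra_simps)
    qed
    define v where "v n = Z n / (real n + c / 2)" for n
    \<comment> \<open>If \<open>c = 0\<close> then \<open>n + c / 2\<close> vanishes at
      \<open>n = 0\<close>; the derivative of a constant polynomial being 0, the factorisation of
      \<open>Z\<close> persists there.\<close>
    have Z0: "Z 0 = 0" by (simp add: Z_def y_def jacobi_on_poly_0_pderiv jacobi_U_def)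
    have Zv: "Z n = (real n + c / 2) * v n" for n
    proof (cases "n = 0")
      case True then show ?thesis by (simp add: v_def Z0)
    next
      case False
      then have "real n + c / 2 \<noteq> 0" using ab0 by (simp add: add_nonneg_eq_0_iff)
      then show ?thesis by (simp add: v_def)
    qed
    have vb: "\<bar>v n\<bar> \<le> 3 * K" for n
    proof (cases "n = 0")
      case True then show ?thesis using K by (simp add: v_def Z0)
    next
      case False
      then have n1: "real n \<ge> 1" by simp
      have "\<bar>Z n\<bar> \<le> K * (2 * real n + a + b + 1)" unfolding Z_def by (rule K(3)[OF \<phi>])
      also have "\<dots> \<le> K * (3 * (real n + c / 2))" 
      proof (rule mult_left_mono[OF _ K(1)])
        show "2 * real n + a + b + 1 \<le> 3 * (real n + c / 2)" using n1 ab0(1,2) unfolding ab0(4) by (simp add: field_simps)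
      qed
      finally have "\<bar>Z n\<bar> \<le> 3 * K * (real n + c / 2)" by (simp only: mult_ac)
      moreover have "real n + c / 2 > 0" using n1 ab0(3) by (intro add_pos_nonneg) auto
      ultimately show ?thesis by (simp add: v_def abs_divide pos_divide_le_eq)
    qed
    have ub: "\<bar>k * U n\<bar> \<le> k * K" for n unfolding abs_mult U_def using k0 K(2)[OF \<phi>] by simp
    have 1: "\<forall>n. \<bar>k * U n\<bar> \<le> B \<and> \<bar>v n\<bar> \<le> B"
    proof
      fix n show "\<bar>k * U n\<bar> \<le> B \<and> \<bar>v n\<bar> \<le> B" using ub[of n] vb[of n] by (auto simp: B_def)
    qed
    have 2: "\<forall>m n. jacobi_wronskian \<alpha> \<beta> (y m) (y n) x = k * U m * ((real n + c / 2) * v n) - (real m + c / 2) * v m * (k * U n)"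
      unfolding Wr Zv[symmetric] by (simp add: algebra_simps)
    show ?thesis by (rule exI[of _ "\<lambda>n. k * U n"], rule exI[of _ v]) (use 1 2 in blast)
  qed
  then show ?thesis using B0 unfolding y_def c_def by blast
qed

section \<open>The transform on square summable sequences\<close>

text \<open>Riesz-Fischer for the squared distance. Along a subsequence with squared increments
  below \<open>(1/4) ^ k\<close>, the series of \<open>2 ^ k * (d k x)^2\<close> has finite
  integral, hence converges almost everywhere. Since
  \<open>\<bar>d\<bar> \<le> (1/2) ^ k + 2 ^ k * d^2\<close>, the increments themselves are then
  summable. Fatou's lemma transfers the Cauchy bound to the limit.\<close>

lemma L2_Cauchy_limit:
  fixes s :: "nat \<Rightarrow> 'a \<Rightarrow> real"
  assumes meas: "\<And>i. s i \<in> borel_measurable M"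
    and C: "\<And>e. e > 0 \<Longrightarrow> \<exists>N. \<forall>i\<ge>N. \<forall>j\<ge>N. (\<integral>\<^sup>+ x. ennreal ((s i x - s j x)\<^sup>2) \<partial>M) \<le> ennreal e"
  shows "\<exists>G\<in>borel_measurable M. \<forall>e>0. \<exists>N. \<forall>j\<ge>N. (\<integral>\<^sup>+ x. ennreal ((G x - s j x)\<^sup>2) \<partial>M) \<le> ennreal e"
proof -
  note [measurable] = meas
  have "\<exists>N. \<forall>i\<ge>N. \<forall>j\<ge>N. (\<integral>\<^sup>+ x. ennreal ((s i x - s j x)\<^sup>2) \<partial>M) \<le> ennreal ((1/4) ^ k)" for k :: nat
    by (rule C) simp
  then obtain N where N: "\<And>k i j. i \<ge> N k \<Longrightarrow> j \<ge> N k \<Longrightarrow> (\<integral>\<^sup>+ x. ennreal ((s i x - s j x)\<^sup>2) \<partial>M) \<le> ennreal ((1/4) ^ k)"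
    by metis
  \<comment> \<open>The cumulative sum is nondecreasing and at least \<open>N k\<close>; the summand
    \<open>k\<close> makes it tend to infinity.\<close>
  define r where "r k = (\<Sum>i\<le>k. N i) + k" for k
  have rN: "N k \<le> r k" for k using member_le_sum[of k "{..k}" N] by (simp add: r_def trans_le_add1)
  have rmono: "r k \<le> r (Suc k)" for k by (simp add: r_def)
  have rk: "k \<le> r k" for k by (simp add: r_def)
  define d where "d k x = s (r (Suc k)) x - s (r k) x" for k x
  have dm [measurable]: "d k \<in> borel_measurable M" for k unfolding d_def by measurable
  have "(\<integral>\<^sup>+ x. (\<Sum>k. ennreal (2 ^ k * (d k x)\<^sup>2)) \<partial>M) = (\<Sum>k. \<integral>\<^sup>+ x. ennreal (2 ^ k * (d k x)\<^sup>2) \<partial>M)"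
    by (intro nn_integral_suminf) measurable
  also have "\<dots> \<le> (\<Sum>k. ennreal ((1/2) ^ k))"
  proof (intro suminf_le)
    fix k
    have "(\<integral>\<^sup>+ x. ennreal (2 ^ k * (d k x)\<^sup>2) \<partial>M) = ennreal (2 ^ k) * (\<integral>\<^sup>+ x. ennreal ((d k x)\<^sup>2) \<partial>M)"
      by (simp add: ennreal_mult nn_integral_cmult)
    also have "\<dots> \<le> ennreal (2 ^ k) * ennreal ((1/4) ^ k)"
      unfolding d_def using rN[of k] rmono[of k] by (intro mult_left_mono N) auto
    also have "\<dots> = ennreal ((1/2) ^ k)"
      by (simp add: ennreal_mult[symmetric] power_mult_distrib[symmetric])
    finally show "(\<integral>\<^sup>+ x. ennreal (2 ^ k * (d k x)\<^sup>2) \<partial>M) \<le> ennreal ((1/2) ^ k)" .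
  qed auto
  also have "\<dots> = ennreal (\<Sum>k. (1/2) ^ k)" by (intro suminf_ennreal2) (auto intro!: summable_geometric)
  also have "\<dots> < \<infinity>" by simp
  finally have "(\<integral>\<^sup>+ x. (\<Sum>k. ennreal (2 ^ k * (d k x)\<^sup>2)) \<partial>M) \<noteq> \<infinity>" by simp
  then have "AE x in M. (\<Sum>k. ennreal (2 ^ k * (d k x)\<^sup>2)) \<noteq> \<infinity>"
    by (intro nn_integral_noteq_infinite) measurable
  then have conv: "AE x in M. convergent (\<lambda>i. s (r i) x)"
  proof eventually_elim
    case (elim x)
    have s1: "summable (\<lambda>k. 2 ^ k * (d k x)\<^sup>2)"
      by (rule summable_suminf_not_top) (use elim in auto)
    have s2: "summable (\<lambda>k. (1/2::real) ^ k + 2 ^ k * (d k x)\<^sup>2)" using s1 by (intro summable_add) (auto intro!: summable_geometric)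
    have "summable (\<lambda>k. d k x)"
    proof (rule summable_comparison_test[OF _ s2], intro exI allI impI)
      fix k
      show "norm (d k x) \<le> (1/2) ^ k + 2 ^ k * (d k x)\<^sup>2"
      proof (cases "\<bar>d k x\<bar> \<le> (1/2) ^ k")
        case True
        have "0 \<le> 2 ^ k * (d k x)\<^sup>2" by simp
        then show ?thesis using True by (simp only: real_norm_def)
      next
        case False
        have "1 * \<bar>d k x\<bar> = 2 ^ k * (1/2) ^ k * \<bar>d k x\<bar>" by (simp add: power_mult_distrib[symmetric])
        also have "\<dots> \<le> 2 ^ k * (\<bar>d k x\<bar> * \<bar>d k x\<bar>)" unfolding mult.assoc using False by (intro mult_left_mono mult_right_mono) auto
        also have "\<bar>d k x\<bar> * \<bar>d k x\<bar> = (d k x)\<^sup>2" by (simp add: power2_eq_square)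
        finally show ?thesis by (simp add: add_increasing)
      qed
    qed
    then have "convergent (\<lambda>n. \<Sum>k<n. d k x)" by (simp add: summable_iff_convergent)
    moreover have "(\<Sum>k<n. d k x) = s (r n) x - s (r 0) x" for n
      unfolding d_def by (rule sum_lessThan_telescope)
    ultimately have "convergent (\<lambda>n. s (r n) x - s (r 0) x)" by simp
    then have "convergent (\<lambda>n. (s (r n) x - s (r 0) x) + s (r 0) x)" by (intro convergent_add convergent_const)
    then show ?case by simp
  qed
  define G where "G x = lim (\<lambda>i. s (r i) x)" for x
  have Gm [measurable]: "G \<in> borel_measurable M" unfolding G_def by measurable
  have "\<exists>N. \<forall>j\<ge>N. (\<integral>\<^sup>+ x. ennreal ((G x - s j x)\<^sup>2) \<partial>M) \<le> ennreal e" if e: "e > 0" for e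
  proof -
    obtain N where N: "\<And>i j. i \<ge> N \<Longrightarrow> j \<ge> N \<Longrightarrow> (\<integral>\<^sup>+ x. ennreal ((s i x - s j x)\<^sup>2) \<partial>M) \<le> ennreal e"
      using C[OF e] by blast
    have "(\<integral>\<^sup>+ x. ennreal ((G x - s j x)\<^sup>2) \<partial>M) \<le> ennreal e" if j: "j \<ge> N" for j
    proof -
      have "(\<integral>\<^sup>+ x. ennreal ((G x - s j x)\<^sup>2) \<partial>M) = (\<integral>\<^sup>+ x. liminf (\<lambda>i. ennreal ((s (r i) x - s j x)\<^sup>2)) \<partial>M)"
      proof (rule nn_integral_cong_AE, use conv in eventually_elim)
        fix x assume "convergent (\<lambda>i. s (r i) x)"
        then have "(\<lambda>i. s (r i) x) \<longlonglongrightarrow> G x" unfolding G_def by (simp add: convergent_LIMSEQ_iff)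
        then have "(\<lambda>i. ennreal ((s (r i) x - s j x)\<^sup>2)) \<longlonglongrightarrow> ennreal ((G x - s j x)\<^sup>2)"
          by (intro tendsto_ennrealI tendsto_intros)
        then show "ennreal ((G x - s j x)\<^sup>2) = liminf (\<lambda>i. ennreal ((s (r i) x - s j x)\<^sup>2))"
          using lim_imp_Liminf[OF sequentially_bot] by metis
      qed
      also have "\<dots> \<le> liminf (\<lambda>i. \<integral>\<^sup>+ x. ennreal ((s (r i) x - s j x)\<^sup>2) \<partial>M)"
        by (intro nn_integral_liminf) measurable
      also have "\<dots> \<le> ennreal e"
      proof (rule Liminf_le)
        show "\<forall>\<^sub>F i in sequentially. (\<integral>\<^sup>+ x. ennreal ((s (r i) x - s j x)\<^sup>2) \<partial>M) \<le> ennreal e"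
          unfolding eventually_sequentially by (intro exI[of _ N] allI impI N j) (rule order.trans[OF _ rk])
      qed simp
      finally show ?thesis .
    qed
    then show ?thesis by blast
  qed
  then show ?thesis using Gm by blast
qed

section \<open>Convergence of Jacobi expansions in L^2\<close>

lemma jacobi_partial_sum_bounded:
  "\<exists>M. \<forall>x. \<bar>\<Sum>k<N. f k * jacobi_on \<alpha> \<beta> k x\<bar> \<le> M"
proof -
  obtain M where M: "\<And>k x. \<bar>jacobi_on \<alpha> \<beta> k x\<bar> \<le> M k" using jacobi_on_bounded by metis
  have "\<bar>\<Sum>k<N. f k * jacobi_on \<alpha> \<beta> k x\<bar> \<le> (\<Sum>k<N. \<bar>f k\<bar> * M k)" for x
    by (rule order.trans[OF sum_abs]) (auto simp: abs_mult intro!: sum_mono mult_left_mono M)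
  then show ?thesis by blast
qed

text \<open>Bessel's inequality for finite sums: orthogonality removes the cross terms, and each
  diagonal integral is at most 1.\<close>

lemma jacobi_partial_sum_L2:
  assumes ab: "\<alpha> \<ge> -1/2" "\<beta> \<ge> -1/2" and "finite I"
  shows "(\<integral>x. (\<Sum>k\<in>I. f k * jacobi_on \<alpha> \<beta> k x)\<^sup>2 \<partial>jacobi_measure \<alpha> \<beta>) \<le> (\<Sum>k\<in>I. (f k)\<^sup>2)"
proof -
  let ?M = "jacobi_measure \<alpha> \<beta>"
  note int = jacobi_on_mult_integrable[OF ab]
  have "(\<integral>x. (\<Sum>k\<in>I. f k * jacobi_on \<alpha> \<beta> k x)\<^sup>2 \<partial>?M)
    = (\<integral>x. (\<Sum>k\<in>I. \<Sum>j\<in>I. f k * f j * (jacobi_on \<alpha> \<beta> k x * jacobi_on \<alpha> \<beta> j x)) \<partial>?M)"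
    by (simp add: power2_eq_square sum_product mult_ac)
  also have "\<dots> = (\<Sum>k\<in>I. \<Sum>j\<in>I. f k * f j * (\<integral>x. jacobi_on \<alpha> \<beta> k x * jacobi_on \<alpha> \<beta> j x \<partial>?M))"
    using int by (subst Bochner_Integration.integral_sum, simp, subst Bochner_Integration.integral_sum) auto
  also have "\<dots> = (\<Sum>k\<in>I. \<Sum>j\<in>I. if j = k then (f k)\<^sup>2 * (\<integral>x. (jacobi_on \<alpha> \<beta> k x)\<^sup>2 \<partial>?M) else 0)"
    using jacobi_on_orthogonal[OF ab] by (intro sum.cong) (auto simp: power2_eq_square)
  also have "\<dots> = (\<Sum>k\<in>I. (f k)\<^sup>2 * (\<integral>x. (jacobi_on \<alpha> \<beta> k x)\<^sup>2 \<partial>?M))"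
    using assms(3) by simp
  also have "\<dots> \<le> (\<Sum>k\<in>I. (f k)\<^sup>2 * 1)"
    by (intro sum_mono mult_left_mono jacobi_on_square_integral_le_1) auto
  finally show ?thesis by simp
qed

text \<open>\<open>jacobi_transform\<close> is chosen by \<open>SOME\<close>, so its properties
  depend on existence. Bessel's inequality makes the partial sums Cauchy and Riesz-Fischer provides
  the limit.\<close>

lemma jacobi_transform_exists:
  assumes ab: "\<alpha> \<ge> -1/2" "\<beta> \<ge> -1/2" and f: "in_l2 f"
  shows "\<exists>G. is_jacobi_transform \<alpha> \<beta> f G"
proof -
  let ?M = "jacobi_measure \<alpha> \<beta>"
  define s where "s N x = (\<Sum>k<N. f k * jacobi_on \<alpha> \<beta> k x)" for N x
  have sm [measurable]: "s N \<in> borel_measurable borel" for N unfolding s_def by measurable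
  have sb: "\<exists>M. \<forall>x. \<bar>s N x\<bar> \<le> M" for N unfolding s_def by (rule jacobi_partial_sum_bounded)
  have sint: "integrable ?M (\<lambda>x. (s i x - s j x)\<^sup>2)" for i j
  proof -
    obtain B1 B2 where B: "\<And>x. \<bar>s i x\<bar> \<le> B1" "\<And>x. \<bar>s j x\<bar> \<le> B2" using sb by metis
    have "\<bar>(s i x - s j x)\<^sup>2\<bar> \<le> (B1 + B2)\<^sup>2" for x
    proof -
      have "\<bar>s i x - s j x\<bar> \<le> \<bar>B1 + B2\<bar>" using B(1)[of x] B(2)[of x] by linarith
      then show ?thesis by (simp add: abs_le_square_iff)
    qed
    then show ?thesis by (intro jacobi_measure_integrable_bounded[OF ab]) auto
  qed
  have sij: "(\<integral>\<^sup>+ x. ennreal ((s i x - s j x)\<^sup>2) \<partial>?M) \<le> ennreal (\<Sum>k\<in>{i..<j}. (f k)\<^sup>2)" if "i \<le> j" for i j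
  proof -
    have e: "(s i x - s j x)\<^sup>2 = (\<Sum>k\<in>{i..<j}. f k * jacobi_on \<alpha> \<beta> k x)\<^sup>2" for x
    proof -
      have "s j x = s i x + (\<Sum>k\<in>{i..<j}. f k * jacobi_on \<alpha> \<beta> k x)"
        unfolding s_def lessThan_atLeast0 using that by (simp add: sum.atLeastLessThan_concat)
      then show ?thesis by (simp add: power2_commute)
    qed
    have "(\<integral>\<^sup>+ x. ennreal ((s i x - s j x)\<^sup>2) \<partial>?M) = ennreal (\<integral>x. (s i x - s j x)\<^sup>2 \<partial>?M)"
      using sint by (intro nn_integral_eq_integral) auto
    also have "\<dots> \<le> ennreal (\<Sum>k\<in>{i..<j}. (f k)\<^sup>2)"
      unfolding e by (intro ennreal_leI jacobi_partial_sum_L2[OF ab]) simp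
    finally show ?thesis .
  qed
  have C: "\<exists>N. \<forall>i\<ge>N. \<forall>j\<ge>N. (\<integral>\<^sup>+ x. ennreal ((s i x - s j x)\<^sup>2) \<partial>?M) \<le> ennreal e" if e: "e > 0" for e
  proof -
    have "Cauchy (\<lambda>N. \<Sum>k<N. (f k)\<^sup>2)" using f unfolding in_l2_def summable_iff_convergent by (rule convergent_Cauchy)
    then obtain N where N: "\<And>i j. i \<ge> N \<Longrightarrow> j \<ge> N \<Longrightarrow> dist (\<Sum>k<i. (f k)\<^sup>2) (\<Sum>k<j. (f k)\<^sup>2) < e"
      using e unfolding Cauchy_def by blast
    have w: "(\<integral>\<^sup>+ x. ennreal ((s i x - s j x)\<^sup>2) \<partial>?M) \<le> ennreal e" if ij: "N \<le> i" "i \<le> j" for i j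
    proof -
      have "(\<Sum>k<j. (f k)\<^sup>2) = (\<Sum>k<i. (f k)\<^sup>2) + (\<Sum>k\<in>{i..<j}. (f k)\<^sup>2)"
        unfolding lessThan_atLeast0 using ij by (simp add: sum.atLeastLessThan_concat)
      then have "(\<Sum>k\<in>{i..<j}. (f k)\<^sup>2) \<le> e" using N[of i j] ij by (simp add: dist_real_def)
      then show ?thesis using sij[OF ij(2)] by (meson ennreal_leI order.trans)
    qed
    have "(\<integral>\<^sup>+ x. ennreal ((s i x - s j x)\<^sup>2) \<partial>?M) \<le> ennreal e" if "N \<le> i" "N \<le> j" for i j
    proof (cases "i \<le> j")
      case True then show ?thesis using w that by simp
    next
      case False
      then show ?thesis using w[of j i] that by (simp add: power2_commute)
    qed
    then show ?thesis by blast
  qed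
  have meq: "borel_measurable ?M = borel_measurable borel" by (rule measurable_cong_sets) simp_all
  have smM: "s i \<in> borel_measurable ?M" for i unfolding meq by (rule sm)
  obtain G where Gm: "G \<in> borel_measurable ?M"
    and G: "\<And>e. e > 0 \<Longrightarrow> \<exists>N. \<forall>j\<ge>N. (\<integral>\<^sup>+ x. ennreal ((G x - s j x)\<^sup>2) \<partial>?M) \<le> ennreal e"
    using L2_Cauchy_limit[OF smM C] by blast
  have Gb [measurable]: "G \<in> borel_measurable borel" using Gm meq by simp
  obtain N1 where N1: "\<And>j. j \<ge> N1 \<Longrightarrow> (\<integral>\<^sup>+ x. ennreal ((G x - s j x)\<^sup>2) \<partial>?M) \<le> ennreal 1" using G[of 1] by auto
  have i1: "integrable ?M (\<lambda>x. (G x - s N1 x)\<^sup>2)"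
  proof (rule integrableI_nonneg)
    show "(\<integral>\<^sup>+ x. ennreal ((G x - s N1 x)\<^sup>2) \<partial>?M) < \<infinity>" using N1[of N1] by (simp add: order.strict_trans1)
  qed auto
  have sq: "integrable ?M (\<lambda>x. (s N1 x)\<^sup>2)" using sint[of N1 0] by (simp add: s_def)
  have iG: "integrable ?M (\<lambda>x. (G x)\<^sup>2)"
  proof (rule Bochner_Integration.integrable_bound)
    show "integrable ?M (\<lambda>x. 2 * (G x - s N1 x)\<^sup>2 + 2 * (s N1 x)\<^sup>2)" using i1 sq by simp
    have "(G x)\<^sup>2 \<le> 2 * (G x - s N1 x)\<^sup>2 + 2 * (s N1 x)\<^sup>2" for x
    proof -
      have "0 \<le> ((G x - s N1 x) - s N1 x)\<^sup>2" by simp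
      then show ?thesis by (simp add: power2_eq_square algebra_simps)
    qed
    then show "AE x in ?M. norm ((G x)\<^sup>2) \<le> norm (2 * (G x - s N1 x)\<^sup>2 + 2 * (s N1 x)\<^sup>2)"
      by (intro AE_I2) simp
  qed measurable
  have "(\<lambda>N. \<integral>x. (G x - s N x)\<^sup>2 \<partial>?M) \<longlonglongrightarrow> 0"
  proof (rule LIMSEQ_I)
    fix e :: real assume e: "e > 0"
    then obtain N where N: "\<And>j. j \<ge> N \<Longrightarrow> (\<integral>\<^sup>+ x. ennreal ((G x - s j x)\<^sup>2) \<partial>?M) \<le> ennreal (e / 2)"
      using G[of "e / 2"] by auto
    have "norm ((\<integral>x. (G x - s j x)\<^sup>2 \<partial>?M) - 0) < e" if "j \<ge> N" for j
    proof -
      have "(\<integral>x. (G x - s j x)\<^sup>2 \<partial>?M) = enn2real (\<integral>\<^sup>+ x. ennreal ((G x - s j x)\<^sup>2) \<partial>?M)"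
        by (intro integral_eq_nn_integral) auto
      also have "\<dots> \<le> enn2real (ennreal (e / 2))" using N[OF that] by (intro enn2real_mono) auto
      finally have "(\<integral>x. (G x - s j x)\<^sup>2 \<partial>?M) \<le> e / 2" using e by simp
      moreover have "(\<integral>x. (G x - s j x)\<^sup>2 \<partial>?M) \<ge> 0" by (intro integral_nonneg_AE) auto
      ultimately show ?thesis using e by simp
    qed
    then show "\<exists>N. \<forall>j\<ge>N. norm ((\<integral>x. (G x - s j x)\<^sup>2 \<partial>?M) - 0) < e" by blast
  qed
  then have "is_jacobi_transform \<alpha> \<beta> f G" unfolding is_jacobi_transform_def s_def using Gb iG by blast
  then show ?thesis by blast
qed

text \<open>The multiplier pairs the transform with a bounded function on a finite measure space,
  and such a pairing is continuous under L^2 convergence. The elementary inequality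
  \<open>t \<le> e + t^2 / e\<close> takes the role of Cauchy-Schwarz. The argument applies to
  whichever representative \<open>SOME\<close> selects.\<close>

lemma interval_multiplier_LIMSEQ:
  assumes ab: "\<alpha> \<ge> -1/2" "\<beta> \<ge> -1/2" and f: "in_l2 f"
  shows "(\<lambda>N. \<Sum>m<N. f m * jacobi_kernel \<alpha> \<beta> c d m n) \<longlonglongrightarrow> interval_multiplier \<alpha> \<beta> c d f n"
proof -
  let ?M = "jacobi_measure \<alpha> \<beta>"
  interpret finite_measure ?M by (rule jacobi_measure_finite[OF ab])
  define G where "G = jacobi_transform \<alpha> \<beta> f"
  have "is_jacobi_transform \<alpha> \<beta> f G"
    unfolding G_def jacobi_transform_def by (rule someI_ex[OF jacobi_transform_exists[OF assms]])
  then have Gm [measurable]: "G \<in> borel_measurable borel" and iG: "integrable ?M (\<lambda>x. (G x)\<^sup>2)"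
    and lim: "(\<lambda>N. \<integral>x. (G x - (\<Sum>k<N. f k * jacobi_on \<alpha> \<beta> k x))\<^sup>2 \<partial>?M) \<longlonglongrightarrow> 0"
    unfolding is_jacobi_transform_def by auto
  define s where "s N x = (\<Sum>k<N. f k * jacobi_on \<alpha> \<beta> k x)" for N x
  have sm [measurable]: "s N \<in> borel_measurable borel" for N unfolding s_def by measurable
  obtain P where P: "P \<ge> 0" "\<And>x. \<bar>jacobi_on \<alpha> \<beta> n x\<bar> \<le> P" using jacobi_on_bounded by metis
  define J where "J x = indicator {c..d} x * jacobi_on \<alpha> \<beta> n x" for x
  have Jm [measurable]: "J \<in> borel_measurable borel" unfolding J_def by measurable
  have Jb: "\<bar>J x\<bar> \<le> P" for x using P(1) P(2)[of x] by (auto simp: J_def indicator_def)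
  have sJ: "integrable ?M (\<lambda>x. s N x * J x)" for N
  proof -
    obtain B where B: "\<And>x. \<bar>s N x\<bar> \<le> B" using jacobi_partial_sum_bounded unfolding s_def by metis
    show ?thesis
      by (rule jacobi_measure_integrable_bounded[OF ab, where M = "B * P"])
         (use B Jb P in \<open>auto simp: abs_mult intro!: mult_mono order.trans[OF abs_ge_zero B]\<close>)
  qed
  have GJ: "integrable ?M (\<lambda>x. G x * J x)"
  proof (rule Bochner_Integration.integrable_bound)
    show "integrable ?M (\<lambda>x. (G x)\<^sup>2 + P\<^sup>2)" using iG by simp
    have "\<bar>G x * J x\<bar> \<le> (G x)\<^sup>2 + P\<^sup>2" for x
    proof -
      have "\<bar>G x * J x\<bar> \<le> \<bar>G x\<bar> * P" unfolding abs_mult using Jb by (intro mult_left_mono) auto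
      also have "\<dots> \<le> (G x)\<^sup>2 + P\<^sup>2"
      proof -
        have "0 \<le> (\<bar>G x\<bar> - P)\<^sup>2" by simp
        moreover have "0 \<le> \<bar>G x\<bar> * P" using P by simp
        ultimately show ?thesis by (simp add: power2_eq_square algebra_simps)
      qed
      finally show ?thesis .
    qed
    then show "AE x in ?M. norm (G x * J x) \<le> norm ((G x)\<^sup>2 + P\<^sup>2)" by (intro AE_I2) simp
  qed measurable
  have part: "(\<Sum>m<N. f m * jacobi_kernel \<alpha> \<beta> c d m n) = (\<integral>x. s N x * J x \<partial>?M)" for N
  proof -
    have "integrable ?M (\<lambda>x. indicator {c..d} x *\<^sub>R (jacobi_on \<alpha> \<beta> m x * jacobi_on \<alpha> \<beta> n x))" for m
      by (intro integrable_mult_indicator jacobi_on_mult_integrable[OF ab]) simp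
    then have "(\<Sum>m<N. f m * jacobi_kernel \<alpha> \<beta> c d m n) = (\<integral>x. (\<Sum>m<N. f m * (indicator {c..d} x *\<^sub>R (jacobi_on \<alpha> \<beta> m x * jacobi_on \<alpha> \<beta> n x))) \<partial>?M)"
      unfolding jacobi_kernel_def set_lebesgue_integral_def by (subst Bochner_Integration.integral_sum) auto
    also have "\<dots> = (\<integral>x. s N x * J x \<partial>?M)"
      unfolding s_def J_def sum_distrib_right
      by (intro Bochner_Integration.integral_cong sum.cong refl) (simp add: mult_ac)
    finally show ?thesis .
  qed
  have whole: "interval_multiplier \<alpha> \<beta> c d f n = (\<integral>x. G x * J x \<partial>?M)"
    unfolding interval_multiplier_def set_lebesgue_integral_def G_def[symmetric] J_def
    by (intro Bochner_Integration.integral_cong) (auto simp: mult_ac)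
  have D2: "integrable ?M (\<lambda>x. (G x - s N x)\<^sup>2)" for N
  proof (rule Bochner_Integration.integrable_bound)
    obtain B where B: "\<And>x. \<bar>s N x\<bar> \<le> B" using jacobi_partial_sum_bounded unfolding s_def by metis
    have "\<bar>(s N x)\<^sup>2\<bar> \<le> B\<^sup>2" for x using B[of x] abs_le_square_iff[of "s N x" B] by simp
    then have "integrable ?M (\<lambda>x. (s N x)\<^sup>2)" by (intro jacobi_measure_integrable_bounded[OF ab]) auto
    then show "integrable ?M (\<lambda>x. 2 * (G x)\<^sup>2 + 2 * (s N x)\<^sup>2)" using iG by simp
    have "(G x - s N x)\<^sup>2 \<le> 2 * (G x)\<^sup>2 + 2 * (s N x)\<^sup>2" for x
    proof -
      have "0 \<le> (G x + s N x)\<^sup>2" by simp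
      then show ?thesis by (simp add: power2_eq_square algebra_simps)
    qed
    then show "AE x in ?M. norm ((G x - s N x)\<^sup>2) \<le> norm (2 * (G x)\<^sup>2 + 2 * (s N x)\<^sup>2)" by (intro AE_I2) simp
  qed measurable
  define V where "V = measure ?M (space ?M)"
  have diff: "\<bar>(\<integral>x. G x * J x \<partial>?M) - (\<integral>x. s N x * J x \<partial>?M)\<bar> \<le> P * (e * V + (\<integral>x. (G x - s N x)\<^sup>2 \<partial>?M) / e)" if e: "e > 0" for N e
  proof -
    have "(\<integral>x. G x * J x \<partial>?M) - (\<integral>x. s N x * J x \<partial>?M) = (\<integral>x. (G x - s N x) * J x \<partial>?M)"
      using GJ sJ by (simp add: left_diff_distrib)
    moreover have "\<bar>\<integral>x. (G x - s N x) * J x \<partial>?M\<bar> \<le> (\<integral>x. P * (e + (G x - s N x)\<^sup>2 / e) \<partial>?M)"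
    proof (rule integral_abs_bound_integral)
      show "integrable ?M (\<lambda>x. (G x - s N x) * J x)" using GJ sJ by (simp add: left_diff_distrib)
      show "integrable ?M (\<lambda>x. P * (e + (G x - s N x)\<^sup>2 / e))" using D2 by simp
      fix x
      define t where "t = \<bar>G x - s N x\<bar>"
      have "t \<le> e + t\<^sup>2 / e"
      proof (cases "t \<le> e")
        case True
        then show ?thesis using e by (simp add: add_increasing2)
      next
        case False
        then have "t * e \<le> t * t" using e by (intro mult_left_mono) auto
        then have "t \<le> t\<^sup>2 / e" using e by (simp add: pos_le_divide_eq power2_eq_square)
        then show ?thesis using e by linarith
      qed
      then have "t * \<bar>J x\<bar> \<le> (e + t\<^sup>2 / e) * P" using Jb[of x] P e by (intro mult_mono) (auto simp: t_def)
      then show "\<bar>(G x - s N x) * J x\<bar> \<le> P * (e + (G x - s N x)\<^sup>2 / e)" by (simp add: abs_mult t_def mult.commute)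
    qed
    moreover have "(\<integral>x. P * (e + (G x - s N x)\<^sup>2 / e) \<partial>?M) = P * (e * V + (\<integral>x. (G x - s N x)\<^sup>2 \<partial>?M) / e)"
      using D2 by (simp add: V_def mult.commute)
    ultimately show ?thesis by (simp only:)
  qed
  have "(\<lambda>N. \<integral>x. s N x * J x \<partial>?M) \<longlonglongrightarrow> (\<integral>x. G x * J x \<partial>?M)"
  proof (rule LIMSEQ_I)
    fix r :: real assume r: "r > 0"
    have V0: "V \<ge> 0" by (simp add: V_def)
    \<comment> \<open>The 1 keeps the divisor positive when \<open>P * V = 0\<close>, and
      \<open>e\<close> is then chosen so that the first error term stays below
      \<open>r / 2\<close>.\<close>
    define Q where "Q = P * V + 1"
    define e where "e = r / (2 * Q)"
    have PV: "Q > 0" using P V0 by (simp add: Q_def add_nonneg_pos)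
    have e: "e > 0" using r PV by (simp add: e_def)
    have "e * (P * V) < e * Q" using e by (simp add: Q_def)
    also have "\<dots> = r / 2" using PV by (simp add: e_def)
    finally have e1: "P * (e * V) < r / 2" by (simp add: mult_ac)
    have "(\<lambda>N. P * ((\<integral>x. (G x - s N x)\<^sup>2 \<partial>?M) / e)) \<longlonglongrightarrow> P * (0 / e)"
      using lim e unfolding s_def by (intro tendsto_intros) auto
    then have "\<forall>\<^sub>F N in sequentially. P * ((\<integral>x. (G x - s N x)\<^sup>2 \<partial>?M) / e) < r / 2"
      by (rule order_tendstoD) (use r in simp)
    then obtain N0 where N0: "\<And>N. N \<ge> N0 \<Longrightarrow> P * ((\<integral>x. (G x - s N x)\<^sup>2 \<partial>?M) / e) < r / 2"
      unfolding eventually_sequentially by blast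
    have "norm ((\<integral>x. s N x * J x \<partial>?M) - (\<integral>x. G x * J x \<partial>?M)) < r" if "N \<ge> N0" for N
      using diff[OF e, of N] e1 N0[OF that] unfolding distrib_left real_norm_def by linarith
    then show "\<exists>N0. \<forall>N\<ge>N0. norm ((\<integral>x. s N x * J x \<partial>?M) - (\<integral>x. G x * J x \<partial>?M)) < r" by blast
  qed
  then show ?thesis unfolding part whole .
qed

section \<open>The multiplier theorem\<close>

text \<open>The identity \<open>(n + e/2) / ((m - n) (m + n + e)) = (1 / (m - n) - 1 / (m + n + e)) / 2\<close> splits the
  kernel into discrete Hilbert transforms with bounded multipliers and a Stieltjes kernel.\<close>

lemma jacobi_kernel_decomposition:
  assumes ab: "\<alpha> \<ge> -1/2" "\<beta> \<ge> -1/2"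
  shows "\<exists>B\<ge>1. \<forall>c d. -1 \<le> c \<longrightarrow> c \<le> d \<longrightarrow> d \<le> 1 \<longrightarrow> (\<exists>x y :: nat \<Rightarrow> nat \<Rightarrow> real. (\<forall>i n. \<bar>x i n\<bar> \<le> B \<and> \<bar>y i n\<bar> \<le> B) \<and>
     (\<forall>m n. \<bar>jacobi_kernel \<alpha> \<beta> c d m n - hilbert_kernel m n * (\<Sum>i<4. x i m * y i n)\<bar>
        \<le> B * stieltjes_kernel m n + (if m = n then 1 else 0)))"
proof -
  define e where "e = \<alpha> + \<beta> + 1"
  have e0: "e \<ge> 0" using ab by (simp add: e_def)
  define W where "W m n = jacobi_wronskian \<alpha> \<beta> (jacobi_on_poly \<alpha> \<beta> m) (jacobi_on_poly \<alpha> \<beta> n)" for m n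
  obtain A where A: "A \<ge> 0" and Wb: "\<And>x. -1 \<le> x \<Longrightarrow> x \<le> 1 \<Longrightarrow> \<exists>u v :: nat \<Rightarrow> real. (\<forall>n. \<bar>u n\<bar> \<le> A \<and> \<bar>v n\<bar> \<le> A) \<and>
     (\<forall>m n. W m n x = u m * ((real n + e / 2) * v n) - ((real m + e / 2) * v m) * u n)"
    using jacobi_wronskian_bound[OF ab] unfolding W_def e_def by blast
  define B where "B = max (A + 1) (4 * A\<^sup>2)"
  have B: "B \<ge> 1" "A \<le> B" "4 * A\<^sup>2 \<le> B" using A by (auto simp: B_def)
  have "\<exists>x y :: nat \<Rightarrow> nat \<Rightarrow> real. (\<forall>i n. \<bar>x i n\<bar> \<le> B \<and> \<bar>y i n\<bar> \<le> B) \<and>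
     (\<forall>m n. \<bar>jacobi_kernel \<alpha> \<beta> c d m n - hilbert_kernel m n * (\<Sum>i<4. x i m * y i n)\<bar>
        \<le> B * stieltjes_kernel m n + (if m = n then 1 else 0))" if cd: "-1 \<le> c" "c \<le> d" "d \<le> 1" for c d
  proof -
    obtain u v where uv: "\<And>n. \<bar>u n\<bar> \<le> A" "\<And>n. \<bar>v n\<bar> \<le> A"
      and Wd: "\<And>m n. W m n d = u m * ((real n + e / 2) * v n) - ((real m + e / 2) * v m) * u n"
      using Wb[of d] cd by auto
    obtain u' v' where uv': "\<And>n. \<bar>u' n\<bar> \<le> A" "\<And>n. \<bar>v' n\<bar> \<le> A"
      and Wc: "\<And>m n. W m n c = u' m * ((real n + e / 2) * v' n) - ((real m + e / 2) * v' m) * u' n"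
      using Wb[of c] cd by auto
    \<comment> \<open>Two products come from the boundary term at \<open>d\<close> and two, with
      opposite sign, from the one at \<open>c\<close>.\<close>
    define x where "x i n = (if i = 0 then v n / 2 else if i = 1 then - u n / 2 else if i = 2 then - v' n / 2 else u' n / 2)" for i n :: nat
    define y where "y i n = (if i = 0 then u n else if i = 1 then v n else if i = 2 then u' n else v' n)" for i n :: nat
    have xb: "\<bar>x i n\<bar> \<le> B" and yb: "\<bar>y i n\<bar> \<le> B" for i n
      using uv[of n] uv'[of n] B(2) A by (auto simp: x_def y_def)
    have sxy: "(\<Sum>i<4. x i m * y i n) = (v m * u n - u m * v n) / 2 - (v' m * u' n - u' m * v' n) / 2" for m n
      by (simp add: x_def y_def eval_nat_numeral field_simps)
    have "\<bar>jacobi_kernel \<alpha> \<beta> c d m n - hilbert_kernel m n * (\<Sum>i<4. x i m * y i n)\<bar>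
        \<le> B * stieltjes_kernel m n + (if m = n then 1 else 0)" for m n
    proof (cases "m = n")
      case True
      then have "\<bar>jacobi_kernel \<alpha> \<beta> c d m n - hilbert_kernel m n * (\<Sum>i<4. x i m * y i n)\<bar> \<le> 1"
        using jacobi_kernel_diagonal[OF ab, of c d n] by (simp add: hilbert_kernel_def)
      moreover have "B * stieltjes_kernel m n \<ge> 0" using B by (simp add: stieltjes_kernel_def)
      ultimately show ?thesis using True by simp
    next
      case False
      define D where "D = real m - real n"
      define P where "P = real m + real n + e"
      have D: "D \<noteq> 0" using False by (simp add: D_def)
      have mn: "real m + real n \<ge> 1" using False by (cases "m = 0") auto
      have P: "P > 0" "2 * P \<ge> real m + real n + 1" using e0 mn by (auto simp: P_def)
      have ev: "real m * (real m + \<alpha> + \<beta> + 1) - real n * (real n + \<alpha> + \<beta> + 1) = D * P"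
        by (simp add: D_def P_def e_def algebra_simps)
      have K: "D * P * jacobi_kernel \<alpha> \<beta> c d m n = W m n d - W m n c"
        using jacobi_kernel_wronskian[OF ab cd, of m n] unfolding ev W_def .
      have n2: "real n + e / 2 = (P - D) / 2" "real m + e / 2 = (P + D) / 2" by (auto simp: P_def D_def)
      have h: "hilbert_kernel m n = - (1 / D)" using False D by (simp add: hilbert_kernel_def D_def divide_simps)
      \<comment> \<open>The part of the boundary terms symmetric in \<open>m\<close> and
        \<open>n\<close>: there the factor \<open>D\<close> cancels, leaving \<open>q / P\<close>.
        With \<open>\<bar>q\<bar> \<le> 2 * A^2\<close> and \<open>2 * P \<ge> m + n + 1\<close>
        this costs \<open>4 * A^2\<close> times the Stieltjes kernel.\<close>
      define q where "q = (u m * v n + v m * u n) / 2 - (u' m * v' n + v' m * u' n) / 2"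
      have "jacobi_kernel \<alpha> \<beta> c d m n = (W m n d - W m n c) / (D * P)"
        using K D P(1) by (simp add: field_simps)
      also have "\<dots> = hilbert_kernel m n * (\<Sum>i<4. x i m * y i n) - q / P"
        unfolding Wd Wc n2 sxy h q_def using D P(1) by (simp add: field_simps)
      finally have "\<bar>jacobi_kernel \<alpha> \<beta> c d m n - hilbert_kernel m n * (\<Sum>i<4. x i m * y i n)\<bar> = \<bar>q\<bar> / P"
        using P(1) by simp
      also have "\<dots> \<le> (2 * A\<^sup>2) / ((real m + real n + 1) / 2)"
      proof (rule frac_le)
        have b: "\<bar>u m * v n\<bar> \<le> A\<^sup>2" "\<bar>v m * u n\<bar> \<le> A\<^sup>2" "\<bar>u' m * v' n\<bar> \<le> A\<^sup>2" "\<bar>v' m * u' n\<bar> \<le> A\<^sup>2"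
          unfolding abs_mult power2_eq_square using uv uv' A by (auto intro!: mult_mono)
        have "\<bar>(x1 + x2) / 2 - (x3 + x4) / 2\<bar> \<le> 2 * K"
          if "\<bar>x1\<bar> \<le> K" "\<bar>x2\<bar> \<le> K" "\<bar>x3\<bar> \<le> K" "\<bar>x4\<bar> \<le> K" for x1 x2 x3 x4 K :: real
        proof -
          have "x1 \<le> K" "- x1 \<le> K" "x2 \<le> K" "- x2 \<le> K" "x3 \<le> K" "- x3 \<le> K" "x4 \<le> K" "- x4 \<le> K"
            using that by (auto simp: abs_le_iff)
          then show ?thesis by (intro abs_leI) (simp_all add: field_simps)
        qed
        from this[OF b] show "\<bar>q\<bar> \<le> 2 * A\<^sup>2" unfolding q_def .
      qed (use P in auto)
      also have "\<dots> = (4 * A\<^sup>2) * stieltjes_kernel m n" by (simp add: stieltjes_kernel_def)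
      also have "\<dots> \<le> B * stieltjes_kernel m n" using B by (intro mult_right_mono) (auto simp: stieltjes_kernel_def)
      finally show ?thesis using False by simp
    qed
    then show ?thesis using xb yb by blast
  qed
  then show ?thesis using B(1) by blast
qed

section \<open>Assembling the truncated multiplier\<close>

lemma sum_powr_le:
  assumes I: "finite I" "I \<noteq> {}" and x: "\<And>i. i \<in> I \<Longrightarrow> x i \<ge> (0::real)" and p: "p > 0"
  shows "(\<Sum>i\<in>I. x i) powr p \<le> real (card I) powr p * (\<Sum>i\<in>I. x i powr p)"
proof -
  have "Max (x ` I) \<in> x ` I" using I by (intro Max_in) auto
  then obtain j where j: "j \<in> I" "x j = Max (x ` I)" by auto
  have "(\<Sum>i\<in>I. x i) \<le> real (card I) * x j"
    using sum_bounded_above[of I x "x j"] j I by auto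
  then have "(\<Sum>i\<in>I. x i) powr p \<le> (real (card I) * x j) powr p"
    using x p by (intro powr_mono2) (auto intro: sum_nonneg)
  also have "\<dots> = real (card I) powr p * x j powr p" using x[OF j(1)] by (simp add: powr_mult)
  also have "\<dots> \<le> real (card I) powr p * (\<Sum>i\<in>I. x i powr p)"
    using j(1) I by (intro mult_left_mono member_le_sum) auto
  finally show ?thesis .
qed

lemma strong_type_sum:
  fixes w :: "'a \<Rightarrow> real"
  assumes I: "finite I" "I \<noteq> {}" and w: "\<And>n. n \<in> X \<Longrightarrow> w n \<ge> 0" and p: "p > 0"
    and x: "\<And>i n. i \<in> I \<Longrightarrow> n \<in> X \<Longrightarrow> x i n \<ge> 0"
    and G: "\<And>n. n \<in> X \<Longrightarrow> \<bar>G n\<bar> \<le> (\<Sum>i\<in>I. x i n)"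
    and D: "\<And>i. i \<in> I \<Longrightarrow> (\<Sum>n\<in>X. w n * x i n powr p) \<le> D"
  shows "(\<Sum>n\<in>X. w n * \<bar>G n\<bar> powr p) \<le> real (card I) powr p * (real (card I) * D)"
proof -
  have "(\<Sum>n\<in>X. w n * \<bar>G n\<bar> powr p) \<le> (\<Sum>n\<in>X. w n * (real (card I) powr p * (\<Sum>i\<in>I. x i n powr p)))"
  proof (intro sum_mono mult_left_mono w)
    fix n assume n: "n \<in> X"
    have "\<bar>G n\<bar> powr p \<le> (\<Sum>i\<in>I. x i n) powr p" using G[OF n] p by (intro powr_mono2) auto
    also have "\<dots> \<le> real (card I) powr p * (\<Sum>i\<in>I. x i n powr p)" using x n by (intro sum_powr_le I p)
    finally show "\<bar>G n\<bar> powr p \<le> real (card I) powr p * (\<Sum>i\<in>I. x i n powr p)" .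
  qed
  also have "\<dots> = real (card I) powr p * (\<Sum>n\<in>X. \<Sum>i\<in>I. w n * x i n powr p)"
    by (simp add: sum_distrib_left mult_ac)
  also have "(\<Sum>n\<in>X. \<Sum>i\<in>I. w n * x i n powr p) = (\<Sum>i\<in>I. \<Sum>n\<in>X. w n * x i n powr p)" by (rule sum.swap)
  also have "real (card I) powr p * \<dots> \<le> real (card I) powr p * (real (card I) * D)"
    using D by (intro mult_left_mono sum_bounded_above) auto
  finally show ?thesis .
qed

text \<open>If the sum exceeds \<open>t\<close>, one of the terms exceeds \<open>t\<close> divided
  by their number. Rescaling the level costs one factor \<open>card I\<close> and adding the level
  sets costs another.\<close>

lemma weak_type_sum:
  fixes w :: "'a \<Rightarrow> real"
  assumes I: "finite I" "I \<noteq> {}" and X: "finite X" and w: "\<And>n. n \<in> X \<Longrightarrow> w n \<ge> 0"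
    and G: "\<And>n. n \<in> X \<Longrightarrow> \<bar>G n\<bar> \<le> (\<Sum>i\<in>I. x i n)" and t: "t > 0"
    and D: "\<And>i t. i \<in> I \<Longrightarrow> t > 0 \<Longrightarrow> t * (\<Sum>n | n \<in> X \<and> x i n > t. w n) \<le> D"
  shows "t * (\<Sum>n | n \<in> X \<and> \<bar>G n\<bar> > t. w n) \<le> (real (card I))\<^sup>2 * D"
proof -
  define c where "c = real (card I)"
  have c: "c > 0" using I by (simp add: c_def card_gt_0_iff)
  have sub: "{n \<in> X. \<bar>G n\<bar> > t} \<subseteq> (\<Union>i\<in>I. {n \<in> X. x i n > t / c})"
  proof
    fix n assume n: "n \<in> {n \<in> X. \<bar>G n\<bar> > t}"
    show "n \<in> (\<Union>i\<in>I. {n \<in> X. x i n > t / c})"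
    proof (rule ccontr)
      assume "\<not> ?thesis"
      then have "x i n \<le> t / c" if "i \<in> I" for i using n that by (auto simp: not_less)
      then have "(\<Sum>i\<in>I. x i n) \<le> c * (t / c)" unfolding c_def by (intro sum_bounded_above) auto
      then show False using G[of n] n c by auto
    qed
  qed
  have "(\<Sum>n | n \<in> X \<and> \<bar>G n\<bar> > t. w n) \<le> sum w (\<Union>i\<in>I. {n \<in> X. x i n > t / c})"
    using sub w X I by (intro sum_mono2) auto
  also have "\<dots> \<le> (\<Sum>i\<in>I. sum w {n \<in> X. x i n > t / c})"
  proof -
    have "sum w (\<Union>i\<in>I. {n \<in> X. x i n > t / c}) \<le> (\<Sum>n\<in>(\<Union>i\<in>I. {n \<in> X. x i n > t / c}). \<Sum>i\<in>I. if x i n > t / c then w n else 0)"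
    proof (rule sum_mono)
      fix n assume "n \<in> (\<Union>i\<in>I. {n \<in> X. x i n > t / c})"
      then obtain i where i: "i \<in> I" "n \<in> X" "x i n > t / c" by auto
      have "(if x i n > t / c then w n else 0) \<le> (\<Sum>i\<in>I. if x i n > t / c then w n else 0)"
        using i I w by (intro member_le_sum) auto
      then show "w n \<le> (\<Sum>i\<in>I. if x i n > t / c then w n else 0)" using i by simp
    qed
    also have "\<dots> \<le> (\<Sum>n\<in>X. \<Sum>i\<in>I. if x i n > t / c then w n else 0)"
      using X w by (intro sum_mono2) (auto intro!: sum_nonneg)
    also have "\<dots> = (\<Sum>i\<in>I. \<Sum>n\<in>X. if x i n > t / c then w n else 0)" by (rule sum.swap)
    also have "\<dots> = (\<Sum>i\<in>I. sum w {n \<in> X. x i n > t / c})"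
      using X by (simp add: sum.inter_filter)
    finally show ?thesis .
  qed
  finally have "t * (\<Sum>n | n \<in> X \<and> \<bar>G n\<bar> > t. w n) \<le> t * (\<Sum>i\<in>I. sum w {n \<in> X. x i n > t / c})"
    using t by (intro mult_left_mono) auto
  also have "\<dots> = (\<Sum>i\<in>I. c * (t / c * sum w {n \<in> X. x i n > t / c}))"
    using c by (simp add: sum_distrib_left)
  also have "\<dots> \<le> (\<Sum>i\<in>I. c * D)"
  proof (intro sum_mono mult_left_mono)
    fix i assume "i \<in> I"
    then show "t / c * sum w {n \<in> X. x i n > t / c} \<le> D" using c t by (intro D) auto
  qed (use c in auto)
  also have "\<dots> = c\<^sup>2 * D" by (simp add: c_def power2_eq_square)
  finally show ?thesis by (simp add: c_def)
qed

text \<open>The truncated operator is dominated by six pieces: four Hilbert transforms, one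
  Stieltjes transform of \<open>\<bar>f\<bar>\<close>, and \<open>\<bar>f\<bar>\<close> itself from
  the diagonal. The interval enters only through the sequences \<open>x\<close> and
  \<open>y\<close>, and these only through their common bound \<open>B\<close>.\<close>

lemma jacobi_multiplier_truncated:
  assumes ab: "\<alpha> \<ge> -1/2" "\<beta> \<ge> -1/2" and Ap: "Ap_weight p w" and p: "p \<ge> 1"
  shows "\<exists>C\<ge>0. \<forall>c d N L f. -1 \<le> c \<longrightarrow> c \<le> d \<longrightarrow> d \<le> 1 \<longrightarrow>
     (p > 1 \<longrightarrow> (\<Sum>n<L. w n * \<bar>\<Sum>m<N. f m * jacobi_kernel \<alpha> \<beta> c d m n\<bar> powr p) \<le> C * (\<Sum>n<N. w n * \<bar>f n\<bar> powr p)) \<and>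
     (p = 1 \<longrightarrow> (\<forall>t>0. t * (\<Sum>n | n < L \<and> \<bar>\<Sum>m<N. f m * jacobi_kernel \<alpha> \<beta> c d m n\<bar> > t. w n) \<le> C * (\<Sum>n<N. w n * \<bar>f n\<bar>)))"
proof -
  have w0: "w k \<ge> 0" for k using Ap by (auto simp: Ap_weight_def weight_def less_imp_le)
  obtain B where B: "B \<ge> 1" and dec: "\<And>c d. -1 \<le> c \<Longrightarrow> c \<le> d \<Longrightarrow> d \<le> 1 \<Longrightarrow> (\<exists>x y :: nat \<Rightarrow> nat \<Rightarrow> real. (\<forall>i n. \<bar>x i n\<bar> \<le> B \<and> \<bar>y i n\<bar> \<le> B) \<and>
     (\<forall>m n. \<bar>jacobi_kernel \<alpha> \<beta> c d m n - hilbert_kernel m n * (\<Sum>i<4. x i m * y i n)\<bar>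
        \<le> B * stieltjes_kernel m n + (if m = n then 1 else 0)))"
    using jacobi_kernel_decomposition[OF ab] by blast
  obtain C1 where C1: "C1 \<ge> 0"
    and H: "\<And>N L f. p > 1 \<Longrightarrow> (\<Sum>n<L. w n * \<bar>\<Sum>m<N. f m * hilbert_kernel m n\<bar> powr p) \<le> C1 * (\<Sum>n<N. w n * \<bar>f n\<bar> powr p)"
    and Hw: "\<And>N L f t. p = 1 \<Longrightarrow> t > 0 \<Longrightarrow> t * (\<Sum>n | n < L \<and> \<bar>\<Sum>m<N. f m * hilbert_kernel m n\<bar> > t. w n) \<le> C1 * (\<Sum>n<N. w n * \<bar>f n\<bar>)"
    using cz_weighted[OF cz_hilbert _ Ap p] by (auto)
  obtain C2 where C2: "C2 \<ge> 0"
    and S: "\<And>N L f. p > 1 \<Longrightarrow> (\<Sum>n<L. w n * \<bar>\<Sum>m<N. f m * stieltjes_kernel m n\<bar> powr p) \<le> C2 * (\<Sum>n<N. w n * \<bar>f n\<bar> powr p)"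
    and Sw: "\<And>N L f t. p = 1 \<Longrightarrow> t > 0 \<Longrightarrow> t * (\<Sum>n | n < L \<and> \<bar>\<Sum>m<N. f m * stieltjes_kernel m n\<bar> > t. w n) \<le> C2 * (\<Sum>n<N. w n * \<bar>f n\<bar>)"
    using cz_weighted[OF cz_stieltjes _ Ap p] by (auto)
  \<comment> \<open>One factor \<open>B powr p\<close> pays for the sequence inside the Hilbert
    transform, the other for the one outside.\<close>
  define C0 where "C0 = (B powr p * B powr p) * (C1 + C2 + 1)"
  have Bp: "B powr p \<ge> 1" using B p by (intro ge_one_powr_ge_zero) auto
  have C0: "C0 \<ge> 0" using C1 C2 by (simp add: C0_def)
  define C where "C = max (6 powr p * (6 * C0)) (6\<^sup>2 * C0)"
  have C: "C \<ge> 0" "6 powr p * (6 * C0) \<le> C" "6\<^sup>2 * C0 \<le> C" using C0 by (auto simp: C_def)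
  have main: "(p > 1 \<longrightarrow> (\<Sum>n<L. w n * \<bar>\<Sum>m<N. f m * jacobi_kernel \<alpha> \<beta> c d m n\<bar> powr p) \<le> C * (\<Sum>n<N. w n * \<bar>f n\<bar> powr p)) \<and>
     (p = 1 \<longrightarrow> (\<forall>t>0. t * (\<Sum>n | n < L \<and> \<bar>\<Sum>m<N. f m * jacobi_kernel \<alpha> \<beta> c d m n\<bar> > t. w n) \<le> C * (\<Sum>n<N. w n * \<bar>f n\<bar>)))"
    if cd: "-1 \<le> c" "c \<le> d" "d \<le> 1" for c d N L f
  proof -
    obtain x y :: "nat \<Rightarrow> nat \<Rightarrow> real" where x: "\<And>i n. \<bar>x i n\<bar> \<le> B" and y: "\<And>i n. \<bar>y i n\<bar> \<le> B"
      and K: "\<And>m n. \<bar>jacobi_kernel \<alpha> \<beta> c d m n - hilbert_kernel m n * (\<Sum>i<4. x i m * y i n)\<bar>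
        \<le> B * stieltjes_kernel m n + (if m = n then 1 else 0)"
      using dec[OF cd] by blast
    define T where "T n = (\<Sum>m<N. f m * jacobi_kernel \<alpha> \<beta> c d m n)" for n
    define Hf where "Hf i n = (\<Sum>m<N. (f m * x i m) * hilbert_kernel m n)" for i n
    define Sf where "Sf n = (\<Sum>m<N. \<bar>f m\<bar> * stieltjes_kernel m n)" for n
    define F where "F n = (if n < N then \<bar>f n\<bar> else 0)" for n
    have Sf0: "Sf n \<ge> 0" for n unfolding Sf_def by (intro sum_nonneg) (auto simp: stieltjes_kernel_def)
    have six: "{..<6::nat} \<noteq> {}" by (metis empty_iff lessThan_iff zero_less_numeral)
    have B0: "B > 0" "B \<ge> 0" using B by auto
    have fx: "\<bar>f n * x i n\<bar> \<le> B * \<bar>f n\<bar>" for n i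
      using mult_right_mono[OF x[of i n] abs_ge_zero[of "f n"]] by (simp add: abs_mult mult.commute)
    have Tb: "\<bar>T n\<bar> \<le> (\<Sum>i<4. B * \<bar>Hf i n\<bar>) + B * Sf n + F n" for n
    proof -
      \<comment> \<open>The product structure is used here: \<open>x i m\<close> is moved into the
        input of the Hilbert transform and \<open>y i n\<close> out of the sum.\<close>
      have e: "T n = (\<Sum>i<4. y i n * Hf i n) + (\<Sum>m<N. f m * (jacobi_kernel \<alpha> \<beta> c d m n - hilbert_kernel m n * (\<Sum>i<4. x i m * y i n)))"
      proof -
        have "(\<Sum>i<4. y i n * Hf i n) = (\<Sum>m<N. f m * (hilbert_kernel m n * (\<Sum>i<4. x i m * y i n)))"
          unfolding Hf_def sum_distrib_left by (subst sum.swap) (simp add: mult_ac)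
        then show ?thesis by (simp add: T_def sum_subtractf right_diff_distrib)
      qed
      have "\<bar>\<Sum>i<4. y i n * Hf i n\<bar> \<le> (\<Sum>i<4. B * \<bar>Hf i n\<bar>)"
        by (rule order.trans[OF sum_abs]) (auto simp: abs_mult intro!: sum_mono mult_right_mono y)
      moreover have "\<bar>\<Sum>m<N. f m * (jacobi_kernel \<alpha> \<beta> c d m n - hilbert_kernel m n * (\<Sum>i<4. x i m * y i n))\<bar> \<le> B * Sf n + F n"
      proof -
        have "\<bar>\<Sum>m<N. f m * (jacobi_kernel \<alpha> \<beta> c d m n - hilbert_kernel m n * (\<Sum>i<4. x i m * y i n))\<bar>
          \<le> (\<Sum>m<N. \<bar>f m\<bar> * (B * stieltjes_kernel m n + (if m = n then 1 else 0)))"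
          by (rule order.trans[OF sum_abs]) (auto simp only: abs_mult intro!: sum_mono mult_left_mono K abs_ge_zero)
        also have "\<dots> = B * Sf n + (\<Sum>m<N. if m = n then \<bar>f m\<bar> else 0)"
          unfolding Sf_def sum_distrib_left sum.distrib[symmetric] by (intro sum.cong) (auto simp: algebra_simps)
        also have "(\<Sum>m<N. if m = n then \<bar>f m\<bar> else 0) = F n" by (simp add: F_def)
        finally show ?thesis .
      qed
      ultimately show ?thesis unfolding e by linarith
    qed
    define z where "z i n = (if i < 4 then B * \<bar>Hf i n\<bar> else if i = 4 then B * Sf n else F n)" for i n :: nat
    have z0: "z i n \<ge> 0" for i n using B0 Sf0[of n] by (auto simp: z_def F_def)
    have Tz: "\<bar>T n\<bar> \<le> (\<Sum>i<6. z i n)" for n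
      using Tb[of n] by (simp add: z_def eval_nat_numeral)
    show ?thesis
    proof (intro conjI impI allI)
      assume p1: "p > 1"
      define Y where "Y = (\<Sum>n<N. w n * \<bar>f n\<bar> powr p)"
      have Y0: "Y \<ge> 0" unfolding Y_def using w0 by (intro sum_nonneg) auto
      have zb: "(\<Sum>n<L. w n * z i n powr p) \<le> C0 * Y" for i
      proof -
        have big: "B powr p * (B powr p * C1 * Y) \<le> C0 * Y" "B powr p * (C2 * Y) \<le> C0 * Y" "Y \<le> C0 * Y"
        proof -
          have "B powr p * (B powr p * C1 * Y) \<le> B powr p * (B powr p * (C1 + C2 + 1) * Y)"
            using C2 Y0 by (intro mult_left_mono mult_right_mono) auto
          then show "B powr p * (B powr p * C1 * Y) \<le> C0 * Y" by (simp add: C0_def mult.assoc)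
          have "B powr p * (1 * C2 * Y) \<le> B powr p * (B powr p * (C1 + C2 + 1) * Y)"
            using C1 C2 Y0 Bp by (intro mult_left_mono mult_right_mono mult_mono) auto
          then show "B powr p * (C2 * Y) \<le> C0 * Y" by (simp add: C0_def mult.assoc)
          have "1 * (1 * 1) \<le> B powr p * (B powr p * (C1 + C2 + 1))" using Bp C1 C2 by (intro mult_mono) auto
          then have "1 * Y \<le> C0 * Y" using Y0 by (intro mult_right_mono) (auto simp: C0_def mult.assoc)
          then show "Y \<le> C0 * Y" by simp
        qed
        consider "i < 4" | "i = 4" | "i > 4" by linarith
        then show ?thesis
        proof cases
          case 1
          have "(\<Sum>n<L. w n * z i n powr p) = B powr p * (\<Sum>n<L. w n * \<bar>Hf i n\<bar> powr p)"
            using 1 B0 by (simp add: z_def powr_mult sum_distrib_left mult_ac)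
          also have "\<dots> \<le> B powr p * (C1 * (\<Sum>n<N. w n * \<bar>f n * x i n\<bar> powr p))"
            unfolding Hf_def by (intro mult_left_mono H p1) auto
          also have "\<dots> \<le> B powr p * (C1 * (\<Sum>n<N. w n * (B powr p * \<bar>f n\<bar> powr p)))"
          proof (intro mult_left_mono sum_mono)
            fix n
            have "\<bar>f n * x i n\<bar> powr p \<le> (B * \<bar>f n\<bar>) powr p"
              using fx[of n i] p by (intro powr_mono2) auto
            then show "\<bar>f n * x i n\<bar> powr p \<le> B powr p * \<bar>f n\<bar> powr p" using B0 by (simp add: powr_mult)
          qed (use C1 w0 in auto)
          also have "\<dots> = B powr p * (B powr p * C1 * Y)" by (simp add: Y_def sum_distrib_left mult_ac)
          finally show ?thesis using big by linarith
        next
          case 2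
          have "(\<Sum>n<L. w n * z i n powr p) = B powr p * (\<Sum>n<L. w n * \<bar>Sf n\<bar> powr p)"
            using 2 B0 Sf0 by (simp add: z_def powr_mult sum_distrib_left mult_ac)
          also have "\<dots> \<le> B powr p * (C2 * (\<Sum>n<N. w n * \<bar>\<bar>f n\<bar>\<bar> powr p))"
            unfolding Sf_def by (intro mult_left_mono S p1) auto
          finally show ?thesis using big unfolding Y_def by simp
        next
          case 3
          have "(\<Sum>n<L. w n * z i n powr p) = (\<Sum>n<L. if n < N then w n * \<bar>f n\<bar> powr p else 0)"
            using 3 p1 by (intro sum.cong) (auto simp: z_def F_def)
          also have "\<dots> = (\<Sum>n | n < L \<and> n < N. w n * \<bar>f n\<bar> powr p)"
            by (subst sum.inter_filter[symmetric]) (auto intro!: sum.cong)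
          also have "\<dots> \<le> Y" unfolding Y_def using w0 by (intro sum_mono2) auto
          finally show ?thesis using big by linarith
        qed
      qed
      have "(\<Sum>n<L. w n * \<bar>T n\<bar> powr p) \<le> real (card {..<6::nat}) powr p * (real (card {..<6::nat}) * (C0 * Y))"
        by (rule strong_type_sum[where x = z, OF _ six]) (use w0 p1 z0 Tz zb in auto)
      also have "\<dots> = (6 powr p * (6 * C0)) * Y" by simp
      also have "\<dots> \<le> C * Y" using C Y0 by (intro mult_right_mono) auto
      finally show "(\<Sum>n<L. w n * \<bar>\<Sum>m<N. f m * jacobi_kernel \<alpha> \<beta> c d m n\<bar> powr p) \<le> C * (\<Sum>n<N. w n * \<bar>f n\<bar> powr p)"
        by (simp add: T_def Y_def)
    next
      fix t :: real assume p1: "p = 1" and t: "t > 0"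
      define Y where "Y = (\<Sum>n<N. w n * \<bar>f n\<bar>)"
      have Y0: "Y \<ge> 0" unfolding Y_def using w0 by (intro sum_nonneg) auto
      have C0': "C0 = B * B * (C1 + C2 + 1)" using p1 B0 by (simp add: C0_def)
      have zb: "t * (\<Sum>n | n \<in> {..<L} \<and> z i n > t. w n) \<le> C0 * Y" if t: "t > 0" for i t
      proof -
        have big: "B * (B * C1 * Y) \<le> C0 * Y" "B * (C2 * Y) \<le> C0 * Y" "Y \<le> C0 * Y"
        proof -
          have "B * (B * C1 * Y) \<le> B * (B * (C1 + C2 + 1) * Y)"
            using C2 Y0 B0 by (intro mult_left_mono mult_right_mono) auto
          then show "B * (B * C1 * Y) \<le> C0 * Y" by (simp add: C0' mult.assoc)
          have "B * (1 * C2 * Y) \<le> B * (B * (C1 + C2 + 1) * Y)"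
            using C1 C2 Y0 B by (intro mult_left_mono mult_right_mono mult_mono) auto
          then show "B * (C2 * Y) \<le> C0 * Y" by (simp add: C0' mult.assoc)
          have "1 * (1 * 1) \<le> B * (B * (C1 + C2 + 1))" using B C1 C2 by (intro mult_mono) auto
          then have "1 * Y \<le> C0 * Y" using Y0 by (intro mult_right_mono) (auto simp: C0' mult.assoc)
          then show "Y \<le> C0 * Y" by simp
        qed
        have tB: "t / B > 0" using t B0 by simp
        consider "i < 4" | "i = 4" | "i > 4" by linarith
        then show ?thesis
        proof cases
          case 1
          have "{n \<in> {..<L}. z i n > t} = {n. n < L \<and> \<bar>Hf i n\<bar> > t / B}"
            using 1 B0 by (auto simp: z_def pos_divide_less_eq mult.commute)
          then have "t * (\<Sum>n | n \<in> {..<L} \<and> z i n > t. w n) = B * (t / B * (\<Sum>n | n < L \<and> \<bar>Hf i n\<bar> > t / B. w n))"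
            using B0 by simp
          also have "\<dots> \<le> B * (C1 * (\<Sum>n<N. w n * \<bar>f n * x i n\<bar>))"
            unfolding Hf_def using B0 by (intro mult_left_mono Hw p1 tB) auto
          also have "\<dots> \<le> B * (C1 * (\<Sum>n<N. w n * (B * \<bar>f n\<bar>)))"
          proof (intro mult_left_mono sum_mono)
            fix n show "\<bar>f n * x i n\<bar> \<le> B * \<bar>f n\<bar>" by (rule fx)
          qed (use C1 w0 B0 in auto)
          also have "\<dots> = B * (B * C1 * Y)" by (simp add: Y_def sum_distrib_left mult_ac)
          finally show ?thesis using big by linarith
        next
          case 2
          have "{n \<in> {..<L}. z i n > t} = {n. n < L \<and> \<bar>Sf n\<bar> > t / B}"
            using 2 B0 Sf0 by (auto simp: z_def pos_divide_less_eq mult.commute)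
          then have "t * (\<Sum>n | n \<in> {..<L} \<and> z i n > t. w n) = B * (t / B * (\<Sum>n | n < L \<and> \<bar>Sf n\<bar> > t / B. w n))"
            using B0 by simp
          also have "\<dots> \<le> B * (C2 * (\<Sum>n<N. w n * \<bar>\<bar>f n\<bar>\<bar>))"
            unfolding Sf_def using B0 by (intro mult_left_mono Sw p1 tB) auto
          finally show ?thesis using big unfolding Y_def by simp
        next
          case 3
          have "t * (\<Sum>n | n \<in> {..<L} \<and> z i n > t. w n) = (\<Sum>n | n \<in> {..<L} \<and> z i n > t. t * w n)"
            by (simp add: sum_distrib_left)
          also have "\<dots> \<le> (\<Sum>n | n \<in> {..<L} \<and> z i n > t. w n * \<bar>f n\<bar>)"
            using 3 w0 t by (intro sum_mono) (auto simp: z_def F_def mult.commute[of t] intro!: mult_left_mono split: if_splits)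
          also have "\<dots> \<le> Y" unfolding Y_def using w0 3 t by (intro sum_mono2) (auto simp: z_def F_def split: if_splits)
          finally show ?thesis using big by linarith
        qed
      qed
      have "t * (\<Sum>n | n \<in> {..<L} \<and> \<bar>T n\<bar> > t. w n) \<le> (real (card {..<6::nat}))\<^sup>2 * (C0 * Y)"
        by (rule weak_type_sum[where x = z, OF _ six]) (use w0 Tz zb t in auto)
      also have "\<dots> = (6\<^sup>2 * C0) * Y" by simp
      also have "\<dots> \<le> C * Y" using C Y0 by (intro mult_right_mono) auto
      finally show "t * (\<Sum>n | n < L \<and> \<bar>\<Sum>m<N. f m * jacobi_kernel \<alpha> \<beta> c d m n\<bar> > t. w n) \<le> C * (\<Sum>n<N. w n * \<bar>f n\<bar>)"
        by (simp add: T_def Y_def)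
    qed
  qed
  then show ?thesis using C(1) by blast
qed

section \<open>Convergence of the series on weighted sequence spaces\<close>

text \<open>The partial sums are the values at the output index 0 of the Stieltjes transform of
  \<open>\<bar>f\<bar>\<close>. Keeping only this output (\<open>L = 1\<close>), where the weight
  \<open>w 0\<close> is positive, the weighted inequality bounds them uniformly.\<close>

lemma in_lpw_summable_harmonic:
  assumes Ap: "Ap_weight p w" and p: "p \<ge> 1" and f: "in_lpw p w f"
  shows "summable (\<lambda>m. \<bar>f m\<bar> / (real m + 1))"
proof -
  have w: "w k > 0" for k using Ap by (auto simp: Ap_weight_def weight_def)
  define Y where "Y = (\<Sum>m. \<bar>f m\<bar> powr p * w m)"
  have Yb: "(\<Sum>n<N. w n * \<bar>f n\<bar> powr p) \<le> Y" for N
    unfolding Y_def using f w by (subst mult.commute, intro sum_le_suminf) (auto simp: in_lpw_def less_imp_le)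
  obtain C where C: "C \<ge> 0"
    and S: "\<And>N L f. p > 1 \<Longrightarrow> (\<Sum>n<L. w n * \<bar>\<Sum>m<N. f m * stieltjes_kernel m n\<bar> powr p) \<le> C * (\<Sum>n<N. w n * \<bar>f n\<bar> powr p)"
    and Sw: "\<And>N L f t. p = 1 \<Longrightarrow> t > 0 \<Longrightarrow> t * (\<Sum>n | n < L \<and> \<bar>\<Sum>m<N. f m * stieltjes_kernel m n\<bar> > t. w n) \<le> C * (\<Sum>n<N. w n * \<bar>f n\<bar>)"
    using cz_weighted[OF cz_stieltjes _ Ap p] by (auto)
  have CY: "C * (\<Sum>n<N. w n * \<bar>f n\<bar> powr p) \<le> C * Y" for N using Yb C by (intro mult_left_mono) auto
  define s where "s N = (\<Sum>m<N. \<bar>f m\<bar> / (real m + 1))" for N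
  have s0: "s N \<ge> 0" for N unfolding s_def by (intro sum_nonneg) auto
  have se: "(\<Sum>m<N. \<bar>f m\<bar> * stieltjes_kernel m 0) = s N" for N by (simp add: s_def stieltjes_kernel_def)
  have bd: "\<exists>R. \<forall>N. s N \<le> R"
  proof (cases "p = 1")
    case True
    have "s N \<le> 2 * (C * Y / w 0)" for N
    proof (cases "s N = 0")
      case True
      have "0 \<le> Y" using Yb[of 0] by simp
      then show ?thesis using True C w[of 0] by (simp add: less_imp_le)
    next
      case False
      then have t: "s N / 2 > 0" using s0[of N] by simp
      \<comment> \<open>The level is half the value at 0, so that the strict level set contains the
        index 0.\<close>
      then have "{n. n < 1 \<and> \<bar>\<Sum>m<N. \<bar>f m\<bar> * stieltjes_kernel m n\<bar> > s N / 2} = {0::nat}"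
        using se[of N] by auto
      then have "s N / 2 * w 0 \<le> C * (\<Sum>n<N. w n * \<bar>\<bar>f n\<bar>\<bar>)"
        using Sw[OF \<open>p = 1\<close> t, where L = 1 and N = N and f = "\<lambda>m. \<bar>f m\<bar>"] by simp
      also have "\<dots> \<le> C * Y" using CY[of N] \<open>p = 1\<close> by simp
      finally show ?thesis using w[of 0] by (simp add: field_simps)
    qed
    then show ?thesis by blast
  next
    case False
    then have p1: "p > 1" using p by simp
    have "s N \<le> (C * Y / w 0) powr (1 / p)" for N
    proof -
      have "w 0 * s N powr p \<le> C * (\<Sum>n<N. w n * \<bar>\<bar>f n\<bar>\<bar> powr p)"
        using S[OF p1, where L = 1 and N = N and f = "\<lambda>m. \<bar>f m\<bar>"] se[of N] s0[of N] by simp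
      also have "\<dots> \<le> C * Y" using CY[of N] by simp
      finally have "s N powr p \<le> C * Y / w 0" using w[of 0] by (simp add: pos_le_divide_eq mult.commute)
      then have "(s N powr p) powr (1 / p) \<le> (C * Y / w 0) powr (1 / p)" using p1 by (intro powr_mono2) auto
      then show ?thesis using p1 s0[of N] by (simp add: powr_powr)
    qed
    then show ?thesis by blast
  qed
  then obtain R where R: "\<And>N. s N \<le> R" by blast
  show ?thesis
  proof (rule bounded_imp_summable)
    show "(\<Sum>k\<le>n. \<bar>f k\<bar> / (real k + 1)) \<le> R" for n
      using R[of "Suc n"] by (simp add: s_def lessThan_Suc_atMost)
  qed auto
qed

text \<open>For fixed \<open>n\<close> the Hilbert kernel, the Stieltjes kernel and the diagonal
  term are each \<open>O(1 / (m + 1))\<close>; the constant \<open>D\<close> grows with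
  \<open>n\<close>.\<close>

lemma jacobi_kernel_decay:
  assumes ab: "\<alpha> \<ge> -1/2" "\<beta> \<ge> -1/2" and cd: "-1 \<le> c" "c \<le> d" "d \<le> 1"
  shows "\<exists>D. \<forall>m. \<bar>jacobi_kernel \<alpha> \<beta> c d m n\<bar> \<le> D / (real m + 1)"
proof -
  obtain B where B: "B \<ge> 1" and dec: "\<And>c d. -1 \<le> c \<Longrightarrow> c \<le> d \<Longrightarrow> d \<le> 1 \<Longrightarrow> (\<exists>x y :: nat \<Rightarrow> nat \<Rightarrow> real. (\<forall>i n. \<bar>x i n\<bar> \<le> B \<and> \<bar>y i n\<bar> \<le> B) \<and>
     (\<forall>m n. \<bar>jacobi_kernel \<alpha> \<beta> c d m n - hilbert_kernel m n * (\<Sum>i<4. x i m * y i n)\<bar>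
        \<le> B * stieltjes_kernel m n + (if m = n then 1 else 0)))"
    using jacobi_kernel_decomposition[OF ab] by blast
  obtain x y :: "nat \<Rightarrow> nat \<Rightarrow> real" where x: "\<And>i n. \<bar>x i n\<bar> \<le> B" and y: "\<And>i n. \<bar>y i n\<bar> \<le> B"
    and K: "\<And>m n. \<bar>jacobi_kernel \<alpha> \<beta> c d m n - hilbert_kernel m n * (\<Sum>i<4. x i m * y i n)\<bar>
        \<le> B * stieltjes_kernel m n + (if m = n then 1 else 0)"
    using dec[OF cd] by blast
  have "\<bar>jacobi_kernel \<alpha> \<beta> c d m n\<bar> \<le> ((real n + 2) * (4 * (B * B)) + B + (real n + 1)) / (real m + 1)" for m
  proof -
    have h: "\<bar>hilbert_kernel m n\<bar> \<le> (real n + 2) / (real m + 1)"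
    proof (cases "m = n")
      case False
      define D where "D = \<bar>real n - real m\<bar>"
      have D: "D \<ge> 1" using False unfolding D_def by linarith
      have "real m + 1 \<le> D + (real n + 1)" unfolding D_def by linarith
      also have "\<dots> \<le> D + D * (real n + 1)" using mult_right_mono[OF D, of "real n + 1"] by simp
      finally have "1 / D \<le> (real n + 2) / (real m + 1)" using D by (simp add: field_simps)
      then show ?thesis using False by (simp add: hilbert_kernel_def D_def)
    qed (simp add: hilbert_kernel_def)
    have "\<bar>\<Sum>i<4. x i m * y i n\<bar> \<le> (\<Sum>i<4::nat. B * B)"
    proof (rule order.trans[OF sum_abs], rule sum_mono)
      fix i show "\<bar>x i m * y i n\<bar> \<le> B * B" unfolding abs_mult using B x y by (intro mult_mono) auto
    qed
    then have s: "\<bar>\<Sum>i<4. x i m * y i n\<bar> \<le> 4 * (B * B)" by simp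
    have "\<bar>hilbert_kernel m n * (\<Sum>i<4. x i m * y i n)\<bar> \<le> (real n + 2) / (real m + 1) * (4 * (B * B))"
      unfolding abs_mult using h s by (intro mult_mono) auto
    moreover have "B * stieltjes_kernel m n \<le> B * (1 / (real m + 1))"
      using B by (intro mult_left_mono) (auto simp: stieltjes_kernel_def frac_le)
    moreover have "(if m = n then 1 else 0) \<le> (real n + 1) / (real m + 1)" by simp
    ultimately have "\<bar>jacobi_kernel \<alpha> \<beta> c d m n\<bar> \<le> (real n + 2) / (real m + 1) * (4 * (B * B)) + B * (1 / (real m + 1)) + (real n + 1) / (real m + 1)"
      using K[of m n] by linarith
    also have "\<dots> = ((real n + 2) * (4 * (B * B)) + B + (real n + 1)) / (real m + 1)"
      by (simp only: times_divide_eq_left times_divide_eq_right mult_1_right add_divide_distrib[symmetric])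
    finally show ?thesis .
  qed
  then show ?thesis by blast
qed

lemma jacobi_series_summable:
  assumes ab: "\<alpha> \<ge> -1/2" "\<beta> \<ge> -1/2" and Ap: "Ap_weight p w" and p: "p \<ge> 1" and f: "in_lpw p w f"
    and cd: "-1 \<le> c" "c \<le> d" "d \<le> 1"
  shows "summable (\<lambda>m. f m * jacobi_kernel \<alpha> \<beta> c d m n)"
proof -
  obtain D where D: "\<And>m. \<bar>jacobi_kernel \<alpha> \<beta> c d m n\<bar> \<le> D / (real m + 1)" using jacobi_kernel_decay[OF ab cd] by blast
  have "summable (\<lambda>m. D * (\<bar>f m\<bar> / (real m + 1)))" by (intro summable_mult in_lpw_summable_harmonic[OF Ap p f])
  then show ?thesis
  proof (rule summable_comparison_test[rotated], intro exI allI impI)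
    fix m
    have "\<bar>f m\<bar> * \<bar>jacobi_kernel \<alpha> \<beta> c d m n\<bar> \<le> \<bar>f m\<bar> * (D / (real m + 1))" using D by (intro mult_left_mono) auto
    then show "norm (f m * jacobi_kernel \<alpha> \<beta> c d m n) \<le> D * (\<bar>f m\<bar> / (real m + 1))" by (simp add: abs_mult mult_ac)
  qed
qed

theorem theorem1p1:
  fixes \<alpha> \<beta> p :: real and w :: "nat \<Rightarrow> real"
  assumes "\<alpha> \<ge> -1/2" and "\<beta> \<ge> -1/2" and "1 \<le> p" and "Ap_weight p w"
  shows
    "(\<forall>a b f n. -1 \<le> a \<and> a \<le> b \<and> b \<le> 1 \<and> in_lpw p w f \<longrightarrow>
        summable (\<lambda>m. f m * jacobi_kernel \<alpha> \<beta> a b m n) \<and>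
        (in_l2 f \<longrightarrow> interval_multiplier \<alpha> \<beta> a b f n
                        = (\<Sum>m. f m * jacobi_kernel \<alpha> \<beta> a b m n)))
     \<and> (1 < p \<longrightarrow> (\<exists>C. \<forall>a b f. -1 \<le> a \<and> a \<le> b \<and> b \<le> 1 \<and> in_lpw p w f \<longrightarrow>
            in_lpw p w (interval_multiplier_series \<alpha> \<beta> a b f) \<and>
            lpw_norm p w (interval_multiplier_series \<alpha> \<beta> a b f) \<le> C * lpw_norm p w f))
     \<and> (p = 1 \<longrightarrow> (\<exists>C. \<forall>a b f. -1 \<le> a \<and> a \<le> b \<and> b \<le> 1 \<and> in_lpw 1 w f \<longrightarrow>
            weak_l1w_bounded w (interval_multiplier_series \<alpha> \<beta> a b f)
              (C * lpw_norm 1 w f)))"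
proof -
  note ab = assms(1,2) and p = assms(3) and Ap = assms(4)
  have w: "w k > 0" and w0: "w k \<ge> 0" for k using Ap by (auto simp: Ap_weight_def weight_def less_imp_le)
  obtain C where C: "C \<ge> 0"
    and strong: "\<And>c d N L f. -1 \<le> c \<Longrightarrow> c \<le> d \<Longrightarrow> d \<le> 1 \<Longrightarrow> p > 1 \<Longrightarrow>
      (\<Sum>n<L. w n * \<bar>\<Sum>m<N. f m * jacobi_kernel \<alpha> \<beta> c d m n\<bar> powr p) \<le> C * (\<Sum>n<N. w n * \<bar>f n\<bar> powr p)"
    and weak: "\<And>c d N L f t. -1 \<le> c \<Longrightarrow> c \<le> d \<Longrightarrow> d \<le> 1 \<Longrightarrow> p = 1 \<Longrightarrow> t > 0 \<Longrightarrow>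
      t * (\<Sum>n | n < L \<and> \<bar>\<Sum>m<N. f m * jacobi_kernel \<alpha> \<beta> c d m n\<bar> > t. w n) \<le> C * (\<Sum>n<N. w n * \<bar>f n\<bar>)"
    using jacobi_multiplier_truncated[OF ab Ap p] by blast
  define T where "T a b f = interval_multiplier_series \<alpha> \<beta> a b f" for a b f
  have sm: "summable (\<lambda>m. f m * jacobi_kernel \<alpha> \<beta> a b m n)" if "-1 \<le> a \<and> a \<le> b \<and> b \<le> 1 \<and> in_lpw p w f" for a b f n
    using jacobi_series_summable[OF ab Ap p] that by blast
  have lim: "(\<lambda>N. \<Sum>m<N. f m * jacobi_kernel \<alpha> \<beta> a b m n) \<longlonglongrightarrow> T a b f n" if "-1 \<le> a \<and> a \<le> b \<and> b \<le> 1 \<and> in_lpw p w f" for a b f n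
    unfolding T_def interval_multiplier_series_def using sm[OF that] by (rule summable_LIMSEQ)
  have Yb: "(\<Sum>n<N. w n * \<bar>f n\<bar> powr p) \<le> (\<Sum>m. \<bar>f m\<bar> powr p * w m)" if "in_lpw p w f" for f N
    using that w0 by (subst mult.commute, intro sum_le_suminf) (auto simp: in_lpw_def)
  have 1: "summable (\<lambda>m. f m * jacobi_kernel \<alpha> \<beta> a b m n) \<and>
      (in_l2 f \<longrightarrow> interval_multiplier \<alpha> \<beta> a b f n = (\<Sum>m. f m * jacobi_kernel \<alpha> \<beta> a b m n))"
    if h: "-1 \<le> a \<and> a \<le> b \<and> b \<le> 1 \<and> in_lpw p w f" for a b f n
    using sm[OF h] LIMSEQ_unique[OF interval_multiplier_LIMSEQ[OF ab] summable_LIMSEQ[OF sm[OF h]]] by blast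
  have 2: "in_lpw p w (T a b f) \<and> lpw_norm p w (T a b f) \<le> C powr (1 / p) * lpw_norm p w f"
    if p1: "1 < p" and h: "-1 \<le> a \<and> a \<le> b \<and> b \<le> 1 \<and> in_lpw p w f" for a b f
  proof -
    define Y where "Y = (\<Sum>m. \<bar>f m\<bar> powr p * w m)"
    have Y0: "Y \<ge> 0" using Yb[of f 0] h by (simp add: Y_def)
    \<comment> \<open>For fixed \<open>L\<close> only finitely many outputs occur, so
      \<open>N\<close> may tend to infinity in the truncated inequality. The bound on partial sums,
      uniform in \<open>L\<close>, then gives summability.\<close>
    have bd: "(\<Sum>n<L. \<bar>T a b f n\<bar> powr p * w n) \<le> C * Y" for L
    proof -
      have "(\<lambda>N. \<Sum>n<L. w n * \<bar>\<Sum>m<N. f m * jacobi_kernel \<alpha> \<beta> a b m n\<bar> powr p) \<longlonglongrightarrow> (\<Sum>n<L. w n * \<bar>T a b f n\<bar> powr p)"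
        using p1 by (intro tendsto_intros tendsto_powr' lim[OF h]) auto
      moreover have "(\<Sum>n<L. w n * \<bar>\<Sum>m<N. f m * jacobi_kernel \<alpha> \<beta> a b m n\<bar> powr p) \<le> C * Y" for N
      proof -
        have "(\<Sum>n<L. w n * \<bar>\<Sum>m<N. f m * jacobi_kernel \<alpha> \<beta> a b m n\<bar> powr p) \<le> C * (\<Sum>n<N. w n * \<bar>f n\<bar> powr p)"
          using h p1 by (intro strong) auto
        also have "\<dots> \<le> C * Y" unfolding Y_def using C Yb h by (intro mult_left_mono) auto
        finally show ?thesis .
      qed
      ultimately have "(\<Sum>n<L. w n * \<bar>T a b f n\<bar> powr p) \<le> C * Y" by (intro LIMSEQ_le_const2) auto
      then show ?thesis by (simp add: mult.commute)
    qed
    have s: "summable (\<lambda>n. \<bar>T a b f n\<bar> powr p * w n)"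
    proof (rule bounded_imp_summable)
      show "(\<Sum>k\<le>n. \<bar>T a b f k\<bar> powr p * w k) \<le> C * Y" for n using bd[of "Suc n"] unfolding lessThan_Suc_atMost .
    qed (use w0 in auto)
    have "(\<Sum>n. \<bar>T a b f n\<bar> powr p * w n) \<le> C * Y" by (rule suminf_le_const[OF s bd])
    moreover have "0 \<le> (\<Sum>n. \<bar>T a b f n\<bar> powr p * w n)" using w0 by (intro suminf_nonneg s) auto
    ultimately have "(\<Sum>n. \<bar>T a b f n\<bar> powr p * w n) powr (1 / p) \<le> (C * Y) powr (1 / p)"
      using p1 by (intro powr_mono2) auto
    then show ?thesis using s C Y0 by (simp add: in_lpw_def lpw_norm_def Y_def[symmetric] powr_mult)
  qed
  have 3: "weak_l1w_bounded w (T a b f) (C * lpw_norm 1 w f)"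
    if p1: "p = 1" and h: "-1 \<le> a \<and> a \<le> b \<and> b \<le> 1 \<and> in_lpw p w f" for a b f
  proof -
    define Y where "Y = (\<Sum>m. \<bar>f m\<bar> powr p * w m)"
    have Y0: "Y \<ge> 0" using Yb[of f 0] h by (simp add: Y_def)
    have bd: "t * (\<Sum>n<L. if \<bar>T a b f n\<bar> > t then w n else 0) \<le> C * Y" if t: "t > 0" for t L
    proof -
      \<comment> \<open>Level sets need not converge, but the strict inequality
        \<open>\<bar>T a b f n\<bar> > t\<close> persists for the truncated sums at finitely many
        \<open>n\<close>, so one large \<open>N\<close> gives the inclusion that is needed.\<close>
      have "\<forall>\<^sub>F N in sequentially. \<forall>n\<in>{n. n < L \<and> \<bar>T a b f n\<bar> > t}. \<bar>\<Sum>m<N. f m * jacobi_kernel \<alpha> \<beta> a b m n\<bar> > t"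
      proof (rule eventually_ball_finite, simp, rule ballI)
        fix n assume n: "n \<in> {n. n < L \<and> \<bar>T a b f n\<bar> > t}"
        show "\<forall>\<^sub>F N in sequentially. \<bar>\<Sum>m<N. f m * jacobi_kernel \<alpha> \<beta> a b m n\<bar> > t"
          by (rule order_tendstoD(1)[OF tendsto_rabs[OF lim[OF h]]]) (use n in auto)
      qed
      then obtain N where N: "\<And>n. n < L \<Longrightarrow> \<bar>T a b f n\<bar> > t \<Longrightarrow> \<bar>\<Sum>m<N. f m * jacobi_kernel \<alpha> \<beta> a b m n\<bar> > t"
        unfolding eventually_sequentially by blast
      have "(\<Sum>n<L. if \<bar>T a b f n\<bar> > t then w n else 0) = (\<Sum>n | n < L \<and> \<bar>T a b f n\<bar> > t. w n)"
        by (subst sum.inter_filter[symmetric]) (auto intro!: sum.cong)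
      also have "\<dots> \<le> (\<Sum>n | n < L \<and> \<bar>\<Sum>m<N. f m * jacobi_kernel \<alpha> \<beta> a b m n\<bar> > t. w n)"
        using N w0 by (intro sum_mono2) auto
      finally have "t * (\<Sum>n<L. if \<bar>T a b f n\<bar> > t then w n else 0) \<le> t * (\<Sum>n | n < L \<and> \<bar>\<Sum>m<N. f m * jacobi_kernel \<alpha> \<beta> a b m n\<bar> > t. w n)"
        using t by (intro mult_left_mono) auto
      also have "\<dots> \<le> C * (\<Sum>n<N. w n * \<bar>f n\<bar>)" using h p1 t by (intro weak) auto
      also have "\<dots> = C * (\<Sum>n<N. w n * \<bar>f n\<bar> powr p)" using p1 by simp
      also have "\<dots> \<le> C * Y" unfolding Y_def using C Yb h by (intro mult_left_mono) auto
      finally show ?thesis .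
    qed
    have nY: "lpw_norm 1 w f = Y" using Y0 p1 by (simp add: lpw_norm_def Y_def)
    show ?thesis unfolding weak_l1w_bounded_def nY
    proof (intro allI impI)
      fix t :: real assume t: "t > 0"
      have bd': "(\<Sum>n<L. if \<bar>T a b f n\<bar> > t then w n else 0) \<le> C * Y / t" for L
        using bd[OF t, of L] t by (simp add: pos_le_divide_eq mult.commute)
      have s: "summable (\<lambda>n. if \<bar>T a b f n\<bar> > t then w n else 0)"
      proof (rule bounded_imp_summable)
        show "(\<Sum>k\<le>n. if \<bar>T a b f k\<bar> > t then w k else 0) \<le> C * Y / t" for n using bd'[of "Suc n"] unfolding lessThan_Suc_atMost .
      qed (use w0 in auto)
      have "(\<Sum>n. if \<bar>T a b f n\<bar> > t then w n else 0) \<le> C * Y / t" by (rule suminf_le_const[OF s bd'])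
      then have "t * (\<Sum>n. if \<bar>T a b f n\<bar> > t then w n else 0) \<le> C * Y"
        using t by (simp add: pos_le_divide_eq mult.commute)
      then show "summable (\<lambda>n. if \<bar>T a b f n\<bar> > t then w n else 0) \<and> t * (\<Sum>n. if \<bar>T a b f n\<bar> > t then w n else 0) \<le> C * Y"
        using s by blast
    qed
  qed
  show ?thesis
  proof (intro conjI impI)
    show "\<forall>a b f n. -1 \<le> a \<and> a \<le> b \<and> b \<le> 1 \<and> in_lpw p w f \<longrightarrow>
        summable (\<lambda>m. f m * jacobi_kernel \<alpha> \<beta> a b m n) \<and>
        (in_l2 f \<longrightarrow> interval_multiplier \<alpha> \<beta> a b f n = (\<Sum>m. f m * jacobi_kernel \<alpha> \<beta> a b m n))"
      using 1 by blast
  next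
    assume "1 < p"
    from 2[OF this] show "\<exists>C. \<forall>a b f. -1 \<le> a \<and> a \<le> b \<and> b \<le> 1 \<and> in_lpw p w f \<longrightarrow>
            in_lpw p w (interval_multiplier_series \<alpha> \<beta> a b f) \<and>
            lpw_norm p w (interval_multiplier_series \<alpha> \<beta> a b f) \<le> C * lpw_norm p w f"
      unfolding T_def by (intro exI[of _ "C powr (1 / p)"]) blast
  next
    assume "p = 1"
    from 3[OF this] this show "\<exists>C. \<forall>a b f. -1 \<le> a \<and> a \<le> b \<and> b \<le> 1 \<and> in_lpw 1 w f \<longrightarrow>
            weak_l1w_bounded w (interval_multiplier_series \<alpha> \<beta> a b f) (C * lpw_norm 1 w f)"
      unfolding T_def by (intro exI[of _ C]) blast
  qed
qed

end
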